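(* Let $d_X,d_Z\in\mathbb N$, $d:=d_X+d_Z$, $r\in\mathbb N$, $s$ real with $r\ge s\ge 3d/4$, $C\ge1$, $c\in(0,1]$, $\delta\in(0,2]$, $\alpha\in(0,1)$. Let $\mathcal{P}$ be a class of distributions $P$ of $(X,Y,Z)$ on $[0,1]^{d_X}\times\mathbb{R}\times[0,1]^{d_Z}$. Write $g_P(x,z):=\mathbb{E}_P(Y\mid X=x,Z=z)$, $m_P(z):=\mathbb{E}_P(Y\mid Z=z)$, $\varepsilon_P:=Y-m_P(Z)$, $\tau_P:=\mathbb{E}_P[\{g_P(X,Z)-m_P(Z)\}^2]$, and suppose that for every $P\in\mathcal{P}$: (a) $\mathbb{E}_P(\varepsilon_P^2\mid X,Z)\ge c$ and $\mathbb{E}_P(|\varepsilon_P|^{2+\delta}\mid X,Z)\le C$; (b) $(X,Z)$ has a density $p_P$ with respect to Lebesgue measure on $[0,1]^d$ with $c\le p_P(x,z)\le C$ for all $(x,z)\in[0,1]^d$; (c) the conditional density $p_{X|Z,P}$ of $X$ given $Z$ satisfies $p_{X|Z,P}(x\mid\cdot)\in\mathcal{H}_s^{d_Z}$ for all $x\in[0,1]^{d_X}$, and $m_P\in\mathcal{H}_s^{d_Z}$, $g_P\in\mathcal{H}_s^{d}$, with $\max\bigl\{\sup_{x}\|p_{X|Z,P}(x\mid\cdot)\|_{\mathcal{H}_s},\|m_P\|_{\mathcal{H}_s},\|g_P\|_{\mathcal{H}_s}\bigr\}\le C$. Let $(\epsilon_n)$ be a positive sequence with $$\epsilon_n\cdot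 n^{\frac{4s}{4s+d}}\to\infty,$$ and let $\mathcal{P}_1(\epsilon_n):=\{P\in\mathcal{P}:\tau_P\ge\epsilon_n\}$. Let $T$ be computed using spline regressions of order $r$ with $N=N_n$ interior knots according to Algorithm 2 (see context), with the tuning parameters chosen such that $K_X\asymp n^{\frac{2d_X}{4s+d}}$ and $K_Z\asymp\widetilde K_Z\asymp n^{\frac{2d_Z}{4s+d}}$. Then, as $n\to\infty$, $$\inf_{P\in\mathcal{P}_1(\epsilon_n)}\mathbb{P}_P(T>z_{1-\alpha})\to1.$$
   Context: Conventions: $0/0:=0$; $z_\alpha$ is the $\alpha$-quantile of $N(0,1)$; $a_n\asymp b_n$ means that $a_n/b_n$ is bounded away from $0$ and $\infty$; the infimum of a probability over an empty class is $1$; families of distributions may depend on $n$ (constants do not); conditional inequalities hold almost surely. Hölder spaces: for $\varsigma>0$ and $s_0:=\lceil \varsigma\rceil-1$, $\mathcal H_\varsigma^{q}$ is the set of $s_0$-times differentiable $f:[0,1]^q\to\mathbb R$ for which there is $B>0$ with $\max_{|\boldsymbol\alpha|=s_0}|D^{\boldsymbol\alpha}f(x)-D^{\boldsymbol\alpha}f(\tilde x)|\le B\|x-\tilde x\|_2^{\varsigma-s_0}$ for all $x,\tilde x\in[0,1]^q$ and $\max_{|\boldsymbol\alpha|=s_0}\|D^{\boldsymbol\alpha}f\|_\infty\le B$ (maxima over multi-indices); $\|f\|_{\mathcal H_\varsigma}$ is the infimum of such $B$. B-splines: for order $r\in\mathbb N$ and $N\in\mathbb N_0$, let $t=(t_1,\dots,t_{N+2r})$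 consist of $0$ repeated $r$ times, then $\ell/(N+1)$ for $\ell=1,\dots,N$, then $1$ repeated $r$ times. For $x\in[0,1)$, $B_{k,1}(x):=\mathbf 1_{[t_k,t_{k+1})}(x)$ and $B_{k,q}(x):=\frac{x-t_k}{t_{k+q-1}-t_k}B_{k,q-1}(x)+\frac{t_{k+q}-x}{t_{k+q}-t_{k+1}}B_{k+1,q-1}(x)$ for $q=2,\dots,r$; values at $x=1$ are left limits. Let $\boldsymbol B_{r,N}(x):=(B_{1,r}(x),\dots,B_{N+r,r}(x))^\top$. For vectors, $\boldsymbol u\otimes\boldsymbol v:=\mathrm{vec}(\boldsymbol u\boldsymbol v^\top)$ (columns stacked). The $q$-tensor B-spline basis of order $r$ with $N$ interior knots is $\boldsymbol B_{r,N}(x_1)\otimes\cdots\otimes\boldsymbol B_{r,N}(x_q)$, with $(N+r)^q$ components. Let $\boldsymbol\phi^X,\boldsymbol\phi^Z$ be the $d_X$- and $d_Z$-tensor B-spline bases of order $r$ with $N$ interior knots, with $K_X:=(N+r)^{d_X}$, $K_Z:=(N+r)^{d_Z}$ components; $\boldsymbol\phi(x,z):=\boldsymbol\phi^X(x)\otimes\boldsymbol\phi^Z(z)$; $\boldsymbol\psi$ is the $d_Z$-tensor B-spline basis of order $2r-1$ with $N$ interior knots, with $\widetilde K_Z:=(N+2r-1)^{d_Z}$ components. Test statistic computed using spline regressions by Algorithm 2 (all regressions by ordinary least squares on the stated basis, with generalised inverses if needed): there are $4n$ i.i.d. copies of $(X,Y,Z)$, split into $\mathcal D_1$ (indices $1,\dots,n$),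 $\mathcal D_2,\mathcal D_3,\mathcal D_4$, each of size $n$. On $\mathcal D_2$: regress $Y$ on $\boldsymbol\phi(X,Z)$ to get $\hat g$; regress $\hat g(X,Z)$ on $\boldsymbol\phi^Z(Z)$ (equivalently $Y$ on $\boldsymbol\phi^Z(Z)$) to get $\tilde m$; set $\hat f(x,z):=\hat g(x,z)-\tilde m(z)$. On $\mathcal D_3$: regress $\hat f(X,Z)$ on $\boldsymbol\psi(Z)$ to get $\hat m_{\hat f}$. On $\mathcal D_4$: regress $Y$ on $\boldsymbol\psi(Z)$ to get $\hat m$. With $L_i:=\{Y_i-\hat m(Z_i)\}\{\hat f(X_i,Z_i)-\hat m_{\hat f}(Z_i)\}$ for $i=1,\dots,n$, $$T:=\frac{n^{-1/2}\sum_{i=1}^nL_i}{\sqrt{n^{-1}\sum_{i=1}^nL_i^2-(n^{-1}\sum_{i=1}^nL_i)^2}}.$$ *)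

theory Defs
  imports "HOL-Probability.Probability" "Jordan_Normal_Form.Matrix"
begin

(* From here on, $ is the component selector of Matrix.vec. *)
unbundle no vec_syntax

section \<open>Hoelder spaces on the closed unit cube\<close>

abbreviation unit_cube :: "'a::euclidean_space set" where
  "unit_cube \<equiv> cbox 0 One"

(* Derivatives are taken within the closed cube, hence are one-sided at its boundary.
   The values of f outside the cube are irrelevant. *)
definition partial :: "'a::euclidean_space \<Rightarrow> ('a \<Rightarrow> real) \<Rightarrow> 'a \<Rightarrow> real" where
  "partial b f x = frechet_derivative f (at x within unit_cube) b"

primrec times_differentiable :: "nat \<Rightarrow> ('a::euclidean_space \<Rightarrow> real) \<Rightarrow> bool" where
  "times_differentiable 0 f \<longleftrightarrow> True"
| "times_differentiable (Suc k) f \<longleftrightarrow>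
     f differentiable_on unit_cube \<and> (\<forall>b\<in>Basis. times_differentiable k (partial b f))"

(* A multi-index of order k is given by a word of k coordinate directions, in which the
   direction b occurs as often as its multi-index entry.  Mixed partial derivatives of
   k times differentiable functions do not depend on the order of the letters. *)
definition iterated_partial :: "'a::euclidean_space list \<Rightarrow> ('a \<Rightarrow> real) \<Rightarrow> 'a \<Rightarrow> real" where
  "iterated_partial bs f = fold partial bs f"

definition holder_order :: "real \<Rightarrow> nat" where
  "holder_order \<sigma> = nat (\<lceil>\<sigma>\<rceil> - 1)"

definition holder_bound :: "real \<Rightarrow> ('a::euclidean_space \<Rightarrow> real) \<Rightarrow> real \<Rightarrow> bool" where
  "holder_bound \<sigma> f B \<longleftrightarrow>
     (\<forall>bs. set bs \<subseteq> Basis \<and> length bs = holder_order \<sigma> \<longrightarrow>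
        (\<forall>x\<in>unit_cube. \<forall>y\<in>unit_cube.
            \<bar>iterated_partial bs f x - iterated_partial bs f y\<bar>
              \<le> B * norm (x - y) powr (\<sigma> - real (holder_order \<sigma>))) \<and>
        (\<forall>x\<in>unit_cube. \<bar>iterated_partial bs f x\<bar> \<le> B))"

definition holder_space :: "real \<Rightarrow> ('a::euclidean_space \<Rightarrow> real) set" where
  "holder_space \<sigma> = {f. times_differentiable (holder_order \<sigma>) f \<and> (\<exists>B>0. holder_bound \<sigma> f B)}"

definition holder_norm :: "real \<Rightarrow> ('a::euclidean_space \<Rightarrow> real) \<Rightarrow> real" where
  "holder_norm \<sigma> f = Inf {B. B > 0 \<and> holder_bound \<sigma> f B}"


section \<open>Tensor B-spline bases\<close>

(* Knots are indexed from 1 to N + 2 r. *)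
definition knot :: "nat \<Rightarrow> nat \<Rightarrow> nat \<Rightarrow> real" where
  "knot r N k = (if k \<le> r then 0 else if k \<le> r + N then real (k - r) / real (N + 1) else 1)"

(* The second argument is the order (order 0 is a dummy); the first is the knot sequence.
   Division by zero is zero, as the recursion requires. *)
fun bspline_rec :: "(nat \<Rightarrow> real) \<Rightarrow> nat \<Rightarrow> nat \<Rightarrow> real \<Rightarrow> real" where
  "bspline_rec t 0 k x = 0"
| "bspline_rec t (Suc 0) k x = indicator {t k..<t (k + 1)} x"
| "bspline_rec t (Suc (Suc q)) k x =
     (x - t k) / (t (k + Suc q) - t k) * bspline_rec t (Suc q) k x
   + (t (k + Suc (Suc q)) - x) / (t (k + Suc (Suc q)) - t (k + 1)) * bspline_rec t (Suc q) (k + 1) x"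

definition bspline :: "nat \<Rightarrow> nat \<Rightarrow> nat \<Rightarrow> real \<Rightarrow> real" where
  "bspline r N k x =
     (if x < 1 then bspline_rec (knot r N) r k x
      else Lim (at_left 1) (bspline_rec (knot r N) r k))"

definition bspline_vec :: "nat \<Rightarrow> nat \<Rightarrow> real \<Rightarrow> real Matrix.vec" where
  "bspline_vec r N x = Matrix.vec (N + r) (\<lambda>j. bspline r N (j + 1) x)"

definition stack_cols :: "real Matrix.mat \<Rightarrow> real Matrix.vec" where
  "stack_cols A = Matrix.vec (dim_row A * dim_col A)
     (\<lambda>l. A $$ (l mod dim_row A, l div dim_row A))"

definition vec_tensor :: "real Matrix.vec \<Rightarrow> real Matrix.vec \<Rightarrow> real Matrix.vec" where
  "vec_tensor u v = stack_cols (Matrix.mat (dim_vec u) (dim_vec v) (\<lambda>(i, j). u $ i * v $ j))"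

(* The factors follow the order of the coordinate type.  The tensor product is associative,
   and the one-component vector (1) is its unit. *)
definition tensor_spline :: "nat \<Rightarrow> nat \<Rightarrow> real ^ 'q::{finite,linorder} \<Rightarrow> real Matrix.vec" where
  "tensor_spline r N x =
     foldr vec_tensor
       (map (\<lambda>i. bspline_vec r N (vec_nth x i)) (sorted_list_of_set (UNIV :: 'q set)))
       (Matrix.vec 1 (\<lambda>_. 1))"


section \<open>Ordinary least squares\<close>

(* No particular generalised inverse is prescribed for singular designs: this is an
   arbitrary rule that selects one, Borel measurably in the matrix entries (otherwise the
   fitted values need not be random variables).  For an invertible A it returns the inverse. *)
definition generalised_inverse_rule :: "(real Matrix.mat \<Rightarrow> real Matrix.mat) \<Rightarrow> bool" where
  "generalised_inverse_rule ginv \<longleftrightarrow>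
     (\<forall>k. \<forall>A\<in>carrier_mat k k. ginv A \<in> carrier_mat k k \<and> A * ginv A * A = A) \<and>
     (\<forall>k. \<forall>i<k. \<forall>j<k.
        (\<lambda>a. ginv (Matrix.mat k k a) $$ (i, j))
          \<in> borel_measurable (PiM ({..<k} \<times> {..<k}) (\<lambda>_. borel)))"

(* Least squares regression of the second components of the list obs on the basis b
   (with K components) evaluated at the first components. *)
definition ols_fit ::
  "(real Matrix.mat \<Rightarrow> real Matrix.mat) \<Rightarrow> nat \<Rightarrow> ('w \<Rightarrow> real Matrix.vec) \<Rightarrow> ('w \<times> real) list \<Rightarrow> 'w \<Rightarrow> real"
where
  "ols_fit ginv K b obs w =
     (let \<Phi> = mat_of_rows K (map (\<lambda>ob. b (fst ob)) obs);
          y = vec_of_list (map snd obs)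
      in scalar_prod (b w) (ginv (transpose_mat \<Phi> * \<Phi>) *\<^sub>v (transpose_mat \<Phi> *\<^sub>v y)))"


section \<open>The test statistic\<close>

type_synonym ('dx, 'dz) obs = "(real ^ 'dx) \<times> real \<times> (real ^ 'dz)"

definition obs_Y :: "('dx::finite, 'dz::finite) obs \<Rightarrow> real" where
  "obs_Y = (\<lambda>(x, y, z). y)"

definition obs_Z :: "('dx::finite, 'dz::finite) obs \<Rightarrow> real ^ 'dz" where
  "obs_Z = (\<lambda>(x, y, z). z)"

definition obs_XZ :: "('dx::finite, 'dz::finite) obs \<Rightarrow> (real ^ 'dx) \<times> (real ^ 'dz)" where
  "obs_XZ = (\<lambda>(x, y, z). (x, z))"

definition spline_test_stat ::
  "(real Matrix.mat \<Rightarrow> real Matrix.mat) \<Rightarrow> nat \<Rightarrow> nat \<Rightarrow> nat \<Rightarrow>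
   (nat \<Rightarrow> ('dx::{finite,linorder}, 'dz::{finite,linorder}) obs) \<Rightarrow> real"
where
  "spline_test_stat ginv r N n \<omega> =
    (let KX = (N + r) ^ CARD('dx);
         KZ = (N + r) ^ CARD('dz);
         KZ' = (N + 2 * r - 1) ^ CARD('dz);
         \<phi>Z = (tensor_spline r N :: real ^ 'dz::{finite,linorder} \<Rightarrow> real Matrix.vec);
         \<phi> = (\<lambda>(x, z). vec_tensor (tensor_spline r N x) (\<phi>Z z));
         \<psi> = (tensor_spline (2 * r - 1) N :: real ^ 'dz::{finite,linorder} \<Rightarrow> real Matrix.vec);
         D2 = map \<omega> [n + 1..<2 * n + 1];
         D3 = map \<omega> [2 * n + 1..<3 * n + 1];
         D4 = map \<omega> [3 * n + 1..<4 * n + 1];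
         g_hat = ols_fit ginv (KX * KZ) \<phi> (map (\<lambda>w. (obs_XZ w, obs_Y w)) D2);
         m_tilde = ols_fit ginv KZ \<phi>Z (map (\<lambda>w. (obs_Z w, g_hat (obs_XZ w))) D2);
         f_hat = (\<lambda>(x, z). g_hat (x, z) - m_tilde z);
         m_f_hat = ols_fit ginv KZ' \<psi> (map (\<lambda>w. (obs_Z w, f_hat (obs_XZ w))) D3);
         m_hat = ols_fit ginv KZ' \<psi> (map (\<lambda>w. (obs_Z w, obs_Y w)) D4);
         L = (\<lambda>i. (obs_Y (\<omega> i) - m_hat (obs_Z (\<omega> i))) *
                  (f_hat (obs_XZ (\<omega> i)) - m_f_hat (obs_Z (\<omega> i))))
     in real n powr (- 1 / 2) * (\<Sum>i=1..n. L i)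
        / sqrt (1 / real n * (\<Sum>i=1..n. (L i)\<^sup>2) - (1 / real n * (\<Sum>i=1..n. L i))\<^sup>2))"

definition std_normal_quantile :: "real \<Rightarrow> real" where
  "std_normal_quantile p = Inf {x. p \<le> cdf std_normal_distribution x}"

definition rejection_prob ::
  "(real Matrix.mat \<Rightarrow> real Matrix.mat) \<Rightarrow> nat \<Rightarrow> nat \<Rightarrow> real \<Rightarrow> nat \<Rightarrow>
   ('dx::{finite,linorder}, 'dz::{finite,linorder}) obs measure \<Rightarrow> real"
where
  "rejection_prob ginv r N \<alpha> n P =
     measure (PiM {1..4 * n} (\<lambda>_. P))
       {\<omega> \<in> space (PiM {1..4 * n} (\<lambda>_. P)).
          spline_test_stat ginv r N n \<omega> > std_normal_quantile (1 - \<alpha>)}"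

(* The infimum of a family of probabilities; over the empty class it is 1. *)
definition inf_prob :: "'c set \<Rightarrow> ('c \<Rightarrow> real) \<Rightarrow> real" where
  "inf_prob \<C> p = (if \<C> = {} then 1 else (INF P\<in>\<C>. p P))"


section \<open>Versions of conditional quantities\<close>

abbreviation sigma_of :: "'w measure \<Rightarrow> ('w \<Rightarrow> 'v::topological_space) \<Rightarrow> 'w measure" where
  "sigma_of P V \<equiv> vimage_algebra (space P) V borel"

(* h is a version of v \<mapsto> E(Y | V = v). *)
definition cond_mean_version ::
  "'w measure \<Rightarrow> ('w \<Rightarrow> real) \<Rightarrow> ('w \<Rightarrow> 'v::topological_space) \<Rightarrow> ('v \<Rightarrow> real) \<Rightarrow> bool"
where
  "cond_mean_version P Y V h \<longleftrightarrow>
     integrable P Y \<and> h \<in> borel_measurable borel \<and>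
     (AE w in P. h (V w) = real_cond_exp P (sigma_of P V) Y w)"

(* The density is taken with respect to Lebesgue measure on the cube. *)
definition joint_density_version ::
  "('dx::finite, 'dz::finite) obs measure \<Rightarrow> ((real ^ 'dx) \<times> (real ^ 'dz) \<Rightarrow> real) \<Rightarrow> bool"
where
  "joint_density_version P p \<longleftrightarrow>
     (\<forall>v\<in>unit_cube. p v \<ge> 0) \<and>
     distributed P lborel obs_XZ (\<lambda>v. ennreal (p v) * indicator unit_cube v)"

(* q x z is a version of the conditional density of X at x given Z = z:
   P(dx, dz) = q x z dx P(dz), where dx is Lebesgue measure on the cube. *)
definition cond_density_version ::
  "('dx::finite, 'dz::finite) obs measure \<Rightarrow> (real ^ 'dx \<Rightarrow> real ^ 'dz \<Rightarrow> real) \<Rightarrow> bool"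
where
  "cond_density_version P q \<longleftrightarrow>
     (\<forall>x\<in>unit_cube. \<forall>z\<in>unit_cube. q x z \<ge> 0) \<and>
     distributed P (density lborel (indicator unit_cube) \<Otimes>\<^sub>M distr P borel obs_Z) obs_XZ
       (\<lambda>(x, z). ennreal (q x z))"

end

theory Submission
  imports Defs "HOL-Real_Asymp.Real_Asymp"
begin

text \<open>Up to an orthogonal correction, \<open>T\<close> estimates \<open>\<tau>\<close> by the mean of a product of two
  residuals. Conditionally on the last three data sets its mean is the inner product of
  \<open>f + \<Delta>\<close> with the fitted direction, where \<open>f = g - m\<close> and \<open>\<Delta>\<close> is the error of \<open>m\<close>. Comparison of
  the empirical and the population norms of piecewise polynomials, which holds because every cell
  of the knot grid receives its share of the observations, turns least squares fits into
  near-projections: the bias terms are of the order of the squared approximation error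
  \<open>n powr (- 4 s / (4 s + d))\<close>, which is negligible against \<open>\<tau>\<close>, and the fluctuations are linear
  in the noise, so that only their second moments are needed. Hence the mean is at least \<open>\<tau> / 2\<close>,
  the variance is small against \<open>n \<tau>\<^sup>2\<close>, and Chebyshev's inequality suffices.\<close>

text \<open>Three obstacles shape the argument. The Hoelder norm controls derivatives of top order
  only, so it does not bound \<open>g\<close> and \<open>m\<close> themselves; the bound
  \<open>f_sq_le\<close> on the signal comes from the noise, because \<open>f\<close> is a
  conditional mean of \<open>\<epsilon>\<close>. The statistic is 0 when its denominator vanishes,
  so a nonpositive summand must occur with high probability; it is found near a zero of
  \<open>f\<close>, which exists because \<open>f\<close> is continuous with mean zero, and near
  which the noise takes both signs. The second moment of a summand contains the product of the
  fitted direction and the error of \<open>m\<close>; it is bounded by the supremum of the one and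
  the square norm of the other, at the price of a factor \<open>Kc\<close>, the number of grid
  cells. With \<open>x^2\<close> the order of \<open>Kc\<close> this leads to
  \<open>x^4 \<le> n\<close>, which is \<open>s \<ge> 3 d / 4\<close>. The number of knots balances
  the squared bias, of order \<open>N powr (- 2 s)\<close>, with the fluctuation of a product of two
  noise terms, of order \<open>sqrt Kc / n\<close>, that is \<open>x / n\<close>; the separation is
  measured in this unit.\<close>

section \<open>Univariate polynomials: coefficients and slopes bounded by values\<close>

lemma poly_altdef_le:
  fixes p :: "real poly"
  assumes "degree p \<le> n"
  shows "poly p x = (\<Sum>i\<le>n. coeff p i * x ^ i)"
  unfolding poly_altdef using assms by (intro sum.mono_neutral_left) (auto simp: coeff_eq_0)

text \<open>Induction on the degree with the combination
  \<open>q(t) = p(t) - 2^(D+1) p(t/2)\<close>: the leading coefficient cancels, and the coefficient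
  of order \<open>i \<le> D\<close> is multiplied by \<open>1 - 2^(D+1-i)\<close>, which has modulus
  at least 1. So the induction hypothesis for \<open>q\<close> bounds the lower coefficients of
  \<open>p\<close>, and the leading one is then read off the value at 1/2.\<close>

lemma poly_coeff_bounded_by_values:
  "\<exists>K\<ge>0. \<forall>p::real poly. \<forall>A. degree p \<le> D --> (\<forall>t. 0 \<le> t \<and> t < 1 --> \<bar>poly p t\<bar> \<le> A)
     --> (\<forall>i. \<bar>coeff p i\<bar> \<le> K * A)"
proof (induction D)
  case 0
  show ?case
  proof (intro exI[of _ 1] conjI allI impI)
    fix p :: "real poly" and A i
    assume d: "degree p \<le> 0" and b: "\<forall>t. 0 \<le> t \<and> t < 1 --> \<bar>poly p t\<bar> \<le> A"
    have "\<bar>coeff p 0\<bar> \<le> A" using b[rule_format, of 0] by (simp add: poly_0_coeff_0)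
    moreover have "coeff p i = 0" if "i \<noteq> 0" using d that by (simp add: coeff_eq_0)
    ultimately show "\<bar>coeff p i\<bar> \<le> 1 * A" by (cases "i = 0") auto
  qed simp
next
  case (Suc D)
  then obtain K where K: "K \<ge> 0" "\<And>p::real poly. \<And>A i. degree p \<le> D ==> (\<And>t. 0 \<le> t ==> t < 1 ==> \<bar>poly p t\<bar> \<le> A)
     ==> \<bar>coeff p i\<bar> \<le> K * A" by metis
  define K1 where "K1 = K * (1 + 2 ^ Suc D)"
  define K2 where "K2 = 2 ^ Suc D * (1 + real (Suc D) * K1)"
  have K1: "K1 \<ge> 0" using K by (simp add: K1_def)
  have K12: "K1 \<le> K2"
  proof -
    have "K1 \<le> 1 + real (Suc D) * K1" using K1 by (simp add: algebra_simps)
    also have "... \<le> 2 ^ Suc D * (1 + real (Suc D) * K1)"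
      using K1 mult_right_mono[of 1 "2 ^ Suc D" "1 + real (Suc D) * K1"] one_le_power[of "2::real" "Suc D"] by simp
    finally show ?thesis by (simp add: K2_def)
  qed
  show ?case
  proof (intro exI[of _ K2] conjI allI impI)
    show "0 \<le> K2" using K1 by (simp add: K2_def)
    fix p :: "real poly" and A i
    assume d: "degree p \<le> Suc D" and b: "\<forall>t. 0 \<le> t \<and> t < 1 --> \<bar>poly p t\<bar> \<le> A"
    have A: "0 \<le> A" using b[rule_format, of 0] by simp
    define q where "q = p - Polynomial.smult (2 ^ Suc D) (pcompose p [:0, 1/2:])"
    have cq: "coeff q i = coeff p i * (1 - 2 ^ Suc D * (1/2) ^ i)" for i
      by (simp add: q_def coeff_pcompose_linear algebra_simps)
    have dq: "degree q \<le> D"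
    proof (rule degree_le, intro allI impI)
      fix i assume "D < i"
      show "coeff q i = 0"
      proof (cases "i = Suc D")
        case True then show ?thesis by (simp add: cq power_divide)
      next
        case False then have "coeff p i = 0" using d \<open>D < i\<close> by (intro coeff_eq_0) auto
        then show ?thesis by (simp add: cq)
      qed
    qed
    have vq: "\<bar>poly q t\<bar> \<le> (1 + 2 ^ Suc D) * A" if "0 \<le> t" "t < 1" for t
    proof -
      have "\<bar>poly p t\<bar> \<le> A" "\<bar>poly p (t/2)\<bar> \<le> A" using b that by auto
      moreover have "poly q t = poly p t - 2 ^ Suc D * poly p (t/2)" by (simp add: q_def poly_pcompose)
      moreover have "\<bar>2 ^ Suc D * poly p (t/2)\<bar> = 2 ^ Suc D * \<bar>poly p (t/2)\<bar>" by (simp add: abs_mult)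
      moreover have "2 ^ Suc D * \<bar>poly p (t/2)\<bar> \<le> 2 ^ Suc D * A" using calculation(2) by (intro mult_left_mono) auto
      ultimately show ?thesis unfolding distrib_right by linarith
    qed
    have cpl: "\<bar>coeff p i\<bar> \<le> K1 * A" if "i \<le> D" for i
    proof -
      have "\<bar>coeff q i\<bar> \<le> K1 * A" using K(2)[OF dq vq, of i] by (simp add: K1_def mult.assoc)
      have e: "(2::real) ^ Suc D * (1/2) ^ i = 2 ^ (Suc D - i)" using that
        by (simp add: power_diff power_divide del: power_Suc)
      have "(2::real) \<le> 2 ^ (Suc D - i)" using that by (metis Suc_diff_le one_le_numeral one_le_power power_Suc mult_le_cancel_left1 mult.right_neutral not_numeral_less_zero)
      then have "1 \<le> \<bar>1 - 2 ^ Suc D * (1/2::real) ^ i\<bar>" unfolding e by simp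
      then have "\<bar>coeff p i\<bar> * 1 \<le> \<bar>coeff p i\<bar> * \<bar>1 - 2 ^ Suc D * (1/2) ^ i\<bar>" by (intro mult_left_mono) auto
      also have "... = \<bar>coeff q i\<bar>" by (simp add: cq abs_mult)
      finally show ?thesis using \<open>\<bar>coeff q i\<bar> \<le> K1 * A\<close> by simp
    qed
    have top: "\<bar>coeff p (Suc D)\<bar> \<le> K2 * A"
    proof -
      have "poly p (1/2) = (\<Sum>i\<le>Suc D. coeff p i * (1/2)^i)" using d by (rule poly_altdef_le)
      then have "coeff p (Suc D) * (1/2)^Suc D = poly p (1/2) - (\<Sum>i\<le>D. coeff p i * (1/2)^i)" by simp
      also have "\<bar>...\<bar> \<le> \<bar>poly p (1/2)\<bar> + (\<Sum>i\<le>D. \<bar>coeff p i * (1/2)^i\<bar>)"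
        by (rule order_trans[OF abs_triangle_ineq4]) (use sum_abs in \<open>simp add: add_left_mono\<close>)
      also have "... \<le> A + (\<Sum>i\<le>D. K1 * A)"
      proof (intro add_mono sum_mono)
        fix i assume "i \<in> {..D}"
        have "\<bar>coeff p i * (1/2)^i\<bar> = \<bar>coeff p i\<bar> * (1/2)^i" by (simp add: abs_mult)
        also have "... \<le> \<bar>coeff p i\<bar> * 1" by (intro mult_left_mono power_le_one) auto
        also have "... \<le> K1 * A" using cpl \<open>i \<in> {..D}\<close> by simp
        finally show "\<bar>coeff p i * (1/2)^i\<bar> \<le> K1 * A" .
      qed (use b in auto)
      also have "... = (1 + real (Suc D) * K1) * A" by (simp add: algebra_simps)
      finally have "\<bar>coeff p (Suc D)\<bar> * (1/2)^Suc D \<le> (1 + real (Suc D) * K1) * A" by (simp add: abs_mult)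
      then have "2 ^ Suc D * (\<bar>coeff p (Suc D)\<bar> * (1/2)^Suc D) \<le> 2 ^ Suc D * ((1 + real (Suc D) * K1) * A)"
        by (intro mult_left_mono) auto
      then show ?thesis by (simp add: K2_def power_divide mult.assoc del: power_Suc)
    qed
    have "\<bar>coeff p i\<bar> \<le> K2 * A" if "i \<le> D" using cpl[OF that] mult_right_mono[OF K12 A] by linarith
    moreover have "coeff p i = 0" if "i > Suc D" using d that by (intro coeff_eq_0) auto
    ultimately show "\<bar>coeff p i\<bar> \<le> K2 * A"
      using top A K12 K1 by (metis abs_zero linorder_neqE_nat mult_nonneg_nonneg not_less_eq order_trans less_Suc_eq_le)
  qed
qed

text \<open>A Markov-type inequality: after rescaling the interval to \<open>[0, 1)\<close> the
  values bound the coefficients, and there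
  \<open>\<bar>s^i - t^i\<bar> \<le> i \<bar>s - t\<bar>\<close>. The constant depends on the degree
  alone; the half-open interval matches the grid cells.\<close>

lemma poly_lipschitz_by_values:
  "\<exists>K\<ge>0. \<forall>p::real poly. \<forall>A a h s t. degree p \<le> D --> 0 < h --> (\<forall>t. a \<le> t \<and> t < a + h --> \<bar>poly p t\<bar> \<le> A)
     --> a \<le> s --> s < a + h --> a \<le> t --> t < a + h --> \<bar>poly p s - poly p t\<bar> \<le> K * A * (\<bar>s - t\<bar> / h)"
proof -
  obtain K where K: "K \<ge> 0" "\<And>p::real poly. \<And>A i. degree p \<le> D ==> (\<And>t. 0 \<le> t ==> t < 1 ==> \<bar>poly p t\<bar> \<le> A)
     ==> \<bar>coeff p i\<bar> \<le> K * A" using poly_coeff_bounded_by_values[of D] by metis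
  define K' where "K' = (\<Sum>i\<le>D. K * real i)"
  show ?thesis
  proof (intro exI[of _ K'] conjI allI impI)
    show "0 \<le> K'" using K by (auto simp: K'_def intro!: sum_nonneg)
    fix p :: "real poly" and A a h s t :: real
    assume d: "degree p \<le> D" and h: "0 < h" and b: "\<forall>t. a \<le> t \<and> t < a + h --> \<bar>poly p t\<bar> \<le> A"
      and st: "a \<le> s" "s < a + h" "a \<le> t" "t < a + h"
    define q where "q = pcompose p [:a, h:]"
    have dq: "degree q \<le> D" using d h by (simp add: q_def degree_pcompose)
    have vq: "\<bar>poly q u\<bar> \<le> A" if "0 \<le> u" "u < 1" for u
      using b[rule_format, of "a + u * h"] that h by (simp add: q_def poly_pcompose mult.commute)
    have A: "0 \<le> A" using vq[of 0] by simp
    define s' where "s' = (s - a) / h"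
    define t' where "t' = (t - a) / h"
    have st': "0 \<le> s'" "s' < 1" "0 \<le> t'" "t' < 1" using st h by (auto simp: s'_def t'_def)
    have "poly q s' = poly p s" "poly q t' = poly p t" using h by (auto simp: q_def poly_pcompose s'_def t'_def)
    then have "poly p s - poly p t = (\<Sum>i\<le>D. coeff q i * (s' ^ i - t' ^ i))"
      using poly_altdef_le[OF dq] by (simp add: sum_subtractf right_diff_distrib)
    also have "\<bar>...\<bar> \<le> (\<Sum>i\<le>D. \<bar>coeff q i * (s' ^ i - t' ^ i)\<bar>)" by (rule sum_abs)
    also have "... \<le> (\<Sum>i\<le>D. (K * A) * (real i * \<bar>s' - t'\<bar>))"
    proof (rule sum_mono)
      fix i
      have "\<bar>s' ^ i - t' ^ i\<bar> \<le> real i * \<bar>s' - t'\<bar>"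
        using norm_power_diff[of s' t' i] st' by auto
      then show "\<bar>coeff q i * (s' ^ i - t' ^ i)\<bar> \<le> (K * A) * (real i * \<bar>s' - t'\<bar>)"
        unfolding abs_mult using K(2)[OF dq vq, of i] by (intro mult_mono) (auto intro: order_trans)
    qed
    also have "... = K' * A * \<bar>s' - t'\<bar>" unfolding K'_def sum_distrib_right by (intro sum.cong) (auto simp: mult_ac)
    also have "\<bar>s' - t'\<bar> = \<bar>s - t\<bar> / h" using h by (simp add: s'_def t'_def diff_divide_distrib[symmetric] abs_div)
    finally show "\<bar>poly p s - poly p t\<bar> \<le> K' * A * (\<bar>s - t\<bar> / h)" .
  qed
qed

section \<open>Grid cells and piecewise polynomials\<close>

text \<open>Half-open, so that the cells of a grid partition it and every B-spline is given there by
  its recursion rather than by the left limit at 1.\<close>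

definition ucube :: "'a::euclidean_space set" where
  "ucube = {x. \<forall>b\<in>Basis. 0 \<le> x \<bullet> b \<and> x \<bullet> b < 1}"

definition cell :: "nat => ('a => nat) => 'a::euclidean_space set" where
  "cell L J = {x. \<forall>b\<in>Basis. real (J b) \<le> real L * (x \<bullet> b) \<and> real L * (x \<bullet> b) < real (J b) + 1}"

text \<open>\<open>restrict\<close> makes the index extensional, so that a point of
  \<open>ucube\<close> lies in the cell of exactly one element of
  \<open>cell_indices\<close>.\<close>

definition cell_index :: "nat => 'a::euclidean_space => 'a => nat" where
  "cell_index L x = restrict (%b. nat \<lfloor>real L * (x \<bullet> b)\<rfloor>) Basis"

definition cell_indices :: "nat => ('a::euclidean_space => nat) set" where
  "cell_indices L = Basis \<rightarrow>\<^sub>E {..<L}"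

definition move :: "'a::euclidean_space => 'a => real => 'a" where
  "move x b t = x + (t - x \<bullet> b) *\<^sub>R b"

lemma move_inner: "b \<in> Basis ==> b' \<in> Basis ==> move x b t \<bullet> b' = (if b' = b then t else x \<bullet> b')"
  by (auto simp: move_def inner_add_left inner_Basis)

lemma move_self [simp]: "move x b (x \<bullet> b) = x"
  by (simp add: move_def)

lemma finite_cell_indices [simp]: "finite (cell_indices L)"
  by (simp add: cell_indices_def finite_PiE)

lemma card_cell_indices: "card (cell_indices L :: ('a::euclidean_space => nat) set) = L ^ DIM('a)"
  by (simp add: cell_indices_def card_PiE)

lemma in_cell_index: "0 < L ==> x \<in> ucube ==> x \<in> cell L (cell_index L x)"
  by (auto simp: cell_def cell_index_def ucube_def)

lemma cell_index_in: assumes "0 < L" "x \<in> ucube" shows "cell_index L x \<in> cell_indices L"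
proof -
  have "nat \<lfloor>real L * (x \<bullet> b)\<rfloor> < L" if "b \<in> Basis" for b
  proof -
    have "0 \<le> x \<bullet> b" "x \<bullet> b < 1" using assms that by (auto simp: ucube_def)
    then have "real L * (x \<bullet> b) < real L" using assms(1) by simp
    then have "\<lfloor>real L * (x \<bullet> b)\<rfloor> < int L" by (simp add: floor_less_iff)
    then show ?thesis using assms(1) by linarith
  qed
  then show ?thesis by (auto simp: cell_index_def cell_indices_def)
qed

lemma cell_index_unique: assumes "x \<in> cell L J" "J \<in> cell_indices L" shows "J = cell_index L x"
proof
  fix b
  show "J b = cell_index L x b"
  proof (cases "b \<in> Basis")
    case True
    then have "real (J b) \<le> real L * (x \<bullet> b) \<and> real L * (x \<bullet> b) < real (J b) + 1" using assms by (auto simp: cell_def)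
    then have "\<lfloor>real L * (x \<bullet> b)\<rfloor> = int (J b)" by linarith
    then show ?thesis using True by (simp add: cell_index_def)
  next
    case False then show ?thesis using assms by (auto simp: cell_index_def cell_indices_def PiE_def extensional_def)
  qed
qed

lemma cell_subset_ucube: assumes "J \<in> cell_indices L" shows "cell L J \<subseteq> ucube"
proof
  fix x assume x: "x \<in> cell L J"
  show "x \<in> ucube" unfolding ucube_def
  proof (safe)
    fix b :: 'a assume b: "b \<in> Basis"
    have k: "J b < L" using assms b by (auto simp: cell_indices_def)
    have 1: "real (J b) \<le> real L * (x \<bullet> b)" "real L * (x \<bullet> b) < real (J b) + 1" using x b by (auto simp: cell_def)
    have L: "0 < real L" using k by simp
    have "0 \<le> real L * (x \<bullet> b)" using 1 by linarith
    then show "0 \<le> x \<bullet> b" using L by (simp add: zero_le_mult_iff)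
    have "real (J b) + 1 \<le> real L" using k by linarith
    then have "real L * (x \<bullet> b) < real L * 1" using 1 by linarith
    then show "x \<bullet> b < 1" using L by (simp only: mult_less_cancel_left_pos)
  qed
qed

lemma borel_cell [measurable]: "cell L J \<in> sets borel"
  unfolding cell_def by measurable

lemma borel_ucube [measurable]: "ucube \<in> sets borel"
  unfolding ucube_def by measurable

text \<open>The cell is squeezed between the open and the closed box with the same corners, which
  have equal volume.\<close>

lemma emeasure_cell:
  assumes L: "0 < L"
  shows "emeasure lborel (cell L J :: 'a::euclidean_space set) = ennreal ((1 / real L) ^ DIM('a))"
proof -
  define l :: 'a where "l = (\<Sum>b\<in>Basis. (real (J b) / real L) *\<^sub>R b)"
  define u :: 'a where "u = (\<Sum>b\<in>Basis. ((real (J b) + 1) / real L) *\<^sub>R b)"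
  have lu: "l \<bullet> b = real (J b) / real L" "u \<bullet> b = (real (J b) + 1) / real L" if "b \<in> Basis" for b
    using that by (auto simp: l_def u_def)
  have le: "l \<bullet> b \<le> u \<bullet> b" if "b \<in> Basis" for b using lu[OF that] L by (simp add: divide_right_mono)
  have iff: "(l \<bullet> b < x --> real (J b) \<le> real L * x) \<and> (x < u \<bullet> b --> real L * x < real (J b) + 1)
      \<and> (real (J b) \<le> real L * x --> l \<bullet> b \<le> x) \<and> (real L * x < real (J b) + 1 --> x \<le> u \<bullet> b)"
    if "b \<in> Basis" for b x
    unfolding lu[OF that] using L by (auto simp: field_simps)
  have "box l u \<subseteq> cell L J" using iff by (auto simp: cell_def mem_box)
  moreover have "cell L J \<subseteq> cbox l u" using iff by (auto simp: cell_def mem_box)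
  moreover have p: "(\<Prod>b\<in>Basis. (u - l) \<bullet> b) = (1 / real L) ^ DIM('a)"
    using lu by (simp add: inner_diff_left diff_divide_distrib[symmetric])
  moreover have "emeasure lborel (box l u) = ennreal ((1 / real L) ^ DIM('a))"
    "emeasure lborel (cbox l u) = ennreal ((1 / real L) ^ DIM('a))"
    using le p by (auto simp: emeasure_lborel_box_eq emeasure_lborel_cbox_eq)
  ultimately show ?thesis
    by (metis borel_cell box_borel cbox_borel emeasure_mono order_antisym sets_lborel)
qed

text \<open>Instead of a joint polynomial on each cell, only the restrictions to axis-parallel
  lines are required to be polynomials; this is all that the inequalities below use.\<close>

definition pp :: "nat => nat => ('a::euclidean_space => real) => bool" where
  "pp L D v \<longleftrightarrow> v \<in> borel_measurable borel \<and> (\<exists>A. \<forall>x\<in>ucube. \<bar>v x\<bar> \<le> A) \<and>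
     (\<forall>x\<in>ucube. \<forall>b\<in>Basis. \<forall>k<L. \<exists>p. degree p \<le> D \<and>
        (\<forall>t. real k \<le> real L * t \<and> real L * t < real k + 1 --> v (move x b t) = poly p t))"

text \<open>The measures are compared cell by cell: \<open>v^2\<close> is at most its supremum over
  the cell, and this supremum is at most \<open>4 v^2\<close> on the subset \<open>e J\<close>,
  whose mass under \<open>\<nu>2\<close> controls the mass of the cell under \<open>\<nu>1\<close>.
  Nothing distinguishes the two measures, so the empirical and the population norm can take either
  role.\<close>

lemma pp_norm_le:
  fixes \<nu>1 \<nu>2 :: "'a::euclidean_space measure"
  assumes f1: "finite_measure \<nu>1" "sets \<nu>1 = sets borel" "AE x in \<nu>1. x \<in> ucube"
    and f2: "finite_measure \<nu>2" "sets \<nu>2 = sets borel" "AE x in \<nu>2. x \<in> ucube"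
    and L: "0 < L" and B: "0 \<le> B" and v: "v \<in> borel_measurable borel" "\<And>x. x \<in> ucube ==> \<bar>v x\<bar> \<le> A"
    and e: "\<And>J. J \<in> cell_indices L ==> e J \<in> sets borel \<and> e J \<subseteq> cell L J \<and>
        measure \<nu>1 (cell L J) \<le> B * measure \<nu>2 (e J) \<and> (\<forall>x\<in>cell L J. \<forall>y\<in>e J. \<bar>v x\<bar> \<le> 2 * \<bar>v y\<bar>)"
  shows "(\<integral>x. (v x)^2 \<partial>\<nu>1) \<le> 4 * B * (\<integral>x. (v x)^2 \<partial>\<nu>2)"
proof -
  interpret f1: finite_measure \<nu>1 by fact
  interpret f2: finite_measure \<nu>2 by fact
  have [measurable]: "v \<in> borel_measurable borel" by fact
  note [measurable_cong] = f1(2) f2(2)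
  define a where "a J = (SUP x\<in>cell L J. (v x)^2)" for J
  have sq: "(v x)^2 \<le> A\<^sup>2" if "x \<in> ucube" for x using power_mono[OF v(2)[OF that], of 2] by simp
  have bdd: "bdd_above ((%x. (v x)^2) ` cell L J)" if "J \<in> cell_indices L" for J
    using cell_subset_ucube[OF that] sq by (auto intro!: bdd_aboveI2)
  have ne: "cell L J \<noteq> ({}::'a set)" for J
    using emeasure_cell[OF L, of J] L by auto
  have aup: "(v x)^2 \<le> a J" if "J \<in> cell_indices L" "x \<in> cell L J" for x J
    unfolding a_def by (rule cSUP_upper[OF that(2) bdd[OF that(1)]])
  have a0: "0 \<le> a J" if "J \<in> cell_indices L" for J
    using aup[OF that] ne[of J] order_trans[OF zero_le_power2] by blast
  have adn: "a J \<le> 4 * (v y)^2" if "J \<in> cell_indices L" "y \<in> e J" for y J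
    unfolding a_def
  proof (rule cSUP_least[OF ne])
    fix x assume "x \<in> cell L J"
    then have "\<bar>v x\<bar> \<le> 2 * \<bar>v y\<bar>" using e[OF that(1)] that(2) by blast
    then have "\<bar>v x\<bar>\<^sup>2 \<le> (2 * \<bar>v y\<bar>)^2" by (intro power_mono) auto
    then show "(v x)^2 \<le> 4 * (v y)^2" by (simp add: power_mult_distrib)
  qed
  \<comment> \<open>At each point only the summand of the cell that contains it survives, so sums
    over all cells can be compared with \<open>v^2\<close> pointwise.\<close>
  have loc: "(\<Sum>J\<in>cell_indices L. c J * indicator (S J) x) = c (cell_index L x) * (indicator (S (cell_index L x)) x :: real)"
    if "x \<in> ucube" "\<And>J. J \<in> cell_indices L ==> S J \<subseteq> cell L J" for x c S
  proof -
    have "(\<Sum>J\<in>cell_indices L. c J * indicator (S J) x) = (\<Sum>J\<in>{cell_index L x}. c J * (indicator (S J) x :: real))"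
    proof (rule sum.mono_neutral_right)
      show "{cell_index L x} \<subseteq> cell_indices L" using cell_index_in[OF L that(1)] by simp
      show "\<forall>i\<in>cell_indices L - {cell_index L x}. c i * (indicator (S i) x :: real) = 0"
      proof (rule ballI)
        fix i assume i: "i \<in> cell_indices L - {cell_index L x}"
        then have "x \<notin> S i" using cell_index_unique[of x L i] that(2)[of i] by auto
        then show "c i * (indicator (S i) x :: real) = 0" by simp
      qed
    qed simp
    also have "... = c (cell_index L x) * indicator (S (cell_index L x)) x" by (subst sum.insert) auto
    finally show ?thesis .
  qed
  have "(\<integral>x. (v x)^2 \<partial>\<nu>1) \<le> (\<integral>x. (\<Sum>J\<in>cell_indices L. a J * indicator (cell L J) x) \<partial>\<nu>1)"
  proof (rule integral_mono_AE)
    show "integrable \<nu>1 (%x. (v x)^2)"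
      using f1(3) sq by (intro f1.integrable_const_bound[where B = "A\<^sup>2"]) auto
    show "integrable \<nu>1 (%x. \<Sum>J\<in>cell_indices L. a J * indicator (cell L J) x)"
      by (intro Bochner_Integration.integrable_sum integrable_mult_right f1.integrable_const_bound[where B = 1]) auto
    show "AE x in \<nu>1. (v x)^2 \<le> (\<Sum>J\<in>cell_indices L. a J * indicator (cell L J) x)"
      using f1(3)
    proof eventually_elim
      case (elim x)
      then show ?case using loc[OF elim, of "cell L" a] aup[OF cell_index_in[OF L elim] in_cell_index[OF L elim]] in_cell_index[OF L elim] by simp
    qed
  qed
  also have "... = (\<Sum>J\<in>cell_indices L. a J * measure \<nu>1 (cell L J))"
    by (subst Bochner_Integration.integral_sum)
      (auto intro!: integrable_mult_right f1.integrable_const_bound[where B = 1] simp: sets_eq_imp_space_eq[OF f1(2)])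
  also have "... \<le> (\<Sum>J\<in>cell_indices L. a J * (B * measure \<nu>2 (e J)))"
    using e a0 by (intro sum_mono mult_left_mono) auto
  also have "... = (\<integral>x. (\<Sum>J\<in>cell_indices L. (a J * B) * indicator (e J) x) \<partial>\<nu>2)"
  proof (subst Bochner_Integration.integral_sum)
    fix J :: "'a => nat" assume k: "J \<in> cell_indices L"
    then have [measurable]: "e J \<in> sets borel" using e by auto
    show "integrable \<nu>2 (%x. (a J * B) * indicator (e J) x)"
      by (intro integrable_mult_right f2.integrable_const_bound[where B = 1]) auto
  next
    show "(\<Sum>J\<in>cell_indices L. a J * (B * measure \<nu>2 (e J))) = (\<Sum>J\<in>cell_indices L. \<integral>x. (a J * B) * indicator (e J) x \<partial>\<nu>2)"
      using e by (intro sum.cong) (auto simp: sets_eq_imp_space_eq[OF f2(2)] mult.assoc)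
  qed
  also have "... \<le> (\<integral>x. 4 * B * (v x)^2 \<partial>\<nu>2)"
  proof (rule integral_mono_AE)
    show "integrable \<nu>2 (%x. 4 * B * (v x)^2)"
      using f2(3) sq by (intro integrable_mult_right f2.integrable_const_bound[where B = "A\<^sup>2"]) auto
    have "e J \<in> sets borel" if "J \<in> cell_indices L" for J using e that by auto
    then show "integrable \<nu>2 (%x. \<Sum>J\<in>cell_indices L. (a J * B) * indicator (e J) x)"
      by (intro Bochner_Integration.integrable_sum integrable_mult_right f2.integrable_const_bound[where B = 1]) auto
    show "AE x in \<nu>2. (\<Sum>J\<in>cell_indices L. (a J * B) * indicator (e J) x) \<le> 4 * B * (v x)^2"
      using f2(3)
    proof eventually_elim
      case (elim x)
      have "(a (cell_index L x) * B) * indicator (e (cell_index L x)) x \<le> 4 * B * (v x)^2"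
        using adn[OF cell_index_in[OF L elim], of x] B mult_right_mono[of "a (cell_index L x)" "4 * (v x)^2" B]
        by (auto simp: indicator_def mult_ac)
      then show ?case using loc[OF elim, of e "%J. a J * B"] e by simp
    qed
  qed
  finally show ?thesis by simp
qed

text \<open>The pointwise counterpart: \<open>(v x)^2 \<le> 4 (v y)^2\<close> for \<open>y\<close>
  in \<open>e\<close>, integrated over \<open>e\<close>. With a lower bound for the mass of
  \<open>e\<close> it becomes an inverse inequality between supremum and square norm.\<close>

lemma pp_sup_le:
  fixes \<nu> :: "'a::euclidean_space measure"
  assumes f1: "finite_measure \<nu>" "sets \<nu> = sets borel" "AE x in \<nu>. x \<in> ucube"
    and v: "v \<in> borel_measurable borel" "\<And>x. x \<in> ucube ==> \<bar>v x\<bar> \<le> A"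
    and e: "e \<in> sets borel" "\<And>y. y \<in> e ==> \<bar>v x\<bar> \<le> 2 * \<bar>v y\<bar>"
  shows "(v x)^2 * measure \<nu> e \<le> 4 * (\<integral>x. (v x)^2 \<partial>\<nu>)"
proof -
  interpret f1: finite_measure \<nu> by fact
  have [measurable]: "v \<in> borel_measurable borel" "e \<in> sets borel" by fact+
  note [measurable_cong] = f1(2)
  have sq: "(v x)^2 \<le> A\<^sup>2" if "x \<in> ucube" for x using power_mono[OF v(2)[OF that], of 2] by simp
  have "(v x)^2 * measure \<nu> e = (\<integral>y. (v x)^2 * indicator e y \<partial>\<nu>)" using e by (simp add: sets_eq_imp_space_eq[OF f1(2)])
  also have "... \<le> (\<integral>y. 4 * (v y)^2 \<partial>\<nu>)"
  proof (rule integral_mono_AE)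
    show "integrable \<nu> (%x. 4 * (v x)^2)"
      using f1(3) sq by (intro integrable_mult_right f1.integrable_const_bound[where B = "A\<^sup>2"]) auto
    show "integrable \<nu> (%y. (v x)^2 * indicator e y)"
      by (intro integrable_mult_right f1.integrable_const_bound[where B = 1]) auto
    have "(v x)^2 \<le> 4 * (v y)^2" if "y \<in> e" for y
    proof -
      have "\<bar>v x\<bar>\<^sup>2 \<le> (2 * \<bar>v y\<bar>)^2" using e(2)[OF that] by (intro power_mono) auto
      then show ?thesis by (simp add: power_mult_distrib)
    qed
    then show "AE y in \<nu>. (v x)^2 * indicator e y \<le> 4 * (v y)^2" by (auto simp: indicator_def)
  qed
  finally show ?thesis by simp
qed

lemma pp_measurable: "pp L D v ==> v \<in> borel_measurable borel"
  by (simp add: pp_def)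

lemma pp_polyD:
  "pp L D v ==> x \<in> ucube ==> b \<in> Basis ==> k < L ==> \<exists>p. degree p \<le> D \<and>
     (\<forall>t. real k \<le> real L * t \<and> real L * t < real k + 1 --> v (move x b t) = poly p t)"
  by (simp add: pp_def)

lemma pp_zero: "pp L D (%x. 0)"
  unfolding pp_def by (auto intro!: exI[of _ "0::real poly"] exI[of _ "0::real"])

lemma pp_add: assumes "pp L D v" "pp L D w" shows "pp L D (%x. v x + w x)"
proof -
  have "\<exists>A. \<forall>x\<in>ucube. \<bar>v x + w x\<bar> \<le> A"
  proof -
    have "\<exists>A. \<forall>x\<in>ucube. \<bar>v x\<bar> \<le> A" "\<exists>B. \<forall>x\<in>ucube. \<bar>w x\<bar> \<le> B" using assms unfolding pp_def by simp_all
    then obtain A B where "\<forall>x\<in>ucube. \<bar>v x\<bar> \<le> A" "\<forall>x\<in>ucube. \<bar>w x\<bar> \<le> B" by blast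
    then show ?thesis by (intro exI[of _ "A + B"]) (auto intro!: order_trans[OF abs_triangle_ineq] add_mono)
  qed
  moreover have "\<exists>p. degree p \<le> D \<and> (\<forall>t. real k \<le> real L * t \<and> real L * t < real k + 1 --> v (move x b t) + w (move x b t) = poly p t)"
    if c: "x \<in> ucube" "b \<in> Basis" "k < L" for x b k
  proof -
    obtain p q where "degree p \<le> D" "\<forall>t. real k \<le> real L * t \<and> real L * t < real k + 1 --> v (move x b t) = poly p t"
      "degree q \<le> D" "\<forall>t. real k \<le> real L * t \<and> real L * t < real k + 1 --> w (move x b t) = poly q t"
      using pp_polyD[OF assms(1) c] pp_polyD[OF assms(2) c] by auto
    then show ?thesis by (intro exI[of _ "p + q"]) (auto intro: degree_add_le)
  qed
  ultimately show ?thesis using assms unfolding pp_def by auto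
qed

lemma pp_cmult: assumes "pp L D v" shows "pp L D (%x. a * v x)"
proof -
  have "\<exists>A. \<forall>x\<in>ucube. \<bar>a * v x\<bar> \<le> A"
  proof -
    have "\<exists>A. \<forall>x\<in>ucube. \<bar>v x\<bar> \<le> A" using assms unfolding pp_def by simp
    then obtain A where "\<forall>x\<in>ucube. \<bar>v x\<bar> \<le> A" by blast
    then show ?thesis by (intro exI[of _ "\<bar>a\<bar> * A"]) (auto simp: abs_mult intro!: mult_left_mono)
  qed
  moreover have "\<exists>p. degree p \<le> D \<and> (\<forall>t. real k \<le> real L * t \<and> real L * t < real k + 1 --> a * v (move x b t) = poly p t)"
    if c: "x \<in> ucube" "b \<in> Basis" "k < L" for x b k
  proof -
    obtain p where "degree p \<le> D" "\<forall>t. real k \<le> real L * t \<and> real L * t < real k + 1 --> v (move x b t) = poly p t"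
      using pp_polyD[OF assms c] by auto
    then show ?thesis by (intro exI[of _ "Polynomial.smult a p"]) (auto intro: order_trans[OF degree_smult_le])
  qed
  ultimately show ?thesis using assms unfolding pp_def by auto
qed

lemma pp_diff: assumes "pp L D v" "pp L D w" shows "pp L D (%x. v x - w x)"
  using pp_add[OF assms(1) pp_cmult[OF assms(2), of "-1"]] by simp

lemma pp_sum: assumes "\<And>i. i \<in> I ==> pp L D (v i)" shows "pp L D (%x. \<Sum>i\<in>I. v i x)"
  using assms by (induction I rule: infinite_finite_induct) (auto simp: pp_zero pp_add)

text \<open>Moving from a near-maximiser of the function to any other point of the same fine cell
  changes its value by at most a quarter of the maximum.\<close>

lemma pp_large_on_fine_cell:
  "\<exists>M>0. \<forall>L>0. \<forall>v::'a::euclidean_space => real. \<forall>J\<in>cell_indices L. pp L D v -->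
     (\<exists>J'\<in>cell_indices (L * M). cell (L * M) J' \<subseteq> cell L J \<and>
        (\<forall>x\<in>cell L J. \<forall>y\<in>cell (L * M) J'. \<bar>v x\<bar> \<le> 2 * \<bar>v y\<bar>))"
proof -
  obtain K where K0: "K \<ge> 0" and K: "\<And>p::real poly. \<And>A a h s t. degree p \<le> D ==> 0 < h ==> (\<And>t. a \<le> t ==> t < a + h ==> \<bar>poly p t\<bar> \<le> A)
     ==> a \<le> s ==> s < a + h ==> a \<le> t ==> t < a + h ==> \<bar>poly p s - poly p t\<bar> \<le> K * A * (\<bar>s - t\<bar> / h)"
    using poly_lipschitz_by_values[of D] by metis
  \<comment> \<open>One coordinate move within a fine cell changes \<open>v\<close> by at most
    \<open>K A / M\<close>. A point is reached by \<open>DIM('a)\<close> such moves, so this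
    \<open>M\<close> keeps the total change at or below \<open>A / 4\<close>.\<close>
  define M where "M = nat \<lceil>4 * real DIM('a) * K\<rceil> + 1"
  have M0: "M > 0" by (simp add: M_def)
  have M: "4 * real DIM('a) * K \<le> real M" unfolding M_def by linarith
  show ?thesis
  proof (intro exI[of _ M] conjI M0 allI impI ballI)
    fix L :: nat and v :: "'a => real" and J :: "'a => nat"
    assume L: "0 < L" and k: "J \<in> cell_indices L" and v: "pp L D v"
    define Q where "Q = cell L J"
    have QU: "Q \<subseteq> ucube" unfolding Q_def by (rule cell_subset_ucube[OF k])
    have "(\<Sum>b\<in>Basis. (real (J b) / real L) *\<^sub>R b) \<in> Q" using L by (auto simp: Q_def cell_def)
    then have Qne: "Q \<noteq> {}" by auto
    have "\<exists>A. \<forall>x\<in>ucube. \<bar>v x\<bar> \<le> A" using v unfolding pp_def by simp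
    then obtain A0 where A0: "\<And>x. x \<in> ucube ==> \<bar>v x\<bar> \<le> A0" by blast
    define A where "A = (SUP x\<in>Q. \<bar>v x\<bar>)"
    have bdd: "bdd_above ((%x. \<bar>v x\<bar>) ` Q)" using A0 QU by (auto intro!: bdd_aboveI2)
    have A: "\<bar>v x\<bar> \<le> A" if "x \<in> Q" for x unfolding A_def by (rule cSUP_upper[OF that bdd])
    have A_nn: "0 \<le> A" using A Qne by (metis abs_ge_zero ex_in_conv order_trans)
    \<comment> \<open>The supremum over a half-open cell need not be attained. A value of
      \<open>3/4 A\<close> is enough: a change by \<open>A / 4\<close> leaves
      \<open>A / 2\<close>.\<close>
    have "\<exists>x\<in>Q. 3/4 * A \<le> \<bar>v x\<bar>"
    proof (cases "A = 0")
      case True then show ?thesis using Qne by auto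
    next
      case False
      then have "3/4 * A < (SUP x\<in>Q. \<bar>v x\<bar>)" using A_nn unfolding A_def[symmetric] by simp
      then show ?thesis using less_cSUP_iff[OF Qne bdd] by (auto intro: less_imp_le)
    qed
    then obtain xs where xs: "xs \<in> Q" "3/4 * A \<le> \<bar>v xs\<bar>" by blast
    define J' where "J' = cell_index (L * M) xs"
    have LM: "0 < L * M" using L M0 by simp
    have xsc: "xs \<in> cell (L * M) J'" unfolding J'_def using in_cell_index[OF LM] xs QU by auto
    have k': "J' \<in> cell_indices (L * M)" unfolding J'_def using cell_index_in[OF LM] xs QU by auto
    have sub: "cell (L * M) J' \<subseteq> Q"
    proof
      fix y assume y: "y \<in> cell (L * M) J'"
      show "y \<in> Q" unfolding Q_def cell_def
      proof (safe)
        fix b :: 'a assume b: "b \<in> Basis"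
        have 1: "real (J b) \<le> real L * (xs \<bullet> b)" "real L * (xs \<bullet> b) < real (J b) + 1" using xs b by (auto simp: Q_def cell_def)
        have 2: "real (J' b) \<le> real (L * M) * (xs \<bullet> b)" "real (L * M) * (xs \<bullet> b) < real (J' b) + 1" using xsc b by (auto simp: cell_def)
        have 3: "real (J' b) \<le> real (L * M) * (y \<bullet> b)" "real (L * M) * (y \<bullet> b) < real (J' b) + 1" using y b by (auto simp: cell_def)
        have Mr: "real M > 0" using M0 by simp
        have "real (J b) * real M \<le> real (L * M) * (xs \<bullet> b)" using mult_right_mono[OF 1(1), of "real M"] Mr by (simp add: mult_ac)
        then have "real (J b * M) < real (J' b + 1)" using 2(2) by (simp add: add.commute)
        \<comment> \<open>From reals to integers: a strict bound by \<open>J' b + 1\<close> becomes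
          a bound by \<open>J' b\<close>, so the fine cell containing \<open>xs\<close> stays inside
          the coarse one.\<close>
        then have "J b * M \<le> J' b" by linarith
        then have "real (J b) * real M \<le> real (J' b)" by (metis of_nat_le_iff of_nat_mult)
        then have "real (J b) * real M \<le> (real L * (y \<bullet> b)) * real M" using 3(1) by (simp add: mult_ac)
        then show "real (J b) \<le> real L * (y \<bullet> b)" using Mr by (simp only: mult_le_cancel_right_pos)
        have "real (L * M) * (xs \<bullet> b) < (real (J b) + 1) * real M" using mult_strict_right_mono[OF 1(2) Mr] by (simp add: mult_ac)
        then have "real (J' b) < real ((J b + 1) * M)" using 2(1) by (simp add: distrib_right)
        then have "J' b + 1 \<le> (J b + 1) * M" by linarith
        then have "real (J' b) + 1 \<le> (real (J b) + 1) * real M" by (metis of_nat_1 of_nat_add of_nat_le_iff of_nat_mult)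
        then have "(real L * (y \<bullet> b)) * real M < (real (J b) + 1) * real M" using 3(2) by (simp add: mult_ac)
        then show "real L * (y \<bullet> b) < real (J b) + 1" using Mr by (simp only: mult_less_cancel_right_pos)
      qed
    qed
    have near: "\<bar>v y - v xs\<bar> \<le> A / 4" if y: "y \<in> cell (L * M) J'" for y
    proof -
      \<comment> \<open>The point that agrees with \<open>y\<close> in the coordinates of
        \<open>S\<close> and with \<open>xs\<close> in the others; enlarging \<open>S\<close> by one
        coordinate moves it along an axis inside the coarse cell.\<close>
      define z where "z S = xs + (\<Sum>b\<in>S. (y \<bullet> b - xs \<bullet> b) *\<^sub>R b)" for S
      have zb: "z S \<bullet> b = (if b \<in> S then y \<bullet> b else xs \<bullet> b)" if "S \<subseteq> Basis" "b \<in> Basis" for S b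
      proof -
        have fS: "finite S" using that(1) finite_Basis by (rule finite_subset)
        have "(\<Sum>b'\<in>S. (y \<bullet> b' - xs \<bullet> b') * (b' \<bullet> b)) = (\<Sum>b'\<in>S. if b' = b then y \<bullet> b - xs \<bullet> b else 0)"
          using that by (intro sum.cong) (auto simp: inner_Basis subset_iff)
        then show ?thesis using fS by (simp add: z_def inner_add_left inner_sum_left sum.delta)
      qed
      have yQ: "y \<in> Q" using y sub by auto
      have zQ: "z S \<in> Q" if "S \<subseteq> Basis" for S
        using xs(1) yQ zb[OF that] by (auto simp: Q_def cell_def)
      have step: "\<bar>v (z S) - v xs\<bar> \<le> real (card S) * (K * A / real M)" if "finite S" "S \<subseteq> Basis" for S
        using that
      proof (induction S)
        case empty then show ?case by (simp add: z_def)
      next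
        case (insert b S)
        have b: "b \<in> Basis" and S: "S \<subseteq> Basis" using insert by auto
        have zi: "z (insert b S) = move (z S) b (y \<bullet> b)"
          using insert.hyps zb[OF S b] by (simp add: z_def move_def inner_add_left algebra_simps)
        have kL: "J b < L" using k b by (auto simp: cell_indices_def)
        have "z S \<in> ucube" using zQ[OF S] QU by auto
        then obtain p where p: "degree p \<le> D" "\<And>t. real (J b) \<le> real L * t ==> real L * t < real (J b) + 1 ==> v (move (z S) b t) = poly p t"
          using pp_polyD[OF v _ b kL] by blast
        define a where "a = real (J b) / real L"
        have ran: "real (J b) \<le> real L * t \<and> real L * t < real (J b) + 1 \<longleftrightarrow> a \<le> t \<and> t < a + 1 / real L" for t
          using L by (auto simp: a_def field_simps)
        have inQ: "move (z S) b t \<in> Q" if "a \<le> t" "t < a + 1 / real L" for t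
          using zQ[OF S] ran[of t] that b by (auto simp: Q_def cell_def move_inner)
        have pA: "\<bar>poly p t\<bar> \<le> A" if "a \<le> t" "t < a + 1 / real L" for t
          using p(2)[of t] A[OF inQ[OF that]] ran[of t] that by auto
        have y1: "a \<le> y \<bullet> b" "y \<bullet> b < a + 1 / real L" using ran[of "y \<bullet> b"] yQ b by (auto simp: Q_def cell_def)
        have x1: "a \<le> xs \<bullet> b" "xs \<bullet> b < a + 1 / real L" using ran[of "xs \<bullet> b"] xs(1) b by (auto simp: Q_def cell_def)
        have "v (z (insert b S)) = poly p (y \<bullet> b)" unfolding zi using p(2)[of "y \<bullet> b"] ran[of "y \<bullet> b"] y1 by auto
        moreover have "v (z S) = poly p (xs \<bullet> b)"
          using p(2)[of "xs \<bullet> b"] ran[of "xs \<bullet> b"] x1 zb[OF S b] insert.hyps move_self[of "z S" b] by auto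
        ultimately have "\<bar>v (z (insert b S)) - v (z S)\<bar> \<le> K * A * (\<bar>y \<bullet> b - xs \<bullet> b\<bar> / (1 / real L))"
          using K[OF p(1), of "1 / real L" a A "y \<bullet> b" "xs \<bullet> b"] pA y1 x1 L by auto
        also have "\<bar>y \<bullet> b - xs \<bullet> b\<bar> / (1 / real L) \<le> 1 / real M"
        proof -
          have "real (J' b) \<le> real (L * M) * (xs \<bullet> b)" "real (L * M) * (xs \<bullet> b) < real (J' b) + 1"
            "real (J' b) \<le> real (L * M) * (y \<bullet> b)" "real (L * M) * (y \<bullet> b) < real (J' b) + 1" using xsc y b by (auto simp: cell_def)
          then have "\<bar>real (L * M) * (y \<bullet> b) - real (L * M) * (xs \<bullet> b)\<bar> \<le> 1" by linarith
          then have "real (L * M) * \<bar>y \<bullet> b - xs \<bullet> b\<bar> \<le> 1"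
            unfolding right_diff_distrib[symmetric] abs_mult by simp
          then show ?thesis using L M0 by (simp add: field_simps)
        qed
        finally have "\<bar>v (z (insert b S)) - v (z S)\<bar> \<le> K * A * (1 / real M)"
          using K0 A_nn by (simp add: mult_left_mono)
        then have "\<bar>v (z (insert b S)) - v xs\<bar> \<le> real (card S) * (K * A / real M) + K * A * (1 / real M)"
          using insert.IH[OF S] by linarith
        also have "... = real (card (insert b S)) * (K * A / real M)" using insert.hyps by (simp add: distrib_right add_divide_distrib)
        finally show ?case .
      qed
      have "z Basis = y" by (simp add: z_def algebra_simps sum_subtractf euclidean_representation)
      then have "\<bar>v y - v xs\<bar> \<le> real DIM('a) * (K * A / real M)" using step[of Basis] by simp
      also have "... = (4 * real DIM('a) * K) * A / (4 * real M)" by simp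
      also have "... \<le> real M * A / (4 * real M)" using M A_nn by (intro divide_right_mono mult_right_mono) auto
      also have "... = A / 4" using M0 by simp
      finally show ?thesis .
    qed
    show "\<exists>J'\<in>cell_indices (L * M). cell (L * M) J' \<subseteq> cell L J \<and>
        (\<forall>x\<in>cell L J. \<forall>y\<in>cell (L * M) J'. \<bar>v x\<bar> \<le> 2 * \<bar>v y\<bar>)"
    proof (intro bexI[OF _ k'] conjI ballI)
      show "cell (L * M) J' \<subseteq> cell L J" using sub by (simp add: Q_def)
      fix x y assume "x \<in> cell L J" "y \<in> cell (L * M) J'"
      then show "\<bar>v x\<bar> \<le> 2 * \<bar>v y\<bar>" using A[of x] near[of y] xs(2) unfolding Q_def by arith
    qed
  qed
qed

section \<open>B-splines: Marsden's identity and quasi-interpolation\<close>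

lemma knot_mono: "mono (knot r N)"
  by (auto simp: mono_def knot_def divide_simps)

lemma knot_0: "k \<le> r ==> knot r N k = 0"
  by (simp add: knot_def)

lemma knot_1: "r + N < k ==> knot r N k = 1"
  by (simp add: knot_def)

text \<open>One formula for the three branches: truncated subtraction produces the repeated knots at
  0, the minimum those at 1.\<close>

lemma knot_eq: "knot r N k = real (min (k - r) (N + 1)) / real (N + 1)"
  by (auto simp: knot_def min_def)

lemma bspline_rec_support:
  assumes t: "mono t" and "bspline_rec t (Suc q) k x \<noteq> 0"
  shows "t k \<le> x \<and> x < t (k + Suc q)"
  using assms(2)
proof (induction q arbitrary: k)
  case 0
  then show ?case by (auto simp: indicator_def split: if_splits)
next
  case (Suc q)
  then have "bspline_rec t (Suc q) k x \<noteq> 0 \<or> bspline_rec t (Suc q) (k + 1) x \<noteq> 0" by auto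
  then have "t k \<le> x \<and> x < t (k + Suc q) \<or> t (k + 1) \<le> x \<and> x < t (k + 1 + Suc q)" using Suc.IH by blast
  moreover have "t k \<le> t (k + 1)" "t (k + Suc q) \<le> t (k + Suc (Suc q))" by (intro monoD[OF t]; simp)+
  ultimately show ?case by auto
qed

text \<open>The weights of the recursion may be negative off the supports; where the lower-order
  B-spline does not vanish, they are nonnegative.\<close>

lemma bspline_rec_nonneg:
  assumes t: "mono t"
  shows "0 \<le> bspline_rec t (Suc q) k x"
proof (induction q arbitrary: k)
  case (Suc q)
  have "0 \<le> (x - t k) / (t (k + Suc q) - t k) * bspline_rec t (Suc q) k x"
  proof (cases "bspline_rec t (Suc q) k x = 0")
    case False
    then have "t k \<le> x \<and> x < t (k + Suc q)" by (rule bspline_rec_support[OF t])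
    then show ?thesis using Suc[of k] by (intro mult_nonneg_nonneg divide_nonneg_nonneg) auto
  qed simp
  moreover have "0 \<le> (t (k + Suc (Suc q)) - x) / (t (k + Suc (Suc q)) - t (k + 1)) * bspline_rec t (Suc q) (k + 1) x"
  proof (cases "bspline_rec t (Suc q) (k + 1) x = 0")
    case False
    then have "t (k + 1) \<le> x \<and> x < t (k + 1 + Suc q)" by (rule bspline_rec_support[OF t])
    then show ?thesis using Suc[of "k + 1"] by (intro mult_nonneg_nonneg divide_nonneg_nonneg) auto
  qed simp
  ultimately show ?case by (simp del: of_nat_Suc)
qed (simp add: indicator_def)

text \<open>Marsden's identity, by induction on the order. In the sum of order \<open>q + 2\<close>
  each B-spline of order \<open>q + 1\<close> occurs twice, and its two coefficients combine to
  \<open>x - y\<close> times its former one. The range starts at \<open>r - q\<close> because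
  functions of order \<open>q + 1\<close> with a smaller index have empty support for these knots;
  for \<open>q = r - 1\<close> it is the full range from 1.\<close>

lemma bspline_rec_marsden:
  assumes "Suc q \<le> r" and x: "0 \<le> x" "x < 1"
  shows "(\<Sum>k=r-q..N+r. (\<Prod>j=1..q. knot r N (k + j) - y) * bspline_rec (knot r N) (Suc q) k x) = (x - y) ^ q"
  using assms(1)
proof (induction q)
  case 0
  \<comment> \<open>\<open>m + r\<close> is the index of the one knot interval that contains
    \<open>x\<close>.\<close>
  define m where "m = nat \<lfloor>real (N + 1) * x\<rfloor>"
  have m1: "real m \<le> real (N + 1) * x" "real (N + 1) * x < real m + 1" using x unfolding m_def by (auto simp: of_nat_nat)
  have "real (N + 1) * x < real (N + 1)" using x by simp
  then have mN: "m \<le> N" using m1 by linarith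
  have ind: "bspline_rec (knot r N) (Suc 0) k x = (if k = m + r then 1 else 0)" if "k \<in> {r..N+r}" for k
  proof -
    have "knot r N k = real (k - r) / real (N + 1)" "knot r N (k + 1) = real (k + 1 - r) / real (N + 1)"
      using that by (auto simp: knot_eq min_def)
    then have "x \<in> {knot r N k..<knot r N (k + 1)} \<longleftrightarrow> real (k - r) \<le> real (N + 1) * x \<and> real (N + 1) * x < real (k + 1 - r)"
      by (simp add: pos_divide_le_eq pos_less_divide_eq mult.commute del: of_nat_add)
    also have "... \<longleftrightarrow> k = m + r"
    proof
      assume "real (k - r) \<le> real (N + 1) * x \<and> real (N + 1) * x < real (k + 1 - r)"
      then have "real (k - r) < real m + 1" "real m < real (k + 1 - r)" using m1 by linarith+
      then show "k = m + r" using that by auto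
    next
      assume "k = m + r" then show "real (k - r) \<le> real (N + 1) * x \<and> real (N + 1) * x < real (k + 1 - r)"
        using m1 by (simp add: add.commute)
    qed
    finally show ?thesis by (simp add: indicator_def)
  qed
  have "(\<Sum>k=r..N+r. bspline_rec (knot r N) (Suc 0) k x) = (\<Sum>k=r..N+r. if k = m + r then 1 else 0)"
    by (intro sum.cong refl ind)
  also have "... = 1" using mN by simp
  finally show ?case by simp
next
  case (Suc q)
  define t where "t = knot r N"
  have t: "mono t" by (simp add: t_def knot_mono)
  define B where "B k = bspline_rec t (Suc q) k x" for k
  define P where "P k = (\<Prod>j=1..q. t (k + j) - y)" for k
  define \<alpha> where "\<alpha> k = (x - t k) / (t (k + Suc q) - t k)" for k
  define \<beta> where "\<beta> k = (t (k + Suc (Suc q)) - x) / (t (k + Suc (Suc q)) - t (k + 1))" for k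
  define R where "R k = (\<Prod>j=1..Suc q. t (k + j) - y)" for k
  have rq: "r - q = Suc (r - Suc q)" using Suc.prems by simp
  have le: "r - Suc q \<le> N + r" by simp
  \<comment> \<open>The boundary functions that the index shift brings in have the empty supports
    \<open>[0, 0)\<close> and \<open>[1, 1)\<close>.\<close>
  have B0: "B (r - Suc q) = 0"
  proof (rule ccontr)
    assume "B (r - Suc q) \<noteq> 0"
    then have "x < t (r - Suc q + Suc q)" unfolding B_def using bspline_rec_support[OF t] by blast
    moreover have "t (r - Suc q + Suc q) = 0" unfolding t_def using Suc.prems by (intro knot_0) simp
    ultimately show False using x by simp
  qed
  have B1: "B (Suc (N + r)) = 0"
  proof (rule ccontr)
    assume "B (Suc (N + r)) \<noteq> 0"
    then have "t (Suc (N + r)) \<le> x" unfolding B_def using bspline_rec_support[OF t] by blast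
    moreover have "t (Suc (N + r)) = 1" unfolding t_def by (intro knot_1) simp
    ultimately show False using x by simp
  qed
  have br: "R (Suc k) * \<alpha> (Suc k) * B (Suc k) + R k * \<beta> k * B (Suc k) = (x - y) * (P (Suc k) * B (Suc k))" for k
  proof (cases "B (Suc k) = 0")
    case False
    then have "t (Suc k) \<le> x \<and> x < t (Suc k + Suc q)" unfolding B_def by (rule bspline_rec_support[OF t])
    then have ne: "t (Suc k + Suc q) - t (Suc k) \<noteq> 0" by auto
    have R1: "R (Suc k) = P (Suc k) * (t (Suc k + Suc q) - y)" by (simp add: R_def P_def)
    have R2: "R k = (t (Suc k) - y) * P (Suc k)"
      unfolding R_def P_def by (subst prod.atLeast_Suc_atMost) (simp_all add: prod.shift_bounds_cl_Suc_ivl del: prod.cl_ivl_Suc)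
    \<comment> \<open>Linear interpolation of \<open>x - y\<close> between the two end knots of the
      support: this is why products of knot values minus \<open>y\<close> are the right
      coefficients.\<close>
    have "(t (Suc k + Suc q) - y) * (x - t (Suc k)) + (t (Suc k) - y) * (t (Suc k + Suc q) - x) = (x - y) * (t (Suc k + Suc q) - t (Suc k))"
      by (simp add: algebra_simps)
    then have "(t (Suc k + Suc q) - y) * \<alpha> (Suc k) + (t (Suc k) - y) * \<beta> k = x - y"
      using ne unfolding \<alpha>_def \<beta>_def by (simp add: add_divide_distrib[symmetric])
    then have "P (Suc k) * B (Suc k) * ((t (Suc k + Suc q) - y) * \<alpha> (Suc k) + (t (Suc k) - y) * \<beta> k) = P (Suc k) * B (Suc k) * (x - y)" by simp
    then show ?thesis unfolding R1 R2 by (simp add: algebra_simps)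
  qed simp
  have "(\<Sum>k=r-Suc q..N+r. R k * bspline_rec t (Suc (Suc q)) k x)
      = (\<Sum>k=r-Suc q..N+r. R k * \<alpha> k * B k) + (\<Sum>k=r-Suc q..N+r. R k * \<beta> k * B (Suc k))"
    by (simp add: sum.distrib[symmetric] B_def \<alpha>_def \<beta>_def algebra_simps)
  also have "(\<Sum>k=r-Suc q..N+r. R k * \<alpha> k * B k) = (\<Sum>k=Suc (r-Suc q)..Suc (N+r). R k * \<alpha> k * B k)"
    using B0 B1 by (subst sum.atLeast_Suc_atMost[OF le]) simp
  also have "... = (\<Sum>k=r-Suc q..N+r. R (Suc k) * \<alpha> (Suc k) * B (Suc k))" by (rule sum.shift_bounds_cl_Suc_ivl)
  also have "... + (\<Sum>k=r-Suc q..N+r. R k * \<beta> k * B (Suc k)) = (\<Sum>k=r-Suc q..N+r. (x - y) * (P (Suc k) * B (Suc k)))"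
    by (simp only: sum.distrib[symmetric] br)
  also have "... = (x - y) * (\<Sum>k=Suc (r-Suc q)..Suc (N+r). P k * B k)"
    by (simp only: sum_distrib_left sum.shift_bounds_cl_Suc_ivl)
  also have "(\<Sum>k=Suc (r-Suc q)..Suc (N+r). P k * B k) = (\<Sum>k=r-q..N+r. P k * B k)"
    using B1 by (simp add: rq)
  also have "... = (x - y) ^ q" using Suc unfolding P_def B_def t_def by simp
  finally show ?case by (simp add: R_def t_def)
qed

lemma bspline_marsden:
  assumes "0 < r" "0 \<le> x" "x < 1"
  shows "(\<Sum>k=1..N+r. (\<Prod>j=1..r-1. knot r N (k + j) - y) * bspline r N k x) = (x - y) ^ (r - 1)"
  using bspline_rec_marsden[of "r - 1" r x N y] assms by (simp add: bspline_def)

lemma bspline_nonneg: "0 < r ==> x < 1 ==> 0 \<le> bspline r N k x"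
  using bspline_rec_nonneg[of "knot r N" "r - 1" k x] knot_mono by (simp add: bspline_def)

lemma bspline_support: "0 < r ==> x < 1 ==> bspline r N k x \<noteq> 0 ==> knot r N k \<le> x \<and> x < knot r N (k + r)"
  using bspline_rec_support[of "knot r N" "r - 1" k x] knot_mono by (simp add: bspline_def)

text \<open>Lagrange interpolation at distinct nodes; the coefficients of the \<open>Lg l\<close>
  form the inverse of a Vandermonde matrix.\<close>

lemma lagrange_basis:
  fixes X :: "nat => real"
  assumes inj: "inj_on X {..<r}"
  obtains Lg where "\<And>l. l < r ==> degree (Lg l) < r"
    "\<And>q. degree q < r ==> q = (\<Sum>l<r. Polynomial.smult (poly q (X l)) (Lg l))"
proof -
  define Lg where "Lg l = Polynomial.smult (1 / (\<Prod>m\<in>{..<r}-{l}. X l - X m)) (\<Prod>m\<in>{..<r}-{l}. [:- X m, 1:])" for l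
  have d: "degree (Lg l) < r" if "l < r" for l
  proof -
    have "degree (Lg l) \<le> degree (\<Prod>m\<in>{..<r}-{l}. [:- X m, 1:])" unfolding Lg_def by (rule degree_smult_le)
    also have "... \<le> (\<Sum>m\<in>{..<r}-{l}. degree [:- X m, 1:])" using degree_prod_sum_le[of "{..<r}-{l}" "%m. [:- X m, 1:]"] by (simp add: comp_def)
    also have "... = r - 1" using that by simp
    finally show ?thesis using that by simp
  qed
  have v: "poly (Lg l) (X m) = (if m = l then 1 else 0)" if "l < r" "m < r" for l m
  proof (cases "m = l")
    case True
    have "(\<Prod>m\<in>{..<r}-{l}. X l - X m) \<noteq> 0"
      using inj that by (auto simp: inj_on_def)
    then show ?thesis using True by (simp add: Lg_def poly_prod)
  next
    case False
    then have "(\<Prod>j\<in>{..<r}-{l}. X m - X j) = 0" using that by (intro prod_zero) auto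
    then show ?thesis using False by (simp add: Lg_def poly_prod)
  qed
  have "q = (\<Sum>l<r. Polynomial.smult (poly q (X l)) (Lg l))" if dq: "degree q < r" for q
  proof (rule poly_eqI_degree[of "X ` {..<r}"])
    fix x assume "x \<in> X ` {..<r}"
    then obtain m where m: "m < r" "x = X m" by auto
    have "poly (\<Sum>l<r. Polynomial.smult (poly q (X l)) (Lg l)) x = (\<Sum>l<r. if l = m then poly q (X l) else 0)"
      unfolding poly_sum using v m by (intro sum.cong) auto
    then show "poly q x = poly (\<Sum>l<r. Polynomial.smult (poly q (X l)) (Lg l)) x" using m by simp
  next
    have c: "card (X ` {..<r}) = r" using inj by (simp add: card_image)
    show "degree q < card (X ` {..<r})" using dq c by simp
    have "degree (\<Sum>l<r. Polynomial.smult (poly q (X l)) (Lg l)) \<le> r - 1"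
    proof (intro degree_sum_le)
      fix l assume "l \<in> {..<r}"
      then have "degree (Lg l) \<le> r - 1" using d[of l] by simp
      then show "degree (Polynomial.smult (poly q (X l)) (Lg l)) \<le> r - 1" by (rule order_trans[OF degree_smult_le])
    qed simp
    then show "degree (\<Sum>l<r. Polynomial.smult (poly q (X l)) (Lg l)) < card (X ` {..<r})" using dq c by simp
  qed
  then show ?thesis using that d by blast
qed

text \<open>By the binomial theorem the coefficients in \<open>y\<close> of the left-hand side are
  multiples of the moments \<open>\<Sum> a l * X l ^ i\<close> with \<open>i < r\<close>. Any values
  of these moments can be attained, because the Lagrange polynomials solve the Vandermonde
  system.\<close>

lemma shifted_powers_span:
  fixes X :: "nat => real"
  assumes r: "0 < r" and inj: "inj_on X {..<r}" and p: "degree p < r"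
  shows "\<exists>a. \<forall>y. (\<Sum>l<r. a l * (X l - y) ^ (r - 1)) = poly p y"
proof -
  obtain Lg where L: "\<And>l. l < r ==> degree (Lg l) < r"
    "\<And>q. degree q < r ==> q = (\<Sum>l<r. Polynomial.smult (poly q (X l)) (Lg l))" using lagrange_basis[OF inj] by blast
  \<comment> \<open>The moment of order \<open>i\<close> that makes the coefficient of
    \<open>y^(r-1-i)\<close> equal to that of \<open>p\<close>.\<close>
  define P where "P i = coeff p (r - 1 - i) / (real (r - 1 choose i) * (-1) ^ (r - 1 - i))" for i
  define a where "a l = (\<Sum>i\<le>r-1. coeff (Lg l) i * P i)" for l
  have mom: "(\<Sum>l<r. a l * X l ^ i) = P i" if "i \<le> r - 1" for i
  proof -
    have "degree (monom 1 i :: real poly) < r" using that r by (simp add: degree_monom_eq)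
    from L(2)[OF this] have m: "monom 1 i = (\<Sum>l<r. Polynomial.smult (X l ^ i) (Lg l))" by (simp add: poly_monom)
    have "coeff (monom 1 i) j = (\<Sum>l<r. X l ^ i * coeff (Lg l) j)" for j by (subst m) (simp add: coeff_sum)
    then have c: "(\<Sum>l<r. X l ^ i * coeff (Lg l) j) = (if i = j then 1 else 0)" for j unfolding coeff_monom by (rule sym)
    have "(\<Sum>l<r. a l * X l ^ i) = (\<Sum>l<r. \<Sum>j\<le>r-1. P j * (X l ^ i * coeff (Lg l) j))"
      by (simp add: a_def sum_distrib_right sum_distrib_left mult_ac)
    also have "... = (\<Sum>j\<le>r-1. P j * (\<Sum>l<r. X l ^ i * coeff (Lg l) j))"
      by (subst sum.swap) (simp add: sum_distrib_left)
    also have "... = (\<Sum>j\<le>r-1. if i = j then P j else 0)" by (simp add: c if_distrib cong: if_cong)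
    also have "... = P i" using that by simp
    finally show ?thesis .
  qed
  show ?thesis
  proof (intro exI[of _ a] allI)
    fix y
    have "(\<Sum>l<r. a l * (X l - y) ^ (r - 1)) = (\<Sum>l<r. \<Sum>i\<le>r-1. a l * (real (r - 1 choose i) * X l ^ i * (- y) ^ (r - 1 - i)))"
      using binomial_ring[of _ "- y" "r - 1"] by (simp add: sum_distrib_left)
    also have "... = (\<Sum>i\<le>r-1. real (r - 1 choose i) * (- y) ^ (r - 1 - i) * (\<Sum>l<r. a l * X l ^ i))"
      by (subst sum.swap) (simp add: sum_distrib_left mult_ac)
    also have "... = (\<Sum>i\<le>r-1. coeff p (r - 1 - i) * y ^ (r - 1 - i))"
    proof (intro sum.cong refl)
      fix i assume i: "i \<in> {..r-1}"
      have "real (r - 1 choose i) \<noteq> 0" using i by simp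
      moreover have "(- y) ^ (r - 1 - i) = (-1) ^ (r - 1 - i) * y ^ (r - 1 - i)" by (rule power_minus)
      ultimately show "real (r - 1 choose i) * (- y) ^ (r - 1 - i) * (\<Sum>l<r. a l * X l ^ i) = coeff p (r - 1 - i) * y ^ (r - 1 - i)"
        using mom i by (simp add: P_def)
    qed
    also have "... = (\<Sum>i\<le>r-1. coeff p i * y ^ i)"
      by (rule sum.reindex_bij_witness[of _ "%i. r - 1 - i" "%i. r - 1 - i"]) auto
    also have "... = poly p y" using p by (intro poly_altdef_le[symmetric]) simp
    finally show "(\<Sum>l<r. a l * (X l - y) ^ (r - 1)) = poly p y" .
  qed
qed

text \<open>The dual functionals are combinations of point evaluations.  Their coefficients depend
  only on the relative positions of the knots, of which there are finitely many patterns.\<close>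

lemma bspline_dual_coefficients:
  assumes r: "0 < r"
  shows "\<exists>A\<ge>0. \<forall>N. \<exists>a. \<forall>k\<in>{1..N+r}. (\<Sum>l<r. \<bar>a k l\<bar>) \<le> A \<and>
    (\<forall>y. (\<Sum>l<r. a k l * ((real (k - r) + real l / real r) / real (N + 1) - y) ^ (r - 1)) = (\<Prod>j=1..r-1. knot r N (k + j) - y))"
proof -
  define X where "X l = real l / real r" for l
  have injX: "inj_on X {..<r}" using r by (auto simp: inj_on_def X_def)
  have "\<exists>a. \<forall>y. (\<Sum>l<r. a l * (X l - y) ^ (r - 1)) = (\<Prod>j=1..r-1. real (\<tau> j) - y)" for \<tau> :: "nat => nat"
  proof -
    define p where "p = (\<Prod>j=1..r-1. [:real (\<tau> j), -1:])"
    have "degree p \<le> (\<Sum>j=1..r-1. degree [:real (\<tau> j), -1:])"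
      using degree_prod_sum_le[of "{1..r-1}" "%j. [:real (\<tau> j), -1:]"] by (simp add: comp_def p_def)
    then have "degree p < r" using r by simp
    moreover have "poly p y = (\<Prod>j=1..r-1. real (\<tau> j) - y)" for y by (simp add: p_def poly_prod)
    ultimately show ?thesis using shifted_powers_span[OF r injX, of p] by simp
  qed
  then obtain a where a: "\<And>\<tau> y. (\<Sum>l<r. a \<tau> l * (X l - y) ^ (r - 1)) = (\<Prod>j=1..r-1. real (\<tau> j) - y)" by metis
  define \<T> where "\<T> = ({1..r-1} \<rightarrow>\<^sub>E {..r})"
  have fin: "finite \<T>" by (simp add: \<T>_def finite_PiE)
  \<comment> \<open>A sum over all patterns, hence independent of \<open>N\<close> and of the index
    of the B-spline.\<close>
  define A where "A = (\<Sum>\<tau>\<in>\<T>. \<Sum>l<r. \<bar>a \<tau> l\<bar>)"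
  have A: "(\<Sum>l<r. \<bar>a \<tau> l\<bar>) \<le> A" if "\<tau> \<in> \<T>" for \<tau>
    unfolding A_def by (rule member_le_sum[OF that _ fin]) (simp add: sum_nonneg)
  show ?thesis
  proof (intro exI[of _ A] conjI allI)
    show "0 \<le> A" unfolding A_def by (intro sum_nonneg) auto
    fix N :: nat
    \<comment> \<open>Positions of the following knots in units of the mesh width, counted from knot
      \<open>k\<close>; the repeated knots at 0 and 1 are the reason why several patterns
      occur.\<close>
    define \<tau> where "\<tau> k = restrict (%j. min (k + j - r) (N + 1) - (k - r)) {1..r-1}" for k
    show "\<exists>a. \<forall>k\<in>{1..N+r}. (\<Sum>l<r. \<bar>a k l\<bar>) \<le> A \<and>
      (\<forall>y. (\<Sum>l<r. a k l * ((real (k - r) + real l / real r) / real (N + 1) - y) ^ (r - 1)) = (\<Prod>j=1..r-1. knot r N (k + j) - y))"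
    proof (intro exI[of _ "%k. a (\<tau> k)"] ballI conjI allI)
      fix k assume k: "k \<in> {1..N+r}"
      have "\<tau> k \<in> \<T>" by (auto simp: \<tau>_def \<T>_def)
      then show "(\<Sum>l<r. \<bar>a (\<tau> k) l\<bar>) \<le> A" by (rule A)
      fix y
      \<comment> \<open>Both sides are homogeneous of degree \<open>r - 1\<close>, so the mesh width
        factors out once \<open>y\<close> is expressed through \<open>\<eta>\<close>.\<close>
      define h where "h = 1 / real (N + 1)"
      define \<eta> where "\<eta> = y * real (N + 1) - real (k - r)"
      have y: "y = h * (real (k - r) + \<eta>)" by (simp add: h_def \<eta>_def)
      have kn: "knot r N (k + j) - y = h * (real (\<tau> k j) - \<eta>)" if "j \<in> {1..r-1}" for j
      proof -
        have "k - r \<le> min (k + j - r) (N + 1)" using k by auto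
        then have "real (\<tau> k j) = real (min (k + j - r) (N + 1)) - real (k - r)" using that by (simp add: \<tau>_def of_nat_diff)
        moreover have "knot r N (k + j) = h * real (min (k + j - r) (N + 1))" by (simp add: knot_eq h_def)
        ultimately show ?thesis by (simp add: y right_diff_distrib distrib_left)
      qed
      have "(\<Sum>l<r. a (\<tau> k) l * ((real (k - r) + real l / real r) / real (N + 1) - y) ^ (r - 1))
          = (\<Sum>l<r. a (\<tau> k) l * (h * (X l - \<eta>)) ^ (r - 1))"
        unfolding y h_def X_def by (simp add: algebra_simps add_divide_distrib diff_divide_distrib)
      also have "... = h ^ (r - 1) * (\<Sum>l<r. a (\<tau> k) l * (X l - \<eta>) ^ (r - 1))"
        by (simp add: power_mult_distrib sum_distrib_left mult_ac)
      also have "... = h ^ (r - 1) * (\<Prod>j=1..r-1. real (\<tau> k j) - \<eta>)" by (simp only: a)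
      also have "... = (\<Prod>j=1..r-1. h * (real (\<tau> k j) - \<eta>))" by (simp add: prod.distrib)
      also have "... = (\<Prod>j=1..r-1. knot r N (k + j) - y)" by (intro prod.cong refl kn[symmetric])
      finally show "(\<Sum>l<r. a (\<tau> k) l * ((real (k - r) + real l / real r) / real (N + 1) - y) ^ (r - 1)) = (\<Prod>j=1..r-1. knot r N (k + j) - y)" .
    qed
  qed
qed

text \<open>Both sides of Marsden's identity are polynomials in \<open>y\<close>; the claim compares
  their coefficients of \<open>y^(r-1)\<close>.\<close>

lemma bspline_sum_1:
  assumes r: "0 < r" and x: "0 \<le> x" "x < 1"
  shows "(\<Sum>k=1..N+r. bspline r N k x) = 1"
proof -
  define p where "p T = (\<Prod>j=1..r-1. [:T j, -1:])" for T :: "nat => real"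
  have pp: "poly (p T) y = (\<Prod>j=1..r-1. T j - y)" for T y by (simp add: p_def poly_prod)
  have lc: "coeff (p T) (r - 1) = (-1) ^ (r - 1)" for T
  proof -
    have "degree (p T) = (\<Sum>j=1..r-1. degree [:T j, -1:])" unfolding p_def by (rule degree_prod_eq_sum_degree) simp
    then have "degree (p T) = r - 1" by simp
    moreover have "lead_coeff (p T) = (-1) ^ (r - 1)" unfolding p_def lead_coeff_prod by simp
    ultimately show ?thesis by simp
  qed
  define q where "q = (\<Sum>k=1..N+r. Polynomial.smult (bspline r N k x) (p (%j. knot r N (k + j))))"
  have "poly q y = poly (p (%j. x)) y" for y
    using bspline_marsden[OF r x, of N y] by (simp add: q_def poly_sum pp mult.commute)
  then have "q = p (%j. x)" by (simp add: poly_eq_poly_eq_iff[symmetric] fun_eq_iff)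
  then have "coeff q (r - 1) = (-1) ^ (r - 1)" using lc[of "%j. x"] by simp
  moreover have "coeff q (r - 1) = (\<Sum>k=1..N+r. bspline r N k x) * (-1) ^ (r - 1)"
    unfolding q_def coeff_sum coeff_smult lc sum_distrib_right ..
  ultimately show ?thesis by simp
qed

lemma bspline_le_1:
  assumes r: "0 < r" and x: "0 \<le> x" "x < 1" and k: "k \<in> {1..N+r}"
  shows "bspline r N k x \<le> 1"
  using member_le_sum[OF k, of "%k. bspline r N k x"] bspline_sum_1[OF r x, of N] bspline_nonneg[OF r x(2)] by simp

text \<open>The operator reproduces polynomials of degree below \<open>r\<close>: its functionals
  return Marsden's coefficients for shifted powers, and these span. If \<open>p\<close> agrees with
  \<open>u\<close> at \<open>x\<close>, the error at \<open>x\<close> is the operator applied to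
  \<open>p - u\<close>, and only evaluations within \<open>r\<close> mesh widths of \<open>x\<close>
  contribute. The polynomial may change with \<open>x\<close>, whereas \<open>a\<close> and
  \<open>\<xi>\<close> depend on \<open>N\<close> alone.\<close>

lemma bspline_quasi_interpolant:
  assumes r: "0 < r"
  shows "\<exists>A\<ge>0. \<forall>N. \<exists>a \<xi>. (\<forall>k\<in>{1..N+r}. (\<Sum>l<r. \<bar>a k l\<bar>) \<le> A \<and> (\<forall>l<r. 0 \<le> \<xi> k l \<and> \<xi> k l < 1)) \<and>
    (\<forall>x u p E. 0 \<le> x --> x < 1 --> degree p < r --> poly p x = u x -->
       (\<forall>t. 0 \<le> t \<and> t < 1 \<and> \<bar>t - x\<bar> \<le> real r / real (N + 1) --> \<bar>u t - poly p t\<bar> \<le> E) -->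
       \<bar>u x - (\<Sum>k=1..N+r. (\<Sum>l<r. a k l * u (\<xi> k l)) * bspline r N k x)\<bar> \<le> A * E)"
proof -
  obtain A where A: "A \<ge> 0" "\<forall>N. \<exists>a. \<forall>k\<in>{1..N+r}. (\<Sum>l<r. \<bar>a k l\<bar>) \<le> A \<and>
    (\<forall>y. (\<Sum>l<r. a k l * ((real (k - r) + real l / real r) / real (N + 1) - y) ^ (r - 1)) = (\<Prod>j=1..r-1. knot r N (k + j) - y))"
    using bspline_dual_coefficients[OF r] by blast
  show ?thesis
  proof (intro exI[of _ A] conjI allI A(1))
    fix N :: nat
    define \<xi> where "\<xi> k l = (real (k - r) + real l / real r) / real (N + 1)" for k l
    obtain a where a1: "\<And>k. k \<in> {1..N+r} ==> (\<Sum>l<r. \<bar>a k l\<bar>) \<le> A"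
      and a2: "\<And>k y. k \<in> {1..N+r} ==> (\<Sum>l<r. a k l * (\<xi> k l - y) ^ (r - 1)) = (\<Prod>j=1..r-1. knot r N (k + j) - y)"
      using A(2) unfolding \<xi>_def by meson
    have \<xi>01: "0 \<le> \<xi> k l \<and> \<xi> k l < 1" if "k \<in> {1..N+r}" "l < r" for k l
    proof -
      have "real (k - r) \<le> real N" using that by auto
      moreover have "real l / real r < 1" using that by simp
      ultimately have "real (k - r) + real l / real r < real (N + 1)" by simp
      then show ?thesis by (simp add: \<xi>_def)
    qed
    define Q where "Q u x = (\<Sum>k=1..N+r. (\<Sum>l<r. a k l * u (\<xi> k l)) * bspline r N k x)" for u x
    have Qpow: "Q (%t. (t - y) ^ (r - 1)) x = (x - y) ^ (r - 1)" if "0 \<le> x" "x < 1" for x y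
      proof -
      have "Q (%t. (t - y) ^ (r - 1)) x = (\<Sum>k=1..N+r. (\<Prod>j=1..r-1. knot r N (k + j) - y) * bspline r N k x)"
        unfolding Q_def using a2 by (intro sum.cong) auto
      then show ?thesis unfolding bspline_marsden[OF r that] .
    qed
    have inj: "inj_on real {..<r}" by (auto simp: inj_on_def)
    have Qpoly: "Q (poly p) x = poly p x" if "0 \<le> x" "x < 1" "degree p < r" for x p
    proof -
      have "\<exists>b. \<forall>y. (\<Sum>l<r. b l * (real l - y) ^ (r - 1)) = poly p y"
        using shifted_powers_span[OF r inj that(3)] .
      then obtain b where b: "\<And>y. (\<Sum>l<r. b l * (real l - y) ^ (r - 1)) = poly p y" by blast
      have flip: "(real l - y) ^ (r - 1) = (-1) ^ (r - 1) * (y - real l) ^ (r - 1)" for l and y :: real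
        by (metis minus_diff_eq power_minus)
      have b': "poly p y = (\<Sum>l<r. (b l * (-1) ^ (r - 1)) * (y - real l) ^ (r - 1))" for y
        unfolding b[symmetric] flip by (simp add: mult.assoc)
      have "Q (poly p) x = (\<Sum>l'<r. (b l' * (-1) ^ (r - 1)) * Q (%t. (t - real l') ^ (r - 1)) x)"
      proof -
        have "Q (poly p) x = (\<Sum>k=1..N+r. \<Sum>l<r. \<Sum>l'<r. (b l' * (-1) ^ (r - 1)) * (a k l * (\<xi> k l - real l') ^ (r - 1) * bspline r N k x))"
          unfolding Q_def b' by (simp add: sum_distrib_left sum_distrib_right mult_ac)
        also have "... = (\<Sum>l'<r. \<Sum>k=1..N+r. \<Sum>l<r. (b l' * (-1) ^ (r - 1)) * (a k l * (\<xi> k l - real l') ^ (r - 1) * bspline r N k x))"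
          by (subst sum.swap[of _ "{..<r}" "{..<r}"], subst sum.swap) simp
        also have "... = (\<Sum>l'<r. (b l' * (-1) ^ (r - 1)) * Q (%t. (t - real l') ^ (r - 1)) x)"
          unfolding Q_def by (simp add: sum_distrib_left sum_distrib_right mult_ac)
        finally show ?thesis .
      qed
      also have "... = poly p x" unfolding b' using Qpow that by simp
      finally show ?thesis .
    qed
    show "\<exists>a \<xi>. (\<forall>k\<in>{1..N+r}. (\<Sum>l<r. \<bar>a k l\<bar>) \<le> A \<and> (\<forall>l<r. 0 \<le> \<xi> k l \<and> \<xi> k l < 1)) \<and>
      (\<forall>x u p E. 0 \<le> x --> x < 1 --> degree p < r --> poly p x = u x -->
         (\<forall>t. 0 \<le> t \<and> t < 1 \<and> \<bar>t - x\<bar> \<le> real r / real (N + 1) --> \<bar>u t - poly p t\<bar> \<le> E) -->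
         \<bar>u x - (\<Sum>k=1..N+r. (\<Sum>l<r. a k l * u (\<xi> k l)) * bspline r N k x)\<bar> \<le> A * E)"
    proof (rule exI[of _ a], rule exI[of _ \<xi>], intro conjI ballI allI impI)
      fix k assume "k \<in> {1..N+r}" then show "(\<Sum>l<r. \<bar>a k l\<bar>) \<le> A" by (rule a1)
    next
      fix k l assume "k \<in> {1..N+r}" "l < r"
      then show "0 \<le> \<xi> k l" "\<xi> k l < 1" using \<xi>01 by auto
    next
      fix x E :: real and u :: "real => real" and p
      assume x: "0 \<le> x" "x < 1" and dp: "degree p < r" and px: "poly p x = u x"
        and E: "\<forall>t. 0 \<le> t \<and> t < 1 \<and> \<bar>t - x\<bar> \<le> real r / real (N + 1) --> \<bar>u t - poly p t\<bar> \<le> E"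
      have "0 \<le> E" using E[rule_format, of x] x px by simp
      have "u x - Q u x = Q (poly p) x - Q u x" using Qpoly[OF x dp] px by simp
      also have "... = (\<Sum>k=1..N+r. (\<Sum>l<r. a k l * (poly p (\<xi> k l) - u (\<xi> k l))) * bspline r N k x)"
        by (simp add: Q_def sum_subtractf left_diff_distrib right_diff_distrib)
      also have "\<bar>...\<bar> \<le> (\<Sum>k=1..N+r. \<bar>(\<Sum>l<r. a k l * (poly p (\<xi> k l) - u (\<xi> k l))) * bspline r N k x\<bar>)"
        by (rule sum_abs)
      also have "... \<le> (\<Sum>k=1..N+r. (A * E) * bspline r N k x)"
      proof (rule sum_mono)
        fix k assume k: "k \<in> {1..N+r}"
        show "\<bar>(\<Sum>l<r. a k l * (poly p (\<xi> k l) - u (\<xi> k l))) * bspline r N k x\<bar> \<le> (A * E) * bspline r N k x"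
        proof (cases "bspline r N k x = 0")
          case False
          then have sup: "knot r N k \<le> x \<and> x < knot r N (k + r)" by (rule bspline_support[OF r x(2)])
          have n: "knot r N k = real (k - r) / real (N + 1)" "knot r N (k + r) \<le> real k / real (N + 1)"
            using k by (auto simp: knot_eq min_def intro!: divide_right_mono)
          have "\<bar>\<Sum>l<r. a k l * (poly p (\<xi> k l) - u (\<xi> k l))\<bar> \<le> (\<Sum>l<r. \<bar>a k l * (poly p (\<xi> k l) - u (\<xi> k l))\<bar>)" by (rule sum_abs)
          also have "... \<le> (\<Sum>l<r. \<bar>a k l\<bar> * E)"
          proof (rule sum_mono)
            fix l assume l: "l \<in> {..<r}"
            have lr: "0 \<le> real l / real r" "real l / real r \<le> 1" using l by auto
            have "x < real k / real (N + 1)" "real (k - r) / real (N + 1) \<le> x" using sup n by auto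
            then have hb: "x * real (N + 1) < real k" "real (k - r) \<le> x * real (N + 1)"
              by (simp_all add: pos_divide_le_eq pos_less_divide_eq del: of_nat_add)
            have kr: "real k \<le> real (k - r) + real r" by simp
            \<comment> \<open>In mesh units both \<open>x\<close> and the evaluation point lie
              between \<open>k - r\<close> (cut off at 0) and \<open>k\<close>.\<close>
            have "\<bar>(\<xi> k l - x) * real (N + 1)\<bar> \<le> real r"
            proof -
              have e: "(\<xi> k l - x) * real (N + 1) = real (k - r) + real l / real r - x * real (N + 1)" by (simp add: \<xi>_def field_simps)
              have "real r \<ge> 1" using r by simp
              then show ?thesis unfolding e abs_le_iff using lr hb kr by linarith
            qed
            then have "\<bar>\<xi> k l - x\<bar> \<le> real r / real (N + 1)" by (simp add: abs_mult pos_le_divide_eq del: of_nat_add)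
            then have "\<bar>u (\<xi> k l) - poly p (\<xi> k l)\<bar> \<le> E" using E \<xi>01[OF k] l by auto
            then show "\<bar>a k l * (poly p (\<xi> k l) - u (\<xi> k l))\<bar> \<le> \<bar>a k l\<bar> * E"
              unfolding abs_mult by (subst abs_minus_commute) (rule mult_left_mono, auto)
          qed
          also have "... \<le> A * E" unfolding sum_distrib_right[symmetric] by (rule mult_right_mono[OF a1[OF k] \<open>0 \<le> E\<close>])
          finally show ?thesis unfolding abs_mult using bspline_nonneg[OF r x(2), of N k] by (simp add: mult_right_mono)
        qed simp
      qed
      also have "... = A * E" unfolding sum_distrib_left[symmetric] bspline_sum_1[OF r x] by simp
      finally show "\<bar>u x - (\<Sum>k=1..N+r. (\<Sum>l<r. a k l * u (\<xi> k l)) * bspline r N k x)\<bar> \<le> A * E" by (simp add: Q_def)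
    qed
  qed
qed

lemma bspline_rec_piecewise:
  assumes "j < N + 1"
  shows "\<exists>p. degree p \<le> q \<and> (\<forall>x. real j \<le> real (N + 1) * x \<and> real (N + 1) * x < real j + 1 -->
     bspline_rec (knot r N) (Suc q) k x = poly p x)"
proof (induction q arbitrary: k)
  case 0
  define i where "i l = min (l - r) (N + 1)" for l
  have k: "knot r N l = real (i l) / real (N + 1)" for l by (simp add: knot_eq i_def)
  have "bspline_rec (knot r N) (Suc 0) k x = (if i k \<le> j \<and> j < i (k + 1) then 1 else 0)"
    if "real j \<le> real (N + 1) * x" "real (N + 1) * x < real j + 1" for x
  proof -
    have "x \<in> {knot r N k..<knot r N (k + 1)} \<longleftrightarrow> real (i k) \<le> real (N + 1) * x \<and> real (N + 1) * x < real (i (k + 1))"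
      unfolding k by (auto simp: field_simps)
    also have "... \<longleftrightarrow> i k \<le> j \<and> j < i (k + 1)" using that by auto
    finally show ?thesis by (simp add: indicator_def)
  qed
  then show ?case by (intro exI[of _ "[:if i k \<le> j \<and> j < i (k + 1) then 1 else 0:]"]) auto
next
  case (Suc q)
  define t where "t = knot r N"
  obtain p1 where p1: "degree p1 \<le> q" "\<And>x. real j \<le> real (N + 1) * x ==> real (N + 1) * x < real j + 1 ==>
     bspline_rec t (Suc q) k x = poly p1 x" using Suc[of k] unfolding t_def by blast
  obtain p2 where p2: "degree p2 \<le> q" "\<And>x. real j \<le> real (N + 1) * x ==> real (N + 1) * x < real j + 1 ==>
     bspline_rec t (Suc q) (k + 1) x = poly p2 x" using Suc[of "k + 1"] unfolding t_def by blast
  \<comment> \<open>If the knots of a factor coincide, division by zero makes that linear factor 0,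
    exactly as in the recursion.\<close>
  define p where "p = [:- t k / (t (k + Suc q) - t k), 1 / (t (k + Suc q) - t k):] * p1
      + [:t (k + Suc (Suc q)) / (t (k + Suc (Suc q)) - t (k + 1)), - 1 / (t (k + Suc (Suc q)) - t (k + 1)):] * p2"
  have "degree p \<le> Suc q" unfolding p_def
    by (intro degree_add_le order_trans[OF degree_mult_le]) (use p1 p2 in auto)
  moreover have "bspline_rec t (Suc (Suc q)) k x = poly p x" if "real j \<le> real (N + 1) * x" "real (N + 1) * x < real j + 1" for x
    using p1(2)[OF that] p2(2)[OF that]
    by (simp add: p_def diff_divide_distrib algebra_simps)
  ultimately show ?case unfolding t_def by blast
qed

lemma bspline_piecewise:
  assumes "0 < r" "j < N + 1"
  shows "\<exists>p. degree p < r \<and> (\<forall>x. real j \<le> real (N + 1) * x \<and> real (N + 1) * x < real j + 1 --> bspline r N k x = poly p x)"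
proof -
  obtain p where p: "degree p \<le> r - 1" "\<And>x. real j \<le> real (N + 1) * x ==> real (N + 1) * x < real j + 1 ==>
     bspline_rec (knot r N) r k x = poly p x" using bspline_rec_piecewise[OF assms(2), of "r - 1" r k] assms(1) by auto
  have "bspline r N k x = poly p x" if "real j \<le> real (N + 1) * x" "real (N + 1) * x < real j + 1" for x
  proof -
    have "real j + 1 \<le> real (N + 1)" using assms(2) by linarith
    from less_le_trans[OF that(2) this] have "x < 1" by simp
    then show ?thesis using p(2)[OF that] by (simp add: bspline_def)
  qed
  then show ?thesis using p(1) assms(1) by (intro exI[of _ p]) auto
qed

lemma borel_measurable_bspline [measurable]: "bspline r N k \<in> borel_measurable borel"
proof -
  have [measurable]: "bspline_rec t q k \<in> borel_measurable borel" for t q k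
  proof (induction q arbitrary: k)
    case (Suc q)
    then show ?case by (cases q) simp_all
  next
    case 0
    have "bspline_rec t 0 k = (%x. 0)" by (simp add: fun_eq_iff)
    then show ?case by simp
  qed
  show ?thesis unfolding bspline_def by measurable
qed

no_notation scalar_prod (infix "\<bullet>" 70)

section \<open>Taylor expansion along the axes\<close>

text \<open>The norm is an infimum, so some admissible bound lies strictly below
  \<open>C + 1\<close>. This is why \<open>C + 1\<close> replaces \<open>C\<close> in the Taylor
  estimates.\<close>

lemma holder_norm_bound:
  fixes f :: "'a::euclidean_space => real"
  assumes "f \<in> holder_space s" "holder_norm s f \<le> C"
  shows "holder_bound s f (C + 1)"
proof -
  define S where "S = {B. B > 0 \<and> holder_bound s f B}"
  have "S \<noteq> {}" using assms by (auto simp: holder_space_def S_def)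
  moreover have "Inf S < C + 1" using assms by (simp add: holder_norm_def S_def)
  ultimately obtain B where B: "B \<in> S" "B < C + 1" by (meson cInf_lessD)
  show ?thesis unfolding holder_bound_def
  proof (intro allI impI conjI ballI)
    fix bs :: "'a list" and x y :: 'a assume bs: "set bs \<subseteq> Basis \<and> length bs = holder_order s" and xy: "x \<in> unit_cube" "y \<in> unit_cube"
    then have "\<bar>iterated_partial bs f x - iterated_partial bs f y\<bar> \<le> B * norm (x - y) powr (s - real (holder_order s))"
      using B by (auto simp: S_def holder_bound_def)
    also have "... \<le> (C + 1) * norm (x - y) powr (s - real (holder_order s))" using B by (intro mult_right_mono) auto
    finally show "\<bar>iterated_partial bs f x - iterated_partial bs f y\<bar> \<le> (C + 1) * norm (x - y) powr (s - real (holder_order s))" .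
  next
    fix bs :: "'a list" and x :: 'a assume bs: "set bs \<subseteq> Basis \<and> length bs = holder_order s" and x: "x \<in> unit_cube"
    then have "\<bar>iterated_partial bs f x\<bar> \<le> B" using B by (auto simp: S_def holder_bound_def)
    then show "\<bar>iterated_partial bs f x\<bar> \<le> C + 1" using B by simp
  qed
qed

lemma mem_unit_cube: "x \<in> unit_cube \<longleftrightarrow> (\<forall>b\<in>Basis. 0 \<le> x \<bullet> b \<and> x \<bullet> b \<le> 1)"
  by (simp add: mem_box)

lemma move_unit_cube: "x \<in> unit_cube ==> b \<in> Basis ==> 0 \<le> t ==> t \<le> 1 ==> move x b t \<in> unit_cube"
  by (auto simp: mem_unit_cube move_inner)

lemma move_ucube: "x \<in> ucube ==> b \<in> Basis ==> 0 \<le> t ==> t < 1 ==> move x b t \<in> ucube"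
  by (auto simp: ucube_def move_inner)

lemma ucube_subset: "ucube \<subseteq> unit_cube"
  by (auto simp: mem_unit_cube ucube_def less_imp_le)

lemma iterated_partial_replicate: "iterated_partial (replicate j b) f = (partial b ^^ j) f"
  unfolding iterated_partial_def by (induction j arbitrary: f) (auto simp: funpow_swap1)

lemma times_differentiable_funpow:
  "times_differentiable (j + k) f ==> b \<in> Basis ==> times_differentiable k ((partial b ^^ j) f)"
  by (induction j arbitrary: f) (auto simp: funpow_swap1)

text \<open>Chain rule along \<open>move x b\<close>, whose path stays in the cube. Since
  \<open>partial\<close> is a derivative within the cube, the derivative obtained is one-sided at 0
  and 1.\<close>

lemma partial_along_axis:
  fixes F :: "'a::euclidean_space => real"
  assumes F: "F differentiable_on unit_cube" and x: "x \<in> unit_cube" "b \<in> Basis" and t: "0 \<le> t" "t \<le> 1"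
  shows "((%t. F (move x b t)) has_field_derivative partial b F (move x b t)) (at t within {0..1})"
proof -
  define F' where "F' = frechet_derivative F (at (move x b t) within unit_cube)"
  have "F differentiable (at (move x b t) within unit_cube)"
    using F move_unit_cube[OF x t] by (auto simp: differentiable_on_def)
  then have d: "(F has_derivative F') (at (move x b t) within unit_cube)" unfolding F'_def by (simp add: frechet_derivative_works)
  have "move x b ` {0..1} \<subseteq> unit_cube" using move_unit_cube[OF x] by auto
  then have d2: "(F has_derivative F') (at (move x b t) within move x b ` {0..1})" using d has_derivative_subset by blast
  have "(move x b has_derivative (%h. h *\<^sub>R b)) (at t within {0..1})"
    unfolding move_def by (auto intro!: derivative_eq_intros)
  from diff_chain_within[OF this d2] have "((%t. F (move x b t)) has_derivative (%h. F' (h *\<^sub>R b))) (at t within {0..1})"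
    by (simp add: comp_def)
  moreover have "(%h. F' (h *\<^sub>R b)) = (*) (F' b)"
  proof
    fix h have "linear F'" using d by (rule has_derivative_linear)
    then show "F' (h *\<^sub>R b) = F' b * h" by (simp add: linear_scale mult.commute)
  qed
  ultimately show ?thesis unfolding has_field_derivative_def partial_def F'_def by simp
qed

text \<open>Taylor's formula is applied to \<open>f\<close> minus its term of top order along the
  line: the derivative of order \<open>k\<close> of the difference is \<open>D k t - D k x0\<close>,
  which the Hoelder condition bounds, so no derivative beyond order \<open>k\<close> occurs. Here
  \<open>s > 1\<close> gives \<open>k \<ge> 1\<close>, and \<open>s \<le> r\<close> gives
  \<open>k < r\<close>.\<close>

lemma holder_taylor_axis:
  fixes f :: "'a::euclidean_space => real"
  assumes s: "1 < s" "s \<le> real r" and f: "f \<in> holder_space s" "holder_norm s f \<le> C" and x: "x \<in> unit_cube" "b \<in> Basis"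
  shows "\<exists>p. degree p < r \<and> (\<forall>t. 0 \<le> t \<and> t \<le> 1 --> \<bar>f (move x b t) - poly p t\<bar> \<le> (C + 1) * \<bar>t - x \<bullet> b\<bar> powr s)"
proof -
  define k where "k = holder_order s"
  have k: "1 \<le> k" "real k < s" "k < r" using s unfolding k_def holder_order_def by linarith+
  have td: "times_differentiable k f" using f by (simp add: holder_space_def k_def)
  have hb: "holder_bound s f (C + 1)" using f by (rule holder_norm_bound)
  define D where "D j t = (partial b ^^ j) f (move x b t)" for j t
  define x0 where "x0 = x \<bullet> b"
  have x0: "0 \<le> x0" "x0 \<le> 1" using x by (auto simp: x0_def mem_unit_cube)
  have dD: "(D j has_field_derivative D (Suc j) t) (at t within {0..1})" if "j < k" "0 \<le> t" "t \<le> 1" for j t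
  proof -
    have "times_differentiable (k - j) ((partial b ^^ j) f)" using times_differentiable_funpow[of j "k - j" f b] td that x by simp
    moreover have "k - j = Suc (k - j - 1)" using that by simp
    ultimately have "(partial b ^^ j) f differentiable_on unit_cube" by (metis times_differentiable.simps(2))
    from partial_along_axis[OF this x that(2,3)] show ?thesis by (simp add: D_def[abs_def])
  qed
  have wd: "set (replicate k b) \<subseteq> Basis \<and> length (replicate k b) = holder_order s" using x by (auto simp: k_def)
  note hbk = hb[unfolded holder_bound_def, THEN spec, of "replicate k b", THEN mp, OF wd, folded k_def, unfolded iterated_partial_replicate]
  have top: "\<bar>D k t - D k x0\<bar> \<le> (C + 1) * \<bar>t - x0\<bar> powr (s - real k)" if "0 \<le> t" "t \<le> 1" for t
  proof -
    have "move x b t - move x b x0 = (t - x0) *\<^sub>R b" by (simp add: move_def algebra_simps)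
    then have "norm (move x b t - move x b x0) = \<bar>t - x0\<bar>" using x by simp
    then show ?thesis
      using hbk[THEN conjunct1, THEN bspec, OF move_unit_cube[OF x that], THEN bspec, OF move_unit_cube[OF x x0]] unfolding D_def by simp
  qed
  \<comment> \<open>The subtracted monomial has constant derivative \<open>D k x0\<close> of order
    \<open>k\<close> and vanishes at \<open>x0\<close> together with its lower derivatives, so the
    Taylor coefficients below order \<open>k\<close> are unchanged.\<close>
  define G where "G j t = D j t - D k x0 * (t - x0) ^ (k - j) / fact (k - j)" for j t
  have dG: "(G j has_field_derivative G (Suc j) t) (at t within S)" if "j < k" "t \<in> S" "S \<subseteq> {0..1}" for j t S
  proof -
    have kj: "k - j = Suc (k - Suc j)" using that by simp
    have "((%t. D k x0 * (t - x0) ^ (k - j) / fact (k - j)) has_field_derivative D k x0 * (t - x0) ^ (k - Suc j) / fact (k - Suc j)) (at t within S)"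
    proof -
      define n where "n = k - Suc j"
      have e: "D k x0 * (real (Suc n) * y) / fact (Suc n) = D k x0 * y / fact n" for y
        by (simp add: fact_Suc del: of_nat_Suc)
      have "((%t. D k x0 * (t - x0) ^ Suc n / fact (Suc n)) has_field_derivative D k x0 * (real (Suc n) * (t - x0) ^ n) / fact (Suc n)) (at t within S)"
        by (auto intro!: derivative_eq_intros simp del: power_Suc fact_Suc of_nat_Suc)
      from this[unfolded e] show ?thesis unfolding kj n_def .
    qed
    moreover have "(D j has_field_derivative D (Suc j) t) (at t within S)" using dD[of j t] that DERIV_subset by fastforce
    ultimately show ?thesis unfolding G_def by (intro DERIV_diff)
  qed
  have C: "0 \<le> C + 1" using hbk[THEN conjunct2, THEN bspec, OF x(1)] by linarith
  define p where "p = (\<Sum>i\<le>k. Polynomial.smult (D i x0 / fact i) ([:-x0, 1:] ^ i))"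
  have "degree p \<le> k" unfolding p_def
  proof (intro degree_sum_le)
    fix i assume "i \<in> {..k}"
    have "degree ([:-x0, 1:] ^ i) \<le> degree [:-x0, 1:] * i" by (rule degree_power_le)
    then show "degree (Polynomial.smult (D i x0 / fact i) ([:-x0, 1:] ^ i)) \<le> k"
      using \<open>i \<in> {..k}\<close> by (intro order_trans[OF degree_smult_le]) auto
  qed simp
  then have dp: "degree p < r" using k by simp
  have pv: "poly p t = (\<Sum>i\<le>k. D i x0 * (t - x0) ^ i / fact i)" for t
    by (simp add: p_def poly_sum poly_power algebra_simps)
  have main: "\<bar>f (move x b t) - poly p t\<bar> \<le> (C + 1) * \<bar>t - x0\<bar> powr s" if t: "0 \<le> t" "t \<le> 1" for t
  proof (cases "t = x0")
    case True
    have "poly p x0 = (\<Sum>i\<le>k. if i = 0 then D i x0 else 0)" unfolding pv by (intro sum.cong) (auto simp: power_0_left)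
    then show ?thesis using True by (simp add: D_def)
  next
    case False
    define S where "S = closed_segment x0 t"
    have S: "S \<subseteq> {0..1}" unfolding S_def using x0 t by (auto simp: closed_segment_eq_real_ivl split: if_splits)
    have Sx: "\<bar>u - x0\<bar> \<le> \<bar>t - x0\<bar>" if "u \<in> S" for u using that by (auto simp: S_def closed_segment_eq_real_ivl split: if_splits)
    define E where "E = (C + 1) * \<bar>t - x0\<bar> powr (s - real k)"
    obtain k' where k': "k = Suc k'" using k by (cases k) auto
    have "norm (G 0 t - (\<Sum>i\<le>k'. G i x0 * (t - x0) ^ i / fact i)) \<le> E * norm (t - x0) ^ Suc k' / fact k'"
    proof (rule field_Taylor[of S])
      show "convex S" "x0 \<in> S" "t \<in> S" by (auto simp: S_def)
      show "(G i has_field_derivative G (Suc i) u) (at u within S)" if "u \<in> S" "i \<le> k'" for u i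
        using dG[of i u S] that S k' by auto
      show "norm (G (Suc k') u) \<le> E" if "u \<in> S" for u
      proof -
        have "\<bar>D k u - D k x0\<bar> \<le> (C + 1) * \<bar>u - x0\<bar> powr (s - real k)" using top[of u] that S by auto
        also have "... \<le> E" unfolding E_def using Sx[OF that] C k by (intro mult_left_mono powr_mono2) auto
        finally show ?thesis by (simp add: G_def k')
      qed
    qed
    moreover have "G 0 t - (\<Sum>i\<le>k'. G i x0 * (t - x0) ^ i / fact i) = D 0 t - poly p t"
    proof -
      have "G i x0 = D i x0" if "i \<le> k'" for i using that by (simp add: G_def k')
      then have "(\<Sum>i\<le>k'. G i x0 * (t - x0) ^ i / fact i) = (\<Sum>i\<le>k'. D i x0 * (t - x0) ^ i / fact i)"
        by (intro sum.cong) simp_all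
      then show ?thesis unfolding pv k' by (simp add: G_def k')
    qed
    ultimately have "\<bar>f (move x b t) - poly p t\<bar> \<le> E * \<bar>t - x0\<bar> ^ k / fact k'" by (simp add: D_def k')
    also have "... \<le> E * \<bar>t - x0\<bar> ^ k / 1" using C unfolding E_def
      by (intro divide_left_mono mult_nonneg_nonneg) auto
    also have "... = (C + 1) * \<bar>t - x0\<bar> powr s"
      using False by (simp add: E_def powr_realpow[symmetric] powr_add[symmetric])
    finally show ?thesis .
  qed
  show ?thesis using dp main unfolding x0_def by blast
qed

lemma holder_continuous:
  assumes "1 < s" "f \<in> holder_space s"
  shows "continuous_on unit_cube f"
proof -
  have "holder_order s = Suc (holder_order s - 1)" using assms(1) unfolding holder_order_def by linarith
  then have "f differentiable_on unit_cube" using assms(2) unfolding holder_space_def by (metis (mono_tags, lifting) mem_Collect_eq times_differentiable.simps(2))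
  then show ?thesis by (rule differentiable_imp_continuous_on)
qed

section \<open>Spline approximation in several variables\<close>

text \<open>What the one-dimensional quasi-interpolant requires, for the restrictions of
  \<open>F\<close> to all axis-parallel lines. The polynomial may depend on the base point, and
  mixed derivatives do not enter.\<close>

definition axis_taylor :: "nat => real => real => ('a::euclidean_space => real) => bool" where
  "axis_taylor r \<rho> E F \<longleftrightarrow> (\<forall>x\<in>ucube. \<forall>b\<in>Basis. \<exists>p. degree p < r \<and> poly p (x \<bullet> b) = F x \<and>
     (\<forall>t. 0 \<le> t \<and> t < 1 \<and> \<bar>t - x \<bullet> b\<bar> \<le> \<rho> --> \<bar>F (move x b t) - poly p t\<bar> \<le> E))"

lemma sum_PiE_insert:
  assumes "b \<notin> S" "finite S" "finite T"
  shows "(\<Sum>J\<in>(insert b S) \<rightarrow>\<^sub>E T. f J) = (\<Sum>k\<in>T. \<Sum>J\<in>S \<rightarrow>\<^sub>E T. f (J(b := k)))"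
proof -
  have "(\<Sum>J\<in>(insert b S) \<rightarrow>\<^sub>E T. f J) = (\<Sum>z\<in>T \<times> (S \<rightarrow>\<^sub>E T). f ((%(y, g). g(b := y)) z))"
    unfolding PiE_insert_eq by (rule sum.reindex[OF inj_combinator[OF assms(1)], unfolded comp_def])
  then show ?thesis by (simp add: sum.cartesian_product case_prod_beta)
qed

text \<open>The quasi-interpolant is applied in one coordinate after the other, so that only
  one-dimensional Taylor expansions enter.\<close>

lemma tensor_spline_approximation_aux:
  assumes r: "0 < r" and S: "finite S" "S \<subseteq> (Basis :: 'a::euclidean_space set)"
  shows "\<exists>K\<ge>0. \<forall>N E. \<forall>F :: 'a => real. axis_taylor r (real r / real (N + 1)) E F --> 0 \<le> E -->
    (\<exists>c. (\<forall>J x y. (\<forall>b\<in>Basis - S. x \<bullet> b = y \<bullet> b) --> c J x = c J y) \<and>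
      (\<forall>x\<in>ucube. \<bar>F x - (\<Sum>J\<in>S \<rightarrow>\<^sub>E {1..N+r}. c J x * (\<Prod>b\<in>S. bspline r N (J b) (x \<bullet> b)))\<bar> \<le> K * E))"
  using S
proof (induction S)
  case empty
  show ?case
  proof (intro exI[of _ 0] conjI allI impI)
    fix N E and F :: "'a => real"
    show "\<exists>c. (\<forall>J x y. (\<forall>b\<in>Basis - {}. x \<bullet> b = y \<bullet> b) --> c J x = c J y) \<and>
      (\<forall>x\<in>ucube. \<bar>F x - (\<Sum>J\<in>{} \<rightarrow>\<^sub>E {1..N+r}. c J x * (\<Prod>b\<in>{}. bspline r N (J b) (x \<bullet> b)))\<bar> \<le> 0 * E)"
      by (rule exI[of _ "%J x. F x"]) (auto simp: euclidean_eq_iff[symmetric])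
  qed simp
next
  case (insert b S)
  have b: "b \<in> Basis" "b \<notin> S" and SB: "S \<subseteq> Basis" using insert by auto
  obtain K where K: "K \<ge> 0" and IH: "\<And>N E. \<And>F :: 'a => real. axis_taylor r (real r / real (N + 1)) E F ==> 0 \<le> E ==>
    (\<exists>c. (\<forall>J x y. (\<forall>b\<in>Basis - S. x \<bullet> b = y \<bullet> b) --> c J x = c J y) \<and>
      (\<forall>x\<in>ucube. \<bar>F x - (\<Sum>J\<in>S \<rightarrow>\<^sub>E {1..N+r}. c J x * (\<Prod>b\<in>S. bspline r N (J b) (x \<bullet> b)))\<bar> \<le> K * E))"
    using insert.IH[OF SB] by blast
  obtain A where A: "A \<ge> 0" and QI: "\<And>N. \<exists>a \<xi>. (\<forall>k\<in>{1..N+r}. (\<Sum>l<r. \<bar>a k l\<bar>) \<le> A \<and> (\<forall>l<r. 0 \<le> \<xi> k l \<and> \<xi> k l < 1)) \<and>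
    (\<forall>x u p E. 0 \<le> x --> x < 1 --> degree p < r --> poly p x = u x -->
       (\<forall>t. 0 \<le> t \<and> t < 1 \<and> \<bar>t - x\<bar> \<le> real r / real (N + 1) --> \<bar>u t - poly p t\<bar> \<le> E) -->
       \<bar>u x - (\<Sum>k=1..N+r. (\<Sum>l<r. a k l * u (\<xi> k l)) * bspline r N k x)\<bar> \<le> A * E)"
    using bspline_quasi_interpolant[OF r] by blast
  show ?case
  \<comment> \<open>Interpolating \<open>F\<close> along \<open>b\<close> costs \<open>A E\<close>;
    interpolating the error \<open>K E\<close> left by the coordinates in \<open>S\<close> costs
    another \<open>A K E\<close>.\<close>
  proof (intro exI[of _ "A + A * K"] conjI allI impI)
    show "0 \<le> A + A * K" using A K by simp
    fix N and E :: real and F :: "'a => real"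
    assume tay: "axis_taylor r (real r / real (N + 1)) E F" and E: "0 \<le> E"
    obtain c where c1: "\<And>J x y. (\<forall>b\<in>Basis - S. x \<bullet> b = y \<bullet> b) ==> c J x = c J y"
      and c2: "\<And>x. x \<in> ucube ==> \<bar>F x - (\<Sum>J\<in>S \<rightarrow>\<^sub>E {1..N+r}. c J x * (\<Prod>b\<in>S. bspline r N (J b) (x \<bullet> b)))\<bar> \<le> K * E"
      using IH[OF tay E] by blast
    obtain a \<xi> where a\<xi>: "\<forall>k\<in>{1..N+r}. (\<Sum>l<r. \<bar>a k l\<bar>) \<le> A \<and> (\<forall>l<r. 0 \<le> \<xi> k l \<and> \<xi> k l < 1)"
      and qi0: "\<forall>x u p E. 0 \<le> x --> x < 1 --> degree p < r --> poly p x = u x -->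
       (\<forall>t. 0 \<le> t \<and> t < 1 \<and> \<bar>t - x\<bar> \<le> real r / real (N + 1) --> \<bar>u t - poly p t\<bar> \<le> E) -->
       \<bar>u x - (\<Sum>k=1..N+r. (\<Sum>l<r. a k l * u (\<xi> k l)) * bspline r N k x)\<bar> \<le> A * E"
      using QI[of N] by (elim exE conjE)
    have a: "\<And>k. k \<in> {1..N+r} ==> (\<Sum>l<r. \<bar>a k l\<bar>) \<le> A"
      and \<xi>: "\<And>k l. k \<in> {1..N+r} ==> l < r ==> 0 \<le> \<xi> k l \<and> \<xi> k l < 1"
      using a\<xi> by auto
    note qi = qi0[rule_format]
    define G where "G x = (\<Sum>J\<in>S \<rightarrow>\<^sub>E {1..N+r}. c J x * (\<Prod>b\<in>S. bspline r N (J b) (x \<bullet> b)))" for x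
    \<comment> \<open>The functional along \<open>b\<close> is applied to the coefficient functions
      found for \<open>S\<close>. These may depend on the coordinates outside \<open>S\<close>;
      evaluating them at fixed points along \<open>b\<close> removes the dependence on
      \<open>b\<close>.\<close>
    define c' where "c' J x = (\<Sum>l<r. a (J b) l * c (restrict J S) (move x b (\<xi> (J b) l)))" for J x
    show "\<exists>c. (\<forall>J x y. (\<forall>b\<in>Basis - insert b S. x \<bullet> b = y \<bullet> b) --> c J x = c J y) \<and>
      (\<forall>x\<in>ucube. \<bar>F x - (\<Sum>J\<in>insert b S \<rightarrow>\<^sub>E {1..N+r}. c J x * (\<Prod>b\<in>insert b S. bspline r N (J b) (x \<bullet> b)))\<bar> \<le> (A + A * K) * E)"
    proof (intro exI[of _ c'] conjI allI impI ballI)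
      fix J x y assume xy: "\<forall>b'\<in>Basis - insert b S. x \<bullet> b' = y \<bullet> b'"
      have "c (restrict J S) (move x b t) = c (restrict J S) (move y b t)" for t
        using xy b by (intro c1) (auto simp: move_inner)
      then show "c' J x = c' J y" by (simp add: c'_def)
    next
      fix x :: 'a assume x: "x \<in> ucube"
      have xb: "0 \<le> x \<bullet> b" "x \<bullet> b < 1" using x b by (auto simp: ucube_def)
      have "(\<Sum>J\<in>insert b S \<rightarrow>\<^sub>E {1..N+r}. c' J x * (\<Prod>b\<in>insert b S. bspline r N (J b) (x \<bullet> b)))
          = (\<Sum>k=1..N+r. \<Sum>J\<in>S \<rightarrow>\<^sub>E {1..N+r}. (\<Sum>l<r. a k l * c J (move x b (\<xi> k l))) * (bspline r N k (x \<bullet> b) * (\<Prod>b\<in>S. bspline r N (J b) (x \<bullet> b))))"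
        unfolding sum_PiE_insert[OF b(2) insert.hyps(1) finite_atLeastAtMost]
      proof (intro sum.cong refl)
        fix k J assume J: "J \<in> S \<rightarrow>\<^sub>E {1..N+r}"
        have "restrict (J(b := k)) S = J" using J b(2) by (auto simp: restrict_def PiE_def extensional_def fun_eq_iff)
        moreover have "(\<Prod>b'\<in>S. bspline r N ((J(b := k)) b') (x \<bullet> b')) = (\<Prod>b\<in>S. bspline r N (J b) (x \<bullet> b))"
          using b(2) by (intro prod.cong) auto
        ultimately show "c' (J(b := k)) x * (\<Prod>b'\<in>insert b S. bspline r N ((J(b := k)) b') (x \<bullet> b'))
          = (\<Sum>l<r. a k l * c J (move x b (\<xi> k l))) * (bspline r N k (x \<bullet> b) * (\<Prod>b\<in>S. bspline r N (J b) (x \<bullet> b)))"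
          using b(2) insert.hyps(1) by (simp add: c'_def)
      qed
      also have "... = (\<Sum>k=1..N+r. (\<Sum>l<r. a k l * G (move x b (\<xi> k l))) * bspline r N k (x \<bullet> b))"
      proof (intro sum.cong refl)
        fix k
        have "G (move x b t) = (\<Sum>J\<in>S \<rightarrow>\<^sub>E {1..N+r}. c J (move x b t) * (\<Prod>b\<in>S. bspline r N (J b) (x \<bullet> b)))" for t
        proof -
          have "(\<Prod>b'\<in>S. bspline r N (J b') (move x b t \<bullet> b')) = (\<Prod>b'\<in>S. bspline r N (J b') (x \<bullet> b'))" for J
            using b SB by (intro prod.cong) (auto simp: move_inner)
          then show ?thesis by (simp add: G_def)
        qed
        then show "(\<Sum>J\<in>S \<rightarrow>\<^sub>E {1..N+r}. (\<Sum>l<r. a k l * c J (move x b (\<xi> k l))) * (bspline r N k (x \<bullet> b) * (\<Prod>b\<in>S. bspline r N (J b) (x \<bullet> b))))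
          = (\<Sum>l<r. a k l * G (move x b (\<xi> k l))) * bspline r N k (x \<bullet> b)"
          by (simp add: sum_distrib_left sum_distrib_right sum.swap[of _ "{..<r}"] mult_ac)
      qed
      finally have eq: "(\<Sum>J\<in>insert b S \<rightarrow>\<^sub>E {1..N+r}. c' J x * (\<Prod>b\<in>insert b S. bspline r N (J b) (x \<bullet> b)))
          = (\<Sum>k=1..N+r. (\<Sum>l<r. a k l * G (move x b (\<xi> k l))) * bspline r N k (x \<bullet> b))" .
      obtain p where p: "degree p < r" "poly p (x \<bullet> b) = F x"
        "\<And>t. 0 \<le> t \<and> t < 1 \<and> \<bar>t - x \<bullet> b\<bar> \<le> real r / real (N + 1) ==> \<bar>F (move x b t) - poly p t\<bar> \<le> E"
        using tay x b unfolding axis_taylor_def by meson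
      have 1: "\<bar>F x - (\<Sum>k=1..N+r. (\<Sum>l<r. a k l * F (move x b (\<xi> k l))) * bspline r N k (x \<bullet> b))\<bar> \<le> A * E"
        using qi[OF xb p(1), of "%t. F (move x b t)" E] p by simp
      have 2: "\<bar>(\<Sum>k=1..N+r. (\<Sum>l<r. a k l * F (move x b (\<xi> k l))) * bspline r N k (x \<bullet> b))
          - (\<Sum>k=1..N+r. (\<Sum>l<r. a k l * G (move x b (\<xi> k l))) * bspline r N k (x \<bullet> b))\<bar> \<le> A * (K * E)"
      proof -
        have "\<bar>\<Sum>k=1..N+r. (\<Sum>l<r. a k l * (F (move x b (\<xi> k l)) - G (move x b (\<xi> k l)))) * bspline r N k (x \<bullet> b)\<bar>
          \<le> (\<Sum>k=1..N+r. (A * (K * E)) * bspline r N k (x \<bullet> b))"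
        proof (intro order_trans[OF sum_abs] sum_mono)
          fix k assume k: "k \<in> {1..N+r}"
          have "\<bar>\<Sum>l<r. a k l * (F (move x b (\<xi> k l)) - G (move x b (\<xi> k l)))\<bar> \<le> (\<Sum>l<r. \<bar>a k l\<bar> * (K * E))"
          proof (intro order_trans[OF sum_abs] sum_mono)
            fix l assume l: "l \<in> {..<r}"
            have "move x b (\<xi> k l) \<in> ucube" using move_ucube[OF x b(1)] \<xi>[OF k] l by auto
            then show "\<bar>a k l * (F (move x b (\<xi> k l)) - G (move x b (\<xi> k l)))\<bar> \<le> \<bar>a k l\<bar> * (K * E)"
              unfolding abs_mult using c2[folded G_def] by (intro mult_left_mono) auto
          qed
          also have "... \<le> A * (K * E)" unfolding sum_distrib_right[symmetric] using a[OF k] K E by (intro mult_right_mono) auto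
          finally show "\<bar>(\<Sum>l<r. a k l * (F (move x b (\<xi> k l)) - G (move x b (\<xi> k l)))) * bspline r N k (x \<bullet> b)\<bar> \<le> A * (K * E) * bspline r N k (x \<bullet> b)"
            unfolding abs_mult using bspline_nonneg[OF r xb(2), of N k] by (simp add: mult_right_mono)
        qed
        also have "... = A * (K * E)" unfolding sum_distrib_left[symmetric] bspline_sum_1[OF r xb] by simp
        finally show ?thesis by (simp add: sum_subtractf left_diff_distrib right_diff_distrib)
      qed
      show "\<bar>F x - (\<Sum>J\<in>insert b S \<rightarrow>\<^sub>E {1..N+r}. c' J x * (\<Prod>b\<in>insert b S. bspline r N (J b) (x \<bullet> b)))\<bar> \<le> (A + A * K) * E"
        unfolding eq using 1 2 by (simp add: algebra_simps)
    qed
  qed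
qed

lemma tensor_spline_approximation:
  assumes r: "0 < r"
  shows "\<exists>K\<ge>0. \<forall>N E. \<forall>F :: 'a::euclidean_space => real. axis_taylor r (real r / real (N + 1)) E F --> 0 \<le> E -->
    (\<exists>c. \<forall>x\<in>ucube. \<bar>F x - (\<Sum>J\<in>Basis \<rightarrow>\<^sub>E {1..N+r}. c J * (\<Prod>b\<in>Basis. bspline r N (J b) (x \<bullet> b)))\<bar> \<le> K * E)"
proof -
  obtain K where K: "K \<ge> 0" and IH: "\<And>N E. \<And>F :: 'a => real. axis_taylor r (real r / real (N + 1)) E F ==> 0 \<le> E ==>
    (\<exists>c. (\<forall>J x y. (\<forall>b\<in>Basis - Basis. x \<bullet> b = y \<bullet> b) --> c J x = c J y) \<and>
      (\<forall>x\<in>ucube. \<bar>F x - (\<Sum>J\<in>Basis \<rightarrow>\<^sub>E {1..N+r}. c J x * (\<Prod>b\<in>Basis. bspline r N (J b) (x \<bullet> b)))\<bar> \<le> K * E))"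
    using tensor_spline_approximation_aux[OF r finite_Basis order_refl, where 'a='a] by blast
  show ?thesis
  proof (intro exI[of _ K] conjI K allI impI)
    fix N E and F :: "'a => real" assume "axis_taylor r (real r / real (N + 1)) E F" "0 \<le> E"
    from IH[OF this] obtain c where c0: "\<forall>J x y. (\<forall>b\<in>Basis - Basis. x \<bullet> b = y \<bullet> b) --> c J x = c J y" and
      c2: "\<forall>x\<in>ucube. \<bar>F x - (\<Sum>J\<in>Basis \<rightarrow>\<^sub>E {1..N+r}. c J x * (\<Prod>b\<in>Basis. bspline r N (J b) (x \<bullet> b)))\<bar> \<le> K * E"
      by (elim exE conjE)
    have c: "c J x = c J y" for J x y using c0 by blast
    show "\<exists>c. \<forall>x\<in>ucube. \<bar>F x - (\<Sum>J\<in>Basis \<rightarrow>\<^sub>E {1..N+r}. c J * (\<Prod>b\<in>Basis. bspline r N (J b) (x \<bullet> b)))\<bar> \<le> K * E"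
    \<comment> \<open>All coordinates have been used up, so the coefficient functions are constant
      and any point may be inserted.\<close>
    proof (intro exI[of _ "%J. c J 0"] ballI)
      fix x :: 'a assume "x \<in> ucube"
      have "c J 0 = c J x" for J by (rule c)
      then show "\<bar>F x - (\<Sum>J\<in>Basis \<rightarrow>\<^sub>E {1..N+r}. c J 0 * (\<Prod>b\<in>Basis. bspline r N (J b) (x \<bullet> b)))\<bar> \<le> K * E"
        using c2[rule_format, OF \<open>x \<in> ucube\<close>] by simp
    qed
  qed
qed

text \<open>On an axis-parallel line all factors but one are constant.\<close>

lemma pp_prod:
  assumes \<eta>: "\<And>b. b \<in> Basis ==> \<eta> b \<in> borel_measurable borel"
    "\<And>b t. b \<in> Basis ==> 0 \<le> t ==> t < 1 ==> \<bar>\<eta> b t\<bar> \<le> 1"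
    "\<And>b k. b \<in> Basis ==> k < L ==> \<exists>p. degree p \<le> D \<and> (\<forall>t. real k \<le> real L * t \<and> real L * t < real k + 1 --> \<eta> b t = poly p t)"
  shows "pp L D (%x::'a::euclidean_space. \<Prod>b\<in>Basis. \<eta> b (x \<bullet> b))"
  unfolding pp_def
proof (intro conjI ballI allI impI)
  show "(%x. \<Prod>b\<in>Basis. \<eta> b (x \<bullet> b)) \<in> borel_measurable borel"
    by (intro borel_measurable_prod measurable_compose[OF _ \<eta>(1)]) auto
  have "\<bar>\<Prod>b\<in>Basis. \<eta> b (x \<bullet> b)\<bar> \<le> 1" if "x \<in> ucube" for x :: 'a
    unfolding abs_prod using that by (intro prod_le_1) (auto simp: ucube_def \<eta>(2))
  then show "\<exists>A. \<forall>x\<in>ucube. \<bar>\<Prod>b\<in>Basis. \<eta> b (x \<bullet> b)\<bar> \<le> A" by blast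
  fix x b :: 'a and k assume x: "x \<in> ucube" and b: "b \<in> Basis" and k: "k < L"
  obtain p where p: "degree p \<le> D" "\<And>t. real k \<le> real L * t \<and> real L * t < real k + 1 ==> \<eta> b t = poly p t" using \<eta>(3)[OF b k] by blast
  have "(\<Prod>b'\<in>Basis. \<eta> b' (move x b t \<bullet> b')) = \<eta> b t * (\<Prod>b'\<in>Basis - {b}. \<eta> b' (x \<bullet> b'))" for t
    using b by (subst prod.remove[of _ b]) (auto simp: move_inner intro!: prod.cong)
  then show "\<exists>p. degree p \<le> D \<and> (\<forall>t. real k \<le> real L * t \<and> real L * t < real k + 1 --> (\<Prod>b'\<in>Basis. \<eta> b' (move x b t \<bullet> b')) = poly p t)"
    using p by (intro exI[of _ "Polynomial.smult (\<Prod>b'\<in>Basis - {b}. \<eta> b' (x \<bullet> b')) p"])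
      (auto intro: order_trans[OF degree_smult_le])
qed

type_synonym ('dx, 'dz) cov = "(real ^ 'dx) \<times> (real ^ 'dz)"

section \<open>Tensor bases\<close>

lemma dim_vec_tensor [simp]: "dim_vec (vec_tensor u v) = dim_vec u * dim_vec v"
  by (simp add: vec_tensor_def stack_cols_def)

lemma vec_tensor_index:
  assumes "l < dim_vec u * dim_vec v"
  shows "vec_tensor u v $ l = u $ (l mod dim_vec u) * v $ (l div dim_vec u)"
    and "l mod dim_vec u < dim_vec u" and "l div dim_vec u < dim_vec v"
proof -
  have "0 < dim_vec u" using assms by (cases "dim_vec u") auto
  then show 1: "l mod dim_vec u < dim_vec u" by simp
  show 2: "l div dim_vec u < dim_vec v" using assms by (simp add: less_mult_imp_div_less mult.commute)
  show "vec_tensor u v $ l = u $ (l mod dim_vec u) * v $ (l div dim_vec u)"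
    using assms 1 2 by (simp add: vec_tensor_def stack_cols_def)
qed

lemma vec_tensor_index_pair:
  assumes "i < dim_vec u" "j < dim_vec v"
  shows "i + dim_vec u * j < dim_vec u * dim_vec v" "vec_tensor u v $ (i + dim_vec u * j) = u $ i * v $ j"
proof -
  have "i + dim_vec u * j < dim_vec u * (j + 1)" using assms by simp
  also have "... \<le> dim_vec u * dim_vec v" using assms by (intro mult_le_mono) auto
  finally show 1: "i + dim_vec u * j < dim_vec u * dim_vec v" .
  show "vec_tensor u v $ (i + dim_vec u * j) = u $ i * v $ j"
  proof -
    have "(i + dim_vec u * j) div dim_vec u = j" using assms(1) by (subst div_mult_self2) auto
    then show ?thesis using vec_tensor_index(1)[OF 1] assms by simp
  qed
qed

text \<open>\<open>tensor_spline\<close> for an arbitrary list of coordinates, which permits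
  induction over the list.\<close>

definition tens :: "nat => nat => 'q list => real ^ 'q::{finite,linorder} => real Matrix.vec" where
  "tens r N is x = foldr vec_tensor (map (%i. bspline_vec r N (vec_nth x i)) is) (Matrix.vec 1 (%_. 1))"

lemma tens_Cons: "tens r N (i # is) x = vec_tensor (bspline_vec r N (vec_nth x i)) (tens r N is x)"
  by (simp add: tens_def)

lemma dim_tens [simp]: "dim_vec (tens r N is x) = (N + r) ^ length is"
  by (induction "is") (auto simp: tens_Cons bspline_vec_def tens_def)

lemma tensor_spline_tens: "tensor_spline r N = tens r N (sorted_list_of_set UNIV)"
  by (simp add: fun_eq_iff tensor_spline_def tens_def)

lemma dim_tensor_spline [simp]: "dim_vec (tensor_spline r N (x :: real ^ 'q::{finite,linorder})) = (N + r) ^ CARD('q)"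
  by (simp add: tensor_spline_tens)

text \<open>Column stacking turns the position \<open>l\<close> into a number in base
  \<open>N + r\<close> whose lowest digit selects the B-spline of the first listed
  coordinate.\<close>

lemma tens_component:
  assumes r: "0 < r" and "distinct is" "l < (N + r) ^ length is"
  shows "\<exists>J. (\<forall>i. J i \<in> {1..N+r}) \<and> (\<forall>x. tens r N is x $ l = (\<Prod>i\<in>set is. bspline r N (J i) (vec_nth x i)))"
  using assms(2,3)
proof (induction "is" arbitrary: l)
  case Nil
  then show ?case using r by (intro exI[of _ "%_. 1"]) (auto simp: tens_def)
next
  case (Cons i "is")
  define u where "u = N + r"
  have u: "dim_vec (bspline_vec r N t) = u" for t by (simp add: bspline_vec_def u_def)
  have ll: "l < u * u ^ length is" using Cons.prems by (simp add: u_def)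
  have l1: "l mod u < u" "l div u < u ^ length is"
  proof -
    have "0 < u" using r by (simp add: u_def)
    then show "l mod u < u" by simp
    show "l div u < u ^ length is" using ll by (simp add: less_mult_imp_div_less mult.commute)
  qed
  obtain J where J: "\<forall>i. J i \<in> {1..N+r}" "\<forall>x. tens r N is x $ (l div u) = (\<Prod>i\<in>set is. bspline r N (J i) (vec_nth x i))"
    using Cons.IH[of "l div u"] Cons.prems l1(2) by (auto simp: u_def)
  have "tens r N (i # is) x $ l = (\<Prod>j\<in>set (i # is). bspline r N ((J(i := l mod u + 1)) j) (vec_nth x j))" for x
  proof -
    have "tens r N (i # is) x $ l = bspline_vec r N (vec_nth x i) $ (l mod u) * tens r N is x $ (l div u)"
      using vec_tensor_index(1)[of l "bspline_vec r N (vec_nth x i)" "tens r N is x"] ll by (simp add: tens_Cons u u_def)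
    also have "bspline_vec r N (vec_nth x i) $ (l mod u) = bspline r N (l mod u + 1) (vec_nth x i)"
      using l1 by (simp add: bspline_vec_def u_def)
    also have "tens r N is x $ (l div u) = (\<Prod>j\<in>set is. bspline r N ((J(i := l mod u + 1)) j) (vec_nth x j))"
      using J Cons.prems by (auto intro!: prod.cong)
    finally show ?thesis using Cons.prems by simp
  qed
  then show ?case using J(1) l1(1) by (intro exI[of _ "J(i := l mod u + 1)"]) (auto simp: u_def)
qed

text \<open>The digits \<open>J i - 1\<close> are assembled into the position \<open>l\<close>;
  B-splines are numbered from 1, vector entries from 0.\<close>

lemma tens_product:
  assumes "distinct is" "\<And>i. i \<in> set is ==> J i \<in> {1..N+r}"
  shows "\<exists>l<(N + r) ^ length is. \<forall>x. tens r N is x $ l = (\<Prod>i\<in>set is. bspline r N (J i) (vec_nth x i))"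
  using assms
proof (induction "is")
  case Nil
  then show ?case by (auto simp: tens_def)
next
  case (Cons i "is")
  have u: "dim_vec (bspline_vec r N t) = N + r" for t by (simp add: bspline_vec_def)
  obtain l where l: "l < (N + r) ^ length is" "\<forall>x. tens r N is x $ l = (\<Prod>i\<in>set is. bspline r N (J i) (vec_nth x i))"
    using Cons by auto
  have k: "J i - 1 < N + r" "J i - 1 + 1 = J i" using Cons.prems(2)[of i] by auto
  show ?case
  proof (intro exI[of _ "(J i - 1) + (N + r) * l"] conjI allI)
    fix x
    note vt = vec_tensor_index_pair[of "J i - 1" "bspline_vec r N (vec_nth x i)" l "tens r N is x", unfolded u dim_tens, OF k(1) l(1)]
    have "bspline_vec r N (vec_nth x i) $ (J i - 1) = bspline r N (J i) (vec_nth x i)"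
      using k unfolding bspline_vec_def by (subst index_vec) auto
    then show "tens r N (i # is) x $ (J i - 1 + (N + r) * l) = (\<Prod>i\<in>set (i # is). bspline r N (J i) (vec_nth x i))"
      unfolding tens_Cons vt(2) using l(2) Cons.prems(1) by simp
    show "J i - 1 + (N + r) * l < (N + r) ^ length (i # is)" using vt(1) by simp
  qed
qed

lemma tensor_spline_component:
  fixes N :: nat
  assumes r: "0 < r" and l: "l < (N + r) ^ CARD('q::{finite,linorder})"
  shows "\<exists>J. (\<forall>i. J i \<in> {1..N+r}) \<and> (\<forall>x::real^'q::{finite,linorder}. tensor_spline r N x $ l = (\<Prod>i\<in>UNIV. bspline r N (J i) (vec_nth x i)))"
  using tens_component[OF r, of "sorted_list_of_set (UNIV :: 'q set)" l N] l by (simp add: tensor_spline_tens)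

lemma tensor_spline_product:
  fixes N :: nat and J :: "'q::{finite,linorder} => nat"
  assumes "\<And>i. J i \<in> {1..N+r}"
  shows "\<exists>l<(N + r) ^ CARD('q). \<forall>x::real^'q::{finite,linorder}. tensor_spline r N x $ l = (\<Prod>i\<in>UNIV. bspline r N (J i) (vec_nth x i))"
  using tens_product[of "sorted_list_of_set (UNIV :: 'q set)" J N r] assms by (simp add: tensor_spline_tens)

lemma prod_Basis_vec: "(\<Prod>b\<in>(Basis :: (real ^ 'q) set). G b) = (\<Prod>i\<in>UNIV. G (axis i 1))"
proof -
  have B: "(Basis :: (real ^ 'q) set) = range (%i. axis i 1)" by (auto simp: Basis_vec_def)
  have "inj (%i::'q. axis i (1::real))" by (auto simp: inj_def axis_eq_axis)
  from prod.reindex[OF this, of G] show ?thesis unfolding B by (simp add: comp_def)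
qed

lemma prod_Basis_pair:
  "(\<Prod>b\<in>(Basis :: ((real ^ 'dx) \<times> (real ^ 'dz)) set). G b) = (\<Prod>i\<in>UNIV. G (axis i 1, 0)) * (\<Prod>j\<in>UNIV. G (0, axis j 1))"
proof -
  have "(\<Prod>b\<in>(Basis :: ((real ^ 'dx) \<times> (real ^ 'dz)) set). G b)
      = (\<Prod>b\<in>(%u. (u, 0)) ` Basis. G b) * (\<Prod>b\<in>(%v. (0, v)) ` Basis. G b)"
    unfolding Basis_prod_def by (rule prod.union_disjoint) auto
  also have "(\<Prod>b\<in>(%u. (u, 0)) ` Basis. G b) = (\<Prod>u\<in>Basis. G (u, 0))"
    by (subst prod.reindex) (auto simp: inj_on_def)
  also have "(\<Prod>b\<in>(%v. (0, v)) ` Basis. G b) = (\<Prod>v\<in>Basis. G (0, v))"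
    by (subst prod.reindex) (auto simp: inj_on_def)
  finally show ?thesis by (simp only: prod_Basis_vec)
qed

section \<open>Spans of the spline bases and their approximation power\<close>

definition spn :: "nat => ('w => real Matrix.vec) => ('w => real) => bool" where
  "spn K \<phi> v \<longleftrightarrow> (\<exists>c. \<forall>w. v w = (\<Sum>l<K. c l * \<phi> w $ l))"

lemma spn_zero: "spn K \<phi> (%w. 0)"
  unfolding spn_def by (rule exI[of _ "%_. 0"]) simp

lemma spn_add: assumes "spn K \<phi> v" "spn K \<phi> v'" shows "spn K \<phi> (%w. v w + v' w)"
proof -
  obtain c c' where "\<forall>w. v w = (\<Sum>l<K. c l * \<phi> w $ l)" "\<forall>w. v' w = (\<Sum>l<K. c' l * \<phi> w $ l)" using assms by (auto simp: spn_def)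
  then show ?thesis unfolding spn_def by (intro exI[of _ "%l. c l + c' l"]) (simp add: distrib_right sum.distrib)
qed

lemma spn_cmult: assumes "spn K \<phi> v" shows "spn K \<phi> (%w. a * v w)"
proof -
  obtain c where "\<forall>w. v w = (\<Sum>l<K. c l * \<phi> w $ l)" using assms by (auto simp: spn_def)
  then show ?thesis unfolding spn_def by (intro exI[of _ "%l. a * c l"]) (simp add: sum_distrib_left mult.assoc)
qed

lemma spn_diff: assumes "spn K \<phi> v" "spn K \<phi> v'" shows "spn K \<phi> (%w. v w - v' w)"
  using spn_add[OF assms(1) spn_cmult[OF assms(2), of "-1"]] by simp

lemma spn_sum: assumes "\<And>i. i \<in> I ==> spn K \<phi> (v i)" shows "spn K \<phi> (%w. \<Sum>i\<in>I. v i w)"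
  using assms by (induction I rule: infinite_finite_induct) (auto simp: spn_zero spn_add)

lemma spn_component: assumes "l < K" shows "spn K \<phi> (%w. \<phi> w $ l)"
  unfolding spn_def using assms by (intro exI[of _ "%i. if i = l then 1 else 0"]) (auto simp: if_distrib[of "%x. x * _"] cong: if_cong)

lemma pp_spn: assumes "\<And>l. l < K ==> pp L D (%w. \<phi> w $ l)" "spn K \<phi> v" shows "pp L D v"
proof -
  obtain c where "\<forall>w. v w = (\<Sum>l<K. c l * \<phi> w $ l)" using assms(2) by (auto simp: spn_def)
  then have "v = (%w. \<Sum>l<K. c l * \<phi> w $ l)" by auto
  then show ?thesis using assms(1) by (auto intro!: pp_sum pp_cmult)
qed

definition basis_xz :: "nat => nat => ('dx::{finite,linorder}, 'dz::{finite,linorder}) cov => real Matrix.vec" where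
  "basis_xz r N = (%(x, z). vec_tensor (tensor_spline r N x) (tensor_spline r N z))"

text \<open>Read as a function of the pair, so that functions of \<open>z\<close> alone and
  functions of \<open>(x, z)\<close> share one space, one inner product and one notion of piecewise
  polynomial.\<close>

definition basis_z :: "nat => nat => ('dx::{finite,linorder}, 'dz::{finite,linorder}) cov => real Matrix.vec" where
  "basis_z r N = (%(x, z). tensor_spline r N z)"

lemma basis_xz_component:
  fixes N :: nat
  assumes r: "0 < r" and l: "l < (N + r) ^ CARD('dx::{finite,linorder}) * (N + r) ^ CARD('dz::{finite,linorder})"
  shows "\<exists>J. (\<forall>b. J b \<in> {1..N+r}) \<and> (\<forall>w::('dx::{finite,linorder}, 'dz::{finite,linorder}) cov. basis_xz r N w $ l = (\<Prod>b\<in>Basis. bspline r N (J b) (w \<bullet> b)))"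
proof -
  define u where "u = (N + r) ^ CARD('dx)"
  have "0 < u" using r by (simp add: u_def)
  then have 1: "l mod u < (N + r) ^ CARD('dx)" unfolding u_def by simp
  have 2: "l div u < (N + r) ^ CARD('dz)" using l by (simp add: u_def less_mult_imp_div_less mult.commute)
  obtain J1 where k1: "\<forall>i. J1 i \<in> {1..N+r}" "\<forall>x::real^'dx::{finite,linorder}. tensor_spline r N x $ (l mod u) = (\<Prod>i\<in>UNIV. bspline r N (J1 i) (vec_nth x i))"
    using tensor_spline_component[OF r 1] by blast
  obtain J2 where k2: "\<forall>i. J2 i \<in> {1..N+r}" "\<forall>x::real^'dz::{finite,linorder}. tensor_spline r N x $ (l div u) = (\<Prod>i\<in>UNIV. bspline r N (J2 i) (vec_nth x i))"
    using tensor_spline_component[OF r 2] by blast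
  \<comment> \<open>The basis vectors of the product are \<open>(axis i 1, 0)\<close> and
    \<open>(0, axis j 1)\<close>; \<open>SOME\<close> recovers the coordinate from the
    vector.\<close>
  define J where "J b = (if snd b = 0 then J1 (SOME i. fst b = axis i 1) else J2 (SOME i. snd b = axis i 1))" for b :: "('dx, 'dz) cov"
  have e: "J (axis i 1, 0) = J1 i" "J (0, axis j 1) = J2 j" for i j
    by (auto simp: J_def axis_eq_axis axis_eq_0_iff)
  have "basis_xz r N w $ l = (\<Prod>b\<in>Basis. bspline r N (J b) (w \<bullet> b))" for w :: "('dx, 'dz) cov"
  proof -
    obtain x z where w: "w = (x, z)" by (cases w)
    have "basis_xz r N w $ l = tensor_spline r N x $ (l mod u) * tensor_spline r N z $ (l div u)"
      using vec_tensor_index(1)[of l "tensor_spline r N x" "tensor_spline r N z"] l by (simp add: basis_xz_def w u_def)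
    then show ?thesis using k1 k2 by (simp add: prod_Basis_pair e w inner_axis)
  qed
  moreover have "J b \<in> {1..N+r}" for b using k1 k2 by (simp add: J_def)
  ultimately show ?thesis by blast
qed

lemma basis_xz_product:
  fixes N :: nat and J :: "('dx::{finite,linorder}, 'dz::{finite,linorder}) cov => nat"
  assumes "\<And>b. b \<in> Basis ==> J b \<in> {1..N+r}"
  shows "\<exists>l<(N + r) ^ CARD('dx) * (N + r) ^ CARD('dz). \<forall>w. basis_xz r N w $ l = (\<Prod>b\<in>Basis. bspline r N (J b) (w \<bullet> b))"
proof -
  have B: "(axis i 1, 0) \<in> (Basis :: (('dx, 'dz) cov) set)" "(0, axis j 1) \<in> (Basis :: (('dx, 'dz) cov) set)" for i j
    by (auto simp: Basis_prod_def Basis_vec_def)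
  obtain l1 where l1: "l1 < (N + r) ^ CARD('dx)" "\<forall>x::real^'dx::{finite,linorder}. tensor_spline r N x $ l1 = (\<Prod>i\<in>UNIV. bspline r N (J (axis i 1, 0)) (vec_nth x i))"
    using tensor_spline_product[of "%i. J (axis i 1, 0)" N r] assms B by blast
  obtain l2 where l2: "l2 < (N + r) ^ CARD('dz)" "\<forall>x::real^'dz::{finite,linorder}. tensor_spline r N x $ l2 = (\<Prod>i\<in>UNIV. bspline r N (J (0, axis i 1)) (vec_nth x i))"
    using tensor_spline_product[of "%i. J (0, axis i 1)" N r] assms B by blast
  define l where "l = l1 + (N + r) ^ CARD('dx) * l2"
  have vt: "l < (N + r) ^ CARD('dx) * (N + r) ^ CARD('dz)" "vec_tensor (tensor_spline r N x) (tensor_spline r N z) $ l = tensor_spline r N x $ l1 * tensor_spline r N z $ l2"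
    for x :: "real^'dx::{finite,linorder}" and z :: "real^'dz::{finite,linorder}"
    using vec_tensor_index_pair[of l1 "tensor_spline r N x" l2 "tensor_spline r N z"] l1(1) l2(1) by (auto simp: l_def)
  show ?thesis
  proof (intro exI[of _ l] conjI allI vt(1))
    fix w :: "('dx, 'dz) cov"
    obtain x z where w: "w = (x, z)" by (cases w)
    show "basis_xz r N w $ l = (\<Prod>b\<in>Basis. bspline r N (J b) (w \<bullet> b))"
      using l1 l2 by (simp add: basis_xz_def w vt prod_Basis_pair inner_axis)
  qed
qed

lemma bspline_piece:
  assumes "0 < r" "r \<le> D + 1" "k < N + 1"
  shows "\<exists>p. degree p \<le> D \<and> (\<forall>t. real k \<le> real (N + 1) * t \<and> real (N + 1) * t < real k + 1 --> bspline r N j t = poly p t)"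
proof -
  obtain p where "degree p < r" "\<forall>x. real k \<le> real (N + 1) * x \<and> real (N + 1) * x < real k + 1 --> bspline r N j x = poly p x"
    using bspline_piecewise[OF assms(1,3)] by blast
  then show ?thesis using assms(2) by (intro exI[of _ p]) auto
qed

lemma bspline_abs_le_1:
  assumes "0 < r" "k \<in> {1..N+r}" "0 \<le> t" "t < 1"
  shows "\<bar>bspline r N k t\<bar> \<le> 1"
  using bspline_le_1[OF assms(1,3,4,2)] bspline_nonneg[OF assms(1,4), of N k] by simp

lemma pp_basis_xz:
  assumes r: "0 < r" "r \<le> D + 1" and l: "l < (N + r) ^ CARD('dx::{finite,linorder}) * (N + r) ^ CARD('dz::{finite,linorder})"
  shows "pp (N + 1) D (%w::('dx::{finite,linorder}, 'dz::{finite,linorder}) cov. basis_xz r N w $ l)"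
proof -
  obtain J where J: "\<forall>b. J b \<in> {1..N+r}" "\<forall>w::('dx, 'dz) cov. basis_xz r N w $ l = (\<Prod>b\<in>Basis. bspline r N (J b) (w \<bullet> b))"
    using basis_xz_component[OF r(1) l] by blast
  have "pp (N + 1) D (%w::('dx, 'dz) cov. \<Prod>b\<in>Basis. bspline r N (J b) (w \<bullet> b))"
    using bspline_piece[OF r] J(1) by (intro pp_prod borel_measurable_bspline bspline_abs_le_1[OF r(1)]) auto
  then show ?thesis unfolding J(2)[rule_format, symmetric] .
qed

lemma pp_basis_z:
  assumes r: "0 < r" "r \<le> D + 1" and l: "l < (N + r) ^ CARD('dz::{finite,linorder})"
  shows "pp (N + 1) D (%w::('dx::{finite,linorder}, 'dz::{finite,linorder}) cov. basis_z r N w $ l)"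
proof -
  obtain J where J: "\<forall>i. J i \<in> {1..N+r}" "\<forall>x::real^'dz::{finite,linorder}. tensor_spline r N x $ l = (\<Prod>i\<in>UNIV. bspline r N (J i) (vec_nth x i))"
    using tensor_spline_component[OF r(1) l] by blast
  \<comment> \<open>A factor 1 for every coordinate of \<open>x\<close> turns a product over the
    coordinates of \<open>z\<close> into one over all coordinates.\<close>
  define \<eta> where "\<eta> b = (if snd b = 0 then (%t. 1) else bspline r N (J (SOME i. snd b = axis i 1)))" for b :: "('dx, 'dz) cov"
  have e: "\<eta> (axis i 1, 0) t = 1" "\<eta> (0, axis j 1) t = bspline r N (J j) t" for i j t
    by (auto simp: \<eta>_def axis_eq_axis axis_eq_0_iff)
  have "pp (N + 1) D (%w::('dx, 'dz) cov. \<Prod>b\<in>Basis. \<eta> b (w \<bullet> b))"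
  proof (rule pp_prod)
    fix b :: "('dx, 'dz) cov" and t :: real and k :: nat
    show "\<eta> b \<in> borel_measurable borel" by (simp add: \<eta>_def)
    show "\<bar>\<eta> b t\<bar> \<le> 1" if "0 \<le> t" "t < 1" using that J(1) by (simp add: \<eta>_def bspline_abs_le_1[OF r(1)])
    show "\<exists>p. degree p \<le> D \<and> (\<forall>t. real k \<le> real (N + 1) * t \<and> real (N + 1) * t < real k + 1 --> \<eta> b t = poly p t)" if "k < N + 1"
    proof (cases "snd b = 0")
      case True then show ?thesis by (intro exI[of _ 1]) (simp add: \<eta>_def)
    next
      case False then show ?thesis using bspline_piece[OF r that] by (simp add: \<eta>_def)
    qed
  qed
  moreover have "(\<Prod>b\<in>Basis. \<eta> b (w \<bullet> b)) = basis_z r N w $ l" for w :: "('dx, 'dz) cov"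
    using J(2) by (cases w) (simp add: prod_Basis_pair e basis_z_def inner_axis)
  ultimately show ?thesis by simp
qed

lemma basis_xz_approximation:
  assumes r: "0 < r"
  shows "\<exists>K\<ge>0. \<forall>N E. \<forall>F :: ('dx::{finite,linorder}, 'dz::{finite,linorder}) cov => real. axis_taylor r (real r / real (N + 1)) E F --> 0 \<le> E -->
    (\<exists>v. spn ((N + r) ^ CARD('dx) * (N + r) ^ CARD('dz)) (basis_xz r N) v \<and> (\<forall>w\<in>ucube. \<bar>F w - v w\<bar> \<le> K * E))"
proof -
  obtain K where K: "K \<ge> 0" and ap: "\<And>N E. \<And>F :: ('dx, 'dz) cov => real. axis_taylor r (real r / real (N + 1)) E F ==> 0 \<le> E ==>
    (\<exists>c. \<forall>x\<in>ucube. \<bar>F x - (\<Sum>J\<in>Basis \<rightarrow>\<^sub>E {1..N+r}. c J * (\<Prod>b\<in>Basis. bspline r N (J b) (x \<bullet> b)))\<bar> \<le> K * E)"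
    using tensor_spline_approximation[OF r, where 'a = "('dx, 'dz) cov"] by blast
  show ?thesis
  proof (intro exI[of _ K] conjI K allI impI)
    fix N E and F :: "('dx, 'dz) cov => real" assume "axis_taylor r (real r / real (N + 1)) E F" "0 \<le> E"
    from ap[OF this] obtain c where c: "\<forall>x\<in>ucube. \<bar>F x - (\<Sum>J\<in>Basis \<rightarrow>\<^sub>E {1..N+r}. c J * (\<Prod>b\<in>Basis. bspline r N (J b) (x \<bullet> b)))\<bar> \<le> K * E" by blast
    have "spn ((N + r) ^ CARD('dx) * (N + r) ^ CARD('dz)) (basis_xz r N) (%w::('dx, 'dz) cov. \<Sum>J\<in>Basis \<rightarrow>\<^sub>E {1..N+r}. c J * (\<Prod>b\<in>Basis. bspline r N (J b) (w \<bullet> b)))"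
    proof (intro spn_sum spn_cmult)
      fix J :: "('dx, 'dz) cov => nat" assume "J \<in> Basis \<rightarrow>\<^sub>E {1..N+r}"
      then obtain l where l: "l<(N + r) ^ CARD('dx) * (N + r) ^ CARD('dz)" "\<forall>w. basis_xz r N w $ l = (\<Prod>b\<in>Basis. bspline r N (J b) (w \<bullet> b))"
        using basis_xz_product[of J N r] by blast
      show "spn ((N + r) ^ CARD('dx) * (N + r) ^ CARD('dz)) (basis_xz r N) (%w. \<Prod>b\<in>Basis. bspline r N (J b) (w \<bullet> b))"
        unfolding l(2)[rule_format, symmetric] by (rule spn_component[OF l(1)])
    qed
    then show "\<exists>v. spn ((N + r) ^ CARD('dx) * (N + r) ^ CARD('dz)) (basis_xz r N) v \<and> (\<forall>w\<in>ucube. \<bar>F w - v w\<bar> \<le> K * E)"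
      using c by blast
  qed
qed

lemma snd_ucube: "w \<in> ucube ==> snd w \<in> ucube"
proof -
  assume w: "w \<in> ucube"
  have "0 \<le> snd w \<bullet> b \<and> snd w \<bullet> b < 1" if "b \<in> Basis" for b
  proof -
    have "(0, b) \<in> Basis" using that by (simp add: Basis_prod_def)
    then have "0 \<le> w \<bullet> (0, b) \<and> w \<bullet> (0, b) < 1" using w unfolding ucube_def by blast
    then show ?thesis by (simp add: inner_prod_def)
  qed
  then show "snd w \<in> ucube" by (simp add: ucube_def)
qed

lemma basis_z_approximation:
  assumes r: "0 < r"
  shows "\<exists>K\<ge>0. \<forall>N E. \<forall>F :: real ^ 'dz::{finite,linorder} => real. axis_taylor r (real r / real (N + 1)) E F --> 0 \<le> E -->
    (\<exists>v. spn ((N + r) ^ CARD('dz)) (basis_z r N) v \<and> (\<forall>w::('dx::{finite,linorder}, 'dz::{finite,linorder}) cov\<in>ucube. \<bar>F (snd w) - v w\<bar> \<le> K * E))"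
proof -
  obtain K where K: "K \<ge> 0" and ap: "\<And>N E. \<And>F :: real ^ 'dz::{finite,linorder} => real. axis_taylor r (real r / real (N + 1)) E F ==> 0 \<le> E ==>
    (\<exists>c. \<forall>x\<in>ucube. \<bar>F x - (\<Sum>J\<in>Basis \<rightarrow>\<^sub>E {1..N+r}. c J * (\<Prod>b\<in>Basis. bspline r N (J b) (x \<bullet> b)))\<bar> \<le> K * E)"
    using tensor_spline_approximation[OF r, where 'a = "real ^ 'dz::{finite,linorder}"] by blast
  show ?thesis
  proof (intro exI[of _ K] conjI K allI impI)
    fix N E and F :: "real ^ 'dz::{finite,linorder} => real" assume "axis_taylor r (real r / real (N + 1)) E F" "0 \<le> E"
    from ap[OF this] obtain c where c: "\<forall>x\<in>ucube. \<bar>F x - (\<Sum>J\<in>Basis \<rightarrow>\<^sub>E {1..N+r}. c J * (\<Prod>b\<in>Basis. bspline r N (J b) (x \<bullet> b)))\<bar> \<le> K * E" by blast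
    have "spn ((N + r) ^ CARD('dz)) (basis_z r N) (%w::('dx, 'dz) cov. \<Sum>J\<in>Basis \<rightarrow>\<^sub>E {1..N+r}. c J * (\<Prod>b\<in>Basis. bspline r N (J b) (snd w \<bullet> b)))"
    proof (intro spn_sum spn_cmult)
      fix J :: "real ^ 'dz::{finite,linorder} => nat" assume k: "J \<in> Basis \<rightarrow>\<^sub>E {1..N+r}"
      have "J (axis i 1) \<in> {1..N+r}" for i by (rule PiE_mem[OF k]) (auto simp: Basis_vec_def)
      then obtain l where l: "l<(N + r) ^ CARD('dz)" "\<forall>x::real^'dz::{finite,linorder}. tensor_spline r N x $ l = (\<Prod>i\<in>UNIV. bspline r N (J (axis i 1)) (vec_nth x i))"
        using tensor_spline_product[of "%i. J (axis i 1)" N r] by blast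
      have "(%w::('dx, 'dz) cov. \<Prod>b\<in>Basis. bspline r N (J b) (snd w \<bullet> b)) = (%w. basis_z r N w $ l)"
        using l(2) by (auto simp: fun_eq_iff basis_z_def prod_Basis_vec inner_axis)
      then show "spn ((N + r) ^ CARD('dz)) (basis_z r N) (%w::('dx, 'dz) cov. \<Prod>b\<in>Basis. bspline r N (J b) (snd w \<bullet> b))"
        using spn_component[OF l(1), of "basis_z r N"] by simp
    qed
    then show "\<exists>v. spn ((N + r) ^ CARD('dz)) (basis_z r N) v \<and> (\<forall>w::('dx, 'dz) cov\<in>ucube. \<bar>F (snd w) - v w\<bar> \<le> K * E)"
      using c snd_ucube by blast
  qed
qed

section \<open>Least squares\<close>

definition gram :: "nat => ('w => real Matrix.vec) => 'i set => ('i => 'w) => real Matrix.mat" where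
  "gram K b I x = Matrix.mat K K (%(l, m). \<Sum>i\<in>I. b (x i) $ l * b (x i) $ m)"

text \<open>The weight of the response \<open>i\<close> in the fitted value at \<open>w\<close>: the
  hat matrix, extended from the design points to arbitrary \<open>w\<close>.\<close>

definition ols_kernel ::
  "(real Matrix.mat => real Matrix.mat) => nat => ('w => real Matrix.vec) => 'i set => ('i => 'w) => 'i => 'w => real" where
  "ols_kernel ginv K b I x i w = (\<Sum>l<K. (\<Sum>m<K. ginv (gram K b I x) $$ (l, m) * b (x i) $ m) * b w $ l)"

text \<open>Indexed by a set instead of a list, and visibly linear in \<open>y\<close>; this
  linearity lets responses be split into regression function and noise.\<close>

definition fit ::
  "(real Matrix.mat => real Matrix.mat) => nat => ('w => real Matrix.vec) => 'i set => ('i => 'w) => ('i => real) => 'w => real" where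
  "fit ginv K b I x y w = (\<Sum>i\<in>I. ols_kernel ginv K b I x i w * y i)"

lemma ols_fit_eq_fit:
  assumes g: "generalised_inverse_rule ginv" and b: "\<And>w. dim_vec (b w) = K" and d: "distinct is"
  shows "ols_fit ginv K b (map (%i. (x i, y i)) is) w = fit ginv K b (set is) x y w"
proof -
  define n where "n = length is"
  define \<Phi> where "\<Phi> = mat_of_rows K (map (%i. b (x i)) is)"
  have \<Phi>: "\<Phi> \<in> carrier_mat n K" unfolding \<Phi>_def n_def using mat_of_rows_carrier(1)[of K "map (%i. b (x i)) is"] by simp
  have \<Phi>i: "\<Phi> $$ (i, l) = b (x (is ! i)) $ l" if "i < n" "l < K" for i l
    using that by (simp add: \<Phi>_def n_def mat_of_rows_def)
  have si: "(\<Sum>i = 0..<n. f (is ! i)) = (\<Sum>i\<in>set is. f i)" for f :: "'b => real"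
    using d by (simp add: n_def sum.distinct_set_conv_list sum_list_sum_nth)
  have gr: "transpose_mat \<Phi> * \<Phi> = gram K b (set is) x"
    by (rule eq_matI) (use \<Phi> in \<open>auto simp: gram_def scalar_prod_def \<Phi>i si[symmetric]\<close>)
  have yv: "transpose_mat \<Phi> *\<^sub>v vec_of_list (map y is) = Matrix.vec K (%m. \<Sum>i\<in>set is. b (x i) $ m * y i)"
    by (rule eq_vecI) (use \<Phi> in \<open>auto simp: scalar_prod_def \<Phi>i si[symmetric] n_def vec_of_list_index\<close>)
  have G: "ginv (gram K b (set is) x) \<in> carrier_mat K K"
    using g unfolding generalised_inverse_rule_def gram_def by auto
  have "ols_fit ginv K b (map (%i. (x i, y i)) is) w =
      scalar_prod (b w) (ginv (gram K b (set is) x) *\<^sub>v Matrix.vec K (%m. \<Sum>i\<in>set is. b (x i) $ m * y i))"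
    unfolding ols_fit_def Let_def map_map comp_def fst_conv snd_conv \<Phi>_def[symmetric] gr yv ..
  also have "... = (\<Sum>l = 0..<K. b w $ l * (\<Sum>m = 0..<K. ginv (gram K b (set is) x) $$ (l, m) * (\<Sum>i\<in>set is. b (x i) $ m * y i)))"
    using G by (auto simp: scalar_prod_def intro!: sum.cong)
  also have "... = fit ginv K b (set is) x y w"
  proof -
    define Gm where "Gm l m = ginv (gram K b (set is) x) $$ (l, m)" for l m
    have "(\<Sum>l<K. b w $ l * (\<Sum>m<K. Gm l m * (\<Sum>i\<in>set is. b (x i) $ m * y i)))
        = (\<Sum>l<K. \<Sum>i\<in>set is. (\<Sum>m<K. Gm l m * b (x i) $ m) * b w $ l * y i)"
    proof (rule sum.cong[OF refl])
      fix l
      have "(\<Sum>m<K. Gm l m * (\<Sum>i\<in>set is. b (x i) $ m * y i)) = (\<Sum>m<K. \<Sum>i\<in>set is. Gm l m * (b (x i) $ m * y i))"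
        by (simp only: sum_distrib_left)
      also have "... = (\<Sum>i\<in>set is. \<Sum>m<K. Gm l m * (b (x i) $ m * y i))" by (rule sum.swap)
      also have "... = (\<Sum>i\<in>set is. (\<Sum>m<K. Gm l m * b (x i) $ m) * y i)" by (simp only: sum_distrib_right mult.assoc)
      finally have "b w $ l * (\<Sum>m<K. Gm l m * (\<Sum>i\<in>set is. b (x i) $ m * y i)) = (\<Sum>i\<in>set is. b w $ l * ((\<Sum>m<K. Gm l m * b (x i) $ m) * y i))"
        by (simp only: sum_distrib_left[of _ _ "set is"])
      then show "b w $ l * (\<Sum>m<K. Gm l m * (\<Sum>i\<in>set is. b (x i) $ m * y i)) = (\<Sum>i\<in>set is. (\<Sum>m<K. Gm l m * b (x i) $ m) * b w $ l * y i)"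
        by (simp only: mult.assoc mult.left_commute)
    qed
    also have "... = (\<Sum>i\<in>set is. \<Sum>l<K. (\<Sum>m<K. Gm l m * b (x i) $ m) * b w $ l * y i)"
      by (rule sum.swap)
    finally show ?thesis unfolding fit_def ols_kernel_def atLeast0LessThan Gm_def by (simp only: sum_distrib_right)
  qed
  finally show ?thesis .
qed

lemma spn_ols_kernel: "spn K b (ols_kernel ginv K b I x i)"
  unfolding spn_def ols_kernel_def
  by (rule exI[of _ "%l. \<Sum>m<K. ginv (gram K b I x) $$ (l, m) * b (x i) $ m"]) simp

lemma spn_fit: "spn K b (fit ginv K b I x y)"
proof -
  have "fit ginv K b I x y = (%w. \<Sum>i\<in>I. y i * ols_kernel ginv K b I x i w)" by (simp add: fit_def mult.commute fun_eq_iff)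
  then show ?thesis by (simp only:) (intro spn_sum spn_cmult spn_ols_kernel)
qed

text \<open>Let \<open>\<Phi>\<close> have the rows \<open>b (x i)\<close> and let
  \<open>A = \<Phi>^T \<Phi>\<close>. From \<open>A G A = A\<close> the matrix
  \<open>M = A G \<Phi>^T - \<Phi>^T\<close> satisfies \<open>M \<Phi> = 0\<close>, hence
  \<open>M M^T = 0\<close> and \<open>M = 0\<close>. This is the normal equation, and it holds for
  every generalised inverse.\<close>

lemma fit_normal:
  assumes g: "generalised_inverse_rule ginv" and I: "finite I" and v: "spn K b v"
  shows "(\<Sum>i\<in>I. (y i - fit ginv K b I x y (x i)) * v (x i)) = 0"
proof -
  define A where "A l m = (\<Sum>i\<in>I. b (x i) $ l * b (x i) $ m)" for l m
  define G where "G l m = ginv (gram K b I x) $$ (l, m)" for l m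
  have gc: "gram K b I x \<in> carrier_mat K K" by (simp add: gram_def)
  then have G1: "ginv (gram K b I x) \<in> carrier_mat K K" "gram K b I x * ginv (gram K b I x) * gram K b I x = gram K b I x"
    using g unfolding generalised_inverse_rule_def by auto
  have AGA: "(\<Sum>q<K. (\<Sum>p<K. A l p * G p q) * A q m) = A l m" if "l < K" "m < K" for l m
  proof -
    have "(gram K b I x * ginv (gram K b I x) * gram K b I x) $$ (l, m) = (\<Sum>q = 0..<K. (\<Sum>p = 0..<K. A l p * G p q) * A q m)"
      using that gc G1(1) by (auto simp: scalar_prod_def A_def G_def gram_def intro!: sum.cong)
    moreover have "gram K b I x $$ (l, m) = A l m" using that by (simp add: gram_def A_def)
    ultimately show ?thesis using G1(2) by (simp add: atLeast0LessThan)
  qed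
  \<comment> \<open>The entries of \<open>A G \<Phi>^T - \<Phi>^T\<close>, which have to
    vanish.\<close>
  define M where "M l i = (\<Sum>q<K. (\<Sum>p<K. A l p * G p q) * b (x i) $ q) - b (x i) $ l" for l i
  have M1: "(\<Sum>i\<in>I. M l i * b (x i) $ m) = 0" if "l < K" "m < K" for l m
  proof -
    have "(\<Sum>i\<in>I. M l i * b (x i) $ m) = (\<Sum>q<K. (\<Sum>p<K. A l p * G p q) * A q m) - A l m"
    proof -
      have "(\<Sum>i\<in>I. (\<Sum>q<K. (\<Sum>p<K. A l p * G p q) * b (x i) $ q) * b (x i) $ m)
          = (\<Sum>i\<in>I. \<Sum>q<K. (\<Sum>p<K. A l p * G p q) * (b (x i) $ q * b (x i) $ m))"
        by (simp only: sum_distrib_right mult.assoc)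
      also have "... = (\<Sum>q<K. (\<Sum>p<K. A l p * G p q) * A q m)"
        unfolding A_def[of _ m] sum_distrib_left[of _ _ I] by (rule sum.swap)
      finally show ?thesis unfolding M_def left_diff_distrib sum_subtractf by (simp add: A_def[of l m])
    qed
    then show ?thesis using AGA[OF that] by simp
  qed
  \<comment> \<open>The rows of \<open>M\<close> are combinations of rows of
    \<open>\<Phi>^T\<close>, to which they are orthogonal by \<open>M1\<close>; so their squared
    length is 0.\<close>
  have M0: "M l i = 0" if "l < K" "i \<in> I" for l i
  proof -
    have "(\<Sum>i\<in>I. (M l i)^2) = (\<Sum>i\<in>I. \<Sum>q<K. (\<Sum>p<K. A l p * G p q) * (M l i * b (x i) $ q)) - (\<Sum>i\<in>I. M l i * b (x i) $ l)"
      unfolding sum_subtractf[symmetric]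
    proof (intro sum.cong refl)
      fix i
      have "(M l i)^2 = M l i * ((\<Sum>q<K. (\<Sum>p<K. A l p * G p q) * b (x i) $ q) - b (x i) $ l)"
        by (simp add: power2_eq_square M_def)
      then show "(M l i)^2 = (\<Sum>q<K. (\<Sum>p<K. A l p * G p q) * (M l i * b (x i) $ q)) - M l i * b (x i) $ l"
        unfolding right_diff_distrib sum_distrib_left by (simp only: mult.left_commute)
    qed
    also have "(\<Sum>i\<in>I. \<Sum>q<K. (\<Sum>p<K. A l p * G p q) * (M l i * b (x i) $ q)) = (\<Sum>q<K. (\<Sum>p<K. A l p * G p q) * (\<Sum>i\<in>I. M l i * b (x i) $ q))"
      unfolding sum_distrib_left[of _ _ I] by (rule sum.swap)
    also have "... - (\<Sum>i\<in>I. M l i * b (x i) $ l) = 0" using M1 that by simp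
    finally have "(\<Sum>i\<in>I. (M l i)^2) = 0" .
    then have "\<forall>i\<in>I. (M l i)^2 = 0" using sum_nonneg_eq_0_iff[OF I, of "%i. (M l i)^2"] by simp
    then show ?thesis using that by simp
  qed
  have comp: "(\<Sum>i\<in>I. (y i - fit ginv K b I x y (x i)) * b (x i) $ l) = 0" if l: "l < K" for l
  proof -
    have "(\<Sum>i\<in>I. fit ginv K b I x y (x i) * b (x i) $ l) = (\<Sum>j\<in>I. (\<Sum>q<K. (\<Sum>p<K. A l p * G p q) * b (x j) $ q) * y j)"
    proof -
      define Y where "Y q = (\<Sum>j\<in>I. b (x j) $ q * y j)" for q
      have fitp: "fit ginv K b I x y w = (\<Sum>p<K. (\<Sum>q<K. G p q * Y q) * b w $ p)" for w
      proof -
        have "fit ginv K b I x y w = (\<Sum>p<K. \<Sum>j\<in>I. (\<Sum>q<K. G p q * b (x j) $ q) * b w $ p * y j)"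
          unfolding fit_def ols_kernel_def G_def[symmetric] sum_distrib_right by (rule sum.swap)
        also have "... = (\<Sum>p<K. (\<Sum>j\<in>I. \<Sum>q<K. G p q * (b (x j) $ q * y j)) * b w $ p)"
        proof (rule sum.cong[OF refl])
          fix p
          have "(\<Sum>q<K. G p q * b (x j) $ q) * b w $ p * y j = (\<Sum>q<K. G p q * (b (x j) $ q * y j)) * b w $ p" for j
            unfolding sum_distrib_right by (intro sum.cong refl) (simp add: mult_ac)
          then show "(\<Sum>j\<in>I. (\<Sum>q<K. G p q * b (x j) $ q) * b w $ p * y j) = (\<Sum>j\<in>I. \<Sum>q<K. G p q * (b (x j) $ q * y j)) * b w $ p"
            by (simp only: sum_distrib_right[of _ I])
        qed
        also have "... = (\<Sum>p<K. (\<Sum>q<K. G p q * Y q) * b w $ p)"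
        proof -
          have "(\<Sum>j\<in>I. \<Sum>q<K. G p q * (b (x j) $ q * y j)) = (\<Sum>q<K. G p q * Y q)" for p
            unfolding Y_def sum_distrib_left by (rule sum.swap)
          then show ?thesis by simp
        qed
        finally show ?thesis .
      qed
      have "(\<Sum>i\<in>I. fit ginv K b I x y (x i) * b (x i) $ l) = (\<Sum>i\<in>I. \<Sum>p<K. (\<Sum>q<K. G p q * Y q) * (b (x i) $ l * b (x i) $ p))"
        unfolding fitp by (simp add: sum_distrib_right sum_distrib_left mult_ac)
      also have "... = (\<Sum>p<K. (\<Sum>q<K. G p q * Y q) * A l p)"
        unfolding A_def by (subst sum.swap) (simp add: sum_distrib_left)
      also have "... = (\<Sum>p<K. \<Sum>q<K. A l p * G p q * Y q)" by (simp add: sum_distrib_left sum_distrib_right mult_ac)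
      also have "... = (\<Sum>q<K. \<Sum>p<K. A l p * G p q * Y q)" by (rule sum.swap)
      also have "... = (\<Sum>q<K. \<Sum>j\<in>I. (\<Sum>p<K. A l p * G p q) * b (x j) $ q * y j)"
      proof (rule sum.cong[OF refl])
        fix q
        have "(\<Sum>p<K. A l p * G p q * Y q) = (\<Sum>p<K. A l p * G p q) * Y q" by (simp only: sum_distrib_right)
        also have "... = (\<Sum>j\<in>I. (\<Sum>p<K. A l p * G p q) * (b (x j) $ q * y j))" unfolding Y_def sum_distrib_left ..
        finally show "(\<Sum>p<K. A l p * G p q * Y q) = (\<Sum>j\<in>I. (\<Sum>p<K. A l p * G p q) * b (x j) $ q * y j)" by (simp only: mult.assoc)
      qed
      also have "... = (\<Sum>j\<in>I. (\<Sum>q<K. (\<Sum>p<K. A l p * G p q) * b (x j) $ q) * y j)"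
        unfolding sum_distrib_right by (rule sum.swap)
      finally show ?thesis .
    qed
    also have "... = (\<Sum>j\<in>I. b (x j) $ l * y j)" using M0[OF l] by (intro sum.cong) (auto simp: M_def)
    finally show ?thesis unfolding left_diff_distrib sum_subtractf by (simp add: mult.commute)
  qed
  obtain c where c: "\<And>w. v w = (\<Sum>l<K. c l * b w $ l)" using v by (auto simp: spn_def)
  have "(\<Sum>i\<in>I. (y i - fit ginv K b I x y (x i)) * v (x i)) = (\<Sum>l<K. c l * (\<Sum>i\<in>I. (y i - fit ginv K b I x y (x i)) * b (x i) $ l))"
    unfolding c sum_distrib_left by (subst sum.swap) (simp add: mult_ac)
  then show ?thesis using comp by simp
qed

text \<open>The fit differs from any other element of the span by an element of the span, to which
  the residual is orthogonal.\<close>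

lemma fit_pythagoras:
  assumes g: "generalised_inverse_rule ginv" and I: "finite I" and v: "spn K b v"
  shows "(\<Sum>i\<in>I. (y i - v (x i))^2) = (\<Sum>i\<in>I. (y i - fit ginv K b I x y (x i))^2) + (\<Sum>i\<in>I. (fit ginv K b I x y (x i) - v (x i))^2)"
proof -
  define f where "f = fit ginv K b I x y"
  have "spn K b (%w. f w - v w)" unfolding f_def by (intro spn_diff spn_fit v)
  from fit_normal[OF g I this] have o: "(\<Sum>i\<in>I. (y i - f (x i)) * (f (x i) - v (x i))) = 0" unfolding f_def .
  have "(\<Sum>i\<in>I. (y i - v (x i))^2) = (\<Sum>i\<in>I. (y i - f (x i))^2 + (f (x i) - v (x i))^2 + 2 * ((y i - f (x i)) * (f (x i) - v (x i))))"
    by (intro sum.cong refl) (simp add: power2_eq_square algebra_simps)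
  also have "... = (\<Sum>i\<in>I. (y i - f (x i))^2) + (\<Sum>i\<in>I. (f (x i) - v (x i))^2) + 2 * (\<Sum>i\<in>I. (y i - f (x i)) * (f (x i) - v (x i)))"
    by (simp add: sum.distrib sum_distrib_left)
  finally show ?thesis using o by (simp add: f_def)
qed

lemma fit_residual_le:
  assumes "generalised_inverse_rule ginv" "finite I" "spn K b v"
  shows "(\<Sum>i\<in>I. (y i - fit ginv K b I x y (x i))^2) \<le> (\<Sum>i\<in>I. (y i - v (x i))^2)"
  using fit_pythagoras[OF assms, where y = y and x = x] sum_nonneg[of I "%i. (fit ginv K b I x y (x i) - v (x i))^2"] by simp

lemma fit_diff_le:
  assumes "generalised_inverse_rule ginv" "finite I" "spn K b v"
  shows "(\<Sum>i\<in>I. (fit ginv K b I x y (x i) - v (x i))^2) \<le> (\<Sum>i\<in>I. (y i - v (x i))^2)"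
  using fit_pythagoras[OF assms, where y = y and x = x] sum_nonneg[of I "%i. (y i - fit ginv K b I x y (x i))^2"] by simp

lemma fit_contraction:
  assumes "generalised_inverse_rule ginv" "finite I"
  shows "(\<Sum>i\<in>I. (fit ginv K b I x y (x i))^2) \<le> (\<Sum>i\<in>I. (y i)^2)"
  using fit_diff_le[OF assms spn_zero, where y = y and K = K and b = b and x = x] by simp

lemma fit_add: "fit ginv K b I x (%i. y i + z i) w = fit ginv K b I x y w + fit ginv K b I x z w"
  by (simp add: fit_def distrib_left sum.distrib)

lemma fit_cmult: "fit ginv K b I x (%i. a * y i) w = a * fit ginv K b I x y w"
  unfolding fit_def sum_distrib_left by (intro sum.cong refl) (rule mult.left_commute)

lemma fit_sum: "fit ginv K b I x (%i. \<Sum>j\<in>J. y j i) w = (\<Sum>j\<in>J. fit ginv K b I x (y j) w)"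
  unfolding fit_def sum_distrib_left by (rule sum.swap)

lemma fit_cong: "(\<And>i. i \<in> I ==> x i = x' i) ==> (\<And>i. i \<in> I ==> y i = y' i) ==> fit ginv K b I x y w = fit ginv K b I x' y' w"
proof -
  assume x: "\<And>i. i \<in> I ==> x i = x' i" and y: "\<And>i. i \<in> I ==> y i = y' i"
  have "gram K b I x = gram K b I x'" unfolding gram_def by (rule eq_matI) (auto simp: x)
  then show ?thesis by (simp add: fit_def ols_kernel_def x y)
qed

text \<open>The entries of the Gram matrix are measurable in the sample, and the rule selects the
  generalised inverse measurably in these entries.\<close>

lemma measurable_fit:
  assumes g: "generalised_inverse_rule ginv" and b: "\<And>l. l < K ==> (%w. b w $ l) \<in> borel_measurable B"
    and x: "\<And>i. i \<in> I ==> (%D. x D i) \<in> measurable M B" and y: "\<And>i. i \<in> I ==> (%D. y D i) \<in> borel_measurable M"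
    and w: "w \<in> measurable M B"
  shows "(%D. fit ginv K b I (x D) (y D) (w D)) \<in> borel_measurable M"
proof -
  have bx: "(%D. b (x D i) $ l) \<in> borel_measurable M" if "i \<in> I" "l < K" for i l
    using measurable_compose[OF x[OF that(1)] b[OF that(2)]] .
  have bw: "(%D. b (w D) $ l) \<in> borel_measurable M" if "l < K" for l
    using measurable_compose[OF w b[OF that]] .
  have G: "(%D. ginv (gram K b I (x D)) $$ (l, m)) \<in> borel_measurable M" if "l < K" "m < K" for l m
  proof -
    define a where "a D = restrict (%p. \<Sum>i\<in>I. b (x D i) $ fst p * b (x D i) $ snd p) ({..<K} \<times> {..<K})" for D
    have "a \<in> measurable M (PiM ({..<K} \<times> {..<K}) (%_. borel))"
      unfolding a_def using bx by (intro measurable_restrict borel_measurable_sum borel_measurable_times) auto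
    moreover have "(%a. ginv (Matrix.mat K K a) $$ (l, m)) \<in> borel_measurable (PiM ({..<K} \<times> {..<K}) (%_. borel))"
      using g that unfolding generalised_inverse_rule_def by blast
    ultimately have "(%D. ginv (Matrix.mat K K (a D)) $$ (l, m)) \<in> borel_measurable M" by (rule measurable_compose)
    moreover have "Matrix.mat K K (a D) = gram K b I (x D)" for D
      unfolding gram_def by (rule eq_matI) (auto simp: a_def)
    ultimately show ?thesis by simp
  qed
  show ?thesis unfolding fit_def ols_kernel_def
    by (intro borel_measurable_sum borel_measurable_times y G bx bw) auto
qed

section \<open>Product measures\<close>

text \<open>The map \<open>r\<close> forgets the part of an observation on which the weights must not depend.\<close>

lemma noise_second_moment:
  fixes \<xi> :: "'o => real" and w :: "'i => ('i => 'o) => real"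
  assumes P: "prob_space P" and I: "finite I" "J \<subseteq> I" and \<xi> [measurable]: "\<xi> \<in> borel_measurable P"
    and w [measurable]: "\<And>i. i \<in> J ==> w i \<in> borel_measurable (PiM I (%_. P))"
    and r: "\<And>i j x a. i \<in> J ==> j \<in> J ==> x \<in> space (PiM (I - {j}) (%_. P)) ==> a \<in> space P ==> w i (x(j := a)) = w i (x(j := r a))"
    and N1: "\<And>k. k \<in> borel_measurable P ==> (\<integral>a. k (r a) * \<xi> a \<partial>P) = 0"
    and N2: "\<And>k. k \<in> borel_measurable P ==> (\<integral>\<^sup>+a. ennreal ((k (r a) * \<xi> a)^2) \<partial>P) \<le> ennreal C0 * (\<integral>\<^sup>+a. ennreal ((k (r a))^2) \<partial>P)"
    and C0: "C0 > 0"
  shows "(\<integral>\<^sup>+D. ennreal ((\<Sum>i\<in>J. w i D * \<xi> (D i))^2) \<partial>PiM I (%_. P)) \<le> ennreal C0 * (\<integral>\<^sup>+D. ennreal (\<Sum>i\<in>J. (w i D)^2) \<partial>PiM I (%_. P))"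
proof -
  interpret P: prob_space P by fact
  interpret product_sigma_finite "%_. P" by standard
  define M where "M = PiM I (%_. P)"
  define U where "U i D = w i D * \<xi> (D i)" for i D
  have J: "finite J" using I finite_subset by blast
  have [measurable]: "w i \<in> borel_measurable M" if "i \<in> J" for i using w that by (simp add: M_def)
  have [measurable]: "(%D. D i) \<in> measurable M P" if "i \<in> J" for i using that I by (auto simp: M_def intro!: measurable_component_singleton)
  have U [measurable]: "U i \<in> borel_measurable M" if "i \<in> J" for i
    using that unfolding U_def by measurable
  have insI: "insert i (I - {i}) = I" if "i \<in> J" for i using that I by auto
  have upd: "(%a. x(i := a)) \<in> measurable P M" if "i \<in> J" "x \<in> space (PiM (I - {i}) (%_. P))" for i x
  proof -
    have "(%a. x(i := a)) \<in> measurable P (PiM (insert i (I - {i})) (%_. P))"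
      using that(2) by (intro measurable_fun_upd[where J = "I - {i}"]) auto
    then show ?thesis using insI[OF that(1)] by (simp add: M_def)
  qed
  \<comment> \<open>The coordinate \<open>i\<close> is integrated first, with all others fixed:
    \<open>w i\<close> sees it through \<open>r\<close> only, so \<open>N2\<close> applies.\<close>
  have U2: "(\<integral>\<^sup>+D. ennreal ((U i D)^2) \<partial>M) \<le> ennreal C0 * (\<integral>\<^sup>+D. ennreal ((w i D)^2) \<partial>M)" if i: "i \<in> J" for i
  proof -
    have [measurable]: "U i \<in> borel_measurable M" "w i \<in> borel_measurable M" using U i by auto
    have "(\<integral>\<^sup>+D. ennreal ((U i D)^2) \<partial>M) = (\<integral>\<^sup>+x. (\<integral>\<^sup>+y. ennreal ((U i (x(i := y)))^2) \<partial>P) \<partial>PiM (I - {i}) (%_. P))"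
      using product_nn_integral_insert[of "I - {i}" i "%D. ennreal ((U i D)^2)"] I insI[OF i] by (simp add: M_def[symmetric])
    also have "... \<le> (\<integral>\<^sup>+x. ennreal C0 * (\<integral>\<^sup>+y. ennreal ((w i (x(i := y)))^2) \<partial>P) \<partial>PiM (I - {i}) (%_. P))"
    proof (rule nn_integral_mono)
      fix x assume x: "x \<in> space (PiM (I - {i}) (%_. P))"
      have m: "(%y. w i (x(i := y))) \<in> borel_measurable P" using measurable_compose[OF upd[OF i x], of "w i"] i by auto
      have e: "w i (x(i := r y)) = w i (x(i := y))" if "y \<in> space P" for y using r[OF i i x that] by simp
      have "(\<integral>\<^sup>+y. ennreal ((U i (x(i := y)))^2) \<partial>P) = (\<integral>\<^sup>+y. ennreal ((w i (x(i := r y)) * \<xi> y)^2) \<partial>P)"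
        by (intro nn_integral_cong) (simp add: U_def e)
      also have "... \<le> ennreal C0 * (\<integral>\<^sup>+y. ennreal ((w i (x(i := r y)))^2) \<partial>P)" by (rule N2[OF m])
      also have "(\<integral>\<^sup>+y. ennreal ((w i (x(i := r y)))^2) \<partial>P) = (\<integral>\<^sup>+y. ennreal ((w i (x(i := y)))^2) \<partial>P)"
        by (intro nn_integral_cong) (simp add: e)
      finally show "(\<integral>\<^sup>+y. ennreal ((U i (x(i := y)))^2) \<partial>P) \<le> ennreal C0 * (\<integral>\<^sup>+y. ennreal ((w i (x(i := y)))^2) \<partial>P)" .
    qed
    also have "... = ennreal C0 * (\<integral>\<^sup>+x. (\<integral>\<^sup>+y. ennreal ((w i (x(i := y)))^2) \<partial>P) \<partial>PiM (I - {i}) (%_. P))"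
    proof (rule nn_integral_cmult)
      have "(%(x, y). x(i := y)) \<in> measurable (PiM (I - {i}) (%_. P) \<Otimes>\<^sub>M P) M"
        using measurable_add_dim[of i "I - {i}" "%_. P"] insI[OF i] by (simp add: M_def)
      then have "(%(x, y). ennreal ((w i (x(i := y)))^2)) \<in> borel_measurable (PiM (I - {i}) (%_. P) \<Otimes>\<^sub>M P)"
        using measurable_compose[of _ _ M "%D. ennreal ((w i D)^2)" borel] by (simp add: case_prod_beta')
      then show "(%x. \<integral>\<^sup>+y. ennreal ((w i (x(i := y)))^2) \<partial>P) \<in> borel_measurable (PiM (I - {i}) (%_. P))"
        by (rule P.borel_measurable_nn_integral)
    qed
    also have "(\<integral>\<^sup>+x. (\<integral>\<^sup>+y. ennreal ((w i (x(i := y)))^2) \<partial>P) \<partial>PiM (I - {i}) (%_. P)) = (\<integral>\<^sup>+D. ennreal ((w i D)^2) \<partial>M)"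
      using product_nn_integral_insert[of "I - {i}" i "%D. ennreal ((w i D)^2)"] I insI[OF i] by (simp add: M_def[symmetric])
    finally show ?thesis .
  qed
  have sumw: "(\<integral>\<^sup>+D. ennreal (\<Sum>i\<in>J. (w i D)^2) \<partial>M) = (\<Sum>i\<in>J. \<integral>\<^sup>+D. ennreal ((w i D)^2) \<partial>M)"
  proof -
    have "(\<integral>\<^sup>+D. ennreal (\<Sum>i\<in>J. (w i D)^2) \<partial>M) = (\<integral>\<^sup>+D. (\<Sum>i\<in>J. ennreal ((w i D)^2)) \<partial>M)"
      by (intro nn_integral_cong) simp
    also have "... = (\<Sum>i\<in>J. \<integral>\<^sup>+D. ennreal ((w i D)^2) \<partial>M)" by (intro nn_integral_sum) auto
    finally show ?thesis .
  qed
  show ?thesis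
  \<comment> \<open>With an infinite right-hand side there is nothing to prove; otherwise all
    products are integrable and Fubini's theorem applies to them.\<close>
  proof (cases "(\<integral>\<^sup>+D. ennreal (\<Sum>i\<in>J. (w i D)^2) \<partial>M) = \<infinity>")
    case True
    then show ?thesis using C0 by (simp add: M_def[symmetric] ennreal_mult_top)
  next
    case False
    have fin: "(\<integral>\<^sup>+D. ennreal ((w i D)^2) \<partial>M) < \<infinity>" if "i \<in> J" for i
      using False sumw J that by (simp add: less_top)
    have iU: "integrable M (%D. (U i D)^2)" if i: "i \<in> J" for i
    proof (rule integrableI_bounded)
      show "(%D. (U i D)^2) \<in> borel_measurable M" using U[OF i] by measurable
      have "(\<integral>\<^sup>+D. ennreal (norm ((U i D)^2)) \<partial>M) \<le> ennreal C0 * (\<integral>\<^sup>+D. ennreal ((w i D)^2) \<partial>M)" using U2[OF i] by simp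
      also have "... < \<infinity>" using fin[OF i] by (simp add: ennreal_mult_less_top)
      finally show "(\<integral>\<^sup>+D. ennreal (norm ((U i D)^2)) \<partial>M) < \<infinity>" .
    qed
    have iUU: "integrable M (%D. U i D * U j D)" if "i \<in> J" "j \<in> J" for i j
    proof (rule Bochner_Integration.integrable_bound)
      show "integrable M (%D. (U i D)^2 + (U j D)^2)" using iU that by auto
      show "(%D. U i D * U j D) \<in> borel_measurable M" using U that by (intro borel_measurable_times) auto
      have "\<bar>a * b\<bar> \<le> a\<^sup>2 + b\<^sup>2" for a b :: real
      proof -
        have "2 * (\<bar>a\<bar> * \<bar>b\<bar>) \<le> a\<^sup>2 + b\<^sup>2" using sum_squares_bound[of "\<bar>a\<bar>" "\<bar>b\<bar>"] by simp
        moreover have "0 \<le> \<bar>a\<bar> * \<bar>b\<bar>" by simp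
        ultimately show ?thesis unfolding abs_mult by linarith
      qed
      then show "AE D in M. norm (U i D * U j D) \<le> norm ((U i D)^2 + (U j D)^2)" by simp
    qed
    have zero: "(\<integral>D. U i D * U j D \<partial>M) = 0" if i: "i \<in> J" and j: "j \<in> J" and ij: "i \<noteq> j" for i j
    proof -
      have "(\<integral>D. U i D * U j D \<partial>M) = (\<integral>x. (\<integral>y. U i (x(i := y)) * U j (x(i := y)) \<partial>P) \<partial>PiM (I - {i}) (%_. P))"
        using product_integral_insert[of "I - {i}" i "%D. U i D * U j D"] I insI[OF i] iUU[OF i j] by (simp add: M_def[symmetric])
      also have "... = (\<integral>x. 0 \<partial>PiM (I - {i}) (%_. P))"
      proof (rule Bochner_Integration.integral_cong[OF refl])
        fix x assume x: "x \<in> space (PiM (I - {i}) (%_. P))"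
        \<comment> \<open>For \<open>i \<noteq> j\<close> the other noise \<open>\<xi> (x j)\<close>
          does not involve the coordinate \<open>i\<close>. All factors besides
          \<open>\<xi> y\<close> then depend on \<open>r y\<close> alone, and \<open>N1\<close>
          kills the cross term.\<close>
        define k where "k y = w i (x(i := y)) * w j (x(i := y)) * \<xi> (x j)" for y
        have m: "(%y. w l (x(i := y))) \<in> borel_measurable P" if "l \<in> J" for l using measurable_compose[OF upd[OF i x], of "w l"] that by auto
        have k: "k \<in> borel_measurable P" unfolding k_def using m[OF i] m[OF j] by measurable
        have "(\<integral>y. U i (x(i := y)) * U j (x(i := y)) \<partial>P) = (\<integral>y. k (r y) * \<xi> y \<partial>P)"
          using ij r[OF i i x] r[OF j i x] by (intro Bochner_Integration.integral_cong) (auto simp: U_def k_def)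
        also have "... = 0" by (rule N1[OF k])
        finally show "(\<integral>y. U i (x(i := y)) * U j (x(i := y)) \<partial>P) = 0" .
      qed
      finally show ?thesis by simp
    qed
    have sq: "(\<Sum>i\<in>J. U i D)^2 = (\<Sum>i\<in>J. \<Sum>j\<in>J. U i D * U j D)" for D
      by (simp add: power2_eq_square sum_product)
    have int: "integrable M (%D. (\<Sum>i\<in>J. U i D)^2)" unfolding sq using iUU by auto
    have "(\<integral>D. (\<Sum>i\<in>J. U i D)^2 \<partial>M) = (\<Sum>i\<in>J. \<Sum>j\<in>J. \<integral>D. U i D * U j D \<partial>M)"
      unfolding sq using iUU by (subst Bochner_Integration.integral_sum, auto intro!: sum.cong Bochner_Integration.integral_sum)
    also have "... = (\<Sum>i\<in>J. \<Sum>j\<in>J. if j = i then (\<integral>D. (U i D)^2 \<partial>M) else 0)"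
      using zero by (intro sum.cong refl) (auto simp: power2_eq_square)
    also have "... = (\<Sum>i\<in>J. \<integral>D. (U i D)^2 \<partial>M)" using J by simp
    finally have main: "(\<integral>D. (\<Sum>i\<in>J. U i D)^2 \<partial>M) = (\<Sum>i\<in>J. \<integral>D. (U i D)^2 \<partial>M)" .
    have "(\<integral>\<^sup>+D. ennreal ((\<Sum>i\<in>J. U i D)^2) \<partial>M) = ennreal (\<integral>D. (\<Sum>i\<in>J. U i D)^2 \<partial>M)"
      by (rule nn_integral_eq_integral[OF int]) simp
    also have "... = (\<Sum>i\<in>J. ennreal (\<integral>D. (U i D)^2 \<partial>M))" unfolding main by (simp add: sum_ennreal)
    also have "... = (\<Sum>i\<in>J. \<integral>\<^sup>+D. ennreal ((U i D)^2) \<partial>M)"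
      using iU by (intro sum.cong nn_integral_eq_integral[symmetric] refl) auto
    also have "... \<le> (\<Sum>i\<in>J. ennreal C0 * (\<integral>\<^sup>+D. ennreal ((w i D)^2) \<partial>M))" using U2 by (rule sum_mono)
    also have "... = ennreal C0 * (\<integral>\<^sup>+D. ennreal (\<Sum>i\<in>J. (w i D)^2) \<partial>M)" unfolding sumw by (simp add: sum_distrib_left)
    finally show ?thesis by (simp add: U_def M_def)
  qed
qed

lemma nn_integral_PiM_prod_sub:
  assumes P: "prob_space P" and I: "finite I" "J \<subseteq> I" and g: "g \<in> borel_measurable P"
  shows "(\<integral>\<^sup>+D. (\<Prod>i\<in>J. g (D i)) \<partial>PiM I (%_. P)) = (\<integral>\<^sup>+a. g a \<partial>P) ^ card J"
proof -
  interpret P: prob_space P by fact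
  interpret product_sigma_finite "%_. P" by standard
  have "(\<integral>\<^sup>+D. (\<Prod>i\<in>J. g (D i)) \<partial>PiM I (%_. P)) = (\<integral>\<^sup>+D. (\<Prod>i\<in>I. (if i \<in> J then g else (%_. 1)) (D i)) \<partial>PiM I (%_. P))"
    using I by (intro nn_integral_cong prod.mono_neutral_cong_left) auto
  also have "... = (\<Prod>i\<in>I. \<integral>\<^sup>+a. (if i \<in> J then g else (%_. 1)) a \<partial>P)"
    using g by (intro product_nn_integral_prod I) auto
  also have "... = (\<Prod>i\<in>J. \<integral>\<^sup>+a. g a \<partial>P)"
    using I by (intro prod.mono_neutral_cong_right) (auto simp: P.emeasure_space_1)
  finally show ?thesis by simp
qed

text \<open>The exponential Markov inequality, with
  \<open>1 + p (exp t - 1) \<le> exp (p (exp t - 1))\<close> for each indicator. The factor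
  \<open>t\<close> on both sides of the event covers both tails: negative \<open>t\<close> gives the
  lower one.\<close>

lemma count_exponential_bound:
  fixes t x :: real
  assumes P: "prob_space P" and I: "finite I" "J \<subseteq> I" and E: "E \<in> sets P"
  shows "measure (PiM I (%_. P)) {D\<in>space (PiM I (%_. P)). t * x \<le> t * (\<Sum>i\<in>J. indicator E (D i))}
    \<le> exp (real (card J) * measure P E * (exp t - 1) - t * x)"
proof -
  interpret P: prob_space P by fact
  define M where "M = PiM I (%_. P)"
  interpret M: prob_space M unfolding M_def by (intro prob_space_PiM P)
  define p where "p = measure P E"
  define c where "c D = (\<Sum>i\<in>J. indicator E (D i) :: real)" for D
  have cs: "(%D. D i) \<in> measurable M P" if "i \<in> J" for i using that I by (auto simp: M_def intro!: measurable_component_singleton)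
  have c[measurable]: "c \<in> borel_measurable M" unfolding c_def
    by (intro borel_measurable_sum measurable_compose[OF cs borel_measurable_indicator[OF E]])
  have ge: "(\<integral>\<^sup>+a. ennreal (exp (t * indicator E a)) \<partial>P) \<le> ennreal (exp (p * (exp t - 1)))"
  proof -
    have e: "exp (t * indicator E a) = 1 + (exp t - 1) * indicator E a" for a by (simp add: indicator_def)
    have iE: "integrable P (indicat_real E)" using E by (intro P.integrable_const_bound[where B = 1]) auto
    have int: "integrable P (%a. 1 + (exp t - 1) * indicator E a)" using E by (intro Bochner_Integration.integrable_add integrable_mult_right P.integrable_const_bound[where B = 1]) auto
    have nn: "0 \<le> 1 + (exp t - 1) * (indicator E a :: real)" for a unfolding e[symmetric] by simp
    have "(\<integral>\<^sup>+a. ennreal (exp (t * indicator E a)) \<partial>P) = ennreal (\<integral>a. 1 + (exp t - 1) * indicator E a \<partial>P)"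
      unfolding e using nn by (intro nn_integral_eq_integral[OF int]) auto
    also have "(\<integral>a. 1 + (exp t - 1) * indicator E a \<partial>P) = 1 + (exp t - 1) * p"
      using E iE by (subst Bochner_Integration.integral_add) (auto simp: p_def P.prob_space)
    also have "... \<le> exp (p * (exp t - 1))" using exp_ge_add_one_self[of "p * (exp t - 1)"] by (simp add: mult.commute)
    finally show ?thesis by (simp add: ennreal_leI)
  qed
  have "(\<integral>\<^sup>+D. ennreal (exp (t * c D)) \<partial>M) = (\<integral>\<^sup>+D. (\<Prod>i\<in>J. ennreal (exp (t * indicator E (D i)))) \<partial>M)"
    by (intro nn_integral_cong) (simp only: c_def sum_distrib_left exp_sum[OF finite_subset[OF I(2,1)]] prod_ennreal exp_ge_zero)
  also have "... = (\<integral>\<^sup>+a. ennreal (exp (t * indicator E a)) \<partial>P) ^ card J"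
    unfolding M_def
  proof (intro nn_integral_PiM_prod_sub P I)
    note [measurable] = E
    show "(%a. ennreal (exp (t * indicator E a))) \<in> borel_measurable P" by measurable
  qed
  also have "... \<le> ennreal (exp (p * (exp t - 1))) ^ card J" using ge by (rule power_mono) simp
  also have "... = ennreal (exp (real (card J) * p * (exp t - 1)))" by (simp add: ennreal_power exp_of_nat_mult[symmetric] mult.assoc)
  finally have mgf: "(\<integral>\<^sup>+D. ennreal (exp (t * c D)) \<partial>M) \<le> ennreal (exp (real (card J) * p * (exp t - 1)))" .
  have "emeasure M {D\<in>space M. t * x \<le> t * c D} = (\<integral>\<^sup>+D. indicator {D\<in>space M. t * x \<le> t * c D} D \<partial>M)"
    by (subst nn_integral_indicator) auto
  also have "... \<le> (\<integral>\<^sup>+D. ennreal (exp (- t * x)) * ennreal (exp (t * c D)) \<partial>M)"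
    by (intro nn_integral_mono) (auto simp: indicator_def ennreal_mult[symmetric] exp_add[symmetric])
  also have "... = ennreal (exp (- t * x)) * (\<integral>\<^sup>+D. ennreal (exp (t * c D)) \<partial>M)" by (intro nn_integral_cmult) measurable
  also have "... \<le> ennreal (exp (- t * x)) * ennreal (exp (real (card J) * p * (exp t - 1)))" using mgf by (intro mult_left_mono) auto
  also have "... = ennreal (exp (real (card J) * p * (exp t - 1) - t * x))" by (simp add: ennreal_mult[symmetric] exp_add[symmetric] algebra_simps)
  finally show ?thesis unfolding M_def[symmetric] c_def[symmetric] p_def[symmetric] M.emeasure_eq_measure by (simp add: ennreal_le_iff)
qed

lemma count_lower_tail:
  assumes P: "prob_space P" and I: "finite I" "J \<subseteq> I" and E: "E \<in> sets P"
  shows "measure (PiM I (%_. P)) {D\<in>space (PiM I (%_. P)). (\<Sum>i\<in>J. indicator E (D i)) \<le> real (card J) * measure P E / 2}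
    \<le> exp (- (real (card J) * measure P E) / 10)"
proof -
  define q where "q = real (card J) * measure P E"
  have "5/2 \<le> exp (1::real)" using exp_lower_Taylor_quadratic[of "1::real"] by simp
  then have "exp (-1) \<le> (2/5::real)" by (simp add: exp_minus field_simps)
  moreover have "0 \<le> q" by (simp add: q_def)
  \<comment> \<open>\<open>2/5 - 1 + 1/2 = - 1/10\<close>: the origin of the rate 1/10.\<close>
  ultimately have "q * (exp (-1) - 1) + q / 2 \<le> q * (2/5 - 1) + q / 2" by (intro add_right_mono mult_left_mono) auto
  then have "q * (exp (-1) - 1) - (-1) * (q / 2) \<le> - q / 10" by simp
  then show ?thesis using count_exponential_bound[OF P I E, of "-1" "q / 2"] unfolding q_def[symmetric]
    by simp (metis (no_types, lifting) exp_le_cancel_iff order_trans)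
qed

text \<open>Here \<open>t = 1\<close> and \<open>exp 1 \<le> 3\<close> give the exponent
  \<open>- q\<close>; it is weakened to the rate of the lower tail, so that one bound serves
  both.\<close>

lemma count_upper_tail:
  assumes P: "prob_space P" and I: "finite I" "J \<subseteq> I" and E: "E \<in> sets P"
  shows "measure (PiM I (%_. P)) {D\<in>space (PiM I (%_. P)). 3 * (real (card J) * measure P E) \<le> (\<Sum>i\<in>J. indicator E (D i))}
    \<le> exp (- (real (card J) * measure P E) / 10)"
proof -
  define q where "q = real (card J) * measure P E"
  have "0 \<le> q" by (simp add: q_def)
  then have "q * (exp 1 - 1) - 3 * q \<le> q * (3 - 1) - 3 * q" using exp_le by (intro diff_right_mono mult_left_mono) auto
  then have "q * (exp 1 - 1) - 1 * (3 * q) \<le> - q / 10" using \<open>0 \<le> q\<close> by simp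
  then show ?thesis using count_exponential_bound[OF P I E, of 1 "3 * q"] unfolding q_def[symmetric]
    by simp (metis (no_types, lifting) exp_le_cancel_iff order_trans)
qed

text \<open>Three ways to fail: Chebyshev's inequality bounds the deviation of the sum from its
  mean, Markov's inequality the sum of squares, and by independence all summands are positive with
  probability at most \<open>(1 - \<eta>) ^ card J\<close>. The last event matters because it is the
  one in which the empirical variance might vanish.\<close>

lemma sample_mean_bounds:
  fixes l :: "'o => real" and J :: "'i set"
  assumes P: "prob_space P" and J: "finite J" "J \<noteq> {}" and l [measurable]: "l \<in> borel_measurable P"
    and Q: "(\<integral>\<^sup>+a. ennreal ((l a)^2) \<partial>P) \<le> ennreal Q" "0 < Q" and \<mu>: "(\<integral>a. l a \<partial>P) = \<mu>" "0 < \<mu>"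
    and \<eta>: "\<eta> \<le> measure P {a\<in>space P. l a \<le> 0}" and A: "0 < A"
  shows "emeasure (PiM J (%_. P)) {D\<in>space (PiM J (%_. P)).
      \<not> (real (card J) * \<mu> / 2 \<le> (\<Sum>i\<in>J. l (D i)) \<and> (\<Sum>i\<in>J. (l (D i))^2) \<le> real (card J) * (A * Q) \<and> (\<exists>i\<in>J. l (D i) \<le> 0))}
    \<le> ennreal (4 * Q / (real (card J) * \<mu>\<^sup>2) + 1 / A + (1 - \<eta>) ^ card J)"
proof -
  interpret P: prob_space P by fact
  define M where "M = PiM J (%_. P)"
  interpret M: prob_space M unfolding M_def by (intro prob_space_PiM P)
  define n where "n = real (card J)"
  have n: "0 < n" using J by (simp add: n_def card_gt_0_iff)
  have [measurable]: "(%D. D i) \<in> measurable M P" if "i \<in> J" for i using that by (auto simp: M_def intro!: measurable_component_singleton)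
  have l2: "integrable P (%a. (l a)^2)"
    using Q by (intro integrableI_bounded) (auto intro: order_le_less_trans)
  have l1: "integrable P l" by (rule P.square_integrable_imp_integrable[OF l l2])
  define B1 where "B1 = {D\<in>space M. (n * \<mu> / 2)^2 \<le> (\<Sum>i\<in>J. l (D i) - \<mu>)^2}"
  define B2 where "B2 = {D\<in>space M. n * (A * Q) \<le> (\<Sum>i\<in>J. (l (D i))^2)}"
  define B3 where "B3 = {D\<in>space M. \<forall>i\<in>J. 0 < l (D i)}"
  have mB [measurable]: "B1 \<in> sets M" "B2 \<in> sets M" "B3 \<in> sets M"
    unfolding B1_def B2_def B3_def using J by measurable
  have var: "(\<integral>\<^sup>+D. ennreal ((\<Sum>i\<in>J. 1 * (l (D i) - \<mu>))^2) \<partial>M) \<le> ennreal Q * (\<integral>\<^sup>+D. ennreal (\<Sum>i\<in>J. 1\<^sup>2) \<partial>M)"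
    unfolding M_def
  \<comment> \<open>Unit weights depend on nothing, so \<open>r\<close> may be constant; the lemma
    then reduces to the variance of a sum of independent centred terms.\<close>
  proof (rule noise_second_moment[where r = "%_. undefined" and \<xi> = "%a. l a - \<mu>" and w = "%_ _. 1"])
    fix k :: "'o => real"
    show "(\<integral>a. k undefined * (l a - \<mu>) \<partial>P) = 0" using l1 \<mu> by (simp add: P.prob_space)
    have "(\<integral>\<^sup>+a. ennreal ((l a - \<mu>)^2) \<partial>P) = ennreal (\<integral>a. (l a - \<mu>)^2 \<partial>P)"
    proof (rule nn_integral_eq_integral)
      show "integrable P (%a. (l a - \<mu>)^2)" using l1 l2 by (simp add: power2_diff)
    qed simp
    also have "(\<integral>a. (l a - \<mu>)^2 \<partial>P) = (\<integral>a. (l a)^2 \<partial>P) - \<mu>\<^sup>2"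
      using P.variance_eq[OF l1 l2] \<mu> by simp
    also have "... \<le> (\<integral>a. (l a)^2 \<partial>P)" by simp
    also have "ennreal ... = (\<integral>\<^sup>+a. ennreal ((l a)^2) \<partial>P)" using l2 by (intro nn_integral_eq_integral[symmetric]) auto
    finally have v: "(\<integral>\<^sup>+a. ennreal ((l a - \<mu>)^2) \<partial>P) \<le> ennreal Q" using Q by (auto intro: ennreal_leI order_trans)
    have "(\<integral>\<^sup>+a. ennreal ((k undefined * (l a - \<mu>))^2) \<partial>P) = ennreal ((k undefined)^2) * (\<integral>\<^sup>+a. ennreal ((l a - \<mu>)^2) \<partial>P)"
      by (simp add: power_mult_distrib ennreal_mult nn_integral_cmult)
    also have "... \<le> ennreal ((k undefined)^2) * ennreal Q" using v by (intro mult_left_mono) auto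
    finally show "(\<integral>\<^sup>+a. ennreal ((k undefined * (l a - \<mu>))^2) \<partial>P) \<le> ennreal Q * (\<integral>\<^sup>+a. ennreal ((k undefined)^2) \<partial>P)"
      by (simp add: P.emeasure_space_1 mult.commute)
  qed (use P J Q in auto)
  have cheb: "emeasure M {D\<in>space M. a \<le> f D} \<le> ennreal (b / a)"
    if f: "f \<in> borel_measurable M" "\<And>D. 0 \<le> f D" "(\<integral>\<^sup>+D. ennreal (f D) \<partial>M) \<le> ennreal b" and a: "0 < a" "0 \<le> b" for f a b
  proof -
    have [measurable]: "f \<in> borel_measurable M" by fact
    have "emeasure M {D\<in>space M. a \<le> f D} = (\<integral>\<^sup>+D. indicator {D\<in>space M. a \<le> f D} D \<partial>M)" by simp
    also have "... \<le> (\<integral>\<^sup>+D. ennreal (1 / a) * ennreal (f D) \<partial>M)"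
      using a f(2) by (intro nn_integral_mono) (auto simp: indicator_def ennreal_mult[symmetric] intro!: ennreal_ge_1[THEN iffD2])
    also have "... = ennreal (1 / a) * (\<integral>\<^sup>+D. ennreal (f D) \<partial>M)" by (intro nn_integral_cmult) auto
    also have "... \<le> ennreal (1 / a) * ennreal b" using f(3) by (intro mult_left_mono) auto
    finally show ?thesis using a by (simp add: ennreal_mult[symmetric])
  qed
  have e1: "emeasure M B1 \<le> ennreal (4 * Q / (n * \<mu>\<^sup>2))"
  proof -
    have "emeasure M B1 \<le> ennreal (Q * n / (n * \<mu> / 2)^2)" unfolding B1_def
    proof (rule cheb)
      show "(\<integral>\<^sup>+D. ennreal ((\<Sum>i\<in>J. l (D i) - \<mu>)^2) \<partial>M) \<le> ennreal (Q * n)"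
        using var Q n by (simp add: n_def ennreal_mult M.emeasure_space_1 flip: ennreal_of_nat_eq_real_of_nat)
    qed (use n \<mu> Q in auto)
    also have "Q * n / (n * \<mu> / 2)^2 = 4 * Q / (n * \<mu>\<^sup>2)" using n \<mu> by (simp add: power2_eq_square field_simps)
    finally show ?thesis .
  qed
  have e2: "emeasure M B2 \<le> ennreal (1 / A)"
  proof -
    have "emeasure M B2 \<le> ennreal (n * Q / (n * (A * Q)))" unfolding B2_def
    proof (rule cheb)
      have "(\<integral>\<^sup>+D. ennreal (\<Sum>i\<in>J. (l (D i))^2) \<partial>M) = (\<Sum>i\<in>J. \<integral>\<^sup>+D. ennreal ((l (D i))^2) \<partial>M)"
        by (subst nn_integral_sum[symmetric]) (auto simp: sum_ennreal)
      also have "... = (\<Sum>i\<in>J. \<integral>\<^sup>+a. ennreal ((l a)^2) \<partial>P)"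
      proof (intro sum.cong refl)
        fix i assume i: "i \<in> J"
        then show "(\<integral>\<^sup>+D. ennreal ((l (D i))^2) \<partial>M) = (\<integral>\<^sup>+a. ennreal ((l a)^2) \<partial>P)"
          using nn_integral_PiM_prod_sub[OF P J(1), of "{i}" "%a. ennreal ((l a)^2)"] by (simp add: M_def)
      qed
      also have "... \<le> (\<Sum>i\<in>J. ennreal Q)" using Q by (intro sum_mono) auto
      also have "... = ennreal (n * Q)" using Q by (simp add: n_def ennreal_mult ennreal_of_nat_eq_real_of_nat)
      finally show "(\<integral>\<^sup>+D. ennreal (\<Sum>i\<in>J. (l (D i))^2) \<partial>M) \<le> ennreal (n * Q)" .
    qed (use n A Q in \<open>auto simp: sum_nonneg\<close>)
    then show ?thesis using n Q by simp
  qed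
  have e3: "emeasure M B3 \<le> ennreal ((1 - \<eta>) ^ card J)"
  proof -
    have "emeasure M B3 = (\<integral>\<^sup>+D. indicator B3 D \<partial>M)" by simp
    also have "... = (\<integral>\<^sup>+D. (\<Prod>i\<in>J. indicator {a\<in>space P. 0 < l a} (D i)) \<partial>M)"
    proof (intro nn_integral_cong)
      fix D assume w: "D \<in> space M"
      then have s: "D i \<in> space P" if "i \<in> J" for i using that by (auto simp: M_def space_PiM)
      show "indicator B3 D = (\<Prod>i\<in>J. indicator {a\<in>space P. 0 < l a} (D i) :: ennreal)"
      proof (cases "D \<in> B3")
        case True then show ?thesis using s by (auto simp: B3_def)
      next
        case False
        then obtain i where "i \<in> J" "\<not> 0 < l (D i)" using w by (auto simp: B3_def)
        then have "(\<Prod>i\<in>J. indicator {a\<in>space P. 0 < l a} (D i) :: ennreal) = 0" by (intro prod_zero[OF J(1)] bexI[of _ i]) auto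
        then show ?thesis using False by simp
      qed
    qed
    also have "... = (\<integral>\<^sup>+a. indicator {a\<in>space P. 0 < l a} a \<partial>P) ^ card J"
      unfolding M_def by (intro nn_integral_PiM_prod_sub P J) auto
    also have "(\<integral>\<^sup>+a. indicator {a\<in>space P. 0 < l a} a \<partial>P) = ennreal (measure P {a\<in>space P. 0 < l a})"
      by (simp add: P.emeasure_eq_measure)
    also have "measure P {a\<in>space P. 0 < l a} = 1 - measure P {a\<in>space P. l a \<le> 0}"
      using P.prob_compl[of "{a\<in>space P. l a \<le> 0}"] by (simp add: set_diff_eq not_le cong: conj_cong)
    also have "ennreal (1 - measure P {a\<in>space P. l a \<le> 0}) ^ card J \<le> ennreal (1 - \<eta>) ^ card J"
      using \<eta> by (intro power_mono ennreal_leI) auto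
    also have "... = ennreal ((1 - \<eta>) ^ card J)"
      using order_trans[OF \<eta> P.prob_le_1] by (simp add: ennreal_power)
    finally show ?thesis .
  qed
  have "{D\<in>space M. \<not> (n * \<mu> / 2 \<le> (\<Sum>i\<in>J. l (D i)) \<and> (\<Sum>i\<in>J. (l (D i))^2) \<le> n * (A * Q) \<and> (\<exists>i\<in>J. l (D i) \<le> 0))} \<subseteq> B1 \<union> (B2 \<union> B3)"
  proof
    fix D assume w: "D \<in> {D\<in>space M. \<not> (n * \<mu> / 2 \<le> (\<Sum>i\<in>J. l (D i)) \<and> (\<Sum>i\<in>J. (l (D i))^2) \<le> n * (A * Q) \<and> (\<exists>i\<in>J. l (D i) \<le> 0))}"
    have "D \<in> B1" if "(\<Sum>i\<in>J. l (D i)) < n * \<mu> / 2"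
    proof -
      have "(\<Sum>i\<in>J. l (D i) - \<mu>) = (\<Sum>i\<in>J. l (D i)) - n * \<mu>" by (simp add: sum_subtractf n_def)
      then have "n * \<mu> / 2 \<le> - (\<Sum>i\<in>J. l (D i) - \<mu>)" using that by linarith
      then have "(n * \<mu> / 2)^2 \<le> (- (\<Sum>i\<in>J. l (D i) - \<mu>))^2" using n \<mu> by (intro power_mono) auto
      then show ?thesis using w by (simp add: B1_def)
    qed
    then show "D \<in> B1 \<union> (B2 \<union> B3)" using w by (auto simp: B2_def B3_def not_le)
  qed
  then have "emeasure M {D\<in>space M. \<not> (n * \<mu> / 2 \<le> (\<Sum>i\<in>J. l (D i)) \<and> (\<Sum>i\<in>J. (l (D i))^2) \<le> n * (A * Q) \<and> (\<exists>i\<in>J. l (D i) \<le> 0))}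
      \<le> emeasure M (B1 \<union> (B2 \<union> B3))" by (intro emeasure_mono) auto
  also have "... \<le> emeasure M B1 + (emeasure M B2 + emeasure M B3)"
    by (intro order_trans[OF emeasure_subadditive] add_left_mono emeasure_subadditive) auto
  also have "... \<le> ennreal (4 * Q / (n * \<mu>\<^sup>2)) + (ennreal (1 / A) + ennreal ((1 - \<eta>) ^ card J))"
    by (intro add_mono e1 e2 e3)
  also have "... = ennreal (4 * Q / (n * \<mu>\<^sup>2) + 1 / A + (1 - \<eta>) ^ card J)"
    using Q n A order_trans[OF \<eta> P.prob_le_1] by (simp add: ennreal_plus[symmetric] add.assoc del: ennreal_plus)
  finally show ?thesis by (simp add: M_def n_def)
qed

section \<open>The regression model\<close>

lemma obs_measurable [measurable]:
  "obs_Y \<in> borel_measurable borel" "obs_Z \<in> borel_measurable borel" "obs_XZ \<in> borel_measurable borel"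
  unfolding obs_Y_def obs_Z_def obs_XZ_def case_prod_beta
  by (auto intro!: borel_measurable_continuous_onI continuous_intros)

lemma cond_mean_noise:
  fixes V :: "'w => 'v::topological_space"
  assumes P: "prob_space P" and V: "V \<in> measurable P borel" and h: "cond_mean_version P Y V h" and k: "k \<in> borel_measurable borel"
  shows "(\<integral>a. k (V a) * (Y a - h (V a)) \<partial>P) = 0" "integrable P (%a. h (V a))"
proof -
  interpret P: prob_space P by fact
  define F where "F = sigma_of P V"
  have sp: "V \<in> space P \<rightarrow> space borel" using measurable_space[OF V] by auto
  have VF: "V \<in> measurable F borel" unfolding F_def by (rule measurable_vimage_algebra1[OF sp])
  have sub: "subalgebra P F" unfolding subalgebra_def F_def sets_vimage_algebra2[OF sp] using measurable_sets[OF V] by auto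
  interpret finite_measure_subalgebra P F by standard (rule sub)
  have Y: "integrable P Y" and hm: "h \<in> borel_measurable borel" and ae: "AE w in P. h (V w) = real_cond_exp P F Y w"
    using h by (auto simp: cond_mean_version_def F_def)
  have hF: "(%a. h (V a)) \<in> borel_measurable F" by (rule measurable_compose[OF VF hm])
  have hP: "(%a. h (V a)) \<in> borel_measurable P" by (rule measurable_compose[OF V hm])
  show ih: "integrable P (%a. h (V a))"
    by (rule integrable_cong_AE_imp[OF real_cond_exp_int(1)[OF Y] hP]) (use ae in auto)
  have z: "AE a in P. real_cond_exp P F (%a. Y a - h (V a)) a = 0"
    using real_cond_exp_diff[OF Y ih] real_cond_exp_F_meas[OF ih hF] ae by eventually_elim simp
  show "(\<integral>a. k (V a) * (Y a - h (V a)) \<partial>P) = 0"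
  proof (cases "integrable P (%a. k (V a) * (Y a - h (V a)))")
    case True
    have "(\<integral>a. k (V a) * (Y a - h (V a)) \<partial>P) = (\<integral>a. k (V a) * real_cond_exp P F (%a. Y a - h (V a)) a \<partial>P)"
      using Y hP by (intro real_cond_exp_intg(2)[symmetric] True measurable_compose[OF VF k]) auto
    also have "... = (\<integral>a. 0 \<partial>P)"
      by (rule integral_cong_AE) (use z measurable_compose[OF V k] in \<open>auto elim!: eventually_mono\<close>)
    finally show ?thesis by simp
  next
    \<comment> \<open>The integral of a function that is not integrable is 0 by convention; hence
      the identity holds for every measurable \<open>k\<close>.\<close>
    case False then show ?thesis by (rule not_integrable_integral_eq)
  qed
qed

text \<open>The weight \<open>k (V a)\<close> is measurable with respect to \<open>V\<close>, so
  \<open>e\<close> may be replaced by its conditional expectation under the integral. Working with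
  nonnegative integrals avoids integrability conditions on \<open>k\<close>.\<close>

lemma nn_cond_exp_bounds:
  fixes V :: "'w => 'v::topological_space" and k :: "'v => ennreal"
  assumes P: "prob_space P" and V: "V \<in> measurable P borel" and e: "e \<in> borel_measurable P" and k: "k \<in> borel_measurable borel"
  shows "AE w in P. b \<le> nn_cond_exp P (sigma_of P V) e w ==> b * (\<integral>\<^sup>+a. k (V a) \<partial>P) \<le> (\<integral>\<^sup>+a. k (V a) * e a \<partial>P)"
    and "AE w in P. nn_cond_exp P (sigma_of P V) e w \<le> b ==> (\<integral>\<^sup>+a. k (V a) * e a \<partial>P) \<le> b * (\<integral>\<^sup>+a. k (V a) \<partial>P)"
proof -
  interpret P: prob_space P by fact
  define F where "F = sigma_of P V"
  have sp: "V \<in> space P \<rightarrow> space borel" using measurable_space[OF V] by auto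
  have VF: "V \<in> measurable F borel" unfolding F_def by (rule measurable_vimage_algebra1[OF sp])
  have sub: "subalgebra P F" unfolding subalgebra_def F_def sets_vimage_algebra2[OF sp] using measurable_sets[OF V] by auto
  interpret finite_measure_subalgebra P F by standard (rule sub)
  have kP: "(%a. k (V a)) \<in> borel_measurable P" by (rule measurable_compose[OF V k])
  have eq: "(\<integral>\<^sup>+a. k (V a) * nn_cond_exp P F e a \<partial>P) = (\<integral>\<^sup>+a. k (V a) * e a \<partial>P)"
    by (rule nn_cond_exp_intg[OF measurable_compose[OF VF k] e])
  have cm: "(\<integral>\<^sup>+a. b * k (V a) \<partial>P) = b * (\<integral>\<^sup>+a. k (V a) \<partial>P)" by (rule nn_integral_cmult[OF kP])
  show "b * (\<integral>\<^sup>+a. k (V a) \<partial>P) \<le> (\<integral>\<^sup>+a. k (V a) * e a \<partial>P)" if "AE w in P. b \<le> nn_cond_exp P (sigma_of P V) e w"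
    unfolding eq[symmetric] cm[symmetric]
  proof (rule nn_integral_mono_AE)
    show "AE a in P. b * k (V a) \<le> k (V a) * nn_cond_exp P F e a"
      using that unfolding F_def
    proof eventually_elim
      case (elim a)
      then have "k (V a) * b \<le> k (V a) * nn_cond_exp P (sigma_of P V) e a" by (rule mult_left_mono) simp
      then show ?case by (simp only: mult.commute)
    qed
  qed
  show "(\<integral>\<^sup>+a. k (V a) * e a \<partial>P) \<le> b * (\<integral>\<^sup>+a. k (V a) \<partial>P)" if "AE w in P. nn_cond_exp P (sigma_of P V) e w \<le> b"
    unfolding eq[symmetric] cm[symmetric]
  proof (rule nn_integral_mono_AE)
    show "AE a in P. k (V a) * nn_cond_exp P F e a \<le> b * k (V a)"
      using that unfolding F_def
    proof eventually_elim
      case (elim a)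
      then have "k (V a) * nn_cond_exp P (sigma_of P V) e a \<le> k (V a) * b" by (rule mult_left_mono) simp
      then show ?case by (simp only: mult.commute)
    qed
  qed
qed

text \<open>The conditions on one distribution, with versions of the regression functions and of the
  density fixed. Quantitative bounds that follow are to depend on the constants only, so that they
  are uniform over the class.\<close>

locale regression_model =
  fixes P :: "('dx::{finite,linorder}, 'dz::{finite,linorder}) obs measure"
    and g :: "('dx::{finite,linorder}, 'dz::{finite,linorder}) cov => real"
    and m :: "real ^ 'dz::{finite,linorder} => real"
    and p :: "('dx, 'dz) cov => real"
    and r :: nat and s C c \<delta> :: real
  assumes s: "1 < s" "s \<le> real r" and constants: "1 \<le> C" "0 < c" "0 < \<delta>"
    and prob: "prob_space P" and sets_P: "sets P = sets borel"
    and g_version: "cond_mean_version P obs_Y obs_XZ g"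
    and m_version: "cond_mean_version P obs_Y obs_Z m"
    and p_version: "joint_density_version P p"
    and noise_lower: "AE w in P. ennreal c \<le> nn_cond_exp P (sigma_of P obs_XZ) (%w. ennreal ((obs_Y w - m (obs_Z w))^2)) w"
    and noise_upper: "AE w in P. nn_cond_exp P (sigma_of P obs_XZ) (%w. ennreal (\<bar>obs_Y w - m (obs_Z w)\<bar> powr (2 + \<delta>))) w \<le> ennreal C"
    and density: "\<forall>v\<in>unit_cube. c \<le> p v \<and> p v \<le> C"
    and holder_m: "m \<in> holder_space s" "holder_norm s m \<le> C"
    and holder_g: "g \<in> holder_space s" "holder_norm s g \<le> C"
begin

sublocale prob_space P by (rule prob)

definition "f v = g v - m (snd v)"
text \<open>Two noises: \<open>\<xi>\<close> is centred given \<open>(X, Z)\<close>, whereas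
  \<open>\<epsilon>\<close> is centred given \<open>Z\<close> only and has conditional mean
  \<open>f\<close> given \<open>(X, Z)\<close>. The regression on \<open>(X, Z)\<close> meets the
  first, the regression on \<open>Z\<close> the second.\<close>

definition \<epsilon> :: "('dx, 'dz) obs => real" where "\<epsilon> a = obs_Y a - m (obs_Z a)"
definition "\<xi> a = obs_Y a - g (obs_XZ a)"
definition "\<nu> = distr P borel obs_XZ"
definition "\<tau> = (\<integral>a. (f (obs_XZ a))^2 \<partial>P)"

lemma space_P [simp]: "space P = UNIV"
  using sets_eq_imp_space_eq[OF sets_P] by simp

lemmas sets_P_cong [measurable_cong] = sets_P

lemma measP: "measurable P M = measurable borel M"
  by (rule measurable_cong_sets[OF sets_P refl])

lemma obs_P [measurable]: "obs_Y \<in> measurable P borel" "obs_Z \<in> measurable P borel" "obs_XZ \<in> measurable P borel"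
  by (simp_all add: measP obs_measurable)

lemma XZ_P: "h \<in> measurable borel M ==> (%a. h (obs_XZ a)) \<in> measurable P M"
  by (rule measurable_compose[OF obs_P(3)], simp)

lemma g_meas [measurable]: "g \<in> borel_measurable borel" and m_meas [measurable]: "m \<in> borel_measurable borel"
  using g_version m_version by (auto simp: cond_mean_version_def)

lemma snd_meas [measurable]: "snd \<in> measurable borel borel"
  by (intro borel_measurable_continuous_onI continuous_intros)

lemma f_meas [measurable]: "f \<in> borel_measurable borel"
  unfolding f_def by measurable

lemma eps_meas [measurable]: "\<epsilon> \<in> borel_measurable borel" and xi_meas [measurable]: "\<xi> \<in> borel_measurable borel"
  unfolding \<epsilon>_def \<xi>_def by measurable

lemma snd_obs_XZ [simp]: "snd (obs_XZ a) = obs_Z a"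
  by (cases a) (simp add: obs_XZ_def obs_Z_def)

lemma eps_decomposition: "\<epsilon> a = f (obs_XZ a) + \<xi> a"
  by (simp add: \<epsilon>_def \<xi>_def f_def)

lemma prob_nu: "prob_space \<nu>"
  unfolding \<nu>_def by (rule prob_space_distr[OF obs_P(3)])

lemma sets_nu [simp, measurable_cong]: "sets \<nu> = sets borel"
  by (simp add: \<nu>_def)

lemma space_nu [simp]: "space \<nu> = UNIV"
  by (simp add: \<nu>_def)

lemma integral_nu: "h \<in> borel_measurable borel ==> (\<integral>v. h v \<partial>\<nu>) = (\<integral>a. h (obs_XZ a) \<partial>P)" for h :: "_ => real"
  unfolding \<nu>_def by (rule integral_distr[OF obs_P(3)])

lemma emeasure_nu:
  assumes "E \<in> sets borel"
  shows "emeasure \<nu> E = (\<integral>\<^sup>+v\<in>E. ennreal (p v) * indicator unit_cube v \<partial>lborel)"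
proof -
  have d: "distr P lborel obs_XZ = density lborel (%v. ennreal (p v) * indicator unit_cube v)" "(%v. ennreal (p v) * indicator unit_cube v) \<in> borel_measurable lborel"
    using p_version by (auto simp: joint_density_version_def distributed_def)
  have "emeasure \<nu> E = emeasure (distr P lborel obs_XZ) E"
  proof -
    have "obs_XZ \<in> measurable P lborel" using obs_P(3) by simp
    then show ?thesis using assms obs_P(3) by (simp add: \<nu>_def emeasure_distr)
  qed
  then show ?thesis using assms d by (simp add: emeasure_density)
qed

lemma nu_bounds:
  assumes E: "E \<in> sets borel" "E \<subseteq> unit_cube"
  shows "ennreal c * emeasure lborel E \<le> emeasure \<nu> E" "emeasure \<nu> E \<le> ennreal C * emeasure lborel E"
proof -
  have "emeasure \<nu> E = (\<integral>\<^sup>+v. (ennreal (p v) * indicator unit_cube v) * indicator E v \<partial>lborel)"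
    by (simp add: emeasure_nu E)
  moreover have "ennreal c * emeasure lborel E = (\<integral>\<^sup>+v. ennreal c * indicator E v \<partial>lborel)"
    using E by (simp add: nn_integral_cmult)
  moreover have "ennreal C * emeasure lborel E = (\<integral>\<^sup>+v. ennreal C * indicator E v \<partial>lborel)"
    using E by (simp add: nn_integral_cmult)
  moreover have "(\<integral>\<^sup>+v. ennreal c * indicator E v \<partial>lborel) \<le> (\<integral>\<^sup>+v. (ennreal (p v) * indicator unit_cube v) * indicator E v \<partial>lborel)"
    using E density by (intro nn_integral_mono) (auto simp: indicator_def intro!: ennreal_leI)
  moreover have "(\<integral>\<^sup>+v. (ennreal (p v) * indicator unit_cube v) * indicator E v \<partial>lborel) \<le> (\<integral>\<^sup>+v. ennreal C * indicator E v \<partial>lborel)"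
    using E density by (intro nn_integral_mono) (auto simp: indicator_def intro!: ennreal_leI)
  ultimately show "ennreal c * emeasure lborel E \<le> emeasure \<nu> E" "emeasure \<nu> E \<le> ennreal C * emeasure lborel E" by auto
qed

lemma nu_cell:
  assumes L: "0 < L" and k: "\<kappa> \<in> cell_indices L"
  shows "c * (1 / real L) ^ DIM(('dx, 'dz) cov) \<le> measure \<nu> (cell L \<kappa>)"
    "measure \<nu> (cell L \<kappa>) \<le> C * (1 / real L) ^ DIM(('dx, 'dz) cov)"
proof -
  interpret nu: prob_space \<nu> by (rule prob_nu)
  have "cell L \<kappa> \<subseteq> (unit_cube :: (('dx, 'dz) cov) set)" using cell_subset_ucube[OF k] ucube_subset by blast
  from nu_bounds[OF borel_cell this] show "c * (1 / real L) ^ DIM(('dx, 'dz) cov) \<le> measure \<nu> (cell L \<kappa>)"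
    "measure \<nu> (cell L \<kappa>) \<le> C * (1 / real L) ^ DIM(('dx, 'dz) cov)"
    using constants unfolding emeasure_cell[OF L] nu.emeasure_eq_measure
    by (simp_all add: ennreal_mult[symmetric])
qed

text \<open>The faces that \<open>ucube\<close> omits have Lebesgue measure zero, since both cubes
  have volume 1, and the density is bounded by \<open>C\<close>.\<close>

lemma AE_ucube: "AE a in P. obs_XZ a \<in> ucube"
proof -
  interpret nu: prob_space \<nu> by (rule prob_nu)
  have u1: "emeasure lborel (ucube :: (('dx, 'dz) cov) set) = 1"
  proof -
    have "(ucube :: (('dx, 'dz) cov) set) = cell 1 (%_. 0)" by (simp add: ucube_def cell_def)
    then show ?thesis using emeasure_cell[where 'a = "('dx, 'dz) cov" and L = 1 and J = "%_. 0"] by simp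
  qed
  have u2: "emeasure lborel (unit_cube :: (('dx, 'dz) cov) set) = 1"
    by (subst emeasure_lborel_cbox_eq) (auto simp: inner_sum_left inner_Basis)
  have "emeasure lborel (unit_cube - ucube :: (('dx, 'dz) cov) set) = 1 - 1"
    using ucube_subset u1 u2 by (subst emeasure_Diff) auto
  then have "emeasure \<nu> (unit_cube - ucube) = 0" using nu_bounds(2)[of "unit_cube - ucube"] by simp
  moreover have "emeasure \<nu> (- unit_cube) = 0"
  proof -
    have "(%v. ennreal (p v) * indicator unit_cube v * indicator (- unit_cube) v) = (%_. 0)" by (auto simp: indicator_def)
    then show ?thesis by (subst emeasure_nu) simp_all
  qed
  ultimately have "emeasure \<nu> ((unit_cube - ucube) \<union> - unit_cube) = 0"
    using emeasure_subadditive[of "unit_cube - ucube" \<nu> "- unit_cube"] by simp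
  moreover have "(unit_cube - ucube) \<union> - unit_cube = - (ucube :: (('dx, 'dz) cov) set)" using ucube_subset by auto
  ultimately have "AE v in \<nu>. v \<in> ucube" by (intro AE_I'[of "- ucube"]) (auto simp: null_sets_def)
  then show ?thesis unfolding \<nu>_def by (subst (asm) AE_distr_iff[OF obs_P(3)]) auto
qed

lemma AE_nu_ucube: "AE v in \<nu>. v \<in> ucube"
  unfolding \<nu>_def using AE_ucube by (subst AE_distr_iff[OF obs_P(3)]) auto

text \<open>The higher moment controls the second one through \<open>\<epsilon>^2 \<le> 1 +
  \<bar>\<epsilon>\<bar> powr (2 + \<delta>)\<close>.\<close>

lemma noise_second_upper:
  assumes k: "k \<in> borel_measurable borel"
  shows "(\<integral>\<^sup>+a. k (obs_XZ a) * ennreal ((\<epsilon> a)^2) \<partial>P) \<le> ennreal (1 + C) * (\<integral>\<^sup>+a. k (obs_XZ a) \<partial>P)"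
proof -
  have kP [measurable]: "(%a. k (obs_XZ a)) \<in> borel_measurable P" using k by (rule XZ_P)
  have le: "(\<epsilon> a)^2 \<le> 1 + \<bar>\<epsilon> a\<bar> powr (2 + \<delta>)" for a
  proof (cases "\<bar>\<epsilon> a\<bar> \<le> 1")
    case True
    then have "\<bar>\<epsilon> a\<bar>\<^sup>2 \<le> 1" by (intro power_le_one) auto
    then show ?thesis by (simp add: add_increasing2)
  next
    case False
    then have "\<bar>\<epsilon> a\<bar> powr 2 \<le> \<bar>\<epsilon> a\<bar> powr (2 + \<delta>)" using constants by (intro powr_mono) auto
    moreover have "\<bar>\<epsilon> a\<bar> powr 2 = (\<epsilon> a)^2" using False by (subst powr_numeral) auto
    ultimately show ?thesis by simp
  qed
  have "(\<integral>\<^sup>+a. k (obs_XZ a) * ennreal ((\<epsilon> a)^2) \<partial>P) \<le> (\<integral>\<^sup>+a. k (obs_XZ a) + k (obs_XZ a) * ennreal (\<bar>\<epsilon> a\<bar> powr (2 + \<delta>)) \<partial>P)"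
  proof (rule nn_integral_mono)
    fix a
    have "ennreal ((\<epsilon> a)^2) \<le> 1 + ennreal (\<bar>\<epsilon> a\<bar> powr (2 + \<delta>))" using ennreal_leI[OF le[of a]] by (simp add: ennreal_plus)
    then have "k (obs_XZ a) * ennreal ((\<epsilon> a)^2) \<le> k (obs_XZ a) * (1 + ennreal (\<bar>\<epsilon> a\<bar> powr (2 + \<delta>)))" by (rule mult_left_mono) simp
    then show "k (obs_XZ a) * ennreal ((\<epsilon> a)^2) \<le> k (obs_XZ a) + k (obs_XZ a) * ennreal (\<bar>\<epsilon> a\<bar> powr (2 + \<delta>))" by (simp add: distrib_left)
  qed
  also have "... = (\<integral>\<^sup>+a. k (obs_XZ a) \<partial>P) + (\<integral>\<^sup>+a. k (obs_XZ a) * ennreal (\<bar>\<epsilon> a\<bar> powr (2 + \<delta>)) \<partial>P)"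
    by (intro nn_integral_add) measurable
  also have "... \<le> (\<integral>\<^sup>+a. k (obs_XZ a) \<partial>P) + ennreal C * (\<integral>\<^sup>+a. k (obs_XZ a) \<partial>P)"
    unfolding \<epsilon>_def by (intro add_left_mono nn_cond_exp_bounds(2)[OF prob obs_P(3) _ k noise_upper]) measurable
  also have "... = ennreal (1 + C) * (\<integral>\<^sup>+a. k (obs_XZ a) \<partial>P)"
    using constants by (simp add: ennreal_plus distrib_right)
  finally show ?thesis .
qed

lemma noise_second_lower:
  assumes k: "k \<in> borel_measurable borel"
  shows "ennreal c * (\<integral>\<^sup>+a. k (obs_XZ a) \<partial>P) \<le> (\<integral>\<^sup>+a. k (obs_XZ a) * ennreal ((\<epsilon> a)^2) \<partial>P)"
  unfolding \<epsilon>_def by (rule nn_cond_exp_bounds(1)[OF prob obs_P(3) _ k noise_lower]) measurable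

lemma noise_high_upper:
  assumes k: "k \<in> borel_measurable borel"
  shows "(\<integral>\<^sup>+a. k (obs_XZ a) * ennreal (\<bar>\<epsilon> a\<bar> powr (2 + \<delta>)) \<partial>P) \<le> ennreal C * (\<integral>\<^sup>+a. k (obs_XZ a) \<partial>P)"
  unfolding \<epsilon>_def by (rule nn_cond_exp_bounds(2)[OF prob obs_P(3) _ k noise_upper]) measurable

lemma integrable_eps2: "integrable P (%a. (\<epsilon> a)^2)"
proof (rule integrableI_bounded)
  have "(\<integral>\<^sup>+a. ennreal (norm ((\<epsilon> a)^2)) \<partial>P) \<le> ennreal (1 + C) * (\<integral>\<^sup>+a. 1 \<partial>P)"
    using noise_second_upper[of "%_. 1"] by simp
  also have "... < \<infinity>" using emeasure_space_1 by simp
  finally show "(\<integral>\<^sup>+a. ennreal (norm ((\<epsilon> a)^2)) \<partial>P) < \<infinity>" .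
qed measurable

lemma integrable_eps: "integrable P \<epsilon>"
  by (rule square_integrable_imp_integrable[OF _ integrable_eps2]) (simp add: measP)

lemma xi_mean: "k \<in> borel_measurable borel ==> (\<integral>a. k (obs_XZ a) * \<xi> a \<partial>P) = 0"
  unfolding \<xi>_def by (rule cond_mean_noise(1)[OF prob obs_P(3) g_version])

lemma eps_mean: "k \<in> borel_measurable borel ==> (\<integral>a. k (obs_Z a) * \<epsilon> a \<partial>P) = 0"
  unfolding \<epsilon>_def by (rule cond_mean_noise(1)[OF prob obs_P(2) m_version])

lemma continuous_f: "continuous_on unit_cube f"
proof -
  have "snd ` (unit_cube :: (('dx, 'dz) cov) set) \<subseteq> (unit_cube :: (real ^ 'dz::{finite,linorder}) set)"
  proof
    fix z :: "real ^ 'dz::{finite,linorder}"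
    assume "z \<in> snd ` (unit_cube :: (('dx, 'dz) cov) set)"
    then obtain x where "(x, z) \<in> (unit_cube :: (('dx, 'dz) cov) set)" by auto
    then show "z \<in> unit_cube" unfolding mem_unit_cube by (auto simp: Basis_prod_def dest!: bspec[of _ _ "(0, _)"])
  qed
  then have "continuous_on (unit_cube :: (('dx, 'dz) cov) set) (%v. m (snd v))"
    by (intro continuous_on_compose2[OF holder_continuous[OF s(1) holder_m(1)]] continuous_on_snd continuous_on_id)
  with holder_continuous[OF s(1) holder_g(1)] show ?thesis unfolding f_def[abs_def] by (rule continuous_on_diff)
qed

lemma bounded_on_ucube:
  assumes "continuous_on (unit_cube :: (('dx, 'dz) cov) set) h"
  obtains B where "B > 0" "\<And>v. v \<in> ucube ==> \<bar>h v\<bar> \<le> (B :: real)"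
proof -
  have "compact (h ` unit_cube)" using assms by (intro compact_continuous_image) auto
  then obtain B where "B > 0" "\<forall>x\<in>h ` unit_cube. norm x \<le> B" using compact_imp_bounded bounded_pos by blast
  then show ?thesis using that ucube_subset by (metis image_eqI real_norm_def subsetD)
qed

lemma integrable_bounded_XZ:
  fixes h :: "_ => real"
  assumes "h \<in> borel_measurable borel" "\<And>v. v \<in> ucube ==> \<bar>h v\<bar> \<le> B"
  shows "integrable P (%a. h (obs_XZ a))" "integrable \<nu> h"
proof -
  interpret nu: prob_space \<nu> by (rule prob_nu)
  have [measurable]: "h \<in> borel_measurable borel" by fact
  show "integrable P (%a. h (obs_XZ a))"
  proof (rule integrable_const_bound[where B = B])
    show "AE a in P. norm (h (obs_XZ a)) \<le> B" using AE_ucube by eventually_elim (simp add: assms(2))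
  qed (rule XZ_P[OF assms(1)])
  show "integrable \<nu> h"
  proof (rule nu.integrable_const_bound[where B = B])
    show "AE a in \<nu>. norm (h a) \<le> B" using AE_nu_ucube by eventually_elim (simp add: assms(2))
  qed measurable
qed

text \<open>By the decomposition \<open>\<epsilon> = f + \<xi>\<close>, with \<open>\<xi>\<close>
  orthogonal to all functions of \<open>(X, Z)\<close>.\<close>

lemma eps_XZ:
  assumes k: "k \<in> borel_measurable borel" "\<And>v. v \<in> ucube ==> \<bar>k v\<bar> \<le> B"
  shows "integrable P (%a. k (obs_XZ a) * \<epsilon> a)" "(\<integral>a. k (obs_XZ a) * \<epsilon> a \<partial>P) = (\<integral>a. k (obs_XZ a) * f (obs_XZ a) \<partial>P)"
proof -
  have [measurable]: "k \<in> borel_measurable borel" by fact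
  obtain F where F: "F > 0" "\<And>v. v \<in> ucube ==> \<bar>f v\<bar> \<le> F" using bounded_on_ucube[OF continuous_f] by blast
  have B: "0 \<le> B" using k(2)[of 0] by (simp add: ucube_def)
  show i: "integrable P (%a. k (obs_XZ a) * \<epsilon> a)"
  proof (rule Bochner_Integration.integrable_bound)
    show "integrable P (%a. B * \<epsilon> a)" using integrable_eps by simp
    show "AE a in P. norm (k (obs_XZ a) * \<epsilon> a) \<le> norm (B * \<epsilon> a)"
      using AE_ucube
    proof eventually_elim
      case (elim a)
      have "\<bar>k (obs_XZ a)\<bar> * \<bar>\<epsilon> a\<bar> \<le> B * \<bar>\<epsilon> a\<bar>" by (intro mult_right_mono k(2)[OF elim]) simp
      then show ?case using B by (simp add: abs_mult)
    qed
    show "(%a. k (obs_XZ a) * \<epsilon> a) \<in> borel_measurable P" using XZ_P[OF k(1)] by measurable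
  qed
  have i2: "integrable P (%a. k (obs_XZ a) * f (obs_XZ a))"
    by (rule integrable_bounded_XZ(1)[of "%v. k v * f v" "B * F"])
      (use k F in \<open>auto simp: abs_mult intro!: mult_mono order_trans[OF abs_ge_zero k(2)]\<close>)
  have "(\<integral>a. k (obs_XZ a) * \<xi> a \<partial>P) = (\<integral>a. k (obs_XZ a) * \<epsilon> a - k (obs_XZ a) * f (obs_XZ a) \<partial>P)"
    by (simp add: eps_decomposition distrib_left)
  then show "(\<integral>a. k (obs_XZ a) * \<epsilon> a \<partial>P) = (\<integral>a. k (obs_XZ a) * f (obs_XZ a) \<partial>P)"
    using i i2 xi_mean[of k] by simp
qed

end

lemma convex_ucube: "convex ucube"
proof (rule convexI)
  fix x y :: 'a and u v :: real assume *: "x \<in> ucube" "y \<in> ucube" "0 \<le> u" "0 \<le> v" "u + v = 1"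
  show "u *\<^sub>R x + v *\<^sub>R y \<in> ucube" unfolding ucube_def
  proof (safe)
    fix b :: 'a assume b: "b \<in> Basis"
    have 1: "0 \<le> x \<bullet> b" "x \<bullet> b < 1" "0 \<le> y \<bullet> b" "y \<bullet> b < 1" using * b by (auto simp: ucube_def)
    show "0 \<le> (u *\<^sub>R x + v *\<^sub>R y) \<bullet> b" using * 1 by (simp add: inner_add_left)
    have "u * (x \<bullet> b) + v * (y \<bullet> b) < 1"
      using * 1 by (intro convex_bound_lt) auto
    then show "(u *\<^sub>R x + v *\<^sub>R y) \<bullet> b < 1" by (simp add: inner_add_left)
  qed
qed

lemma holder_axis_taylor:
  fixes h :: "'a::euclidean_space => real"
  assumes s: "1 < s" "s \<le> real r" and h: "h \<in> holder_space s" "holder_norm s h \<le> C" and C: "0 \<le> C" and \<rho>: "0 \<le> \<rho>"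
  shows "axis_taylor r \<rho> ((C + 1) * \<rho> powr s) h"
  unfolding axis_taylor_def
proof (intro ballI)
  fix x b :: 'a assume x: "x \<in> ucube" and b: "b \<in> Basis"
  have xc: "x \<in> unit_cube" using x ucube_subset by auto
  obtain p where p: "degree p < r" "\<And>t. 0 \<le> t ==> t \<le> 1 ==> \<bar>h (move x b t) - poly p t\<bar> \<le> (C + 1) * \<bar>t - x \<bullet> b\<bar> powr s"
    using holder_taylor_axis[OF s h xc b] by blast
  have "poly p (x \<bullet> b) = h x" using p(2)[of "x \<bullet> b"] xc b by (auto simp: mem_unit_cube)
  moreover have "\<bar>h (move x b t) - poly p t\<bar> \<le> (C + 1) * \<rho> powr s" if "0 \<le> t \<and> t < 1 \<and> \<bar>t - x \<bullet> b\<bar> \<le> \<rho>" for t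
  proof -
    have "\<bar>h (move x b t) - poly p t\<bar> \<le> (C + 1) * \<bar>t - x \<bullet> b\<bar> powr s" using p(2) that by auto
    also have "... \<le> (C + 1) * \<rho> powr s" using that s C by (intro mult_left_mono powr_mono2) auto
    finally show ?thesis .
  qed
  ultimately show "\<exists>p. degree p < r \<and> poly p (x \<bullet> b) = h x \<and> (\<forall>t. 0 \<le> t \<and> t < 1 \<and> \<bar>t - x \<bullet> b\<bar> \<le> \<rho> --> \<bar>h (move x b t) - poly p t\<bar> \<le> (C + 1) * \<rho> powr s)"
    using p(1) by blast
qed

text \<open>The path from \<open>x\<close> to \<open>y\<close> changes one coordinate at a time and
  stays in the half-open cube.\<close>

lemma lipschitz_from_axes:
  fixes h :: "'a::euclidean_space => real"
  assumes "\<And>x b t. x \<in> ucube ==> b \<in> Basis ==> 0 \<le> t ==> t < 1 ==> \<bar>h (move x b t) - h x\<bar> \<le> M * \<bar>t - x \<bullet> b\<bar>"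
    and x: "x \<in> ucube" and y: "y \<in> ucube"
  shows "\<bar>h y - h x\<bar> \<le> M * (\<Sum>b\<in>Basis. \<bar>y \<bullet> b - x \<bullet> b\<bar>)"
proof -
  define z where "z S = x + (\<Sum>b\<in>S. (y \<bullet> b - x \<bullet> b) *\<^sub>R b)" for S
  have zb: "z S \<bullet> b = (if b \<in> S then y \<bullet> b else x \<bullet> b)" if "S \<subseteq> Basis" "b \<in> Basis" for S b
  proof -
    have fS: "finite S" using that(1) finite_Basis by (rule finite_subset)
    have "(\<Sum>b'\<in>S. (y \<bullet> b' - x \<bullet> b') * (b' \<bullet> b)) = (\<Sum>b'\<in>S. if b' = b then y \<bullet> b - x \<bullet> b else 0)"
      using that by (intro sum.cong) (auto simp: inner_Basis subset_iff)
    then show ?thesis using fS by (simp add: z_def inner_add_left inner_sum_left sum.delta)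
  qed
  have zu: "z S \<in> ucube" if "S \<subseteq> Basis" for S using x y zb[OF that] by (auto simp: ucube_def)
  have "\<bar>h (z S) - h x\<bar> \<le> M * (\<Sum>b\<in>S. \<bar>y \<bullet> b - x \<bullet> b\<bar>)" if "finite S" "S \<subseteq> Basis" for S
    using that
  proof (induction S)
    case empty then show ?case by (simp add: z_def)
  next
    case (insert b S)
    have b: "b \<in> Basis" and S: "S \<subseteq> Basis" using insert by auto
    have zi: "z (insert b S) = move (z S) b (y \<bullet> b)"
      using insert.hyps zb[OF S b] by (simp add: z_def move_def inner_add_left algebra_simps)
    have "0 \<le> y \<bullet> b" "y \<bullet> b < 1" using y b by (auto simp: ucube_def)
    from assms(1)[OF zu[OF S] b this] have "\<bar>h (z (insert b S)) - h (z S)\<bar> \<le> M * \<bar>y \<bullet> b - x \<bullet> b\<bar>"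
      using zb[OF S b] insert.hyps by (simp add: zi)
    then show ?case using insert.IH[OF S] insert.hyps by (simp add: distrib_left)
  qed
  from this[of Basis] show ?thesis by (simp add: z_def algebra_simps sum_subtractf euclidean_representation)
qed

context regression_model
begin

lemma nn_indicator_XZ: "A \<in> sets borel ==> (\<integral>\<^sup>+a. indicator A (obs_XZ a) \<partial>P) = ennreal (measure \<nu> A)"
proof -
  assume A: "A \<in> sets borel"
  interpret nu: prob_space \<nu> by (rule prob_nu)
  have "(\<integral>\<^sup>+a. indicator A (obs_XZ a) \<partial>P) = (\<integral>\<^sup>+v. indicator A v \<partial>\<nu>)"
    unfolding \<nu>_def using A by (subst nn_integral_distr[OF obs_P(3)]) auto
  then show ?thesis using A by (simp add: nu.emeasure_eq_measure)
qed

lemma integrable_ind_eps2: "A \<in> sets borel ==> integrable P (%a. indicator A (obs_XZ a) * (\<epsilon> a)^2)"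
proof -
  assume A: "A \<in> sets borel"
  have "(%a. indicator A (obs_XZ a) :: real) \<in> borel_measurable P" using A by (intro XZ_P) simp
  then show ?thesis
    by (intro Bochner_Integration.integrable_bound[OF integrable_eps2]) (auto simp: indicator_def)
qed

lemma eps2_bounds:
  assumes A: "A \<in> sets borel"
  shows "(\<integral>a. indicator A (obs_XZ a) * (\<epsilon> a)^2 \<partial>P) \<le> (1 + C) * measure \<nu> A"
    "c * measure \<nu> A \<le> (\<integral>a. indicator A (obs_XZ a) * (\<epsilon> a)^2 \<partial>P)"
proof -
  have e: "(\<integral>\<^sup>+a. indicator A (obs_XZ a) * ennreal ((\<epsilon> a)^2) \<partial>P) = ennreal (\<integral>a. indicator A (obs_XZ a) * (\<epsilon> a)^2 \<partial>P)"
    by (subst nn_integral_eq_integral[OF integrable_ind_eps2[OF A], symmetric]) (auto intro!: nn_integral_cong simp: indicator_def)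
  have m: "(indicator A :: _ => ennreal) \<in> borel_measurable borel" using A by simp
  show "(\<integral>a. indicator A (obs_XZ a) * (\<epsilon> a)^2 \<partial>P) \<le> (1 + C) * measure \<nu> A"
    using noise_second_upper[OF m] constants unfolding e nn_indicator_XZ[OF A] by (simp add: ennreal_mult[symmetric] del: ennreal_plus)
  show "c * measure \<nu> A \<le> (\<integral>a. indicator A (obs_XZ a) * (\<epsilon> a)^2 \<partial>P)"
    using noise_second_lower[OF m] constants unfolding e nn_indicator_XZ[OF A] by (simp add: ennreal_mult[symmetric] integral_nonneg_AE)
qed

lemma epsh_bounds:
  assumes A: "A \<in> sets borel"
  shows "integrable P (%a. indicator A (obs_XZ a) * \<bar>\<epsilon> a\<bar> powr (2 + \<delta>))" (is "integrable P ?h")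
    "(\<integral>a. indicator A (obs_XZ a) * \<bar>\<epsilon> a\<bar> powr (2 + \<delta>) \<partial>P) \<le> C * measure \<nu> A"
proof -
  have m: "(indicator A :: _ => ennreal) \<in> borel_measurable borel" using A by simp
  have m': "(%a. indicator A (obs_XZ a) :: real) \<in> borel_measurable P" using A by (intro XZ_P) simp
  have e: "(\<integral>\<^sup>+a. ennreal (?h a) \<partial>P) = (\<integral>\<^sup>+a. indicator A (obs_XZ a) * ennreal (\<bar>\<epsilon> a\<bar> powr (2 + \<delta>)) \<partial>P)"
    by (intro nn_integral_cong) (auto simp: indicator_def)
  have le: "(\<integral>\<^sup>+a. ennreal (?h a) \<partial>P) \<le> ennreal (C * measure \<nu> A)"
    using noise_high_upper[OF m] constants unfolding e nn_indicator_XZ[OF A] by (simp add: ennreal_mult)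
  show i: "integrable P ?h"
  proof (rule integrableI_bounded)
    show "?h \<in> borel_measurable P" using m' by measurable
    have "(\<integral>\<^sup>+a. ennreal (norm (?h a)) \<partial>P) = (\<integral>\<^sup>+a. ennreal (?h a) \<partial>P)" by (intro nn_integral_cong) simp
    then show "(\<integral>\<^sup>+a. ennreal (norm (?h a)) \<partial>P) < \<infinity>" using le by (auto intro: order_le_less_trans)
  qed
  have "ennreal (\<integral>a. ?h a \<partial>P) \<le> ennreal (C * measure \<nu> A)"
    using le by (subst nn_integral_eq_integral[OF i, symmetric]) auto
  then show "(\<integral>a. ?h a \<partial>P) \<le> C * measure \<nu> A" using constants by (simp add: ennreal_le_iff)
qed

lemma f_bound_ucube:
  obtains F where "F > 0" "\<And>v. v \<in> ucube ==> \<bar>f v\<bar> \<le> F"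
  using bounded_on_ucube[OF continuous_f] by blast

text \<open>\<open>f\<close> is the conditional mean of \<open>\<epsilon>\<close>, so its square is
  at most a conditional second moment. On the exceptional set \<open>A\<close> this reads: the
  integral of \<open>f^2\<close> equals that of \<open>f \<epsilon>\<close>, which by
  \<open>2 f \<epsilon> \<le> f^2 + \<epsilon>^2\<close> gives at most \<open>(1 + C)\<close> times
  the mass of \<open>A\<close>, while \<open>f^2 > 1 + C\<close> there. Hence \<open>A\<close> is
  null, and continuity extends the bound to the whole cube.\<close>

lemma f_sq_le: assumes v: "v \<in> unit_cube" shows "(f v)^2 \<le> 1 + C"
proof -
  obtain F where F: "F > 0" "\<And>v. v \<in> ucube ==> \<bar>f v\<bar> \<le> F" using f_bound_ucube by blast
  define A where "A = {v. (f v)^2 > 1 + C}"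
  have A: "A \<in> sets borel" unfolding A_def by measurable
  have m: "(%v. indicator A v * f v) \<in> borel_measurable borel" using A by measurable
  have F2: "\<bar>indicator A v * f v\<bar> \<le> F" if "v \<in> ucube" for v using F(1) F(2)[OF that] by (simp add: indicator_def)
  have m2: "(%v. indicator A v * (f v)^2) \<in> borel_measurable borel" using A by measurable
  have i1: "integrable P (%a. indicator A (obs_XZ a) * (f (obs_XZ a))^2)"
  proof (rule integrable_bounded_XZ(1)[OF m2])
    show "\<bar>indicator A v * (f v)^2\<bar> \<le> F\<^sup>2" if "v \<in> ucube" for v
      using power_mono[OF F(2)[OF that], of 2] by (simp add: indicator_def)
  qed
  note e = eps_XZ[OF m F2]
  have "(\<integral>a. indicator A (obs_XZ a) * (f (obs_XZ a))^2 \<partial>P) = (\<integral>a. (indicator A (obs_XZ a) * f (obs_XZ a)) * \<epsilon> a \<partial>P)"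
  proof -
    have "(\<integral>a. indicator A (obs_XZ a) * (f (obs_XZ a))^2 \<partial>P) = (\<integral>a. (indicator A (obs_XZ a) * f (obs_XZ a)) * f (obs_XZ a) \<partial>P)"
      by (simp add: power2_eq_square mult.assoc)
    then show ?thesis using e(2) by simp
  qed
  also have "... \<le> (\<integral>a. (1/2) * (indicator A (obs_XZ a) * (f (obs_XZ a))^2) + (1/2) * (indicator A (obs_XZ a) * (\<epsilon> a)^2) \<partial>P)"
  proof (rule integral_mono[OF e(1)])
    show "integrable P (%a. (1/2) * (indicator A (obs_XZ a) * (f (obs_XZ a))^2) + (1/2) * (indicator A (obs_XZ a) * (\<epsilon> a)^2))"
      using i1 integrable_ind_eps2[OF A] by auto
    fix a show "indicator A (obs_XZ a) * f (obs_XZ a) * \<epsilon> a \<le> (1/2) * (indicator A (obs_XZ a) * (f (obs_XZ a))^2) + (1/2) * (indicator A (obs_XZ a) * (\<epsilon> a)^2)"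
      using sum_squares_bound[of "f (obs_XZ a)" "\<epsilon> a"] by (simp add: indicator_def)
  qed
  also have "... = (1/2) * (\<integral>a. indicator A (obs_XZ a) * (f (obs_XZ a))^2 \<partial>P) + (1/2) * (\<integral>a. indicator A (obs_XZ a) * (\<epsilon> a)^2 \<partial>P)"
    using i1 integrable_ind_eps2[OF A] by simp
  finally have le: "(\<integral>a. indicator A (obs_XZ a) * (f (obs_XZ a))^2 \<partial>P) \<le> (1 + C) * measure \<nu> A"
    using eps2_bounds(1)[OF A] by linarith
  have i2: "integrable P (%a. (1 + C) * indicator A (obs_XZ a))"
    by (rule integrable_bounded_XZ(1)[of _ "1 + C"]) (use A constants in \<open>auto simp: indicator_def\<close>)
  have eA: "(\<integral>a. (1 + C) * indicator A (obs_XZ a) \<partial>P) = (1 + C) * measure \<nu> A"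
  proof -
    have "measure \<nu> A = (\<integral>a. indicator A (obs_XZ a) \<partial>P)" using integral_nu[of "indicator A"] A by simp
    then show ?thesis by simp
  qed
  have "(\<integral>a. indicator A (obs_XZ a) * (f (obs_XZ a))^2 - (1 + C) * indicator A (obs_XZ a) \<partial>P) \<le> 0"
    unfolding Bochner_Integration.integral_diff[OF i1 i2] eA using le by linarith
  moreover have nn: "0 \<le> indicator A (obs_XZ a) * (f (obs_XZ a))^2 - (1 + C) * indicator A (obs_XZ a)" for a
    by (simp add: indicator_def A_def)
  ultimately have "(\<integral>a. indicator A (obs_XZ a) * (f (obs_XZ a))^2 - (1 + C) * indicator A (obs_XZ a) \<partial>P) = 0"
    by (intro antisym integral_nonneg_AE) auto
  then have "AE a in P. indicator A (obs_XZ a) * (f (obs_XZ a))^2 - (1 + C) * indicator A (obs_XZ a) = 0"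
    using i1 i2 nn by (subst (asm) integral_nonneg_eq_0_iff_AE) auto
  then have "AE a in P. obs_XZ a \<notin> A" by eventually_elim (auto simp: A_def indicator_def split: if_splits)
  then have "AE v in \<nu>. v \<notin> A" unfolding \<nu>_def using A by (subst AE_distr_iff[OF obs_P(3)]) auto
  then have nA: "emeasure \<nu> A = 0" using A by (subst (asm) AE_iff_measurable[of A]) auto
  \<comment> \<open>An open null set is empty: the lower bound of the density turns mass zero under
    \<open>\<nu>\<close> into Lebesgue measure zero.\<close>
  define U where "U = {v \<in> box 0 One. f v \<in> {x. x\<^sup>2 > 1 + C}}"
  have bx: "box 0 One \<subseteq> (ucube :: (('dx, 'dz) cov) set)"
    unfolding box_def ucube_def by (intro Collect_mono ballI impI) (auto simp: less_imp_le simp del: inner_Pair)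
  have "open {x::real. x\<^sup>2 > 1 + C}" by (intro open_Collect_less continuous_intros)
  then have oU: "open U"
    unfolding U_def
  proof -
    assume o: "open {x::real. x\<^sup>2 > 1 + C}"
    have "continuous_on (box 0 One) f" using continuous_f by (rule continuous_on_subset) (use box_subset_cbox in blast)
    from continuous_open_preimage[OF this open_box o] show "open {v \<in> box 0 One. f v \<in> {x. x\<^sup>2 > 1 + C}}"
      by (simp add: vimage_def Int_def)
  qed
  have UA: "U \<subseteq> A" "U \<subseteq> unit_cube" using bx ucube_subset by (auto simp: U_def A_def)
  have "emeasure \<nu> U \<le> emeasure \<nu> A" using UA A by (intro emeasure_mono) auto
  then have "ennreal c * emeasure lborel U \<le> 0" using nA nu_bounds(1)[of U] UA oU by auto
  then have "emeasure lborel U = 0" using constants by simp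
  then have "U \<in> null_sets lborel" using oU by (auto simp: null_sets_def)
  then have "U \<in> null_sets lebesgue" by (rule null_sets_completionI)
  then have "negligible U" by (simp add: negligible_iff_null_sets)
  then have U0: "U = {}" using open_not_negligible[OF oU] by auto
  have in_box: "(f v)^2 \<le> 1 + C" if "v \<in> box 0 One" for v
  proof (rule ccontr)
    assume "\<not> (f v)^2 \<le> 1 + C"
    then have "v \<in> U" unfolding U_def using that by (intro CollectI conjI) (simp_all add: not_le)
    then show False using U0 by blast
  qed
  have "box 0 One \<noteq> ({} :: (('dx, 'dz) cov) set)" by (simp add: box_ne_empty)
  then have cl: "closure (box 0 One) = (unit_cube :: (('dx, 'dz) cov) set)" by (rule closure_box)
  show ?thesis
    by (rule continuous_le_on_closure[of "box 0 One" "%v. (f v)^2"])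
      (use cl v in_box continuous_f in \<open>auto intro!: continuous_intros\<close>)
qed

text \<open>Against a function of \<open>(X, Z)\<close> the noise \<open>\<epsilon>\<close>
  integrates like \<open>f\<close>, and against a function of \<open>Z\<close> it integrates to
  0.\<close>

lemma f_orthogonal_Z:
  fixes h :: "('dx, 'dz) cov => real"
  assumes h: "h \<in> borel_measurable borel" "\<And>v. v \<in> ucube ==> \<bar>h v\<bar> \<le> B" "\<And>x x' z. h (x, z) = h (x', z)"
  shows "(\<integral>v. f v * h v \<partial>\<nu>) = 0"
proof -
  have [measurable]: "h \<in> borel_measurable borel" by fact
  define h' where "h' z = h (0, z)" for z
  have "(%z. (0 :: real ^ 'dx::{finite,linorder}, z :: real ^ 'dz::{finite,linorder})) \<in> measurable borel borel"
    by (intro borel_measurable_continuous_onI continuous_intros)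
  from measurable_compose[OF this h(1)] have h'm: "h' \<in> borel_measurable borel" by (simp add: h'_def[abs_def])
  have hh: "h v = h' (snd v)" for v using h(3)[of "fst v" "snd v" 0] by (simp add: h'_def)
  have "(\<integral>v. f v * h v \<partial>\<nu>) = (\<integral>a. h (obs_XZ a) * f (obs_XZ a) \<partial>P)"
    by (subst integral_nu) (auto simp: mult.commute)
  also have "... = (\<integral>a. h (obs_XZ a) * \<epsilon> a \<partial>P)" by (rule eps_XZ(2)[OF h(1,2), symmetric])
  also have "... = (\<integral>a. h' (obs_Z a) * \<epsilon> a \<partial>P)" by (simp add: hh)
  also have "... = 0" by (rule eps_mean[OF h'm])
  finally show ?thesis .
qed

text \<open>\<open>f\<close> has mean zero under \<open>\<nu>\<close> and is continuous on a
  connected set, so it cannot keep one sign. A zero is wanted because near it the noise cannot be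
  dominated by the signal.\<close>

lemma f_zero: obtains v where "v \<in> ucube" "f v = 0"
proof -
  have "\<exists>v\<in>ucube. f v = 0"
  proof (rule ccontr)
    assume nz: "\<not> (\<exists>v\<in>ucube. f v = 0)"
    interpret nu: prob_space \<nu> by (rule prob_nu)
    have m0: "(\<integral>v. f v \<partial>\<nu>) = 0" using f_orthogonal_Z[of "%_. 1" 1] by simp
    obtain F where F: "F > 0" "\<And>v. v \<in> ucube ==> \<bar>f v\<bar> \<le> F" using f_bound_ucube by blast
    have i: "integrable \<nu> f" using integrable_bounded_XZ(2)[of f F] F by simp
    have conn: "connected (f ` ucube)"
      using continuous_f ucube_subset convex_ucube by (intro connected_continuous_image convex_connected) (auto intro: continuous_on_subset)
    have "\<not> (\<exists>u\<in>ucube. \<exists>v\<in>ucube. f u < 0 \<and> 0 < f v)"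
    proof
      assume "\<exists>u\<in>ucube. \<exists>v\<in>ucube. f u < 0 \<and> 0 < f v"
      then obtain u v where "u \<in> ucube" "v \<in> ucube" "f u \<le> 0" "0 \<le> f v" by (auto simp: less_imp_le)
      then have "0 \<in> f ` ucube" using connectedD_interval[OF conn, of "f u" "f v" 0] by auto
      then show False using nz by auto
    qed
    then consider "\<forall>v\<in>ucube. 0 < f v" | "\<forall>v\<in>ucube. 0 < - f v" using nz by (metis linorder_neqE_linordered_idom neg_0_less_iff_less)
    then show False
    proof cases
      case 1
      have "AE v in \<nu>. 0 \<le> f v" using AE_nu_ucube by eventually_elim (use 1 in \<open>auto simp: less_imp_le\<close>)
      then have "AE v in \<nu>. f v = 0" using m0 i by (subst (asm) integral_nonneg_eq_0_iff_AE) auto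
      then have "AE v in \<nu>. False" using AE_nu_ucube by eventually_elim (use 1 in auto)
      then show False by simp
    next
      case 2
      have "AE v in \<nu>. 0 \<le> - f v" using AE_nu_ucube by eventually_elim (use 2 in \<open>auto simp: less_imp_le\<close>)
      moreover have "(\<integral>v. - f v \<partial>\<nu>) = 0" "integrable \<nu> (%v. - f v)" using m0 i by auto
      ultimately have "AE v in \<nu>. - f v = 0" using integral_nonneg_eq_0_iff_AE[of \<nu> "%v. - f v"] by auto
      then have "AE v in \<nu>. False" using AE_nu_ucube by eventually_elim (use 2 in auto)
      then show False by simp
    qed
  qed
  then show ?thesis using that by blast
qed

text \<open>The Taylor polynomial of \<open>f\<close> along an axis is bounded because \<open>f\<close> is, and a bounded
  polynomial of bounded degree has a bounded slope.\<close>

lemma f_axis_lipschitz: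
  assumes K: "K \<ge> 0" "\<And>p::real poly. \<And>A a h s t. degree p \<le> r ==> 0 < h ==> (\<And>t. a \<le> t ==> t < a + h ==> \<bar>poly p t\<bar> \<le> A)
     ==> a \<le> s ==> s < a + h ==> a \<le> t ==> t < a + h ==> \<bar>poly p s - poly p t\<bar> \<le> K * A * (\<bar>s - t\<bar> / h)"
    and x: "x \<in> ucube" and b: "b \<in> Basis" and t: "0 \<le> t" "t < 1"
  shows "\<bar>f (move x b t) - f x\<bar> \<le> (2 * (C + 1) + K * (sqrt (1 + C) + 2 * (C + 1))) * \<bar>t - x \<bullet> b\<bar>"
proof -
  have tay: "\<exists>p. degree p < r \<and> poly p (x \<bullet> b) = h x \<and> (\<forall>t. 0 \<le> t \<and> t < 1 --> \<bar>h (move x b t) - poly p t\<bar> \<le> (C + 1) * \<bar>t - x \<bullet> b\<bar> powr s)"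
    if hx: "h \<in> holder_space s" "holder_norm s h \<le> C" "x \<in> ucube" "b \<in> Basis" for h :: "'e::euclidean_space => real" and x b
  proof -
    have xc: "x \<in> unit_cube" using hx ucube_subset by auto
    obtain p where p: "degree p < r" "\<And>t. 0 \<le> t ==> t \<le> 1 ==> \<bar>h (move x b t) - poly p t\<bar> \<le> (C + 1) * \<bar>t - x \<bullet> b\<bar> powr s"
      using holder_taylor_axis[OF s hx(1,2) xc hx(4)] by blast
    have "poly p (x \<bullet> b) = h x" using p(2)[of "x \<bullet> b"] xc hx by (auto simp: mem_unit_cube)
    then show ?thesis using p by auto
  qed
  obtain pg where pg: "degree pg < r" "poly pg (x \<bullet> b) = g x" "\<And>t. 0 \<le> t ==> t < 1 ==> \<bar>g (move x b t) - poly pg t\<bar> \<le> (C + 1) * \<bar>t - x \<bullet> b\<bar> powr s"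
    using tay[OF holder_g x b] by blast
  \<comment> \<open>Along an axis of \<open>x\<close> the function \<open>m\<close> is constant;
    along an axis of \<open>z\<close> the move is a move in its own cube.\<close>
  have "\<exists>pm. degree pm < r \<and> poly pm (x \<bullet> b) = m (snd x) \<and> (\<forall>t. 0 \<le> t \<and> t < 1 --> \<bar>m (snd (move x b t)) - poly pm t\<bar> \<le> (C + 1) * \<bar>t - x \<bullet> b\<bar> powr s)"
  proof (cases "snd b = 0")
    case True
    then show ?thesis using constants s by (intro exI[of _ "[:m (snd x):]"]) (auto simp: move_def)
  next
    case False
    then obtain b' where b': "b = (0, b')" "b' \<in> Basis" using b by (auto simp: Basis_prod_def)
    have "snd (move x b t) = move (snd x) b' t" "x \<bullet> b = snd x \<bullet> b'" for t by (simp_all add: move_def b' inner_prod_def)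
    then show ?thesis using tay[OF holder_m snd_ucube[OF x] b'(2)] by simp
  qed
  then obtain pm where pm: "degree pm < r" "poly pm (x \<bullet> b) = m (snd x)" "\<And>t. 0 \<le> t ==> t < 1 ==> \<bar>m (snd (move x b t)) - poly pm t\<bar> \<le> (C + 1) * \<bar>t - x \<bullet> b\<bar> powr s"
    by blast
  define p where "p = pg - pm"
  define x0 where "x0 = x \<bullet> b"
  have x0: "0 \<le> x0" "x0 < 1" using x b by (auto simp: x0_def ucube_def)
  have dp: "degree p \<le> r" unfolding p_def using pg pm by (intro degree_diff_le) auto
  have p0: "poly p x0 = f x" using pg pm by (simp add: p_def f_def x0_def)
  have rem: "\<bar>f (move x b t) - poly p t\<bar> \<le> 2 * (C + 1) * \<bar>t - x0\<bar>" if "0 \<le> t" "t < 1" for t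
  proof -
    have "\<bar>t - x0\<bar> powr s \<le> \<bar>t - x0\<bar> powr 1" using that x0 s by (intro powr_mono') auto
    then have a: "(C + 1) * \<bar>t - x0\<bar> powr s \<le> (C + 1) * \<bar>t - x0\<bar>" using constants by (intro mult_left_mono) (auto split: if_splits)
    have "\<bar>g (move x b t) - poly pg t\<bar> \<le> (C + 1) * \<bar>t - x0\<bar>" "\<bar>m (snd (move x b t)) - poly pm t\<bar> \<le> (C + 1) * \<bar>t - x0\<bar>"
      using pg(3)[OF that] pm(3)[OF that] a unfolding x0_def by auto
    moreover have "2 * (C + 1) * \<bar>t - x0\<bar> = (C + 1) * \<bar>t - x0\<bar> + (C + 1) * \<bar>t - x0\<bar>" by simp
    ultimately show ?thesis unfolding f_def p_def poly_diff by linarith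
  qed
  have pb: "\<bar>poly p t\<bar> \<le> sqrt (1 + C) + 2 * (C + 1)" if "0 \<le> t" "t < 1" for t
  proof -
    have "move x b t \<in> unit_cube" using move_ucube[OF x b that] ucube_subset by auto
    from f_sq_le[OF this] have "\<bar>f (move x b t)\<bar> \<le> sqrt (1 + C)" by (rule real_le_rsqrt[of "\<bar>_\<bar>", simplified])
    moreover have "2 * (C + 1) * \<bar>t - x0\<bar> \<le> 2 * (C + 1) * 1" using that x0 constants by (intro mult_left_mono) auto
    ultimately show ?thesis using rem[OF that] by linarith
  qed
  have "\<bar>poly p t - poly p x0\<bar> \<le> K * (sqrt (1 + C) + 2 * (C + 1)) * (\<bar>t - x0\<bar> / 1)"
    using K(2)[of p 1 0 "sqrt (1 + C) + 2 * (C + 1)" t x0] dp pb t x0 by simp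
  then show ?thesis using rem[OF t] p0 unfolding x0_def by (simp add: distrib_right)
qed

text \<open>The grid cell around a zero of \<open>f\<close> is so small that
  \<open>\<bar>f\<bar>\<close> stays below \<open>\<kappa>\<close> on it. The grid \<open>L\<close>
  is chosen from the Lipschitz constant alone, so the lower bound for the mass is uniform over the
  class.\<close>

lemma f_small_set:
  assumes M: "M > 0" "\<And>x b t. x \<in> ucube ==> b \<in> Basis ==> 0 \<le> t ==> t < 1 ==> \<bar>f (move x b t) - f x\<bar> \<le> M * \<bar>t - x \<bullet> b\<bar>"
    and L: "0 < L" "M * DIM(('dx, 'dz) cov) \<le> \<kappa> * real L"
  shows "c * (1 / real L) ^ DIM(('dx, 'dz) cov) \<le> measure \<nu> {v. \<bar>f v\<bar> \<le> \<kappa>}"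
proof -
  interpret nu: prob_space \<nu> by (rule prob_nu)
  obtain x where x: "x \<in> ucube" "f x = 0" by (rule f_zero)
  define \<kappa>' where "\<kappa>' = cell_index L x"
  have k: "\<kappa>' \<in> cell_indices L" "x \<in> cell L \<kappa>'" using x L by (auto simp: \<kappa>'_def intro: cell_index_in in_cell_index)
  have "cell L \<kappa>' \<subseteq> {v. \<bar>f v\<bar> \<le> \<kappa>}"
  proof
    fix y assume y: "y \<in> cell L \<kappa>'"
    have yu: "y \<in> ucube" using y cell_subset_ucube[OF k(1)] by auto
    have "\<bar>f y - f x\<bar> \<le> M * (\<Sum>b\<in>Basis. \<bar>y \<bullet> b - x \<bullet> b\<bar>)" by (rule lipschitz_from_axes[OF M(2) x(1) yu])
    also have "... \<le> M * (\<Sum>b\<in>(Basis :: (('dx, 'dz) cov) set). 1 / real L)"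
    proof (intro mult_left_mono sum_mono)
      fix b :: "('dx, 'dz) cov" assume b: "b \<in> Basis"
      have "\<bar>real L * (y \<bullet> b) - real L * (x \<bullet> b)\<bar> \<le> 1" using y k(2) b by (force simp: cell_def)
      then have "real L * \<bar>y \<bullet> b - x \<bullet> b\<bar> \<le> 1" unfolding right_diff_distrib[symmetric] abs_mult by simp
      then show "\<bar>y \<bullet> b - x \<bullet> b\<bar> \<le> 1 / real L" using L by (simp add: field_simps)
    qed (use M in auto)
    also have "... = M * DIM(('dx, 'dz) cov) / real L" by simp
    also have "... \<le> \<kappa>" using L by (simp add: pos_divide_le_eq del: DIM_prod)
    finally show "y \<in> {v. \<bar>f v\<bar> \<le> \<kappa>}" using x by simp
  qed
  moreover have "{v. \<bar>f v\<bar> \<le> \<kappa>} \<in> sets \<nu>" by simp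
  ultimately have "measure \<nu> (cell L \<kappa>') \<le> measure \<nu> {v. \<bar>f v\<bar> \<le> \<kappa>}" by (rule nu.finite_measure_mono)
  then show ?thesis using nu_cell(1)[OF L(1) k(1)] by linarith
qed

text \<open>Where \<open>f\<close> is small the noise takes both signs: its mean is negligible, while its second
  moment is bounded below and its moment of order \<open>2 + \<delta>\<close> is bounded above.\<close>

lemma noise_sign:
  fixes \<sigma> :: "('dx, 'dz) cov => real"
  assumes \<sigma>: "\<sigma> \<in> borel_measurable borel" "\<And>v. \<sigma> v = 1 \<or> \<sigma> v = -1"
    and \<kappa>: "0 < \<kappa>" "\<kappa> = c / (24 * t)" and t: "t = (2 * C / c) powr (1 / \<delta>)"
    and \<eta>: "\<eta> \<le> measure \<nu> {v. \<bar>f v\<bar> \<le> \<kappa>}"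
  shows "c / (8 * t * (1 + C)) * (c / (4 * t)) * \<eta> \<le> prob {a. \<sigma> (obs_XZ a) * \<epsilon> a \<le> - \<kappa>}"
proof -
  have tp: "0 < t" using constants unfolding t by simp
  \<comment> \<open>The truncation level is chosen so that values of
    \<open>\<bar>\<epsilon>\<bar>\<close> above \<open>t\<close> contribute at most half of the
    lower bound \<open>c\<close> to the second moment.\<close>
  have tpow: "t powr \<delta> = 2 * C / c" using constants unfolding t by (simp add: powr_powr)
  define A where "A = {v. \<bar>f v\<bar> \<le> \<kappa>}"
  have A [measurable]: "A \<in> sets borel" unfolding A_def by measurable
  have [measurable]: "\<sigma> \<in> borel_measurable borel" by fact
  define \<mu> where "\<mu> = measure \<nu> A"
  define I where "I a = (indicator A (obs_XZ a) :: real)" for a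
  have Im [measurable]: "I \<in> borel_measurable P" unfolding I_def using A by (intro XZ_P) simp
  have \<sigma>m [measurable]: "(%a. \<sigma> (obs_XZ a)) \<in> borel_measurable P" by (intro XZ_P) simp
  have \<epsilon>m [measurable]: "\<epsilon> \<in> borel_measurable P" by (simp add: measP)
  define X where "X a = \<sigma> (obs_XZ a) * \<epsilon> a" for a
  have Xa: "\<bar>X a\<bar> = \<bar>\<epsilon> a\<bar>" for a using \<sigma>(2)[of "obs_XZ a"] by (auto simp: X_def)
  have Xm [measurable]: "X \<in> borel_measurable P" unfolding X_def by measurable
  define B where "B = {a. X a \<le> - \<kappa>}"
  have B [measurable]: "B \<in> sets P"
  proof -
    have "{a \<in> space P. X a \<le> - \<kappa>} \<in> sets P" by measurable
    then show ?thesis by (simp add: B_def)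
  qed
  have iI: "integrable P I" "(\<integral>a. I a \<partial>P) = \<mu>"
  proof -
    have m: "(indicator A :: _ => real) \<in> borel_measurable borel" by simp
    show "integrable P I" unfolding I_def by (rule integrable_bounded_XZ(1)[OF m, of 1]) (simp add: indicator_def)
    show "(\<integral>a. I a \<partial>P) = \<mu>" unfolding I_def \<mu>_def integral_nu[OF m, symmetric] by simp
  qed
  have i1: "integrable P (%a. I a * \<bar>\<epsilon> a\<bar>)"
    by (rule Bochner_Integration.integrable_bound[OF integrable_eps]) (auto simp: I_def indicator_def)
  have i2: "integrable P (%a. I a * (\<epsilon> a)^2)" using integrable_ind_eps2[OF A] by (simp add: I_def)
  have iX: "integrable P (%a. I a * X a)"
    by (rule Bochner_Integration.integrable_bound[OF integrable_eps]) (use Xa in \<open>auto simp: I_def indicator_def\<close>)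
  have iB: "integrable P (indicator B :: _ => real)" by (rule integrable_const_bound[where B = 1]) auto
  note i3 = epsh_bounds[OF A, folded I_def \<mu>_def]
  note e2 = eps2_bounds[OF A, folded I_def \<mu>_def]
  have mean: "(\<integral>a. I a * X a \<partial>P) \<le> \<kappa> * \<mu>"
  proof -
    define k where "k v = indicator A v * \<sigma> v" for v
    have km: "k \<in> borel_measurable borel" unfolding k_def by measurable
    have kb: "\<bar>k v\<bar> \<le> 1" for v using \<sigma>(2)[of v] by (auto simp: k_def indicator_def)
    have "(\<integral>a. I a * X a \<partial>P) = (\<integral>a. k (obs_XZ a) * \<epsilon> a \<partial>P)" by (simp add: I_def X_def k_def mult.assoc)
    also have "... = (\<integral>a. k (obs_XZ a) * f (obs_XZ a) \<partial>P)" by (rule eps_XZ(2)[OF km kb])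
    also have "... \<le> (\<integral>a. \<kappa> * I a \<partial>P)"
    proof (rule integral_mono)
      obtain F where F: "F > 0" "\<And>v. v \<in> ucube ==> \<bar>f v\<bar> \<le> F" using f_bound_ucube by blast
      show "integrable P (%a. k (obs_XZ a) * f (obs_XZ a))"
      proof (rule integrable_bounded_XZ(1)[of "%v. k v * f v" F])
        show "(%v. k v * f v) \<in> borel_measurable borel" using km by measurable
        show "\<bar>k v * f v\<bar> \<le> F" if "v \<in> ucube" for v
          using mult_mono[OF kb[of v] F(2)[OF that]] by (simp add: abs_mult)
      qed
      show "integrable P (%a. \<kappa> * I a)" using iI by simp
      fix a show "k (obs_XZ a) * f (obs_XZ a) \<le> \<kappa> * I a"
        using \<sigma>(2)[of "obs_XZ a"] by (auto simp: k_def I_def A_def indicator_def)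
    qed
    finally show ?thesis using iI by simp
  qed
  \<comment> \<open>A first absolute moment bounded below: \<open>\<epsilon>^2\<close> is at most
    \<open>t \<bar>\<epsilon>\<bar>\<close> below the level \<open>t\<close> and at most
    \<open>c / (2 C)\<close> times the higher power above it.\<close>
  have "c * \<mu> \<le> t * (\<integral>a. I a * \<bar>\<epsilon> a\<bar> \<partial>P) + c / (2 * C) * (C * \<mu>)"
  proof -
    have "(\<integral>a. I a * (\<epsilon> a)^2 \<partial>P) \<le> (\<integral>a. t * (I a * \<bar>\<epsilon> a\<bar>) + c / (2 * C) * (I a * \<bar>\<epsilon> a\<bar> powr (2 + \<delta>)) \<partial>P)"
    proof (rule integral_mono[OF i2])
      show "integrable P (%a. t * (I a * \<bar>\<epsilon> a\<bar>) + c / (2 * C) * (I a * \<bar>\<epsilon> a\<bar> powr (2 + \<delta>)))" using i1 i3(1) by auto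
      fix a
      have "(\<epsilon> a)^2 \<le> t * \<bar>\<epsilon> a\<bar> + c / (2 * C) * \<bar>\<epsilon> a\<bar> powr (2 + \<delta>)"
      proof (cases "\<bar>\<epsilon> a\<bar> \<le> t")
        case True
        then have "\<bar>\<epsilon> a\<bar> * \<bar>\<epsilon> a\<bar> \<le> t * \<bar>\<epsilon> a\<bar>" by (intro mult_right_mono) auto
        then have "(\<epsilon> a)^2 \<le> t * \<bar>\<epsilon> a\<bar>" by (simp add: power2_eq_square)
        moreover have "0 \<le> c / (2 * C) * \<bar>\<epsilon> a\<bar> powr (2 + \<delta>)" using constants by simp
        ultimately show ?thesis by linarith
      next
        case False
        then have e0: "0 < \<bar>\<epsilon> a\<bar>" using tp by linarith
        have "2 * C / c \<le> \<bar>\<epsilon> a\<bar> powr \<delta>" unfolding tpow[symmetric] using False tp constants by (intro powr_mono2) auto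
        then have "1 \<le> c / (2 * C) * \<bar>\<epsilon> a\<bar> powr \<delta>" using constants by (simp add: field_simps)
        then have "(\<epsilon> a)^2 * 1 \<le> (\<epsilon> a)^2 * (c / (2 * C) * \<bar>\<epsilon> a\<bar> powr \<delta>)" by (intro mult_left_mono) auto
        also have "... = c / (2 * C) * \<bar>\<epsilon> a\<bar> powr (2 + \<delta>)" using e0 by (simp add: powr_add)
        finally show ?thesis using tp by (simp add: add_increasing)
      qed
      then have "I a * (\<epsilon> a)^2 \<le> I a * (t * \<bar>\<epsilon> a\<bar> + c / (2 * C) * \<bar>\<epsilon> a\<bar> powr (2 + \<delta>))"
        by (rule mult_left_mono) (simp add: I_def)
      then show "I a * (\<epsilon> a)^2 \<le> t * (I a * \<bar>\<epsilon> a\<bar>) + c / (2 * C) * (I a * \<bar>\<epsilon> a\<bar> powr (2 + \<delta>))" by (simp add: algebra_simps)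
    qed
    also have "... = t * (\<integral>a. I a * \<bar>\<epsilon> a\<bar> \<partial>P) + c / (2 * C) * (\<integral>a. I a * \<bar>\<epsilon> a\<bar> powr (2 + \<delta>) \<partial>P)"
      using i1 i3(1) by simp
    also have "... \<le> t * (\<integral>a. I a * \<bar>\<epsilon> a\<bar> \<partial>P) + c / (2 * C) * (C * \<mu>)"
      using i3(2) constants by (intro add_left_mono mult_left_mono) auto
    finally show ?thesis using e2(2) by linarith
  qed
  then have low: "c / (2 * t) * \<mu> \<le> (\<integral>a. I a * \<bar>\<epsilon> a\<bar> \<partial>P)" using tp constants by (simp add: field_simps)
  \<comment> \<open>With this choice \<open>3 \<kappa>\<close> and \<open>\<theta> (1 + C)\<close>
    both equal \<open>c / (8 t)\<close>; their sum is half of the lower bound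
    \<open>c / (2 t)\<close>, and the other half is left for the probability of
    \<open>B\<close>.\<close>
  define \<theta> where "\<theta> = c / (8 * t * (1 + C))"
  have \<theta>: "0 < \<theta>" using tp constants by (simp add: \<theta>_def)
  have "(\<integral>a. I a * \<bar>\<epsilon> a\<bar> \<partial>P) \<le> (\<integral>a. I a * X a + 2 * \<kappa> * I a + \<theta> * (I a * (\<epsilon> a)^2) + (1 / \<theta>) * indicator B a \<partial>P)"
  proof (rule integral_mono[OF i1])
    show "integrable P (%a. I a * X a + 2 * \<kappa> * I a + \<theta> * (I a * (\<epsilon> a)^2) + (1 / \<theta>) * indicator B a)" using iX iI i2 iB by auto
    fix a
    \<comment> \<open>\<open>\<bar>X\<bar>\<close> exceeds \<open>X\<close> by twice its negative
      part. Off \<open>B\<close> this is at most \<open>2 \<kappa>\<close>; on \<open>B\<close> it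
      is at most \<open>2 \<bar>X\<bar> \<le> \<theta> X^2 + 1 / \<theta>\<close>.\<close>
    have "I a * \<bar>X a\<bar> \<le> I a * X a + 2 * \<kappa> * I a + \<theta> * (I a * (X a)^2) + (1 / \<theta>) * indicator B a"
    proof (cases "obs_XZ a \<in> A")
      case False then show ?thesis using \<theta> by (simp add: I_def)
    next
      case True
      then have I1: "I a = 1" by (simp add: I_def)
      show ?thesis
      proof (cases "a \<in> B")
        case False
        then have "\<bar>X a\<bar> \<le> X a + 2 * \<kappa>" using \<kappa>(1) by (auto simp: B_def)
        then show ?thesis using \<theta> False I1 by (simp add: add_increasing2)
      next
        case True
        have "0 \<le> (\<theta> * \<bar>X a\<bar> - 1)^2 / \<theta>" using \<theta> by simp
        also have "... = \<theta> * (X a)^2 + 1 / \<theta> - 2 * \<bar>X a\<bar>" using \<theta> by (simp add: power2_eq_square field_simps)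
        finally have "2 * \<bar>X a\<bar> \<le> \<theta> * (X a)^2 + 1 / \<theta>" by simp
        moreover have "\<bar>X a\<bar> \<le> X a + 2 * \<bar>X a\<bar>" by simp
        ultimately have "\<bar>X a\<bar> \<le> X a + 2 * \<kappa> + \<theta> * (X a)^2 + 1 / \<theta>" using \<kappa>(1) by linarith
        then show ?thesis using True I1 by simp
      qed
    qed
    moreover have "(X a)^2 = (\<epsilon> a)^2" using Xa[of a] by (metis power2_abs)
    ultimately show "I a * \<bar>\<epsilon> a\<bar> \<le> I a * X a + 2 * \<kappa> * I a + \<theta> * (I a * (\<epsilon> a)^2) + (1 / \<theta>) * indicator B a"
      using Xa by simp
  qed
  also have "... = (\<integral>a. I a * X a \<partial>P) + 2 * \<kappa> * \<mu> + \<theta> * (\<integral>a. I a * (\<epsilon> a)^2 \<partial>P) + (1 / \<theta>) * prob B"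
    using iX iI i2 iB by simp
  also have "... \<le> \<kappa> * \<mu> + 2 * \<kappa> * \<mu> + \<theta> * ((1 + C) * \<mu>) + (1 / \<theta>) * prob B"
    using mean e2(1) \<theta> \<kappa>(1) by (intro add_mono mult_left_mono) auto
  finally have up: "(\<integral>a. I a * \<bar>\<epsilon> a\<bar> \<partial>P) \<le> (3 * \<kappa> + \<theta> * (1 + C)) * \<mu> + (1 / \<theta>) * prob B" by (simp add: algebra_simps)
  have D0: "1 + C \<noteq> 0" using constants by simp
  have "\<theta> * (1 + C) = c / (8 * t)"
    unfolding \<theta>_def by (simp only: times_divide_eq_left nonzero_mult_divide_mult_cancel_right[OF D0])
  then have "3 * \<kappa> + \<theta> * (1 + C) = c / (4 * t)" using tp unfolding \<kappa>(2) by (simp add: field_simps)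
  then have "c / (2 * t) * \<mu> \<le> c / (4 * t) * \<mu> + (1 / \<theta>) * prob B" using up low by simp
  moreover have "c / (2 * t) * \<mu> = c / (4 * t) * \<mu> + c / (4 * t) * \<mu>" using tp by (simp add: field_simps)
  ultimately have "c / (4 * t) * \<mu> \<le> (1 / \<theta>) * prob B" by linarith
  then have "\<theta> * (c / (4 * t) * \<mu>) \<le> \<theta> * ((1 / \<theta>) * prob B)" using \<theta> by (intro mult_left_mono) auto
  then have "\<theta> * (c / (4 * t)) * \<mu> \<le> prob B" using \<theta> by simp
  moreover have "\<theta> * (c / (4 * t)) * \<eta> \<le> \<theta> * (c / (4 * t)) * \<mu>"
    using \<eta> \<theta> tp constants unfolding \<mu>_def A_def by (intro mult_left_mono) auto
  ultimately show ?thesis unfolding B_def X_def \<theta>_def by linarith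
qed

end

section \<open>Deterministic analysis of the estimators\<close>

type_synonym ('dx, 'dz) sample = "nat => ('dx, 'dz) obs"

text \<open>The empirical measure as the law of a uniformly chosen observation, a form in which
  \<open>pp_norm_le\<close> applies to it.\<close>

lemma empirical_measure:
  fixes x :: "nat => 'a::euclidean_space" and h :: "'a => real"
  assumes J: "finite J" "J \<noteq> {}"
  defines "E \<equiv> distr (uniform_count_measure J) borel x"
  shows "finite_measure E" "sets E = sets borel"
    "h \<in> borel_measurable borel ==> (\<integral>v. h v \<partial>E) = (\<Sum>i\<in>J. h (x i)) / real (card J)"
    "A \<in> sets borel ==> measure E A = (\<Sum>i\<in>J. indicator A (x i)) / real (card J)"
    "(\<And>i. i \<in> J ==> x i \<in> S) ==> S \<in> sets borel ==> AE v in E. v \<in> S"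
proof -
  have x: "x \<in> measurable (uniform_count_measure J) borel" by (auto simp: measurable_def sets_uniform_count_measure space_uniform_count_measure)
  interpret E: prob_space E unfolding E_def
    by (rule prob_space.prob_space_distr[OF prob_space_uniform_count_measure[OF J] x])
  show "finite_measure E" by standard simp
  show "sets E = sets borel" by (simp add: E_def)
  show i: "(\<integral>v. h v \<partial>E) = (\<Sum>i\<in>J. h (x i)) / real (card J)" if "h \<in> borel_measurable borel" for h :: "'a => real"
    unfolding E_def integral_distr[OF x that] by (rule integral_uniform_count_measure[OF J(1)])
  show "measure E A = (\<Sum>i\<in>J. indicator A (x i)) / real (card J)" if "A \<in> sets borel"
    using i[of "indicator A"] that by (simp add: E_def)
  show "AE v in E. v \<in> S" if "\<And>i. i \<in> J ==> x i \<in> S" "S \<in> sets borel"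
    unfolding E_def using that by (subst AE_distr_iff[OF x]) (auto intro!: AE_I2 simp: space_uniform_count_measure)
qed

lemma integral_cauchy_schwarz:
  fixes u v :: "'a => real"
  assumes "integrable M (%x. (u x)^2)" "integrable M (%x. (v x)^2)" "integrable M (%x. u x * v x)"
  shows "(\<integral>x. u x * v x \<partial>M)^2 \<le> (\<integral>x. (u x)^2 \<partial>M) * (\<integral>x. (v x)^2 \<partial>M)"
proof -
  define a where "a = (\<integral>x. (u x)^2 \<partial>M)"
  define b where "b = (\<integral>x. u x * v x \<partial>M)"
  define d where "d = (\<integral>x. (v x)^2 \<partial>M)"
  have d0: "0 \<le> d" unfolding d_def by (intro integral_nonneg_AE) auto
  have q: "0 \<le> a + 2 * t * b + t\<^sup>2 * d" for t
  proof -
    have "0 \<le> (\<integral>x. (u x + t * v x)^2 \<partial>M)" by (intro integral_nonneg_AE) auto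
    also have "(%x. (u x + t * v x)^2) = (%x. (u x)^2 + (2 * t) * (u x * v x) + t\<^sup>2 * (v x)^2)"
      by (simp add: fun_eq_iff power2_eq_square algebra_simps)
    also have "(\<integral>x. ... x \<partial>M) = a + 2 * t * b + t\<^sup>2 * d" using assms by (simp add: a_def b_def d_def)
    finally show ?thesis .
  qed
  have "b\<^sup>2 \<le> a * d"
  proof (cases "d = 0")
    case True
    have "b = 0"
    proof (rule ccontr)
      assume "b \<noteq> 0"
      then have "2 * (- (a + 1) / (2 * b)) * b = - (a + 1)" by simp
      then show False using q[of "- (a + 1) / (2 * b)"] True by simp
    qed
    then show ?thesis using True by simp
  next
    case False
    then have "0 < d" using d0 by simp
    moreover have "0 \<le> a + 2 * (- b / d) * b + (- b / d)^2 * d" by (rule q)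
    ultimately show ?thesis by (simp add: power2_eq_square field_simps)
  qed
  then show ?thesis by (simp add: a_def b_def d_def)
qed

lemma fit_comp: "fit ginv K (%w. b (h w)) I x y w = fit ginv K b I (%i. h (x i)) y (h w)"
  by (simp add: fit_def ols_kernel_def gram_def)

text \<open>Here \<open>n\<close> and the number of knots are fixed. \<open>M\<close> is the
  refinement factor from the comparison of coarse and fine cells, for the degree
  \<open>2 r - 2\<close> that covers both spline orders, \<open>r\<close> and
  \<open>2 r - 1\<close>; \<open>\<rho>\<close> is a common bound for the three approximation
  errors.\<close>

locale spline_test = regression_model P g m p r s C c \<delta>
  for P :: "('dx::{finite,linorder}, 'dz::{finite,linorder}) obs measure" and g m p r s C c \<delta> +
  fixes ginv :: "real Matrix.mat => real Matrix.mat" and N n M dd :: nat and \<rho> :: real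
  assumes ginv: "generalised_inverse_rule ginv" and n: "0 < n" and M: "0 < M" and dd: "dd = DIM(('dx, 'dz) cov)"
    and fine: "\<And>(v :: ('dx, 'dz) cov => real) \<kappa>. \<kappa> \<in> cell_indices (N + 1) ==> pp (N + 1) (2 * r - 2) v ==>
     (\<exists>\<kappa>'\<in>cell_indices ((N + 1) * M). cell ((N + 1) * M) \<kappa>' \<subseteq> cell (N + 1) \<kappa> \<and>
        (\<forall>x\<in>cell (N + 1) \<kappa>. \<forall>y\<in>cell ((N + 1) * M) \<kappa>'. \<bar>v x\<bar> \<le> 2 * \<bar>v y\<bar>))"
    and \<rho>: "0 \<le> \<rho>"
    and approx_g: "\<exists>v. spn ((N + r) ^ CARD('dx) * (N + r) ^ CARD('dz)) (basis_xz r N) v \<and> (\<forall>w::('dx, 'dz) cov\<in>ucube. \<bar>g w - v w\<bar> \<le> \<rho>)"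
    and approx_m: "\<exists>v. spn ((N + r) ^ CARD('dz)) (basis_z r N) v \<and> (\<forall>w::('dx, 'dz) cov\<in>ucube. \<bar>m (snd w) - v w\<bar> \<le> \<rho>)"
    and approx_m': "\<exists>v. spn ((N + (2 * r - 1)) ^ CARD('dz)) (basis_z (2 * r - 1) N) v \<and> (\<forall>w::('dx, 'dz) cov\<in>ucube. \<bar>m (snd w) - v w\<bar> \<le> \<rho>)"
begin

lemma r_pos: "0 < r" "r \<le> 2 * r - 2 + 1" "0 < 2 * r - 1" "2 * r - 1 \<le> 2 * r - 2 + 1"
  using s by linarith+

text \<open>A factor 4 from squaring \<open>\<bar>v x\<bar> \<le> 2 \<bar>v y\<bar>\<close>, a
  factor 3 from the upper bound for cell counts, the ratio \<open>C / c\<close> of the density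
  bounds and the volume ratio \<open>M ^ dd\<close> of coarse and fine cells.\<close>

definition "\<kappa> = 12 * C * real M ^ dd / c"
definition "Kc = real (N + 1) ^ dd"
text \<open>Block 0 holds the observations that are averaged in the statistic; the blocks 1, 2 and 3
  are the data sets of the three fitting stages.\<close>

definition blk :: "nat => nat set" where "blk k = {k * n + 1..(k + 1) * n}"
definition W :: "('dx, 'dz) sample => nat => ('dx, 'dz) cov" where "W D i = obs_XZ (D i)"
definition emp :: "nat => ('dx, 'dz) sample => (('dx, 'dz) cov => real) => real" where
  "emp k D h = (\<Sum>i\<in>blk k. (h (W D i))^2) / real n"
text \<open>Every fine cell receives more than half of its expected number of observations and every
  coarse cell less than three times it. Only covariates enter, and on this event the comparison of
  norms is purely deterministic.\<close>

definition good :: "nat => ('dx, 'dz) sample => bool" where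
  "good k D \<longleftrightarrow> (\<forall>i\<in>blk k. W D i \<in> ucube) \<and>
     (\<forall>\<kappa>\<in>cell_indices ((N + 1) * M). real n * measure \<nu> (cell ((N + 1) * M) \<kappa>) / 2 < (\<Sum>i\<in>blk k. indicator (cell ((N + 1) * M) \<kappa>) (W D i))) \<and>
     (\<forall>\<kappa>\<in>cell_indices (N + 1). (\<Sum>i\<in>blk k. indicator (cell (N + 1) \<kappa>) (W D i)) < 3 * (real n * measure \<nu> (cell (N + 1) \<kappa>)))"

abbreviation PP :: "(('dx, 'dz) cov => real) => bool" where "PP \<equiv> pp (N + 1) (2 * r - 2)"

text \<open>Boundedness is asked for on \<open>ucube\<close> only, where \<open>\<nu>\<close> is
  concentrated; outside it the functions are not controlled.\<close>

definition bm :: "(('dx, 'dz) cov => real) => bool" where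
  "bm h \<longleftrightarrow> h \<in> borel_measurable borel \<and> (\<exists>B. \<forall>v\<in>ucube. \<bar>h v\<bar> \<le> B)"

definition ip :: "(('dx, 'dz) cov => real) => (('dx, 'dz) cov => real) => real" where "ip u v = (\<integral>x. u x * v x \<partial>\<nu>)"
definition Q :: "(('dx, 'dz) cov => real) => real" where "Q u = (\<integral>x. (u x)^2 \<partial>\<nu>)"

lemma blk_finite [simp]: "finite (blk k)" and blk_card [simp]: "card (blk k) = n" and blk_ne: "blk k \<noteq> {}"
  using n by (auto simp: blk_def)

lemma Kc_ge_1: "1 \<le> Kc"
  unfolding Kc_def by (rule one_le_power) simp

text \<open>A probability density on the unit cube that is at least \<open>c\<close> forces
  \<open>c \<le> 1\<close>.\<close>

lemma kappa_ge_1: "1 \<le> \<kappa>"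
proof -
  interpret nu: prob_space \<nu> by (rule prob_nu)
  have k: "(\<lambda>_\<in>Basis. 0) \<in> (cell_indices 1 :: (('dx, 'dz) cov => nat) set)" by (auto simp: cell_indices_def)
  have "c * (1 / real 1) ^ dd \<le> 1" using nu_cell(1)[OF _ k, folded dd] nu.prob_le_1[of "cell 1 (\<lambda>_\<in>Basis. 0)"] by (simp add: order_trans)
  then have c1: "c \<le> 1" by simp
  have "1 * 1 \<le> C * real M ^ dd" using constants M by (intro mult_mono one_le_power) auto
  then have "c * 1 \<le> 12 * (C * real M ^ dd)" using c1 by linarith
  then show ?thesis using constants by (simp add: \<kappa>_def pos_le_divide_eq mult.assoc)
qed

lemma bm_I: "h \<in> borel_measurable borel ==> (\<And>v. v \<in> ucube ==> \<bar>h v\<bar> \<le> B) ==> bm h" unfolding bm_def by blast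

lemma bm_add: "bm u ==> bm v ==> bm (%x. u x + v x)"
proof -
  assume "bm u" "bm v"
  then obtain A B where *: "u \<in> borel_measurable borel" "v \<in> borel_measurable borel" "\<forall>x\<in>ucube. \<bar>u x\<bar> \<le> A" "\<forall>x\<in>ucube. \<bar>v x\<bar> \<le> B" unfolding bm_def by blast
  then show ?thesis by (intro bm_I[of _ "A + B"]) (auto intro!: order_trans[OF abs_triangle_ineq] add_mono simp del: split_paired_All)
qed

lemma bm_mult: "bm u ==> bm v ==> bm (%x. u x * v x)"
proof -
  assume "bm u" "bm v"
  then obtain A B where *: "u \<in> borel_measurable borel" "v \<in> borel_measurable borel" "\<forall>x\<in>ucube. \<bar>u x\<bar> \<le> A" "\<forall>x\<in>ucube. \<bar>v x\<bar> \<le> B" unfolding bm_def by blast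
  show ?thesis
  proof (rule bm_I[of _ "A * B"])
    show "(%x. u x * v x) \<in> borel_measurable borel" using * by measurable
    fix x :: "('dx, 'dz) cov" assume x: "x \<in> ucube"
    have "\<bar>u x\<bar> \<le> A" "\<bar>v x\<bar> \<le> B" using * x by auto
    then show "\<bar>u x * v x\<bar> \<le> A * B" unfolding abs_mult by (intro mult_mono) auto
  qed
qed

lemma bm_const: "bm (%x. a)" by (rule bm_I[of _ "\<bar>a\<bar>"]) auto

lemma bm_cmult: "bm v ==> bm (%x. a * v x)" by (rule bm_mult[OF bm_const])

lemma bm_diff: "bm u ==> bm v ==> bm (%x. u x - v x)" using bm_add[OF _ bm_cmult[of v "-1"], of u] by simp

lemma bm_integrable: "bm h ==> integrable \<nu> h"
  unfolding bm_def using integrable_bounded_XZ(2) by blast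

lemma bm_square: "bm h ==> integrable \<nu> (%x. (h x)^2)"
  using bm_integrable[OF bm_mult, of h h] by (simp add: power2_eq_square)

lemma bm_PP: "PP v ==> bm v" by (auto simp: pp_def bm_def)

lemma bm_f: "bm f"
proof -
  obtain F where "F > 0" "\<And>v. v \<in> ucube ==> \<bar>f v\<bar> \<le> F" using f_bound_ucube by blast
  then show ?thesis by (intro bm_I[OF f_meas])
qed

lemma bm_g: "bm g" and bm_m: "bm (%v. m (snd v))"
proof -
  obtain B where "B > 0" "\<And>v. v \<in> ucube ==> \<bar>g v\<bar> \<le> B" using bounded_on_ucube[OF holder_continuous[OF s(1) holder_g(1)]] by blast
  then show g: "bm g" by (intro bm_I) auto
  show "bm (%v. m (snd v))" using bm_diff[OF g bm_f] by (simp add: f_def)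
qed

lemma ip_add_left: "bm u ==> bm v ==> bm w ==> ip (%x. u x + v x) w = ip u w + ip v w"
  and ip_add_right: "bm u ==> bm v ==> bm w ==> ip w (%x. u x + v x) = ip w u + ip w v"
  and ip_diff_left: "bm u ==> bm v ==> bm w ==> ip (%x. u x - v x) w = ip u w - ip v w"
  and ip_diff_right: "bm u ==> bm v ==> bm w ==> ip w (%x. u x - v x) = ip w u - ip w v"
  and ip_cmult_right: "ip w (%x. a * u x) = a * ip w u"
  unfolding ip_def by (simp_all add: distrib_left distrib_right left_diff_distrib right_diff_distrib bm_integrable bm_mult mult.assoc mult.left_commute)

lemma ip_sum_right: "(\<And>i. i \<in> I ==> bm (v i)) ==> bm w ==> ip w (%x. \<Sum>i\<in>I. v i x) = (\<Sum>i\<in>I. ip w (v i))"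
  unfolding ip_def by (simp add: sum_distrib_left Bochner_Integration.integral_sum bm_integrable bm_mult)

lemma ip_commute: "ip u v = ip v u" by (simp add: ip_def mult.commute)

lemma Q_nonneg: "0 \<le> Q u" unfolding Q_def by (intro integral_nonneg_AE) auto

lemma ip_le: "bm u ==> bm v ==> (ip u v)^2 \<le> Q u * Q v"
  unfolding ip_def Q_def by (intro integral_cauchy_schwarz bm_square bm_integrable bm_mult)

lemma ip_abs_le: assumes "bm u" "bm v" "Q u \<le> a" "Q v \<le> b" shows "\<bar>ip u v\<bar> \<le> sqrt (a * b)"
proof -
  have "(ip u v)^2 \<le> Q u * Q v" using assms by (intro ip_le)
  also have "... \<le> a * b" using assms Q_nonneg by (intro mult_mono) (auto intro: order_trans[OF Q_nonneg])
  finally have "sqrt ((ip u v)^2) \<le> sqrt (a * b)" by (rule real_sqrt_le_mono)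
  then show ?thesis by simp
qed

lemma Q_add_le: "bm u ==> bm v ==> Q (%x. u x + v x) \<le> 2 * Q u + 2 * Q v"
proof -
  assume u: "bm u" and v: "bm v"
  have "Q (%x. u x + v x) \<le> (\<integral>x. 2 * (u x)^2 + 2 * (v x)^2 \<partial>\<nu>)"
    unfolding Q_def
  proof (rule integral_mono)
    fix x show "(u x + v x)^2 \<le> 2 * (u x)^2 + 2 * (v x)^2"
      using sum_squares_bound[of "u x" "v x"] by (simp add: power2_sum)
  qed (use u v bm_square bm_square[OF bm_add[OF u v]] in auto)
  then show ?thesis using bm_square[OF u] bm_square[OF v] by (simp add: Q_def)
qed

lemma Q_diff_le: "bm u ==> bm v ==> Q (%x. u x - v x) \<le> 2 * Q u + 2 * Q v"
  using Q_add_le[OF _ bm_cmult[of v "-1"], of u] by (simp add: Q_def)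

lemma Q_sup_le: "h \<in> borel_measurable borel ==> (\<And>v. v \<in> ucube ==> \<bar>h v\<bar> \<le> a) ==> Q h \<le> a\<^sup>2"
proof -
  assume h: "h \<in> borel_measurable borel" "\<And>v. v \<in> ucube ==> \<bar>h v\<bar> \<le> a"
  interpret nu: prob_space \<nu> by (rule prob_nu)
  have "Q h \<le> (\<integral>x. a\<^sup>2 \<partial>\<nu>)" unfolding Q_def
  proof (rule integral_mono_AE)
    show "AE x in \<nu>. (h x)^2 \<le> a\<^sup>2" using AE_nu_ucube
    proof eventually_elim
      case (elim x) then show ?case using power_mono[OF h(2)[OF elim], of 2] by simp
    qed
  qed (use bm_square[OF bm_I[OF h]] in auto)
  then show ?thesis using nu.prob_space by simp
qed

lemma Q_f: "Q f = \<tau>"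
  unfolding Q_def \<tau>_def by (rule integral_nu) measurable

context
  fixes D :: "nat => ('dx, 'dz) obs" and k :: nat
  assumes gd: "good k D"
begin

lemma fine_mass:
  assumes "\<kappa>' \<in> cell_indices ((N + 1) * M)"
  shows "c / (real M ^ dd * Kc) \<le> measure \<nu> (cell ((N + 1) * M) \<kappa>')"
proof -
  have "(1 / real ((N + 1) * M)) ^ dd = 1 / (real M ^ dd * Kc)" unfolding Kc_def of_nat_mult by (simp add: power_mult_distrib power_divide)
  then show ?thesis using nu_cell(1)[of "(N + 1) * M" \<kappa>', folded dd] M assms by simp
qed

lemma coarse_mass:
  assumes "\<kappa>' \<in> cell_indices (N + 1)"
  shows "measure \<nu> (cell (N + 1) \<kappa>') \<le> C / Kc"
  using nu_cell(2)[of "N + 1" \<kappa>', folded dd] assms by (simp add: Kc_def power_divide)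

text \<open>The lower count of a fine cell against the population mass of a coarse cell gives the
  factor 8, the upper count of a coarse cell against the population mass of a fine cell gives 12;
  \<open>\<kappa>\<close> covers both directions.\<close>

lemma norm_comparison:
  assumes v: "PP v"
  shows "Q v \<le> \<kappa> * emp k D v" "emp k D v \<le> \<kappa> * Q v"
proof -
  interpret nu: prob_space \<nu> by (rule prob_nu)
  define E where "E = distr (uniform_count_measure (blk k)) borel (W D)"
  note em = empirical_measure[OF blk_finite[of k] blk_ne[of k], where x = "W D", folded E_def]
  have AE: "AE v in E. v \<in> ucube" using gd by (intro em(5)) (auto simp: good_def)
  have eQ: "(\<integral>x. (v x)^2 \<partial>E) = emp k D v" using pp_measurable[OF v] by (subst em(3)) (auto simp: emp_def)
  have Kc0: "0 < Kc" using Kc_ge_1 by linarith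
  have nr: "0 < real n" using n by simp
  define e where "e \<kappa>' = (SOME S. \<exists>\<kappa>''\<in>cell_indices ((N + 1) * M). S = cell ((N + 1) * M) \<kappa>'' \<and> S \<subseteq> cell (N + 1) \<kappa>' \<and>
        (\<forall>x\<in>cell (N + 1) \<kappa>'. \<forall>y\<in>S. \<bar>v x\<bar> \<le> 2 * \<bar>v y\<bar>))" for \<kappa>'
  have e: "\<exists>\<kappa>''\<in>cell_indices ((N + 1) * M). e \<kappa>' = cell ((N + 1) * M) \<kappa>'' \<and> e \<kappa>' \<subseteq> cell (N + 1) \<kappa>' \<and>
        (\<forall>x\<in>cell (N + 1) \<kappa>'. \<forall>y\<in>e \<kappa>'. \<bar>v x\<bar> \<le> 2 * \<bar>v y\<bar>)" if "\<kappa>' \<in> cell_indices (N + 1)" for \<kappa>'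
    unfolding e_def by (rule someI_ex) (use fine[OF that v] in blast)
  obtain A where A: "\<And>x. x \<in> ucube ==> \<bar>v x\<bar> \<le> A" using v unfolding pp_def by blast
  have finel: "c / (real M ^ dd * Kc) / 2 \<le> measure E (cell ((N + 1) * M) \<kappa>')" if "\<kappa>' \<in> cell_indices ((N + 1) * M)" for \<kappa>'
  proof -
    have "c / (real M ^ dd * Kc) / 2 \<le> measure \<nu> (cell ((N + 1) * M) \<kappa>') / 2" using fine_mass[OF that] by simp
    also have "... = (real n * measure \<nu> (cell ((N + 1) * M) \<kappa>') / 2) / real n" using nr by simp
    also have "... \<le> (\<Sum>i\<in>blk k. indicator (cell ((N + 1) * M) \<kappa>') (W D i)) / real n"
      using gd that by (intro divide_right_mono) (auto simp: good_def less_imp_le)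
    also have "... = measure E (cell ((N + 1) * M) \<kappa>')" by (subst em(4)) auto
    finally show ?thesis .
  qed
  have coarseu: "measure E (cell (N + 1) \<kappa>') \<le> 3 * (C / Kc)" if "\<kappa>' \<in> cell_indices (N + 1)" for \<kappa>'
  proof -
    have "measure E (cell (N + 1) \<kappa>') = (\<Sum>i\<in>blk k. indicator (cell (N + 1) \<kappa>') (W D i)) / real n" by (subst em(4)) auto
    also have "... \<le> 3 * (real n * measure \<nu> (cell (N + 1) \<kappa>')) / real n"
      using gd that by (intro divide_right_mono) (auto simp: good_def less_imp_le)
    also have "... = 3 * measure \<nu> (cell (N + 1) \<kappa>')" using nr by simp
    also have "... \<le> 3 * (C / Kc)" using coarse_mass[OF that] by simp
    finally show ?thesis .
  qed
  have Mp: "0 < real M ^ dd" using M by simp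
  have "(\<integral>x. (v x)^2 \<partial>\<nu>) \<le> 4 * (2 * C * real M ^ dd / c) * (\<integral>x. (v x)^2 \<partial>E)"
  proof (rule pp_norm_le[where e = e and L = "N + 1" and A = A])
    fix \<kappa>' :: "('dx, 'dz) cov => nat" assume k: "\<kappa>' \<in> cell_indices (N + 1)"
    obtain \<kappa>'' where k'': "\<kappa>'' \<in> cell_indices ((N + 1) * M)" "e \<kappa>' = cell ((N + 1) * M) \<kappa>''" using e[OF k] by blast
    have "measure \<nu> (cell (N + 1) \<kappa>') \<le> C / Kc" by (rule coarse_mass[OF k])
    also have "... = (2 * C * real M ^ dd / c) * (c / (real M ^ dd * Kc) / 2)" using Mp Kc0 constants by (simp add: field_simps)
    also have "... \<le> (2 * C * real M ^ dd / c) * measure E (e \<kappa>')" unfolding k'' using finel[OF k''(1)] constants by (intro mult_left_mono) auto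
    finally show "e \<kappa>' \<in> sets borel \<and> e \<kappa>' \<subseteq> cell (N + 1) \<kappa>' \<and> measure \<nu> (cell (N + 1) \<kappa>') \<le> (2 * C * real M ^ dd / c) * measure E (e \<kappa>')
        \<and> (\<forall>x\<in>cell (N + 1) \<kappa>'. \<forall>y\<in>e \<kappa>'. \<bar>v x\<bar> \<le> 2 * \<bar>v y\<bar>)"
      using e[OF k] k''(2) by auto
  qed (use nu.finite_measure_axioms em(1,2) AE AE_nu_ucube A pp_measurable[OF v] constants in auto)
  then have "Q v \<le> (8 * C * real M ^ dd / c) * emp k D v" unfolding eQ Q_def by simp
  also have "... \<le> \<kappa> * emp k D v" unfolding \<kappa>_def using constants
    by (intro mult_right_mono divide_right_mono) (auto simp: emp_def sum_nonneg)
  finally show "Q v \<le> \<kappa> * emp k D v" .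
  have "(\<integral>x. (v x)^2 \<partial>E) \<le> 4 * (3 * C * real M ^ dd / c) * (\<integral>x. (v x)^2 \<partial>\<nu>)"
  proof (rule pp_norm_le[where e = e and L = "N + 1" and A = A])
    fix \<kappa>' :: "('dx, 'dz) cov => nat" assume k: "\<kappa>' \<in> cell_indices (N + 1)"
    obtain \<kappa>'' where k'': "\<kappa>'' \<in> cell_indices ((N + 1) * M)" "e \<kappa>' = cell ((N + 1) * M) \<kappa>''" using e[OF k] by blast
    have "measure E (cell (N + 1) \<kappa>') \<le> 3 * (C / Kc)" by (rule coarseu[OF k])
    also have "... = (3 * C * real M ^ dd / c) * (c / (real M ^ dd * Kc))" using Mp Kc0 constants by (simp add: field_simps)
    also have "... \<le> (3 * C * real M ^ dd / c) * measure \<nu> (e \<kappa>')" unfolding k'' using fine_mass[OF k''(1)] constants by (intro mult_left_mono) auto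
    finally show "e \<kappa>' \<in> sets borel \<and> e \<kappa>' \<subseteq> cell (N + 1) \<kappa>' \<and> measure E (cell (N + 1) \<kappa>') \<le> (3 * C * real M ^ dd / c) * measure \<nu> (e \<kappa>')
        \<and> (\<forall>x\<in>cell (N + 1) \<kappa>'. \<forall>y\<in>e \<kappa>'. \<bar>v x\<bar> \<le> 2 * \<bar>v y\<bar>)"
      using e[OF k] k''(2) by auto
  qed (use nu.finite_measure_axioms em(1,2) AE AE_nu_ucube A pp_measurable[OF v] constants in auto)
  then show "emp k D v \<le> \<kappa> * Q v" unfolding eQ Q_def \<kappa>_def by simp
qed

text \<open>An inverse inequality: where \<open>v\<close> is large at a point, it is at least half
  as large on an entire fine cell, whose mass is at least of the order
  \<open>1 / Kc\<close>.\<close>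

lemma sup_bound:
  assumes v: "PP v" and x: "x \<in> ucube"
  shows "(v x)^2 \<le> \<kappa> * Kc * Q v"
proof -
  interpret nu: prob_space \<nu> by (rule prob_nu)
  define \<kappa>' where "\<kappa>' = cell_index (N + 1) x"
  have k: "\<kappa>' \<in> cell_indices (N + 1)" "x \<in> cell (N + 1) \<kappa>'" using x by (auto simp: \<kappa>'_def intro: cell_index_in in_cell_index)
  obtain \<kappa>'' where k'': "\<kappa>'' \<in> cell_indices ((N + 1) * M)" "\<And>y. y \<in> cell ((N + 1) * M) \<kappa>'' ==> \<bar>v x\<bar> \<le> 2 * \<bar>v y\<bar>"
    using fine[OF k(1) v] k(2) by blast
  obtain A where A: "\<And>x. x \<in> ucube ==> \<bar>v x\<bar> \<le> A" using v unfolding pp_def by blast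
  have Kc0: "0 < Kc" using Kc_ge_1 by linarith
  have Mp: "0 < real M ^ dd" using M by simp
  have "(v x)^2 * (c / (real M ^ dd * Kc)) \<le> (v x)^2 * measure \<nu> (cell ((N + 1) * M) \<kappa>'')"
    using fine_mass[OF k''(1)] by (intro mult_left_mono) auto
  also have "... \<le> 4 * Q v" unfolding Q_def
    by (rule pp_sup_le[where A = A]) (use nu.finite_measure_axioms AE_nu_ucube A pp_measurable[OF v] k'' in auto)
  finally have "(v x)^2 * c \<le> 4 * Q v * (real M ^ dd * Kc)" using Mp Kc0 by (simp add: field_simps)
  then have "(v x)^2 \<le> 4 * real M ^ dd / c * (Kc * Q v)" using constants by (simp add: field_simps)
  also have "... \<le> \<kappa> * (Kc * Q v)" unfolding \<kappa>_def
  proof (intro mult_right_mono divide_right_mono)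
    show "4 \<le> 12 * C" using constants by simp
  qed (use constants Kc0 Q_nonneg in auto)
  finally show ?thesis by (simp add: mult.assoc)
qed

end

end

section \<open>Fits as linear operators: leverage, bias and the conditional mean\<close>

definition unit_at :: "nat => nat => real" where "unit_at j i = (if i = j then 1 else 0)"

lemma fit_unit_at: "finite I ==> fit ginv K b I x y v = (\<Sum>j\<in>I. y j * fit ginv K b I x (unit_at j) v)"
  unfolding fit_def by (intro sum.cong refl) (simp add: unit_at_def if_distrib[of "%t. _ * t"] sum.delta' cong: if_cong)

lemma fit_lincomb: "fit ginv K b I x (%i. \<Sum>j\<in>J. c j * z j i) v = (\<Sum>j\<in>J. c j * fit ginv K b I x (z j) v)"
  unfolding fit_sum by (simp only: fit_cmult)

text \<open>Closes the self-bounding estimates, in which a square is first bounded by a multiple of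
  the quantity itself.\<close>

lemma le_of_square_le: "0 \<le> (a::real) ==> 0 \<le> b ==> a\<^sup>2 \<le> b * a ==> a \<le> b"
  by (cases "a = 0") (auto simp: power2_eq_square)

context spline_test
begin

text \<open>The fits act on an arbitrary response vector \<open>y\<close>, and the sample
  \<open>D\<close> enters through its covariates alone. They can thus be applied separately to
  regression function, noise, unit vectors and weight vectors.\<close>

definition A2 :: "('dx, 'dz) sample => (nat => real) => ('dx, 'dz) cov => real" where
  "A2 D = fit ginv ((N + r) ^ CARD('dx) * (N + r) ^ CARD('dz)) (basis_xz r N) (blk 1) (W D)"
definition AZ :: "('dx, 'dz) sample => (nat => real) => ('dx, 'dz) cov => real" where
  "AZ D = fit ginv ((N + r) ^ CARD('dz)) (basis_z r N) (blk 1) (W D)"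
definition BZ :: "nat => ('dx, 'dz) sample => (nat => real) => ('dx, 'dz) cov => real" where
  "BZ k D = fit ginv ((N + (2 * r - 1)) ^ CARD('dz)) (basis_z (2 * r - 1) N) (blk k) (W D)"
definition fh :: "('dx, 'dz) sample => (nat => real) => ('dx, 'dz) cov => real" where
  "fh D y v = A2 D y v - AZ D (%i. A2 D y (W D i)) v"
text \<open>For \<open>y\<close> the observed responses this is the fitted direction: the fitted
  contrast minus its regression on \<open>Z\<close> from the next data set.\<close>

definition Fo :: "('dx, 'dz) sample => (nat => real) => ('dx, 'dz) cov => real" where
  "Fo D y v = fh D y v - BZ 2 D (%i. fh D y (W D i)) v"

lemma PP_xz: "spn ((N + r) ^ CARD('dx) * (N + r) ^ CARD('dz)) (basis_xz r N :: ('dx, 'dz) cov => _) v ==> PP v"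
  by (rule pp_spn[OF pp_basis_xz[OF r_pos(1,2)]])

lemma PP_z: "spn ((N + r) ^ CARD('dz)) (basis_z r N :: ('dx, 'dz) cov => _) v ==> PP v"
  by (rule pp_spn[OF pp_basis_z[OF r_pos(1,2)]])

lemma PP_z': "spn ((N + (2 * r - 1)) ^ CARD('dz)) (basis_z (2 * r - 1) N :: ('dx, 'dz) cov => _) v ==> PP v"
  by (rule pp_spn[OF pp_basis_z[OF r_pos(3,4)]])

lemma PP_A2: "PP (A2 D y)" and PP_AZ: "PP (AZ D y)" and PP_BZ: "PP (BZ k D y)"
  unfolding A2_def AZ_def BZ_def by (rule PP_xz[OF spn_fit] PP_z[OF spn_fit] PP_z'[OF spn_fit])+

lemma PP_fh: "PP (fh D y)" unfolding fh_def[abs_def] by (intro pp_diff PP_A2 PP_AZ)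

lemma PP_Fo: "PP (Fo D y)" unfolding Fo_def[abs_def] by (intro pp_diff PP_fh PP_BZ)

lemma spn_z_fst: assumes "spn K (basis_z r' N :: ('dx, 'dz) cov => _) v" shows "v (x, z) = v (x', z)"
proof -
  obtain c where "\<And>w. v w = (\<Sum>l<K. c l * basis_z r' N w $ l)" using assms by (auto simp: spn_def simp del: split_paired_All)
  then show ?thesis by (simp add: basis_z_def)
qed

lemma f_orthogonal_PP_z:
  assumes "PP h" "\<And>x x' z. h (x, z) = h (x', z)"
  shows "ip f h = 0"
proof -
  obtain B where "\<And>v. v \<in> ucube ==> \<bar>h v\<bar> \<le> B" using assms(1) unfolding pp_def by blast
  then show ?thesis unfolding ip_def using assms by (intro f_orthogonal_Z[of h B] pp_measurable)
qed

lemma fh_linear: "fh D y v = (\<Sum>j\<in>blk 1. y j * fh D (unit_at j) v)"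
proof -
  have a: "A2 D y = (%v. \<Sum>j\<in>blk 1. y j * A2 D (unit_at j) v)" unfolding A2_def by (rule ext) (rule fit_unit_at, simp)
  have "AZ D (%i. A2 D y (W D i)) v = (\<Sum>j\<in>blk 1. y j * AZ D (%i. A2 D (unit_at j) (W D i)) v)"
    unfolding a AZ_def by (rule fit_lincomb)
  moreover have "A2 D y v = (\<Sum>j\<in>blk 1. y j * A2 D (unit_at j) v)" by (simp only: a)
  ultimately show ?thesis unfolding fh_def by (simp only: sum_subtractf right_diff_distrib)
qed

lemma Fo_linear: "Fo D y v = (\<Sum>j\<in>blk 1. y j * Fo D (unit_at j) v)"
proof -
  have a: "fh D y = (%v. \<Sum>j\<in>blk 1. y j * fh D (unit_at j) v)" by (rule ext) (rule fh_linear)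
  have "BZ 2 D (%i. fh D y (W D i)) v = (\<Sum>j\<in>blk 1. y j * BZ 2 D (%i. fh D (unit_at j) (W D i)) v)"
    unfolding a BZ_def by (rule fit_lincomb)
  moreover have "fh D y v = (\<Sum>j\<in>blk 1. y j * fh D (unit_at j) v)" by (rule fh_linear)
  ultimately show ?thesis unfolding Fo_def by (simp only: sum_subtractf right_diff_distrib)
qed

lemma Fo_add: "Fo D (%i. y i + z i) v = Fo D y v + Fo D z v"
  unfolding Fo_linear[of D "%i. y i + z i"] Fo_linear[of D y] Fo_linear[of D z] by (simp add: distrib_right sum.distrib)

lemma emp_nonneg: "0 \<le> emp k D h" by (simp add: emp_def sum_nonneg)

lemma emp_le_sq: "(\<And>v. v \<in> ucube ==> \<bar>h v\<bar> \<le> a) ==> good k D ==> emp k D h \<le> a\<^sup>2"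
proof -
  assume h: "\<And>v. v \<in> ucube ==> \<bar>h v\<bar> \<le> a" and g: "good k D"
  have "(\<Sum>i\<in>blk k. (h (W D i))^2) \<le> (\<Sum>i\<in>blk k. a\<^sup>2)"
  proof (rule sum_mono)
    fix i assume "i \<in> blk k"
    then have "\<bar>h (W D i)\<bar> \<le> a" using g h by (auto simp: good_def)
    from power_mono[OF this, of 2] show "(h (W D i))^2 \<le> a\<^sup>2" by simp
  qed
  then show ?thesis using n by (simp add: emp_def pos_divide_le_eq mult.commute)
qed

lemma emp_fit_le:
  "emp k D (fit ginv K b (blk k) (W D) y) \<le> (\<Sum>i\<in>blk k. (y i)^2) / real n"
  unfolding emp_def by (intro divide_right_mono fit_contraction[OF ginv]) auto

text \<open>For the fit \<open>v\<close> of the unit vector at \<open>j\<close> the normal equations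
  give \<open>n * emp v = v (W D j)\<close>, a diagonal entry of the hat matrix. The inverse
  inequality bounds the square of this value by \<open>\<kappa>^2 * Kc * emp v\<close>, and one
  factor \<open>emp v\<close> cancels.\<close>

lemma leverage:
  assumes g: "good k D" and b: "\<And>y. PP (fit ginv K b (blk k) (W D) y)" and j: "j \<in> blk k"
  shows "emp k D (fit ginv K b (blk k) (W D) (unit_at j)) \<le> \<kappa>^2 * Kc / (real n)^2"
proof -
  define v where "v = fit ginv K b (blk k) (W D) (unit_at j)"
  have v: "PP v" unfolding v_def by (rule b)
  have k0: "0 \<le> \<kappa>" "0 \<le> Kc" using kappa_ge_1 Kc_ge_1 by auto
  have "(\<Sum>i\<in>blk k. (unit_at j i - v (W D i)) * v (W D i)) = 0" unfolding v_def
    by (rule fit_normal[OF ginv blk_finite spn_fit])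
  then have "(\<Sum>i\<in>blk k. (v (W D i))^2) = (\<Sum>i\<in>blk k. unit_at j i * v (W D i))"
    by (simp add: left_diff_distrib sum_subtractf power2_eq_square)
  also have "... = (\<Sum>i\<in>blk k. if i = j then v (W D i) else 0)" by (intro sum.cong refl) (simp add: unit_at_def)
  also have "... = v (W D j)" using j by (simp add: sum.delta)
  finally have e: "real n * emp k D v = v (W D j)" using n by (simp add: emp_def)
  have "(v (W D j))^2 \<le> \<kappa> * Kc * Q v" using sup_bound[OF g v] g j by (auto simp: good_def)
  also have "... \<le> \<kappa> * Kc * (\<kappa> * emp k D v)" using norm_comparison(1)[OF g v] k0 by (intro mult_left_mono) auto
  finally have "(real n)^2 * (emp k D v)^2 \<le> \<kappa>^2 * Kc * emp k D v"
    unfolding e[symmetric] by (simp add: power2_eq_square mult_ac)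
  then have sq: "(emp k D v)^2 \<le> \<kappa>^2 * Kc / (real n)^2 * emp k D v" using n by (simp add: field_simps)
  have nn: "0 \<le> \<kappa>^2 * Kc / (real n)^2" using k0 by simp
  from le_of_square_le[OF emp_nonneg nn sq] show ?thesis unfolding v_def .
qed

lemma leverage_A2: "good 1 D ==> j \<in> blk 1 ==> emp 1 D (A2 D (unit_at j)) \<le> \<kappa>^2 * Kc / (real n)^2"
  unfolding A2_def by (rule leverage[OF _ PP_A2[unfolded A2_def]])

lemma leverage_BZ: "good k D ==> j \<in> blk k ==> emp k D (BZ k D (unit_at j)) \<le> \<kappa>^2 * Kc / (real n)^2"
  unfolding BZ_def by (rule leverage[OF _ PP_BZ[unfolded BZ_def]])

lemma Q_BZ_le: "good k D ==> Q (BZ k D y) \<le> \<kappa> * ((\<Sum>i\<in>blk k. (y i)^2) / real n)"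
proof -
  assume g: "good k D"
  have "Q (BZ k D y) \<le> \<kappa> * emp k D (BZ k D y)" by (rule norm_comparison(1)[OF g PP_BZ])
  also have "... \<le> \<kappa> * ((\<Sum>i\<in>blk k. (y i)^2) / real n)" unfolding BZ_def using kappa_ge_1 by (intro mult_left_mono emp_fit_le) auto
  finally show ?thesis .
qed

text \<open>The fit is a projection for the empirical inner product of its own block; in the
  population norm it is still bounded, at the cost of comparing norms in both directions.\<close>

lemma Q_residual_le:
  assumes g: "good 2 D" and v: "PP v"
  shows "Q (%x. v x - BZ 2 D (%i. v (W D i)) x) \<le> 4 * \<kappa>^2 * Q v"
proof -
  have "Q (%x. v x - BZ 2 D (%i. v (W D i)) x) \<le> 2 * Q v + 2 * Q (BZ 2 D (%i. v (W D i)))"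
    by (intro Q_diff_le bm_PP v PP_BZ)
  also have "Q (BZ 2 D (%i. v (W D i))) \<le> \<kappa> * emp 2 D v" using Q_BZ_le[OF g, of "%i. v (W D i)"] by (simp add: emp_def)
  also have "\<kappa> * emp 2 D v \<le> \<kappa> * (\<kappa> * Q v)" using norm_comparison(2)[OF g v] kappa_ge_1 by (intro mult_left_mono) auto
  also have "2 * Q v + 2 * (\<kappa> * (\<kappa> * Q v)) \<le> 4 * \<kappa>^2 * Q v"
  proof -
    have "1 * Q v \<le> \<kappa>^2 * Q v" using kappa_ge_1 Q_nonneg by (intro mult_right_mono one_le_power) auto
    then show ?thesis by (simp add: power2_eq_square mult_ac)
  qed
  finally show ?thesis by simp
qed

lemma Q_Fo_le_fh:
  assumes "good 1 D" "good 2 D"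
  shows "Q (Fo D y) \<le> 4 * \<kappa> ^ 3 * emp 1 D (fh D y)"
proof -
  have "Q (Fo D y) \<le> 4 * \<kappa>^2 * Q (fh D y)" unfolding Fo_def[abs_def] by (rule Q_residual_le[OF assms(2) PP_fh])
  also have "... \<le> 4 * \<kappa>^2 * (\<kappa> * emp 1 D (fh D y))" using norm_comparison(1)[OF assms(1) PP_fh] by (intro mult_left_mono) auto
  finally show ?thesis by (simp add: power3_eq_cube power2_eq_square mult_ac)
qed

text \<open>Both regressions use the same block, so subtracting the second fit is an exact empirical
  projection and costs no constant.\<close>

lemma emp_fh_le: "emp 1 D (fh D y) \<le> emp 1 D (A2 D y)"
proof -
  have "(\<Sum>i\<in>blk 1. (A2 D y (W D i) - AZ D (%i. A2 D y (W D i)) (W D i))^2) \<le> (\<Sum>i\<in>blk 1. (A2 D y (W D i) - 0)^2)"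
    unfolding AZ_def by (rule fit_residual_le[OF ginv blk_finite spn_zero])
  then show ?thesis unfolding emp_def fh_def by (intro divide_right_mono) auto
qed

lemma kappa3: "0 \<le> 4 * \<kappa> ^ 3" using kappa_ge_1 by simp

lemma Q_Fo_le:
  assumes "good 1 D" "good 2 D"
  shows "Q (Fo D y) \<le> 4 * \<kappa> ^ 3 * emp 1 D (A2 D y)" "Q (Fo D y) \<le> 4 * \<kappa> ^ 3 * ((\<Sum>i\<in>blk 1. (y i)^2) / real n)"
proof -
  show 1: "Q (Fo D y) \<le> 4 * \<kappa> ^ 3 * emp 1 D (A2 D y)"
    by (rule order_trans[OF Q_Fo_le_fh[OF assms] mult_left_mono[OF emp_fh_le kappa3]])
  have "emp 1 D (A2 D y) \<le> (\<Sum>i\<in>blk 1. (y i)^2) / real n" unfolding A2_def by (rule emp_fit_le)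
  from order_trans[OF 1 mult_left_mono[OF this kappa3]] show "Q (Fo D y) \<le> 4 * \<kappa> ^ 3 * ((\<Sum>i\<in>blk 1. (y i)^2) / real n)" .
qed

text \<open>The comparison of norms applies to piecewise polynomials, which \<open>h\<close> is not.
  It is therefore applied to the difference of the fit and the approximant \<open>v\<close>, whose
  empirical norm is at most that of \<open>h - v\<close>.\<close>

lemma Q_fit_bias:
  assumes g: "good k D" and h: "h \<in> borel_measurable borel"
    and v: "spn K b v" "\<And>w. w \<in> ucube ==> \<bar>h w - v w\<bar> \<le> \<rho>" and PPb: "\<And>u. spn K b u ==> PP u"
  shows "Q (%w. h w - fit ginv K b (blk k) (W D) (%i. h (W D i)) w) \<le> 4 * \<kappa> * \<rho>^2"
    "emp k D (%w. fit ginv K b (blk k) (W D) (%i. h (W D i)) w - v w) \<le> \<rho>^2"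
proof -
  define F where "F = fit ginv K b (blk k) (W D) (%i. h (W D i))"
  have F: "spn K b F" unfolding F_def by (rule spn_fit)
  have "(\<Sum>i\<in>blk k. (F (W D i) - v (W D i))^2) \<le> (\<Sum>i\<in>blk k. (h (W D i) - v (W D i))^2)"
    unfolding F_def by (rule fit_diff_le[OF ginv blk_finite v(1)])
  then have "emp k D (%w. F w - v w) \<le> emp k D (%w. h w - v w)" unfolding emp_def by (intro divide_right_mono) auto
  also have "... \<le> \<rho>^2" by (rule emp_le_sq[OF v(2) g])
  finally show e: "emp k D (%w. F w - v w) \<le> \<rho>^2" .
  have PPd: "PP (%w. F w - v w)" by (intro PPb spn_diff F v(1))
  have "Q (%w. F w - v w) \<le> \<kappa> * emp k D (%w. F w - v w)" by (rule norm_comparison(1)[OF g PPd])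
  also have "... \<le> \<kappa> * \<rho>^2" using e kappa_ge_1 by (intro mult_left_mono) auto
  finally have q1: "Q (%w. F w - v w) \<le> \<kappa> * \<rho>^2" .
  have hm: "(%w. h w - v w) \<in> borel_measurable borel" using h pp_measurable[OF PPb[OF v(1)]] by measurable
  have q2: "Q (%w. h w - v w) \<le> \<rho>^2" by (rule Q_sup_le[OF hm v(2)])
  have "Q (%w. (h w - v w) - (F w - v w)) \<le> 2 * Q (%w. h w - v w) + 2 * Q (%w. F w - v w)"
    by (intro Q_diff_le bm_PP PPd bm_I[OF hm v(2)])
  also have "... \<le> 2 * \<rho>^2 + 2 * (\<kappa> * \<rho>^2)" using q1 q2 by linarith
  also have "... \<le> 4 * \<kappa> * \<rho>^2" using mult_right_mono[OF kappa_ge_1 zero_le_power2[of \<rho>]] by linarith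
  finally show "Q (%w. h w - F w) \<le> 4 * \<kappa> * \<rho>^2" by simp
qed

definition gW :: "('dx, 'dz) sample => nat => real" where "gW D i = g (W D i)"
definition mW :: "('dx, 'dz) sample => nat => real" where "mW D i = m (snd (W D i))"
definition bias :: "('dx, 'dz) sample => ('dx, 'dz) cov => real" where "bias D v = m (snd v) - BZ 3 D (mW D) v"

lemma m_snd_meas [measurable]: "(%v::('dx, 'dz) cov. m (snd v)) \<in> borel_measurable borel"
  by measurable

lemma bm_bias: "bm (bias D)" unfolding bias_def[abs_def] by (intro bm_diff bm_m bm_PP PP_BZ)

lemma Q_bias: assumes "good 3 D" shows "Q (bias D) \<le> 4 * \<kappa> * \<rho>^2"
proof -
  obtain v where v: "spn ((N + (2 * r - 1)) ^ CARD('dz)) (basis_z (2 * r - 1) N) v" "\<forall>w::('dx, 'dz) cov\<in>ucube. \<bar>m (snd w) - v w\<bar> \<le> \<rho>"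
    using approx_m' by blast
  show ?thesis unfolding bias_def[abs_def] BZ_def mW_def[abs_def]
    by (rule Q_fit_bias(1)[OF assms m_snd_meas v(1) _ PP_z']) (use v(2) in blast)
qed

lemma approx_g_fit: assumes "good 1 D" shows "Q (%w. g w - A2 D (gW D) w) \<le> 4 * \<kappa> * \<rho>^2"
proof -
  obtain v where v: "spn ((N + r) ^ CARD('dx) * (N + r) ^ CARD('dz)) (basis_xz r N) v" "\<forall>w::('dx, 'dz) cov\<in>ucube. \<bar>g w - v w\<bar> \<le> \<rho>"
    using approx_g by blast
  show ?thesis unfolding A2_def gW_def[abs_def]
    by (rule Q_fit_bias(1)[OF assms g_meas v(1) _ PP_xz]) (use v(2) in blast)
qed

text \<open>Without noise the fitted contrast should be as small as \<open>f\<close>: residuals of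
  the regression on \<open>Z\<close> are no larger than those for the approximant \<open>u\<close>
  of \<open>m\<close>. Hence the size of the direction scales with the signal rather than with
  \<open>g\<close>.\<close>

lemma emp_fh_g: assumes gd: "good 1 D" shows "emp 1 D (fh D (gW D)) \<le> 12 * \<rho>^2 + 4 * emp 1 D f"
proof -
  obtain v where v: "spn ((N + r) ^ CARD('dx) * (N + r) ^ CARD('dz)) (basis_xz r N) v" "\<And>w::('dx, 'dz) cov. w\<in>ucube ==> \<bar>g w - v w\<bar> \<le> \<rho>"
    using approx_g by blast
  obtain u where u: "spn ((N + r) ^ CARD('dz)) (basis_z r N) u" "\<And>w::('dx, 'dz) cov. w\<in>ucube ==> \<bar>m (snd w) - u w\<bar> \<le> \<rho>"
    using approx_m by blast
  define F where "F = A2 D (gW D)"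
  have e: "emp 1 D (%w. F w - v w) \<le> \<rho>^2" unfolding F_def A2_def gW_def[abs_def]
    by (rule Q_fit_bias(2)[OF gd g_meas v(1) v(2) PP_xz])
  have "(\<Sum>i\<in>blk 1. (F (W D i) - AZ D (%i. F (W D i)) (W D i))^2) \<le> (\<Sum>i\<in>blk 1. (F (W D i) - u (W D i))^2)"
    unfolding AZ_def by (rule fit_residual_le[OF ginv blk_finite u(1)])
  also have "... \<le> (\<Sum>i\<in>blk 1. 4 * (F (W D i) - v (W D i))^2 + 8 * \<rho>^2 + 4 * (f (W D i))^2)"
  proof (rule sum_mono)
    fix i assume "i \<in> blk 1"
    then have w: "W D i \<in> ucube" using gd by (simp add: good_def)
    \<comment> \<open>Four terms: fit minus approximant of \<open>g\<close>, approximation error of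
      \<open>g\<close>, the signal \<open>f\<close>, approximation error of
      \<open>m\<close>.\<close>
    define a where "a = F (W D i) - v (W D i)"
    define b where "b = v (W D i) - g (W D i)"
    define d where "d = f (W D i)"
    define e where "e = m (snd (W D i)) - u (W D i)"
    have b: "b\<^sup>2 \<le> \<rho>^2" using power_mono[OF v(2)[OF w], of 2] by (simp add: b_def power2_commute)
    have e: "e\<^sup>2 \<le> \<rho>^2" using power_mono[OF u(2)[OF w], of 2] by (simp add: e_def)
    have "(a + b + d + e)^2 \<le> 4 * (a\<^sup>2 + b\<^sup>2 + d\<^sup>2 + e\<^sup>2)"
    proof -
      have "0 \<le> (a - b)^2 + (a - d)^2 + (a - e)^2 + (b - d)^2 + (b - e)^2 + (d - e)^2" by simp
      then show ?thesis by (simp add: power2_eq_square algebra_simps)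
    qed
    moreover have "F (W D i) - u (W D i) = a + b + d + e" by (simp add: a_def b_def d_def e_def f_def)
    ultimately show "(F (W D i) - u (W D i))^2 \<le> 4 * (F (W D i) - v (W D i))^2 + 8 * \<rho>^2 + 4 * (f (W D i))^2"
      using b e unfolding a_def[symmetric] d_def[symmetric] by (simp add: algebra_simps)
  qed
  also have "... = real n * (4 * emp 1 D (%w. F w - v w) + 8 * \<rho>^2 + 4 * emp 1 D f)"
    using n by (simp add: emp_def sum.distrib sum_distrib_left[symmetric] distrib_left)
  also have "... \<le> real n * (4 * \<rho>^2 + 8 * \<rho>^2 + 4 * emp 1 D f)" using e by (intro mult_left_mono) auto
  finally have "(\<Sum>i\<in>blk 1. (F (W D i) - AZ D (%i. F (W D i)) (W D i))^2) \<le> (12 * \<rho>^2 + 4 * emp 1 D f) * real n" by (simp add: algebra_simps)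
  then show ?thesis using n unfolding emp_def[of 1 D "fh D (gW D)"] fh_def F_def by (simp add: pos_divide_le_eq)
qed

lemma Q_Fo_g: assumes "good 1 D" "good 2 D" shows "Q (Fo D (gW D)) \<le> 4 * \<kappa> ^ 3 * (12 * \<rho>^2 + 4 * emp 1 D f)"
  by (rule order_trans[OF Q_Fo_le_fh[OF assms] mult_left_mono[OF emp_fh_g[OF assms(1)] kappa3]])

text \<open>Both corrections are functions of \<open>z\<close> alone, to which \<open>f\<close> is
  orthogonal; partialling out does not affect the inner product with the signal.\<close>

lemma ip_f_Fo: "ip f (Fo D y) = ip f (A2 D y)"
proof -
  have AZ0: "ip f (AZ D y') = 0" for y' by (rule f_orthogonal_PP_z[OF PP_AZ]) (rule spn_z_fst, unfold AZ_def, rule spn_fit)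
  have BZ0: "ip f (BZ 2 D y') = 0" for y' by (rule f_orthogonal_PP_z[OF PP_BZ]) (rule spn_z_fst, unfold BZ_def, rule spn_fit)
  have "ip f (Fo D y) = ip f (fh D y) - ip f (BZ 2 D (%i. fh D y (W D i)))"
    unfolding Fo_def[abs_def] by (intro ip_diff_right bm_PP PP_fh PP_BZ bm_f)
  also have "ip f (fh D y) = ip f (A2 D y) - ip f (AZ D (%i. A2 D y (W D i)))"
    unfolding fh_def[abs_def] by (intro ip_diff_right bm_PP PP_A2 PP_AZ bm_f)
  finally show ?thesis by (simp add: AZ0 BZ0)
qed

text \<open>The inner product of \<open>f\<close> with \<open>g = f + m\<close> is
  \<open>\<tau>\<close>, because \<open>f\<close> is orthogonal to \<open>m\<close>. The fit error
  enters only through the geometric mean of \<open>\<tau>\<close> and \<open>\<rho>^2\<close>, which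
  is small against \<open>\<tau>\<close> when \<open>\<rho>^2\<close> is.\<close>

lemma ip_f_Fo_g: assumes "good 1 D" shows "\<tau> - sqrt (\<tau> * (4 * \<kappa> * \<rho>^2)) \<le> ip f (Fo D (gW D))"
proof -
  have m0: "ip f (%v. m (snd v)) = 0"
  proof -
    obtain B where "\<And>v::('dx, 'dz) cov. v \<in> ucube ==> \<bar>m (snd v)\<bar> \<le> B" using bm_m unfolding bm_def by blast
    then show ?thesis unfolding ip_def by (intro f_orthogonal_Z[of "%v. m (snd v)" B] m_snd_meas) auto
  qed
  have "ip f g = ip f (%v. f v + m (snd v))" by (simp add: f_def)
  also have "... = ip f f + ip f (%v. m (snd v))" by (intro ip_add_right bm_f bm_m)
  also have "ip f f = \<tau>" unfolding Q_f[symmetric] by (simp add: ip_def Q_def power2_eq_square)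
  finally have fg: "ip f g = \<tau>" using m0 by simp
  have "\<bar>ip f (%w. g w - A2 D (gW D) w)\<bar> \<le> sqrt (\<tau> * (4 * \<kappa> * \<rho>^2))"
    by (intro ip_abs_le bm_f bm_diff bm_g bm_PP PP_A2 approx_g_fit[OF assms]) (simp add: Q_f)
  moreover have "ip f (%w. g w - A2 D (gW D) w) = ip f g - ip f (A2 D (gW D))"
    by (intro ip_diff_right bm_f bm_g bm_PP PP_A2)
  ultimately show ?thesis unfolding ip_f_Fo fg by linarith
qed

text \<open>The weights with which single noise variables enter the conditional mean.
  \<open>w2\<close> depends on covariates only and multiplies \<open>\<xi>\<close>;
  \<open>w4\<close> depends on the fitted direction and on \<open>Z\<close> in the last block, and
  multiplies \<open>\<epsilon>\<close> from that block.\<close>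

definition w2 :: "('dx, 'dz) sample => nat => real" where "w2 D j = ip (%v. f v + bias D v) (Fo D (unit_at j))"
definition w4 :: "('dx, 'dz) sample => nat => real" where "w4 D j = ip (Fo D (%i. obs_Y (D i))) (BZ 3 D (unit_at j))"

lemma bm_fb: "bm (%v. f v + bias D v)" by (intro bm_add bm_f bm_bias)

lemma ip_Fo_sum: "bm u ==> ip u (Fo D y) = (\<Sum>j\<in>blk 1. y j * ip u (Fo D (unit_at j)))"
proof -
  assume u: "bm u"
  have "Fo D y = (%v. \<Sum>j\<in>blk 1. y j * Fo D (unit_at j) v)" by (rule ext) (rule Fo_linear)
  then have "ip u (Fo D y) = ip u (%v. \<Sum>j\<in>blk 1. y j * Fo D (unit_at j) v)" by simp
  also have "... = (\<Sum>j\<in>blk 1. ip u (%v. y j * Fo D (unit_at j) v))" by (intro ip_sum_right bm_cmult bm_PP PP_Fo u)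
  finally show ?thesis by (simp only: ip_cmult_right)
qed

lemma ip_BZ_sum: "bm u ==> ip u (BZ k D y) = (\<Sum>j\<in>blk k. y j * ip u (BZ k D (unit_at j)))"
proof -
  assume u: "bm u"
  have "BZ k D y = (%v. \<Sum>j\<in>blk k. y j * BZ k D (unit_at j) v)" unfolding BZ_def by (rule ext) (rule fit_unit_at, simp)
  then have "ip u (BZ k D y) = ip u (%v. \<Sum>j\<in>blk k. y j * BZ k D (unit_at j) v)" by simp
  also have "... = (\<Sum>j\<in>blk k. ip u (%v. y j * BZ k D (unit_at j) v))" by (intro ip_sum_right bm_cmult bm_PP PP_BZ u)
  finally show ?thesis by (simp only: ip_cmult_right)
qed

text \<open>Duality: the sum of squares \<open>S\<close> is the inner product of
  \<open>f + bias\<close> with the operator \<open>Fo\<close> applied to the weight vector itself.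
  Cauchy-Schwarz and the bound of \<open>Q (Fo y)\<close> by the mean square of \<open>y\<close>
  give \<open>S^2\<close> at most a constant over \<open>n\<close> times \<open>S\<close>.\<close>

lemma sum_w2: assumes "good 1 D" "good 2 D" "good 3 D"
  shows "(\<Sum>j\<in>blk 1. (w2 D j)^2) \<le> (2 * \<tau> + 8 * \<kappa> * \<rho>^2) * (4 * \<kappa> ^ 3) / real n"
proof -
  define S where "S = (\<Sum>j\<in>blk 1. (w2 D j)^2)"
  define X where "X = 2 * \<tau> + 8 * \<kappa> * \<rho>^2"
  have S0: "0 \<le> S" by (simp add: S_def sum_nonneg)
  have "Q (%v. f v + bias D v) \<le> 2 * Q f + 2 * Q (bias D)" by (intro Q_add_le bm_f bm_bias)
  also have "... \<le> X" unfolding X_def Q_f using Q_bias[OF assms(3)] by linarith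
  finally have q1: "Q (%v. f v + bias D v) \<le> X" .
  have X0: "0 \<le> X" using q1 Q_nonneg by (rule order_trans[rotated])
  have "S = ip (%v. f v + bias D v) (Fo D (w2 D))"
    unfolding ip_Fo_sum[OF bm_fb[of D], where D = D and y = "w2 D"] S_def by (simp add: power2_eq_square w2_def)
  then have "S\<^sup>2 \<le> Q (%v. f v + bias D v) * Q (Fo D (w2 D))" using ip_le[OF bm_fb bm_PP[OF PP_Fo]] by simp
  also have "... \<le> X * (4 * \<kappa> ^ 3 * (S / real n))"
    using q1 Q_Fo_le(2)[OF assms(1,2), of "w2 D"] Q_nonneg X0 unfolding S_def by (intro mult_mono) auto
  finally have sq: "S\<^sup>2 \<le> (X * (4 * \<kappa> ^ 3) / real n) * S" by simp
  have nn: "0 \<le> X * (4 * \<kappa> ^ 3) / real n" using X0 kappa3 by (intro divide_nonneg_nonneg mult_nonneg_nonneg) auto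
  from le_of_square_le[OF S0 nn sq] show ?thesis unfolding S_def X_def .
qed

text \<open>The same duality, with the regression on \<open>Z\<close> in the last block and the
  fitted direction as the fixed factor.\<close>

lemma sum_w4: assumes "good 3 D"
  shows "(\<Sum>j\<in>blk 3. (w4 D j)^2) \<le> \<kappa> * Q (Fo D (%i. obs_Y (D i))) / real n"
proof -
  define S where "S = (\<Sum>j\<in>blk 3. (w4 D j)^2)"
  define F where "F = Fo D (%i. obs_Y (D i))"
  have F: "bm F" unfolding F_def by (rule bm_PP[OF PP_Fo])
  have S0: "0 \<le> S" by (simp add: S_def sum_nonneg)
  have "S = ip F (BZ 3 D (w4 D))"
    unfolding ip_BZ_sum[OF F, where k = 3 and D = D and y = "w4 D"] S_def by (simp add: power2_eq_square w4_def F_def)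
  then have "S\<^sup>2 \<le> Q F * Q (BZ 3 D (w4 D))" using ip_le[OF F bm_PP[OF PP_BZ]] by simp
  also have "... \<le> Q F * (\<kappa> * (S / real n))"
    using Q_BZ_le[OF assms, of "w4 D"] Q_nonneg unfolding S_def by (intro mult_left_mono) auto
  finally have sq: "S\<^sup>2 \<le> (\<kappa> * Q F / real n) * S" by (simp add: mult_ac)
  have nn: "0 \<le> \<kappa> * Q F / real n" using Q_nonneg kappa_ge_1 by (intro divide_nonneg_nonneg mult_nonneg_nonneg) auto
  from le_of_square_le[OF S0 nn sq] show ?thesis unfolding S_def F_def .
qed

definition Fhat :: "('dx, 'dz) sample => ('dx, 'dz) cov => real" where "Fhat D = Fo D (%i. obs_Y (D i))"
definition mhat :: "('dx, 'dz) sample => ('dx, 'dz) cov => real" where "mhat D = BZ 3 D (%i. obs_Y (D i))"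
definition \<Delta> :: "('dx, 'dz) sample => ('dx, 'dz) cov => real" where "\<Delta> D v = m (snd v) - mhat D v"
definition xis :: "('dx, 'dz) sample => nat => real" where "xis D i = \<xi> (D i)"
definition epss :: "('dx, 'dz) sample => nat => real" where "epss D i = \<epsilon> (D i)"

lemma Fhat_decomp: "Fhat D v = Fo D (gW D) v + Fo D (xis D) v"
proof -
  have "(%i. obs_Y (D i)) = (%i. gW D i + xis D i)" by (simp add: gW_def xis_def \<xi>_def W_def)
  then show ?thesis by (simp add: Fhat_def Fo_add)
qed

lemma Delta_decomp: "\<Delta> D v = bias D v - BZ 3 D (epss D) v"
proof -
  have "(%i. obs_Y (D i)) = (%i. mW D i + epss D i)" by (simp add: mW_def epss_def \<epsilon>_def W_def)
  then show ?thesis by (simp add: \<Delta>_def mhat_def bias_def BZ_def fit_add)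
qed

lemma bm_Fhat: "bm (Fhat D)" and PP_Fhat: "PP (Fhat D)" unfolding Fhat_def by (rule bm_PP[OF PP_Fo], rule PP_Fo)

lemma bm_Delta: "bm (\<Delta> D)" unfolding \<Delta>_def[abs_def] mhat_def by (intro bm_diff bm_m bm_PP PP_BZ)

lemma Q_Fhat: assumes "good 1 D" "good 2 D"
  shows "Q (Fhat D) \<le> 8 * \<kappa> ^ 3 * (12 * \<rho>^2 + 4 * emp 1 D f + emp 1 D (A2 D (xis D)))"
proof -
  have "Q (Fhat D) \<le> 2 * Q (Fo D (gW D)) + 2 * Q (Fo D (xis D))"
    unfolding Fhat_decomp[abs_def] by (intro Q_add_le bm_PP PP_Fo)
  also have "... \<le> 2 * (4 * \<kappa> ^ 3 * (12 * \<rho>^2 + 4 * emp 1 D f)) + 2 * (4 * \<kappa> ^ 3 * emp 1 D (A2 D (xis D)))"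
    using Q_Fo_g[OF assms] Q_Fo_le(1)[OF assms] by (intro add_mono mult_left_mono) auto
  finally show ?thesis by (simp add: algebra_simps)
qed

lemma Q_Delta: assumes "good 3 D" shows "Q (\<Delta> D) \<le> 8 * \<kappa> * \<rho>^2 + 2 * \<kappa> * emp 3 D (BZ 3 D (epss D))"
proof -
  have "Q (\<Delta> D) \<le> 2 * Q (bias D) + 2 * Q (BZ 3 D (epss D))"
    unfolding Delta_decomp[abs_def] by (intro Q_diff_le bm_bias bm_PP PP_BZ)
  also have "... \<le> 2 * (4 * \<kappa> * \<rho>^2) + 2 * (\<kappa> * emp 3 D (BZ 3 D (epss D)))"
    using Q_bias[OF assms] norm_comparison(1)[OF assms PP_BZ] by (intro add_mono mult_left_mono) auto
  finally show ?thesis by simp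
qed

text \<open>The mean of one summand of the statistic with the three fitting blocks held
  fixed.\<close>

definition \<mu> :: "('dx, 'dz) sample => real" where "\<mu> D = ip (%v. f v + \<Delta> D v) (Fhat D)"
definition noise2 :: "('dx, 'dz) sample => real" where "noise2 D = (\<Sum>j\<in>blk 1. w2 D j * \<xi> (D j))"
definition noise4 :: "('dx, 'dz) sample => real" where "noise4 D = (\<Sum>j\<in>blk 3. w4 D j * \<epsilon> (D j))"

text \<open>Expansion of the inner product in bias and noise. The product of two noises is not split
  further: \<open>noise4\<close> keeps the whole fitted direction in its weights, which is
  legitimate because the noise of the last block is independent of it. What remains is linear in
  each noise.\<close>

lemma mu_lower:
  assumes G: "good 1 D" "good 2 D" "good 3 D"
  shows "\<tau> - sqrt (\<tau> * (4 * \<kappa> * \<rho>^2)) - sqrt (4 * \<kappa> * \<rho>^2 * (4 * \<kappa> ^ 3 * (12 * \<rho>^2 + 4 * emp 1 D f))) - \<bar>noise2 D\<bar> - \<bar>noise4 D\<bar> \<le> \<mu> D"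
proof -
  have "\<mu> D = ip (%v. (f v + bias D v) - BZ 3 D (epss D) v) (Fhat D)"
    unfolding \<mu>_def Delta_decomp by (simp add: add_diff_eq)
  also have "... = ip (%v. f v + bias D v) (Fhat D) - ip (BZ 3 D (epss D)) (Fhat D)"
    by (rule ip_diff_left[OF bm_fb bm_PP[OF PP_BZ] bm_Fhat])
  also have "ip (BZ 3 D (epss D)) (Fhat D) = noise4 D"
  proof -
    have "ip (BZ 3 D (epss D)) (Fhat D) = ip (Fhat D) (BZ 3 D (epss D))" by (rule ip_commute)
    also have "... = (\<Sum>j\<in>blk 3. epss D j * ip (Fhat D) (BZ 3 D (unit_at j)))" by (rule ip_BZ_sum[OF bm_Fhat])
    finally show ?thesis by (simp add: noise4_def w4_def Fhat_def epss_def mult.commute)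
  qed
  also have "ip (%v. f v + bias D v) (Fhat D) = ip (%v. f v + bias D v) (Fo D (gW D)) + ip (%v. f v + bias D v) (Fo D (xis D))"
    unfolding Fhat_decomp[abs_def] by (rule ip_add_right[OF bm_PP[OF PP_Fo] bm_PP[OF PP_Fo] bm_fb])
  also have "ip (%v. f v + bias D v) (Fo D (xis D)) = noise2 D"
  proof -
    have "ip (%v. f v + bias D v) (Fo D (xis D)) = (\<Sum>j\<in>blk 1. xis D j * ip (%v. f v + bias D v) (Fo D (unit_at j)))" by (rule ip_Fo_sum[OF bm_fb])
    then show ?thesis by (simp add: noise2_def w2_def xis_def mult.commute)
  qed
  also have "ip (%v. f v + bias D v) (Fo D (gW D)) = ip f (Fo D (gW D)) + ip (bias D) (Fo D (gW D))"
    by (rule ip_add_left[OF bm_f bm_bias bm_PP[OF PP_Fo]])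
  finally have e: "\<mu> D = ip f (Fo D (gW D)) + ip (bias D) (Fo D (gW D)) + noise2 D - noise4 D" .
  have "\<bar>ip (bias D) (Fo D (gW D))\<bar> \<le> sqrt (4 * \<kappa> * \<rho>^2 * (4 * \<kappa> ^ 3 * (12 * \<rho>^2 + 4 * emp 1 D f)))"
    by (intro ip_abs_le bm_bias bm_PP PP_Fo Q_bias Q_Fo_g G)
  then show ?thesis using ip_f_Fo_g[OF G(1)] unfolding e by linarith
qed

end

section \<open>Stochastic bounds\<close>

text \<open>Truncation by the event \<open>\<Sum>w\<^sup>2 \<le> b\<close> keeps the weights free of the noise, which would
  fail for truncation by an event that involves more of the observations.\<close>

lemma noise_tail:
  fixes \<xi> :: "'o => real" and w :: "'k => 'i => ('i => 'o) => real"
  assumes P: "prob_space P" and I: "finite I" "J \<subseteq> I" and S: "finite S" and \<xi>: "\<xi> \<in> borel_measurable P"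
    and w: "\<And>s i. s \<in> S ==> i \<in> J ==> w s i \<in> borel_measurable (PiM I (%_. P))"
    and r: "\<And>s i j x a. s \<in> S ==> i \<in> J ==> j \<in> J ==> x \<in> space (PiM (I - {j}) (%_. P)) ==> a \<in> space P ==> w s i (x(j := a)) = w s i (x(j := r a))"
    and N1: "\<And>k. k \<in> borel_measurable P ==> (\<integral>a. k (r a) * \<xi> a \<partial>P) = 0"
    and N2: "\<And>k. k \<in> borel_measurable P ==> (\<integral>\<^sup>+a. ennreal ((k (r a) * \<xi> a)^2) \<partial>P) \<le> ennreal C0 * (\<integral>\<^sup>+a. ennreal ((k (r a))^2) \<partial>P)"
    and C0: "C0 > 0" and t: "0 < t" and b: "0 \<le> b"
  defines "M \<equiv> PiM I (%_. P)"
  defines "B \<equiv> {D\<in>space M. (\<Sum>s\<in>S. \<Sum>i\<in>J. (w s i D)^2) \<le> b \<and> t \<le> (\<Sum>s\<in>S. (\<Sum>i\<in>J. w s i D * \<xi> (D i))^2)}"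
  shows "B \<in> sets M" "emeasure M B \<le> ennreal (C0 * b / t)"
proof -
  interpret M: prob_space M unfolding M_def by (intro prob_space_PiM P)
  have J: "finite J" using I finite_subset by blast
  have cm: "(%D. \<xi> (D i)) \<in> borel_measurable M" if "i \<in> J" for i
    using that I unfolding M_def by (intro measurable_compose[OF _ \<xi>] measurable_component_singleton) auto
  have wm: "w s i \<in> borel_measurable M" if "s \<in> S" "i \<in> J" for s i using w[OF that] by (simp add: M_def)
  define A where "A D \<longleftrightarrow> (\<Sum>s\<in>S. \<Sum>i\<in>J. (w s i D)^2) \<le> b" for D
  have Sm [measurable]: "(%D. \<Sum>s\<in>S. \<Sum>i\<in>J. (w s i D)^2) \<in> borel_measurable M"
    by (intro borel_measurable_sum borel_measurable_power wm)
  have Am [measurable]: "Measurable.pred M A" unfolding A_def by measurable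
  define v where "v s i D = (if A D then w s i D else 0)" for s i D
  have vm: "v s i \<in> borel_measurable M" if "s \<in> S" "i \<in> J" for s i
  proof -
    note [measurable] = wm[OF that]
    show ?thesis unfolding v_def by measurable
  qed
  have Ar: "A (x(j := a)) = A (x(j := r a))" if "j \<in> J" "x \<in> space (PiM (I - {j}) (%_. P))" "a \<in> space P" for j x a
    unfolding A_def using r that by (intro arg_cong[where f = "%t. t \<le> b"] sum.cong refl) simp
  have vr: "v s i (x(j := a)) = v s i (x(j := r a))" if "s \<in> S" "i \<in> J" "j \<in> J" "x \<in> space (PiM (I - {j}) (%_. P))" "a \<in> space P" for s i j x a
    using Ar[of j x a] r[of s i j x a] that by (simp add: v_def)
  have Nm: "(%D. (\<Sum>i\<in>J. v s i D * \<xi> (D i))^2) \<in> borel_measurable M" if "s \<in> S" for s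
    using that by (intro borel_measurable_power borel_measurable_sum borel_measurable_times vm cm)
  have vm2: "(%D. \<Sum>i\<in>J. (v s i D)^2) \<in> borel_measurable M" if "s \<in> S" for s
    using that by (intro borel_measurable_sum borel_measurable_power vm)
  have Bm: "B \<in> sets M"
  proof -
    have [measurable]: "(%D. \<Sum>s\<in>S. (\<Sum>i\<in>J. w s i D * \<xi> (D i))^2) \<in> borel_measurable M"
      by (intro borel_measurable_sum borel_measurable_power borel_measurable_times wm cm)
    show ?thesis unfolding B_def by measurable
  qed
  have "emeasure M B = (\<integral>\<^sup>+D. indicator B D \<partial>M)" using Bm by simp
  \<comment> \<open>Markov's inequality for the truncated sums, which on \<open>B\<close> coincide
    with the original ones.\<close>
  also have "... \<le> (\<integral>\<^sup>+D. ennreal (1 / t) * (\<Sum>s\<in>S. ennreal ((\<Sum>i\<in>J. v s i D * \<xi> (D i))^2)) \<partial>M)"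
  proof (rule nn_integral_mono)
    fix D
    show "indicator B D \<le> ennreal (1 / t) * (\<Sum>s\<in>S. ennreal ((\<Sum>i\<in>J. v s i D * \<xi> (D i))^2))"
    proof (cases "D \<in> B")
      case True
      then have "A D" "t \<le> (\<Sum>s\<in>S. (\<Sum>i\<in>J. w s i D * \<xi> (D i))^2)" by (auto simp: B_def A_def)
      then have "1 \<le> 1 / t * (\<Sum>s\<in>S. (\<Sum>i\<in>J. v s i D * \<xi> (D i))^2)" using t by (simp add: v_def field_simps)
      then have "ennreal 1 \<le> ennreal (1 / t * (\<Sum>s\<in>S. (\<Sum>i\<in>J. v s i D * \<xi> (D i))^2))" by (rule ennreal_leI)
      also have "... = ennreal (1 / t) * (\<Sum>s\<in>S. ennreal ((\<Sum>i\<in>J. v s i D * \<xi> (D i))^2))"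
        using t by (simp add: ennreal_mult[symmetric] sum_nonneg sum_ennreal del: ennreal_1)
      finally show ?thesis using True by simp
    qed simp
  qed
  also have "... = ennreal (1 / t) * (\<Sum>s\<in>S. \<integral>\<^sup>+D. ennreal ((\<Sum>i\<in>J. v s i D * \<xi> (D i))^2) \<partial>M)"
    using Nm by (subst nn_integral_cmult) (auto simp: nn_integral_sum simp del: sum_ennreal)
  also have "... \<le> ennreal (1 / t) * (\<Sum>s\<in>S. ennreal C0 * (\<integral>\<^sup>+D. ennreal (\<Sum>i\<in>J. (v s i D)^2) \<partial>M))"
  proof (intro mult_left_mono sum_mono)
    fix s assume s: "s \<in> S"
    show "(\<integral>\<^sup>+D. ennreal ((\<Sum>i\<in>J. v s i D * \<xi> (D i))^2) \<partial>M) \<le> ennreal C0 * (\<integral>\<^sup>+D. ennreal (\<Sum>i\<in>J. (v s i D)^2) \<partial>M)"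
      unfolding M_def
      by (rule noise_second_moment[where w = "v s", OF P I \<xi> vm[OF s, unfolded M_def] vr[OF s] N1 N2 C0])
  qed simp
  also have "... = ennreal (1 / t) * (ennreal C0 * (\<integral>\<^sup>+D. (\<Sum>s\<in>S. ennreal (\<Sum>i\<in>J. (v s i D)^2)) \<partial>M))"
    using vm2 by (subst nn_integral_sum) (auto simp: sum_distrib_left)
  also have "... \<le> ennreal (1 / t) * (ennreal C0 * (\<integral>\<^sup>+D. ennreal b \<partial>M))"
  proof (intro mult_left_mono nn_integral_mono)
    fix D
    have "(\<Sum>s\<in>S. \<Sum>i\<in>J. (v s i D)^2) \<le> b" using b by (cases "A D") (auto simp: v_def A_def)
    then show "(\<Sum>s\<in>S. ennreal (\<Sum>i\<in>J. (v s i D)^2)) \<le> ennreal b" by (simp add: sum_ennreal sum_nonneg ennreal_leI)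
  qed simp_all
  also have "... = ennreal (C0 * b / t)" using t C0 b by (simp add: M.emeasure_space_1 ennreal_mult[symmetric] field_simps)
  finally show "emeasure M B \<le> ennreal (C0 * b / t)" .
  show "B \<in> sets M" by (rule Bm)
qed

text \<open>Covariates enter a fit through their basis values only; for \<open>basis_z\<close> this
  means that the component \<open>x\<close> may be changed freely.\<close>

lemma fit_cong_basis: "(\<And>i. i \<in> I ==> b (x i) = b (x' i)) ==> (\<And>i. i \<in> I ==> y i = y' i) ==> fit ginv K b I x y w = fit ginv K b I x' y' w"
proof -
  assume x: "\<And>i. i \<in> I ==> b (x i) = b (x' i)" and y: "\<And>i. i \<in> I ==> y i = y' i"
  have "gram K b I x = gram K b I x'" unfolding gram_def by (rule eq_matI) (auto simp: x)
  then show ?thesis by (simp add: fit_def ols_kernel_def x y)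
qed

context regression_model
begin

text \<open>The two forgetting maps: one erases the response, the other keeps nothing but
  \<open>Z\<close>. Arbitrary values are put in place of what is erased.\<close>

definition "rXZ a = (fst a, 0 :: real, snd (snd a))" for a :: "('dx, 'dz) obs"
definition "rZ a = (0, 0 :: real, snd (snd a))" for a :: "('dx, 'dz) obs"

lemma obs_rXZ [simp]: "obs_XZ (rXZ a) = obs_XZ a"
  by (simp add: rXZ_def obs_XZ_def case_prod_beta)

lemma obs_rZ [simp]: "snd (obs_XZ (rZ a)) = snd (obs_XZ a)" "obs_Z (rZ a) = obs_Z a"
  by (simp_all add: rZ_def obs_XZ_def obs_Z_def case_prod_beta)

lemma rXZ_factor: "k \<in> borel_measurable P ==> \<exists>k'\<in>borel_measurable borel. \<forall>a. k (rXZ a) = k' (obs_XZ a)"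
proof -
  assume k: "k \<in> borel_measurable P"
  define h :: "('dx, 'dz) cov => _" where "h v = (fst v, 0 :: real, snd v)" for v
  have "h \<in> measurable borel borel" unfolding h_def by (intro borel_measurable_continuous_onI continuous_intros)
  then have "(%v. k (h v)) \<in> borel_measurable borel" using k by (intro measurable_compose[of h borel borel k]) (simp_all add: measP)
  moreover have "k (rXZ a) = k (h (obs_XZ a))" for a by (simp add: rXZ_def h_def obs_XZ_def case_prod_beta)
  ultimately show ?thesis by (intro bexI[of _ "%v. k (h v)"]) auto
qed

lemma rZ_factor: "k \<in> borel_measurable P ==> \<exists>k'\<in>borel_measurable borel. \<forall>a. k (rZ a) = k' (obs_Z a)"
proof -
  assume k: "k \<in> borel_measurable P"
  define h :: "real ^ 'dz::{finite,linorder} => (real ^ 'dx::{finite,linorder}) \<times> real \<times> _" where "h v = (0, 0, v)" for v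
  have "h \<in> measurable borel borel" unfolding h_def by (intro borel_measurable_continuous_onI continuous_intros)
  then have "(%v. k (h v)) \<in> borel_measurable borel" using k by (intro measurable_compose[of h borel borel k]) (simp_all add: measP)
  moreover have "k (rZ a) = k (h (obs_Z a))" for a by (simp add: rZ_def h_def obs_Z_def case_prod_beta)
  ultimately show ?thesis by (intro bexI[of _ "%v. k (h v)"]) auto
qed

lemma xi_N1: "k \<in> borel_measurable P ==> (\<integral>a. k (rXZ a) * \<xi> a \<partial>P) = 0"
proof -
  assume "k \<in> borel_measurable P"
  then obtain k' where k': "k' \<in> borel_measurable borel" "\<And>a. k (rXZ a) = k' (obs_XZ a)" using rXZ_factor by blast
  show ?thesis unfolding k'(2) by (rule xi_mean[OF k'(1)])
qed

lemma eps_N1: "k \<in> borel_measurable P ==> (\<integral>a. k (rZ a) * \<epsilon> a \<partial>P) = 0"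
proof -
  assume "k \<in> borel_measurable P"
  then obtain k' where k': "k' \<in> borel_measurable borel" "\<And>a. k (rZ a) = k' (obs_Z a)" using rZ_factor by blast
  show ?thesis unfolding k'(2) by (rule eps_mean[OF k'(1)])
qed

lemma eps_second: "k' \<in> borel_measurable borel ==> (\<integral>\<^sup>+a. ennreal ((k' (obs_XZ a) * \<epsilon> a)^2) \<partial>P) \<le> ennreal (1 + C) * (\<integral>\<^sup>+a. ennreal ((k' (obs_XZ a))^2) \<partial>P)"
  for k' :: "_ => real"
proof -
  assume k': "k' \<in> borel_measurable borel"
  have "(%v. ennreal ((k' v)^2)) \<in> borel_measurable borel" using k' by measurable
  from noise_second_upper[OF this] show ?thesis by (simp add: power_mult_distrib ennreal_mult)
qed

lemma eps_N2: "k \<in> borel_measurable P ==> (\<integral>\<^sup>+a. ennreal ((k (rZ a) * \<epsilon> a)^2) \<partial>P) \<le> ennreal (4 * (1 + C)) * (\<integral>\<^sup>+a. ennreal ((k (rZ a))^2) \<partial>P)"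
proof -
  assume "k \<in> borel_measurable P"
  then obtain k' where k': "k' \<in> borel_measurable borel" "\<And>a. k (rZ a) = k' (obs_Z a)" using rZ_factor by blast
  have "(%v. k' (snd v)) \<in> borel_measurable borel" using k'(1) by measurable
  from eps_second[OF this] have "(\<integral>\<^sup>+a. ennreal ((k (rZ a) * \<epsilon> a)^2) \<partial>P) \<le> ennreal (1 + C) * (\<integral>\<^sup>+a. ennreal ((k (rZ a))^2) \<partial>P)" by (simp add: k'(2))
  also have "... \<le> ennreal (4 * (1 + C)) * (\<integral>\<^sup>+a. ennreal ((k (rZ a))^2) \<partial>P)" using constants by (intro mult_right_mono ennreal_leI) auto
  finally show ?thesis .
qed

text \<open>\<open>\<xi> = \<epsilon> - f\<close>, hence
  \<open>\<xi>^2 \<le> 2 \<epsilon>^2 + 2 f^2\<close>, and each of the two parts contributes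
  \<open>2 (1 + C)\<close>. The constant for \<open>\<epsilon>\<close> is enlarged to the same
  value, so that both noises share it.\<close>

lemma xi_N2: "k \<in> borel_measurable P ==> (\<integral>\<^sup>+a. ennreal ((k (rXZ a) * \<xi> a)^2) \<partial>P) \<le> ennreal (4 * (1 + C)) * (\<integral>\<^sup>+a. ennreal ((k (rXZ a))^2) \<partial>P)"
proof -
  assume "k \<in> borel_measurable P"
  then obtain k' where k': "k' \<in> borel_measurable borel" "\<And>a. k (rXZ a) = k' (obs_XZ a)" using rXZ_factor by blast
  have km [measurable]: "(%a. k' (obs_XZ a)) \<in> borel_measurable P" by (rule XZ_P[OF k'(1)])
  have em [measurable]: "\<epsilon> \<in> borel_measurable P" by (simp add: measP)
  have "(\<integral>\<^sup>+a. ennreal ((k (rXZ a) * \<xi> a)^2) \<partial>P) \<le> (\<integral>\<^sup>+a. 2 * ennreal ((k' (obs_XZ a) * \<epsilon> a)^2) + ennreal (2 * (1 + C)) * ennreal ((k' (obs_XZ a))^2) \<partial>P)"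
  proof (rule nn_integral_mono_AE)
    show "AE a in P. ennreal ((k (rXZ a) * \<xi> a)^2) \<le> 2 * ennreal ((k' (obs_XZ a) * \<epsilon> a)^2) + ennreal (2 * (1 + C)) * ennreal ((k' (obs_XZ a))^2)"
      using AE_ucube
    proof eventually_elim
      case (elim a)
      have f2: "(f (obs_XZ a))^2 \<le> 1 + C" using f_sq_le[of "obs_XZ a"] elim ucube_subset by blast
      have "(\<xi> a)^2 \<le> 2 * (\<epsilon> a)^2 + 2 * (f (obs_XZ a))^2"
      proof -
        have "0 \<le> (\<epsilon> a + f (obs_XZ a))^2" by simp
        then show ?thesis using eps_decomposition[of a] by (simp add: power2_eq_square algebra_simps)
      qed
      then have "(\<xi> a)^2 \<le> 2 * (\<epsilon> a)^2 + 2 * (1 + C)" using f2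
        by (rule order_trans[OF _ add_left_mono[OF mult_left_mono]]) simp
      then have "(k' (obs_XZ a))^2 * (\<xi> a)^2 \<le> (k' (obs_XZ a))^2 * (2 * (\<epsilon> a)^2 + 2 * (1 + C))" by (rule mult_left_mono) simp
      then have "(k (rXZ a) * \<xi> a)^2 \<le> 2 * (k' (obs_XZ a) * \<epsilon> a)^2 + 2 * (1 + C) * (k' (obs_XZ a))^2"
        by (simp add: k'(2) power_mult_distrib algebra_simps)
      then have "ennreal ((k (rXZ a) * \<xi> a)^2) \<le> ennreal (2 * (k' (obs_XZ a) * \<epsilon> a)^2 + 2 * (1 + C) * (k' (obs_XZ a))^2)" by (rule ennreal_leI)
      also have "... = 2 * ennreal ((k' (obs_XZ a) * \<epsilon> a)^2) + ennreal (2 * (1 + C)) * ennreal ((k' (obs_XZ a))^2)"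
        using constants by (simp add: ennreal_plus[symmetric] ennreal_mult[symmetric] del: ennreal_plus flip: ennreal_numeral)
      finally show ?case .
    qed
  qed
  also have "... = 2 * (\<integral>\<^sup>+a. ennreal ((k' (obs_XZ a) * \<epsilon> a)^2) \<partial>P) + ennreal (2 * (1 + C)) * (\<integral>\<^sup>+a. ennreal ((k' (obs_XZ a))^2) \<partial>P)"
    by (subst nn_integral_add) (auto simp: nn_integral_cmult)
  also have "... \<le> 2 * (ennreal (1 + C) * (\<integral>\<^sup>+a. ennreal ((k' (obs_XZ a))^2) \<partial>P)) + ennreal (2 * (1 + C)) * (\<integral>\<^sup>+a. ennreal ((k' (obs_XZ a))^2) \<partial>P)"
    using eps_second[OF k'(1)] by (intro add_right_mono mult_left_mono) auto
  also have "... = ennreal (4 * (1 + C)) * (\<integral>\<^sup>+a. ennreal ((k' (obs_XZ a))^2) \<partial>P)"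
  proof -
    have "2 * ennreal (1 + C) = ennreal (2 * (1 + C))" using constants by (simp add: ennreal_mult[symmetric] flip: ennreal_numeral del: ennreal_plus)
    moreover have "ennreal (2 * (1 + C)) + ennreal (2 * (1 + C)) = ennreal (4 * (1 + C))" using constants by (simp flip: ennreal_plus)
    ultimately show ?thesis by (simp only: mult.assoc[symmetric] distrib_right[symmetric])
  qed
  finally show ?thesis by (simp add: k'(2))
qed

end

context spline_test
begin

definition "C0 = 4 * (1 + C)"
definition "MM = PiM {1..4 * n} (%_. P)"

lemma C0_pos: "0 < C0" using constants by (simp add: C0_def)

lemma prob_MM: "prob_space MM" unfolding MM_def by (intro prob_space_PiM prob)

lemma blk_subset: "k < 4 ==> blk k \<subseteq> {1..4 * n}"
proof -
  assume "k < 4"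
  then have "(k + 1) * n \<le> 4 * n" by (intro mult_le_mono) auto
  then show ?thesis by (auto simp: blk_def)
qed

lemma comp_MM: "i \<in> {1..4 * n} ==> (%D. D i) \<in> measurable MM P"
  unfolding MM_def by (rule measurable_component_singleton)

lemma W_measurable: "(%o'. om o' i) \<in> measurable \<Omega> P ==> (%o'. W (om o') i) \<in> measurable \<Omega> borel"
  unfolding W_def by (rule measurable_compose[OF _ obs_P(3)])

lemma A2_measurable:
  assumes "\<And>i. i \<in> blk 1 ==> (%o'. om o' i) \<in> measurable \<Omega> P" "\<And>i. i \<in> blk 1 ==> (%o'. y o' i) \<in> borel_measurable \<Omega>" "v \<in> measurable \<Omega> borel"
  shows "(%o'. A2 (om o') (y o') (v o')) \<in> borel_measurable \<Omega>"
  unfolding A2_def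
  by (rule measurable_fit[OF ginv pp_measurable[OF pp_basis_xz[OF r_pos(1,2)]] W_measurable[OF assms(1)] assms(2,3)])

lemma AZ_measurable:
  assumes "\<And>i. i \<in> blk 1 ==> (%o'. om o' i) \<in> measurable \<Omega> P" "\<And>i. i \<in> blk 1 ==> (%o'. y o' i) \<in> borel_measurable \<Omega>" "v \<in> measurable \<Omega> borel"
  shows "(%o'. AZ (om o') (y o') (v o')) \<in> borel_measurable \<Omega>"
  unfolding AZ_def
  by (rule measurable_fit[OF ginv pp_measurable[OF pp_basis_z[OF r_pos(1,2)]] W_measurable[OF assms(1)] assms(2,3)])

lemma BZ_measurable:
  assumes "\<And>i. i \<in> blk k ==> (%o'. om o' i) \<in> measurable \<Omega> P" "\<And>i. i \<in> blk k ==> (%o'. y o' i) \<in> borel_measurable \<Omega>" "v \<in> measurable \<Omega> borel"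
  shows "(%o'. BZ k (om o') (y o') (v o')) \<in> borel_measurable \<Omega>"
  unfolding BZ_def
  by (rule measurable_fit[OF ginv pp_measurable[OF pp_basis_z[OF r_pos(3,4)]] W_measurable[OF assms(1)] assms(2,3)])

lemma fh_measurable:
  assumes "\<And>i. i \<in> blk 1 ==> (%o'. om o' i) \<in> measurable \<Omega> P" "\<And>i. i \<in> blk 1 ==> (%o'. y o' i) \<in> borel_measurable \<Omega>" "v \<in> measurable \<Omega> borel"
  shows "(%o'. fh (om o') (y o') (v o')) \<in> borel_measurable \<Omega>"
  unfolding fh_def by (intro borel_measurable_diff A2_measurable AZ_measurable W_measurable assms)

lemma Fo_measurable:
  assumes "\<And>i. i \<in> blk 1 \<union> blk 2 ==> (%o'. om o' i) \<in> measurable \<Omega> P" "\<And>i. i \<in> blk 1 ==> (%o'. y o' i) \<in> borel_measurable \<Omega>" "v \<in> measurable \<Omega> borel"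
  shows "(%o'. Fo (om o') (y o') (v o')) \<in> borel_measurable \<Omega>"
  unfolding Fo_def by (intro borel_measurable_diff fh_measurable BZ_measurable W_measurable assms UnI1 UnI2)

lemma bias_measurable:
  assumes "\<And>i. i \<in> blk 3 ==> (%o'. om o' i) \<in> measurable \<Omega> P" "v \<in> measurable \<Omega> borel"
  shows "(%o'. bias (om o') (v o')) \<in> borel_measurable \<Omega>"
  unfolding bias_def mW_def
  by (intro borel_measurable_diff BZ_measurable measurable_compose[OF _ m_snd_meas] W_measurable assms)

lemma integral_MM_nu:
  fixes h :: "_ => _ => real"
  assumes "(%o'. h (fst o') (snd o')) \<in> borel_measurable (MM \<Otimes>\<^sub>M \<nu>)"
  shows "(%D. \<integral>v. h D v \<partial>\<nu>) \<in> borel_measurable MM"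
proof -
  interpret nu: prob_space \<nu> by (rule prob_nu)
  have "case_prod h = (%o'. h (fst o') (snd o'))" by (simp add: fun_eq_iff)
  then show ?thesis using nu.borel_measurable_lebesgue_integral[of h MM] assms by simp
qed

lemma fst_comp: "k < 4 ==> i \<in> blk k ==> (%o'. fst o' i) \<in> measurable (MM \<Otimes>\<^sub>M \<nu>) P"
  using blk_subset[THEN subsetD] by (intro measurable_compose[OF measurable_fst comp_MM])

lemma fst_comp_12: "i \<in> blk 1 \<union> blk 2 ==> (%o'. fst o' i) \<in> measurable (MM \<Otimes>\<^sub>M \<nu>) P"
  and fst_comp_1: "i \<in> blk 1 ==> (%o'. fst o' i) \<in> measurable (MM \<Otimes>\<^sub>M \<nu>) P"
  and fst_comp_3: "i \<in> blk 3 ==> (%o'. fst o' i) \<in> measurable (MM \<Otimes>\<^sub>M \<nu>) P"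
  using fst_comp[of 1 i] fst_comp[of 2 i] fst_comp[of 3 i] by (meson UnE one_less_numeral_iff numeral_less_iff semiring_norm)+

lemma snd_comp: "snd \<in> measurable (MM \<Otimes>\<^sub>M \<nu>) borel"
  by (rule measurable_compose[OF measurable_snd, of "%x. x", simplified]) simp

lemma w2_measurable: "w2' \<in> borel_measurable MM" if "w2' = (%D. w2 D j)" for w2'
  unfolding that w2_def ip_def
  by (intro integral_MM_nu borel_measurable_times borel_measurable_add measurable_compose[OF snd_comp f_meas] bias_measurable Fo_measurable snd_comp borel_measurable_const fst_comp_12 fst_comp_1 fst_comp_3)

lemma Fhat_measurable:
  assumes "\<And>i. i \<in> blk 1 \<union> blk 2 ==> (%o'. om o' i) \<in> measurable \<Omega> P" "v \<in> measurable \<Omega> borel"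
  shows "(%o'. Fhat (om o') (v o')) \<in> borel_measurable \<Omega>"
  unfolding Fhat_def
  by (rule Fo_measurable[OF assms(1) measurable_compose[OF assms(1)[OF UnI1] obs_P(1)] assms(2)])

lemma mhat_measurable:
  assumes "\<And>i. i \<in> blk 3 ==> (%o'. om o' i) \<in> measurable \<Omega> P" "v \<in> measurable \<Omega> borel"
  shows "(%o'. mhat (om o') (v o')) \<in> borel_measurable \<Omega>"
  unfolding mhat_def
  by (intro BZ_measurable assms measurable_compose[OF _ obs_P(1)])

lemma w4_measurable: "w4' \<in> borel_measurable MM" if "w4' = (%D. w4 D j)" for w4'
  unfolding that w4_def ip_def Fhat_def[symmetric]
  by (intro integral_MM_nu borel_measurable_times Fhat_measurable BZ_measurable snd_comp borel_measurable_const fst_comp_12 fst_comp_1 fst_comp_3)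

lemma Q_Fhat_measurable: "(%D. Q (Fhat D)) \<in> borel_measurable MM"
  unfolding Q_def by (intro integral_MM_nu borel_measurable_power Fhat_measurable snd_comp fst_comp_12)

lemma emp_measurable:
  assumes "k < 4" "\<And>i. i \<in> blk k ==> (%D. h D (W D i)) \<in> borel_measurable MM"
  shows "(%D. emp k D (h D)) \<in> borel_measurable MM"
  unfolding emp_def by (intro borel_measurable_divide borel_measurable_sum borel_measurable_power assms borel_measurable_const)

lemma good_measurable: assumes "k < 4" shows "Measurable.pred MM (good k)"
proof -
  have Wm: "(%D. W D i) \<in> measurable MM borel" if "i \<in> blk k" for i
    using blk_subset[OF assms, THEN subsetD, OF that] by (intro W_measurable comp_MM)
  have s: "(%D. \<Sum>i\<in>blk k. indicator S (W D i) :: real) \<in> borel_measurable MM" if "S \<in> sets borel" for S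
    using that by (intro borel_measurable_sum measurable_compose[OF Wm borel_measurable_indicator])
  have u: "Measurable.pred MM (%D. W D i \<in> ucube)" if "i \<in> blk k" for i
    by (rule measurable_compose[OF Wm[OF that], of "%v. v \<in> ucube"]) measurable
  have s1: "Measurable.pred MM (%D. real n * measure \<nu> (cell L \<kappa>') / 2 < (\<Sum>i\<in>blk k. indicator (cell L \<kappa>') (W D i)))" for L \<kappa>'
    using s[OF borel_cell[of L \<kappa>']] by measurable
  have s2: "Measurable.pred MM (%D. (\<Sum>i\<in>blk k. indicator (cell L \<kappa>') (W D i)) < 3 * (real n * measure \<nu> (cell L \<kappa>')))" for L \<kappa>'
    using s[OF borel_cell[of L \<kappa>']] by measurable
  show ?thesis unfolding good_def
    by (intro pred_intros_logic pred_intros_finite finite_cell_indices blk_finite u s1 s2)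
qed

text \<open>A union bound over the \<open>M ^ dd * Kc\<close> fine and the \<open>Kc\<close> coarse
  cells, each of mass at least \<open>c / (M ^ dd * Kc)\<close>. That some covariate falls outside
  \<open>ucube\<close> is a null event.\<close>

lemma good_prob:
  assumes k: "k < 4"
  shows "emeasure MM {D\<in>space MM. \<not> good k D} \<le> ennreal (2 * real M ^ dd * Kc * exp (- (c * real n / (10 * real M ^ dd * Kc))))"
proof -
  interpret MM: prob_space MM by (rule prob_MM)
  define E :: "nat => (('dx, 'dz) cov => nat) => ('dx, 'dz) obs set" where "E L \<kappa>' = {a. obs_XZ a \<in> cell L \<kappa>'}" for L \<kappa>'
  have E: "E L \<kappa>' \<in> sets P" for L \<kappa>'
    using measurable_sets[OF obs_P(3) borel_cell[of L \<kappa>']] by (simp add: E_def vimage_def)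
  have PE: "measure P (E L \<kappa>') = measure \<nu> (cell L \<kappa>')" for L \<kappa>'
    unfolding \<nu>_def by (subst measure_distr[OF obs_P(3)]) (auto simp: E_def vimage_def)
  have ind: "indicator (E L \<kappa>') (D i) = (indicator (cell L \<kappa>') (W D i) :: real)" for L \<kappa>' i and D :: "nat => ('dx, 'dz) obs" by (simp add: E_def W_def indicator_def)
  define U where "U = {D\<in>space MM. \<exists>i\<in>blk k. W D i \<notin> ucube}"
  define B1 where "B1 \<kappa>' = {D\<in>space MM. (\<Sum>i\<in>blk k. indicator (E ((N + 1) * M) \<kappa>') (D i)) \<le> real (card (blk k)) * measure P (E ((N + 1) * M) \<kappa>') / 2}" for \<kappa>'
  define B2 where "B2 \<kappa>' = {D\<in>space MM. 3 * (real (card (blk k)) * measure P (E (N + 1) \<kappa>')) \<le> (\<Sum>i\<in>blk k. indicator (E (N + 1) \<kappa>') (D i))}" for \<kappa>'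
  have Wm: "(%D. W D i) \<in> measurable MM borel" if "i \<in> blk k" for i
    using blk_subset[OF k, THEN subsetD, OF that] by (intro W_measurable comp_MM)
  have sm: "(%D. \<Sum>i\<in>blk k. indicator (E L \<kappa>') (D i) :: real) \<in> borel_measurable MM" for L \<kappa>'
    unfolding ind by (intro borel_measurable_sum measurable_compose[OF Wm borel_measurable_indicator] borel_cell)
  have B1m: "B1 \<kappa>' \<in> MM.events" and B2m: "B2 \<kappa>' \<in> MM.events" for \<kappa>' unfolding B1_def B2_def using sm by measurable
  have U0: "U \<in> null_sets MM"
  proof -
    have "AE D in MM. \<forall>i\<in>blk k. W D i \<in> ucube"
    proof (rule AE_finite_allI[OF blk_finite])
      fix i assume i: "i \<in> blk k"
      then have i4: "i \<in> {1..4 * n}" by (rule blk_subset[OF k, THEN subsetD])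
      have d: "distr MM P (%D. D i) = P" unfolding MM_def by (rule distr_PiM_component[OF prob i4])
      have "AE a in distr MM P (%D. D i). obs_XZ a \<in> ucube" unfolding d by (rule AE_ucube)
      then show "AE D in MM. W D i \<in> ucube" unfolding W_def
        by (subst (asm) AE_distr_iff[OF comp_MM[OF i4]]) (use measurable_sets[OF obs_P(3) borel_ucube] in \<open>auto simp: vimage_def\<close>)
    qed
    moreover have "U \<in> sets MM"
    proof -
      have "Measurable.pred MM (%D. W D i \<notin> ucube)" if "i \<in> blk k" for i
        by (rule measurable_compose[OF Wm[OF that], of "%v. v \<notin> ucube"]) measurable
      then have "Measurable.pred MM (%D. \<exists>i\<in>blk k. W D i \<notin> ucube)" by (intro pred_intros_finite blk_finite)
      then show ?thesis unfolding U_def by (simp add: pred_def)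
    qed
    ultimately show ?thesis by (simp add: AE_iff_null_sets) (auto simp: U_def elim!: eventually_mono)
  qed
  define e where "e = exp (- (c * real n / (10 * real M ^ dd * Kc)))"
  have Kc0: "0 < Kc" using Kc_ge_1 by linarith
  have Mp: "1 \<le> real M ^ dd" using M by (intro one_le_power) auto
  have ex: "exp (- (real (card (blk k)) * measure P (E L \<kappa>')) / 10) \<le> e" if "c / (real M ^ dd * Kc) \<le> measure \<nu> (cell L \<kappa>')" for L \<kappa>'
  proof -
    have "real n * (c / (real M ^ dd * Kc)) \<le> real n * measure \<nu> (cell L \<kappa>')" using that by (intro mult_left_mono) auto
    then show ?thesis unfolding e_def PE by (simp add: field_simps)
  qed
  have b1: "emeasure MM (B1 \<kappa>') \<le> ennreal e" if "\<kappa>' \<in> cell_indices ((N + 1) * M)" for \<kappa>'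
  proof -
    have "measure MM (B1 \<kappa>') \<le> exp (- (real (card (blk k)) * measure P (E ((N + 1) * M) \<kappa>')) / 10)"
      unfolding B1_def MM_def by (rule count_lower_tail[OF prob _ blk_subset[OF k] E]) simp
    also have "... \<le> e"
    proof (rule ex)
      have "(1 / real ((N + 1) * M)) ^ dd = 1 / (real M ^ dd * Kc)" unfolding Kc_def of_nat_mult by (simp add: power_mult_distrib power_divide)
      then show "c / (real M ^ dd * Kc) \<le> measure \<nu> (cell ((N + 1) * M) \<kappa>')"
        using nu_cell(1)[of "(N + 1) * M" \<kappa>', folded dd] M that by simp
    qed
    finally show ?thesis by (simp add: MM.emeasure_eq_measure ennreal_leI)
  qed
  have b2: "emeasure MM (B2 \<kappa>') \<le> ennreal e" if "\<kappa>' \<in> cell_indices (N + 1)" for \<kappa>'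
  proof -
    have "measure MM (B2 \<kappa>') \<le> exp (- (real (card (blk k)) * measure P (E (N + 1) \<kappa>')) / 10)"
      unfolding B2_def MM_def by (rule count_upper_tail[OF prob _ blk_subset[OF k] E]) simp
    also have "... \<le> e"
    proof (rule ex)
      have "c / (real M ^ dd * Kc) \<le> c / Kc" using Mp Kc0 constants M by (intro divide_left_mono mult_pos_pos) auto
      also have "... \<le> measure \<nu> (cell (N + 1) \<kappa>')" using nu_cell(1)[of "N + 1" \<kappa>', folded dd] that by (simp add: Kc_def power_divide)
      finally show "c / (real M ^ dd * Kc) \<le> measure \<nu> (cell (N + 1) \<kappa>')" .
    qed
    finally show ?thesis by (simp add: MM.emeasure_eq_measure ennreal_leI)
  qed
  have "{D\<in>space MM. \<not> good k D} \<subseteq> U \<union> ((\<Union>\<kappa>'\<in>cell_indices ((N + 1) * M). B1 \<kappa>') \<union> (\<Union>\<kappa>'\<in>cell_indices (N + 1). B2 \<kappa>'))"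
    by (auto simp: good_def U_def B1_def B2_def ind PE not_less)
  then have "emeasure MM {D\<in>space MM. \<not> good k D} \<le> emeasure MM (U \<union> ((\<Union>\<kappa>'\<in>cell_indices ((N + 1) * M). B1 \<kappa>') \<union> (\<Union>\<kappa>'\<in>cell_indices (N + 1). B2 \<kappa>')))"
    using U0 B1m B2m
    by (intro emeasure_mono sets.Un sets.finite_UN finite_cell_indices) (auto dest: null_setsD2)
  also have "... \<le> emeasure MM U + (emeasure MM (\<Union>\<kappa>'\<in>cell_indices ((N + 1) * M). B1 \<kappa>') + emeasure MM (\<Union>\<kappa>'\<in>cell_indices (N + 1). B2 \<kappa>'))"
    using U0 B1m B2m by (intro order_trans[OF emeasure_subadditive] add_left_mono emeasure_subadditive sets.Un sets.finite_UN finite_cell_indices) (auto dest: null_setsD2)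
  also have "... \<le> 0 + ((\<Sum>\<kappa>'\<in>(cell_indices ((N + 1) * M) :: (('dx, 'dz) cov => nat) set). ennreal e) + (\<Sum>\<kappa>'\<in>(cell_indices (N + 1) :: (('dx, 'dz) cov => nat) set). ennreal e))"
  proof (intro add_mono)
    show "emeasure MM U \<le> 0" using U0 by auto
    show "emeasure MM (\<Union>\<kappa>'\<in>cell_indices ((N + 1) * M). B1 \<kappa>') \<le> (\<Sum>\<kappa>'\<in>(cell_indices ((N + 1) * M) :: (('dx, 'dz) cov => nat) set). ennreal e)"
      proof -
      have u: "emeasure MM (\<Union>\<kappa>'\<in>cell_indices L. B1 \<kappa>') \<le> (\<Sum>\<kappa>'\<in>cell_indices L. emeasure MM (B1 \<kappa>'))" for L
        using B1m by (intro emeasure_subadditive_finite) auto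
      show ?thesis by (rule order_trans[OF u sum_mono]) (rule b1)
    qed
    show "emeasure MM (\<Union>\<kappa>'\<in>cell_indices (N + 1). B2 \<kappa>') \<le> (\<Sum>\<kappa>'\<in>(cell_indices (N + 1) :: (('dx, 'dz) cov => nat) set). ennreal e)"
      proof -
      have u: "emeasure MM (\<Union>\<kappa>'\<in>cell_indices L. B2 \<kappa>') \<le> (\<Sum>\<kappa>'\<in>cell_indices L. emeasure MM (B2 \<kappa>'))" for L
        using B2m by (intro emeasure_subadditive_finite) auto
      show ?thesis by (rule order_trans[OF u sum_mono]) (rule b2)
    qed
  qed
  also have "... = ennreal ((real M ^ dd * Kc) * e + Kc * e)"
  proof -
    have c1: "real (card (cell_indices ((N + 1) * M) :: (('dx, 'dz) cov => nat) set)) = real M ^ dd * Kc"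
      unfolding card_cell_indices dd[symmetric] Kc_def of_nat_power of_nat_mult power_mult_distrib by (rule mult.commute)
    have c2: "real (card (cell_indices (N + 1) :: (('dx, 'dz) cov => nat) set)) = Kc"
      unfolding card_cell_indices dd[symmetric] Kc_def of_nat_power ..
    have "0 \<le> e" by (simp add: e_def)
    then show ?thesis using Kc0 Mp unfolding sum_constant ennreal_of_nat_eq_real_of_nat c1 c2
      by (simp add: ennreal_mult[symmetric] ennreal_plus[symmetric] del: ennreal_plus)
  qed
  also have "... \<le> ennreal (2 * real M ^ dd * Kc * e)"
  proof (rule ennreal_leI)
    have "1 * (Kc * e) \<le> real M ^ dd * (Kc * e)" using Mp Kc0 by (intro mult_right_mono) (auto simp: e_def)
    then show "(real M ^ dd * Kc) * e + Kc * e \<le> 2 * real M ^ dd * Kc * e" by (simp add: algebra_simps)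
  qed
  finally show ?thesis by (simp add: e_def)
qed


section \<open>Dependence of the weights on single observations\<close>

lemma W_rXZ: "W (x(j := a)) = W (x(j := rXZ a))"
  by (rule ext) (simp add: W_def)

lemma A2_W: "W D = W D' ==> A2 D = A2 D'"
  by (simp add: A2_def)

lemma w2_W: "W D = W D' ==> w2 D j = w2 D' j"
  by (simp add: w2_def bias_def[abs_def] Fo_def[abs_def] fh_def[abs_def] A2_def AZ_def BZ_def mW_def[abs_def])

lemma basis_z_snd: "snd w = snd w' ==> (basis_z r' N :: ('dx, 'dz) cov => _) w = basis_z r' N w'"
  by (simp add: basis_z_def case_prod_beta)

lemma BZ_rZ: "BZ k (x(j := a)) y v = BZ k (x(j := rZ a)) y v"
  unfolding BZ_def by (intro fit_cong_basis basis_z_snd refl) (simp add: W_def)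

lemma BZ_snd: "snd v = snd v' ==> BZ k D y v = BZ k D y v'"
  using spn_z_fst[OF spn_fit, where x = "fst v" and z = "snd v" and x' = "fst v'"] unfolding BZ_def
  by (metis prod.collapse)

lemma BZ_cong: "(\<And>i. i \<in> blk k ==> D i = D' i) ==> (\<And>i. i \<in> blk k ==> y i = y' i) ==> BZ k D y v = BZ k D' y' v"
  unfolding BZ_def by (intro fit_cong) (simp_all add: W_def)

lemma A2_cong: "(\<And>i. i \<in> blk 1 ==> D i = D' i) ==> (\<And>i. i \<in> blk 1 ==> y i = y' i) ==> A2 D y v = A2 D' y' v"
  unfolding A2_def by (intro fit_cong) (simp_all add: W_def)

lemma AZ_cong: "(\<And>i. i \<in> blk 1 ==> D i = D' i) ==> (\<And>i. i \<in> blk 1 ==> y i = y' i) ==> AZ D y v = AZ D' y' v"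
  unfolding AZ_def by (intro fit_cong) (simp_all add: W_def)

lemma fh_cong: assumes "\<And>i. i \<in> blk 1 ==> D i = D' i" "\<And>i. i \<in> blk 1 ==> y i = y' i" shows "fh D y v = fh D' y' v"
proof -
  have a: "A2 D y v = A2 D' y' v" for v using assms by (rule A2_cong)
  have "AZ D (%i. A2 D y (W D i)) v = AZ D' (%i. A2 D' y' (W D' i)) v"
    using assms by (intro AZ_cong) (simp_all add: a W_def)
  then show ?thesis by (simp add: fh_def a)
qed

lemma Fhat_cong: assumes "\<And>i. i \<in> blk 1 \<union> blk 2 ==> D i = D' i" shows "Fhat D = Fhat D'"
proof
  fix v
  have h: "fh D (%i. obs_Y (D i)) v = fh D' (%i. obs_Y (D' i)) v" for v using assms by (intro fh_cong) (metis UnI1)+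
  have "BZ 2 D (%i. fh D (%i. obs_Y (D i)) (W D i)) v = BZ 2 D' (%i. fh D' (%i. obs_Y (D' i)) (W D' i)) v"
    by (intro BZ_cong) (simp_all add: assms h W_def)
  then show "Fhat D v = Fhat D' v" by (simp add: Fhat_def Fo_def h)
qed

lemma mhat_cong: assumes "\<And>i. i \<in> blk 3 ==> D i = D' i" shows "mhat D = mhat D'"
  unfolding mhat_def using assms by (intro ext BZ_cong) simp_all

lemma blk_disjoint: "j \<in> blk 3 ==> i \<in> blk 1 \<union> blk 2 ==> i \<noteq> j"
  by (auto simp: blk_def)

text \<open>The fitted direction comes from other blocks, and the regression on \<open>Z\<close>
  sees the changed observation through \<open>Z\<close> only.\<close>

lemma w4_rZ: assumes "j \<in> blk 3" shows "w4 (x(j := a)) i = w4 (x(j := rZ a)) i"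
proof -
  have "Fhat (x(j := a)) = Fhat (x(j := rZ a))" using blk_disjoint[OF assms] by (intro Fhat_cong) simp
  moreover have "BZ 3 (x(j := a)) y = BZ 3 (x(j := rZ a)) y" for y by (rule ext) (rule BZ_rZ)
  ultimately show ?thesis by (simp add: w4_def Fhat_def)
qed

text \<open>\<open>h2\<close> bounds the empirical square norm of fitted noise, \<open>qF\<close>
  and \<open>qD\<close> the square norms of the fitted direction and of the error of
  \<open>m\<close>. The free parameter \<open>A\<close> buys exceptional probabilities of order
  \<open>1 / A\<close>.\<close>

definition "h2 A = A * C0 * \<kappa>^2 * Kc / real n"
definition "qF A = 8 * \<kappa> ^ 3 * (12 * \<rho>^2 + 4 * (A * \<tau>) + h2 A)"
definition "qD A = 8 * \<kappa> * \<rho>^2 + 2 * \<kappa> * h2 A"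

text \<open>Positivity of the block length as a real number, the form in which the averages over a
  block use it.\<close>

lemma n_pos: "0 < real n" using n by simp

lemma sum_leverage:
  assumes "\<And>j. j \<in> blk k ==> emp k D (h j) \<le> \<kappa>^2 * Kc / (real n)^2"
  shows "(\<Sum>i\<in>blk k. \<Sum>j\<in>blk k. (h j (W D i))^2) \<le> \<kappa>^2 * Kc"
proof -
  have "(\<Sum>i\<in>blk k. \<Sum>j\<in>blk k. (h j (W D i))^2) = (\<Sum>j\<in>blk k. \<Sum>i\<in>blk k. (h j (W D i))^2)" by (rule sum.swap)
  also have "... = (\<Sum>j\<in>blk k. real n * emp k D (h j))" using n_pos by (simp add: emp_def)
  \<comment> \<open>Both powers of \<open>n\<close> cancel: there are \<open>n\<close> columns, and
    each sum over a block is \<open>n\<close> times an average. The total squared leverage is of the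
    order of the number of cells.\<close>
  also have "... \<le> (\<Sum>j\<in>blk k. real n * (\<kappa>^2 * Kc / (real n)^2))" using assms by (intro sum_mono mult_left_mono) auto
  also have "... = \<kappa>^2 * Kc" using n_pos by (simp add: power2_eq_square)
  finally show ?thesis .
qed

lemma xi_P: "\<xi> \<in> borel_measurable P" and eps_P: "\<epsilon> \<in> borel_measurable P" by (simp_all add: measP)

text \<open>At each design point of the block the fitted noise is one linear form, with weights from
  the hat matrix. Summing over the points, the total squared weight is bounded on the good event, so
  only the second moments of the noise are needed.\<close>

lemma fit_noise_tail:
  fixes h :: "('dx, 'dz) sample => nat => ('dx, 'dz) cov => real" and e :: "('dx, 'dz) obs => real" and q :: "('dx, 'dz) obs => ('dx, 'dz) obs"
  assumes A: "0 < A" and k: "k < 4" and e: "e \<in> borel_measurable P"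
    and m: "\<And>i j. i \<in> blk k ==> (%D. h D j (W D i)) \<in> borel_measurable MM"
    and q: "\<And>i l j x a. h (x(j := a)) l (W (x(j := a)) i) = h (x(j := q a)) l (W (x(j := q a)) i)"
    and N1: "\<And>u. u \<in> borel_measurable P ==> (\<integral>a. u (q a) * e a \<partial>P) = 0"
    and N2: "\<And>u. u \<in> borel_measurable P ==> (\<integral>\<^sup>+a. ennreal ((u (q a) * e a)^2) \<partial>P) \<le> ennreal C0 * (\<integral>\<^sup>+a. ennreal ((u (q a))^2) \<partial>P)"
    and lev: "\<And>D j. good k D ==> j \<in> blk k ==> emp k D (h D j) \<le> \<kappa>^2 * Kc / (real n)^2"
  shows "emeasure MM {D\<in>space MM. good k D \<and> h2 A \<le> emp k D (%v. \<Sum>j\<in>blk k. h D j v * e (D j))} \<le> ennreal (1 / A)"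
proof -
  define w where "w i j D = h D j (W D i)" for i j D
  have k0: "0 < \<kappa>^2 * Kc" using kappa_ge_1 Kc_ge_1 by (intro mult_pos_pos) auto
  have t: "0 < A * C0 * (\<kappa>^2 * Kc)" using A C0_pos k0 by simp
  have wm: "w i j \<in> borel_measurable (PiM {1..4 * n} (%_. P))" if "i \<in> blk k" for i j
    unfolding w_def MM_def[symmetric] by (rule m[OF that])
  have wr: "w i l (x(j := a)) = w i l (x(j := q a))" for i l j x a unfolding w_def by (rule q)
  define E where "E = {D\<in>space MM. (\<Sum>i\<in>blk k. \<Sum>j\<in>blk k. (w i j D)^2) \<le> \<kappa>^2 * Kc \<and> A * C0 * (\<kappa>^2 * Kc) \<le> (\<Sum>i\<in>blk k. (\<Sum>j\<in>blk k. w i j D * e (D j))^2)}"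
  have nt: "E \<in> sets MM" "emeasure MM E \<le> ennreal (C0 * (\<kappa>^2 * Kc) / (A * C0 * (\<kappa>^2 * Kc)))"
    unfolding E_def MM_def
    by (rule noise_tail[where w = w and r = q and \<xi> = e and ?C0.0 = C0] prob finite_atLeastAtMost blk_subset[OF k] blk_finite e wm wr N1 N2 C0_pos t less_imp_le[OF k0] | assumption)+
  have "{D\<in>space MM. good k D \<and> h2 A \<le> emp k D (%v. \<Sum>j\<in>blk k. h D j v * e (D j))} \<subseteq> E"
    unfolding E_def
  proof (clarify, intro conjI)
    fix D assume g: "good k D" and h: "h2 A \<le> emp k D (%v. \<Sum>j\<in>blk k. h D j v * e (D j))"
    show "(\<Sum>i\<in>blk k. \<Sum>j\<in>blk k. (w i j D)^2) \<le> \<kappa>^2 * Kc"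
      unfolding w_def by (rule sum_leverage[OF lev[OF g]])
    show "A * C0 * (\<kappa>^2 * Kc) \<le> (\<Sum>i\<in>blk k. (\<Sum>j\<in>blk k. w i j D * e (D j))^2)"
      using h n_pos by (simp add: h2_def emp_def w_def divide_le_cancel mult.assoc)
  qed
  from order_trans[OF emeasure_mono[OF this nt(1)] nt(2)] show ?thesis using C0_pos kappa_ge_1 Kc_ge_1 by auto
qed

lemma xi_fit_tail:
  assumes A: "0 < A"
  shows "emeasure MM {D\<in>space MM. good 1 D \<and> h2 A \<le> emp 1 D (A2 D (xis D))} \<le> ennreal (1 / A)"
proof -
  have e: "A2 D (xis D) = (%v. \<Sum>j\<in>blk 1. A2 D (unit_at j) v * \<xi> (D j))" for D
    unfolding A2_def by (rule ext, subst fit_unit_at) (simp_all add: xis_def mult.commute)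
  have b: "blk 1 \<subseteq> {1..4 * n}" by (rule blk_subset) simp
  show ?thesis unfolding e
  proof (rule fit_noise_tail[OF A _ xi_P])
    show "(%D. A2 D (unit_at j) (W D i)) \<in> borel_measurable MM" if "i \<in> blk 1" for i j
      using b that by (intro A2_measurable comp_MM W_measurable borel_measurable_const) blast+
    show "A2 (x(j := a)) (unit_at l) (W (x(j := a)) i) = A2 (x(j := rXZ a)) (unit_at l) (W (x(j := rXZ a)) i)" for i l j x a
      by (metis W_rXZ A2_W)
    show "(1::nat) < 4" by simp
  qed (rule xi_N1 xi_N2[folded C0_def] leverage_A2; assumption)+
qed

lemma eps_fit_tail:
  assumes A: "0 < A"
  shows "emeasure MM {D\<in>space MM. good 3 D \<and> h2 A \<le> emp 3 D (BZ 3 D (epss D))} \<le> ennreal (1 / A)"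
proof -
  have e: "BZ 3 D (epss D) = (%v. \<Sum>j\<in>blk 3. BZ 3 D (unit_at j) v * \<epsilon> (D j))" for D
    unfolding BZ_def by (rule ext, subst fit_unit_at) (simp_all add: epss_def mult.commute)
  have b: "blk 3 \<subseteq> {1..4 * n}" by (rule blk_subset) simp
  show ?thesis unfolding e
  proof (rule fit_noise_tail[OF A _ eps_P])
    show "(%D. BZ 3 D (unit_at j) (W D i)) \<in> borel_measurable MM" if "i \<in> blk 3" for i j
      using b that by (intro BZ_measurable comp_MM W_measurable borel_measurable_const) blast+
    show "BZ 3 (x(j := a)) (unit_at l) (W (x(j := a)) i) = BZ 3 (x(j := rZ a)) (unit_at l) (W (x(j := rZ a)) i)" for i l j x a
      using BZ_snd[of "W (x(j := a)) i" "W (x(j := rZ a)) i"] BZ_rZ by (simp add: W_def)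
    show "(3::nat) < 4" by simp
  qed (rule eps_N1 eps_N2[folded C0_def] leverage_BZ; assumption)+
qed

lemma noise2_tail:
  assumes t: "0 < t"
  shows "emeasure MM {D\<in>space MM. (good 1 D \<and> good 2 D \<and> good 3 D) \<and> t \<le> (noise2 D)^2} \<le> ennreal (C0 * ((2 * \<tau> + 8 * \<kappa> * \<rho>^2) * (4 * \<kappa> ^ 3) / real n) / t)"
proof -
  define b where "b = (2 * \<tau> + 8 * \<kappa> * \<rho>^2) * (4 * \<kappa> ^ 3) / real n"
  \<comment> \<open>A single linear form in the noise, hence the one-element index type.\<close>
  define w :: "unit => nat => ('dx, 'dz) sample => real" where "w s j D = w2 D j" for s j D
  have b1: "blk 1 \<subseteq> {1..4 * n}" by (rule blk_subset) simp
  have b0: "0 \<le> b" using kappa_ge_1 Q_nonneg[of f] unfolding b_def Q_f by simp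
  have wm: "w s j \<in> borel_measurable (PiM {1..4 * n} (%_. P))" for s j
    unfolding w_def MM_def[symmetric] by (rule w2_measurable[OF refl])
  have wr: "w s l (x(j := a)) = w s l (x(j := rXZ a))" for s l j x a
    unfolding w_def by (rule w2_W[OF W_rXZ])
  have f1: "finite (UNIV :: unit set)" by simp
  define E where "E = {D\<in>space MM. (\<Sum>s\<in>UNIV. \<Sum>j\<in>blk 1. (w s j D)^2) \<le> b \<and> t \<le> (\<Sum>s\<in>UNIV. (\<Sum>j\<in>blk 1. w s j D * \<xi> (D j))^2)}"
  have nt: "E \<in> sets MM" "emeasure MM E \<le> ennreal (C0 * (b) / (t))"
    unfolding E_def MM_def
    by (rule noise_tail[where w = w and r = rXZ and \<xi> = \<xi> and ?C0.0 = C0] prob finite_atLeastAtMost b1 f1 xi_P wm wr xi_N1 xi_N2[folded C0_def] C0_pos t b0 | assumption)+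
  have sub: "{D\<in>space MM. (good 1 D \<and> good 2 D \<and> good 3 D) \<and> t \<le> (noise2 D)^2} \<subseteq> E"
    unfolding E_def
  proof (clarify, intro conjI)
    fix D assume "good 1 D" "good 2 D" "good 3 D" "t \<le> (noise2 D)^2"
    then show "(\<Sum>s\<in>UNIV. \<Sum>j\<in>blk 1. (w s j D)^2) \<le> b" "t \<le> (\<Sum>s\<in>UNIV. (\<Sum>j\<in>blk 1. w s j D * \<xi> (D j))^2)"
      using sum_w2[of D] by (simp_all add: b_def w_def noise2_def)
  qed
  show ?thesis unfolding b_def[symmetric]
    using nt by (intro order_trans[OF emeasure_mono[OF sub]])
qed

text \<open>The bound on the weights involves the size of the fitted direction, which is random; it
  is therefore part of the event.\<close>

lemma noise4_tail:
  assumes t: "0 < t" and q: "0 \<le> q"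
  shows "emeasure MM {D\<in>space MM. (good 3 D \<and> Q (Fhat D) \<le> q) \<and> t \<le> (noise4 D)^2} \<le> ennreal (C0 * (\<kappa> * q / real n) / t)"
proof -
  define b where "b = \<kappa> * q / real n"
  define w :: "unit => nat => ('dx, 'dz) sample => real" where "w s j D = w4 D j" for s j D
  have b1: "blk 3 \<subseteq> {1..4 * n}" by (rule blk_subset) simp
  have b0: "0 \<le> b" using kappa_ge_1 q unfolding b_def by simp
  have wm: "w s j \<in> borel_measurable (PiM {1..4 * n} (%_. P))" for s j
    unfolding w_def MM_def[symmetric] by (rule w4_measurable[OF refl])
  have wr: "w s l (x(j := a)) = w s l (x(j := rZ a))" if "j \<in> blk 3" for s l j x a
    unfolding w_def by (rule w4_rZ[OF that])
  have f1: "finite (UNIV :: unit set)" by simp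
  define E where "E = {D\<in>space MM. (\<Sum>s\<in>UNIV. \<Sum>j\<in>blk 3. (w s j D)^2) \<le> b \<and> t \<le> (\<Sum>s\<in>UNIV. (\<Sum>j\<in>blk 3. w s j D * \<epsilon> (D j))^2)}"
  have nt: "E \<in> sets MM" "emeasure MM E \<le> ennreal (C0 * (b) / (t))"
    unfolding E_def MM_def
    by (rule noise_tail[where w = w and r = rZ and \<xi> = \<epsilon> and ?C0.0 = C0] prob finite_atLeastAtMost b1 f1 eps_P wm wr eps_N1 eps_N2[folded C0_def] C0_pos t b0 | assumption)+
  have sub: "{D\<in>space MM. (good 3 D \<and> Q (Fhat D) \<le> q) \<and> t \<le> (noise4 D)^2} \<subseteq> E"
    unfolding E_def
  proof (clarify, intro conjI)
    fix D assume g: "good 3 D" and qq: "Q (Fhat D) \<le> q" and tt: "t \<le> (noise4 D)^2"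
    have "\<kappa> * Q (Fhat D) / real n \<le> b" unfolding b_def using kappa_ge_1 qq by (intro divide_right_mono mult_left_mono) auto
    then show "(\<Sum>s\<in>UNIV. \<Sum>j\<in>blk 3. (w s j D)^2) \<le> b" 
      using sum_w4[OF g] by (simp add: w_def Fhat_def)
    show "t \<le> (\<Sum>s\<in>UNIV. (\<Sum>j\<in>blk 3. w s j D * \<epsilon> (D j))^2)"
      using tt by (simp add: w_def noise4_def)
  qed
  show ?thesis unfolding b_def[symmetric]
    using nt by (intro order_trans[OF emeasure_mono[OF sub]])
qed

text \<open>Markov's inequality, since the mean of the empirical square norm of \<open>f\<close> is
  \<open>\<tau>\<close>.\<close>

lemma emp_f_tail:
  assumes A: "0 < A" and \<tau>: "0 < \<tau>"
  shows "emeasure MM {D\<in>space MM. A * \<tau> \<le> emp 1 D f} \<le> ennreal (1 / A)"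
proof -
  have b1: "i \<in> {1..4 * n}" if "i \<in> blk 1" for i by (rule blk_subset[THEN subsetD, OF _ that]) simp
  define h where "h a = ennreal ((f (obs_XZ a))^2)" for a :: "('dx, 'dz) obs"
  have fP: "(%a. f (obs_XZ a)) \<in> borel_measurable P" by (rule XZ_P[OF f_meas])
  have hP: "h \<in> borel_measurable P" unfolding h_def using fP by measurable
  have hM: "(%D. h (D i)) \<in> borel_measurable MM" if "i \<in> blk 1" for i
    by (rule measurable_compose[OF comp_MM[OF b1[OF that]] hP])
  have eM: "(%D. emp 1 D f) \<in> borel_measurable MM"
    by (rule emp_measurable) (use b1 in \<open>auto intro!: measurable_compose[OF W_measurable[OF comp_MM] f_meas]\<close>)
  define B where "B = {D\<in>space MM. A * \<tau> \<le> emp 1 D f}"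
  have B: "B \<in> sets MM" unfolding B_def using eM by measurable
  have it: "(\<integral>\<^sup>+a. h a \<partial>P) = ennreal \<tau>"
  proof -
    obtain F where F: "\<And>v. v \<in> ucube ==> \<bar>f v\<bar> \<le> F" using bm_f unfolding bm_def by blast
    have "integrable P (%a. (f (obs_XZ a))^2)"
      using integrable_bounded_XZ(1)[of "%v. (f v)^2" "F\<^sup>2"] power_mono[OF F, of _ 2] f_meas by simp
    then show ?thesis unfolding h_def \<tau>_def by (intro nn_integral_eq_integral) auto
  qed
  have "emeasure MM B = (\<integral>\<^sup>+D. indicator B D \<partial>MM)" using B by simp
  also have "... \<le> (\<integral>\<^sup>+D. ennreal (1 / (A * \<tau> * real n)) * (\<Sum>i\<in>blk 1. h (D i)) \<partial>MM)"
  proof (rule nn_integral_mono)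
    fix D
    show "indicator B D \<le> ennreal (1 / (A * \<tau> * real n)) * (\<Sum>i\<in>blk 1. h (D i))"
    proof (cases "D \<in> B")
      case True
      have "1 \<le> 1 / (A * \<tau>) * emp 1 D f" using True A \<tau> by (simp add: B_def)
      also have "... = 1 / (A * \<tau> * real n) * (\<Sum>i\<in>blk 1. (f (obs_XZ (D i)))^2)" by (simp add: emp_def W_def)
      finally have "ennreal 1 \<le> ennreal (1 / (A * \<tau> * real n) * (\<Sum>i\<in>blk 1. (f (obs_XZ (D i)))^2))" by (rule ennreal_leI)
      also have "... = ennreal (1 / (A * \<tau> * real n)) * (\<Sum>i\<in>blk 1. h (D i))"
        using A \<tau> n_pos unfolding h_def by (subst sum_ennreal) (simp_all add: ennreal_mult[symmetric] sum_nonneg del: ennreal_1)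
      finally show ?thesis using True by simp
    qed simp
  qed
  also have "... = ennreal (1 / (A * \<tau> * real n)) * (\<Sum>i\<in>blk 1. \<integral>\<^sup>+D. h (D i) \<partial>MM)"
    using hM by (subst nn_integral_cmult) (auto simp: nn_integral_sum)
  also have "(\<Sum>i\<in>blk 1. \<integral>\<^sup>+D. h (D i) \<partial>MM) = (\<Sum>i\<in>blk 1. ennreal \<tau>)"
  proof (rule sum.cong[OF refl])
    fix i assume i: "i \<in> blk 1"
    have d: "distr MM P (%D. D i) = P" unfolding MM_def by (rule distr_PiM_component[OF prob b1[OF i]])
    have "(\<integral>\<^sup>+a. h a \<partial>distr MM P (%D. D i)) = (\<integral>\<^sup>+D. h (D i) \<partial>MM)" using hP by (intro nn_integral_distr comp_MM b1 i) simp
    then show "(\<integral>\<^sup>+D. h (D i) \<partial>MM) = ennreal \<tau>" unfolding d it by simp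
  qed
  also have "ennreal (1 / (A * \<tau> * real n)) * (\<Sum>i\<in>blk 1. ennreal \<tau>) = ennreal (1 / A)"
    using A \<tau> n_pos by (simp add: ennreal_of_nat_eq_real_of_nat ennreal_mult[symmetric])
  finally show ?thesis unfolding B_def .
qed

end

section \<open>Power of the test for a fixed distribution\<close>

lemma pred_disj: "Measurable.pred M P ==> Measurable.pred M R ==> Measurable.pred M (%x. P x \<or> R x)"
  by measurable

lemma emeasure_disj_le:
  assumes "Measurable.pred M P" "Measurable.pred M R" "0 \<le> a" "0 \<le> b"
    "emeasure M {x\<in>space M. P x} \<le> ennreal a" "emeasure M {x\<in>space M. R x} \<le> ennreal b"
  shows "emeasure M {x\<in>space M. P x \<or> R x} \<le> ennreal (a + b)"
proof -
  have "{x\<in>space M. P x \<or> R x} = {x\<in>space M. P x} \<union> {x\<in>space M. R x}" by auto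
  then have "emeasure M {x\<in>space M. P x \<or> R x} \<le> emeasure M {x\<in>space M. P x} + emeasure M {x\<in>space M. R x}"
    using assms(1,2) by (simp add: emeasure_subadditive)
  also have "... \<le> ennreal a + ennreal b" by (intro add_mono assms)
  finally show ?thesis using assms(3,4) by simp
qed

text \<open>A nonpositive summand makes the empirical variance positive, which excludes the junk value
  of the studentised sum at zero variance.\<close>

lemma studentised_sum_large:
  fixes l :: "nat => real"
  assumes n: "0 < n" and t: "0 < t" and S: "real n * t \<le> (\<Sum>i=1..n. l i)" and B: "(\<Sum>i=1..n. (l i)^2) \<le> real n * B"
    and neg: "\<exists>i\<in>{1..n}. l i \<le> 0" and z: "z\<^sup>2 * B < real n * t\<^sup>2"
  shows "z < real n powr (- 1 / 2) * (\<Sum>i=1..n. l i) / sqrt (1 / real n * (\<Sum>i=1..n. (l i)^2) - (1 / real n * (\<Sum>i=1..n. l i))^2)"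
proof -
  define s where "s = (\<Sum>i=1..n. l i)"
  define V where "V = 1 / real n * (\<Sum>i=1..n. (l i)^2) - (1 / real n * s)^2"
  define a where "a = s / real n"
  have n0: "0 < real n" using n by simp
  have a0: "0 < a" "t \<le> a" using S t n0 unfolding a_def s_def[symmetric] by (auto simp: field_simps intro: less_le_trans[of 0 "real n * t"])
  \<comment> \<open>The squared denominator is the mean squared deviation from \<open>a\<close>, and
    a nonpositive summand deviates from \<open>a > 0\<close> by at least \<open>a\<close>.\<close>
  have "(\<Sum>i=1..n. (l i - a)^2) = (\<Sum>i=1..n. (l i)^2) - 2 * a * s + real n * a\<^sup>2"
    by (simp add: power2_diff sum.distrib sum_subtractf s_def sum_distrib_left mult.commute mult.left_commute)
  also have "... = real n * V" using n0 by (simp add: V_def a_def power2_eq_square field_simps)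
  finally have v: "real n * V = (\<Sum>i=1..n. (l i - a)^2)" ..
  obtain k where k: "k \<in> {1..n}" "l k \<le> 0" using neg by blast
  have "0 < (l k - a)^2" using k a0 by auto
  also have "... \<le> (\<Sum>i=1..n. (l i - a)^2)" using k by (intro member_le_sum) auto
  finally have V0: "0 < V" unfolding v[symmetric] using n0 by (simp add: zero_less_mult_iff)
  have "V \<le> 1 / real n * (\<Sum>i=1..n. (l i)^2)" by (simp add: V_def)
  also have "... \<le> 1 / real n * (real n * B)" using B n0 by (intro mult_left_mono) auto
  finally have VB: "V \<le> B" using n0 by simp
  \<comment> \<open>The absolute value covers thresholds of either sign.\<close>
  have "\<bar>z\<bar> * sqrt V < sqrt (real n) * t"
  proof (rule power_less_imp_less_base[of _ 2])
    have "(\<bar>z\<bar> * sqrt V)^2 = z\<^sup>2 * V" using V0 by (simp add: power_mult_distrib)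
    also have "... \<le> z\<^sup>2 * B" using VB by (intro mult_left_mono) auto
    also have "... < real n * t\<^sup>2" by (rule z)
    finally show "(\<bar>z\<bar> * sqrt V)^2 < (sqrt (real n) * t)^2" by (simp add: power_mult_distrib)
  qed (use t in simp)
  also have "... \<le> sqrt (real n) * a" using a0 by (intro mult_left_mono) auto
  also have "... = real n powr (- 1 / 2) * s"
  proof -
    have "real n powr (- 1 / 2) = 1 / sqrt (real n)" using n0 by (simp add: powr_minus_divide powr_half_sqrt)
    moreover have "sqrt (real n) * (s / (sqrt (real n) * sqrt (real n))) = 1 / sqrt (real n) * s" using n0 by (simp del: real_sqrt_mult_self)
    ultimately show ?thesis by (simp add: a_def)
  qed
  finally have "\<bar>z\<bar> * sqrt V < real n powr (- 1 / 2) * s" .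
  moreover have "z * sqrt V \<le> \<bar>z\<bar> * sqrt V" using V0 by (intro mult_right_mono) auto
  ultimately have "z * sqrt V < real n powr (- 1 / 2) * s" by linarith
  then show ?thesis using V0 unfolding V_def[symmetric] s_def[symmetric] by (simp add: pos_less_divide_eq)
qed

context spline_test
begin

text \<open>The thresholds \<open>\<tau>^2 / 64\<close> allow each noise term a share of
  \<open>\<tau> / 8\<close> in the conditional mean. The last clause presupposes the bound on the
  fitted direction, which follows from the failure of the earlier ones.\<close>

definition "bad A D \<longleftrightarrow> \<not> good 1 D \<or> \<not> good 2 D \<or> \<not> good 3 D \<or> A * \<tau> \<le> emp 1 D f
  \<or> (good 1 D \<and> h2 A \<le> emp 1 D (A2 D (xis D))) \<or> (good 3 D \<and> h2 A \<le> emp 3 D (BZ 3 D (epss D)))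
  \<or> ((good 1 D \<and> good 2 D \<and> good 3 D) \<and> \<tau>^2 / 64 \<le> (noise2 D)^2)
  \<or> ((good 3 D \<and> Q (Fhat D) \<le> qF A) \<and> \<tau>^2 / 64 \<le> (noise4 D)^2)"

text \<open>Bounds the probability that a block fails to be good.\<close>

definition "pgood = 2 * real M ^ dd * Kc * exp (- (c * real n / (10 * real M ^ dd * Kc)))"
definition "pbad A = 3 * pgood + 3 / A + C0 * ((2 * \<tau> + 8 * \<kappa> * \<rho>^2) * (4 * \<kappa> ^ 3) / real n) / (\<tau>^2 / 64) + C0 * (\<kappa> * qF A / real n) / (\<tau>^2 / 64)"

lemma tau_nonneg: "0 \<le> \<tau>" using Q_nonneg[of f] unfolding Q_f .

lemma kappa_pos: "0 < \<kappa>" and Kc_pos: "0 < Kc" using kappa_ge_1 Kc_ge_1 by linarith+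

lemma h2_nonneg: "0 \<le> A ==> 0 \<le> h2 A" using C0_pos kappa_pos Kc_pos by (simp add: h2_def)

lemma qF_nonneg: "0 \<le> A ==> 0 \<le> qF A" using kappa_pos h2_nonneg tau_nonneg by (simp add: qF_def)

lemma qD_nonneg: "0 \<le> A ==> 0 \<le> qD A" using kappa_pos h2_nonneg by (simp add: qD_def)

lemma blk_comp: "k < 4 ==> i \<in> blk k ==> (%D. D i) \<in> measurable MM P"
  using blk_subset[THEN subsetD] by (intro comp_MM)

lemma bad_parts_measurable:
  "(%D. emp 1 D f) \<in> borel_measurable MM" "(%D. emp 1 D (A2 D (xis D))) \<in> borel_measurable MM"
  "(%D. emp 3 D (BZ 3 D (epss D))) \<in> borel_measurable MM" "noise2 \<in> borel_measurable MM" "noise4 \<in> borel_measurable MM"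
proof -
  have b1: "i \<in> blk 1 ==> (%D. D i) \<in> measurable MM P" and b3: "i \<in> blk 3 ==> (%D. D i) \<in> measurable MM P" for i
    by (rule blk_comp; simp)+
  show "(%D. emp 1 D f) \<in> borel_measurable MM"
    by (intro emp_measurable measurable_compose[OF W_measurable[where om = "%x. x", OF b1] f_meas]) simp
  have x: "i \<in> blk 1 ==> (%D. \<xi> (D i)) \<in> borel_measurable MM" and e: "i \<in> blk 3 ==> (%D. \<epsilon> (D i)) \<in> borel_measurable MM" for i
    by (rule measurable_compose[OF b1 xi_P] measurable_compose[OF b3 eps_P]; assumption)+
  show "(%D. emp 1 D (A2 D (xis D))) \<in> borel_measurable MM"
    unfolding xis_def[abs_def]
    by (intro emp_measurable A2_measurable[where om = "%x. x"] b1 x W_measurable) simp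
  show "(%D. emp 3 D (BZ 3 D (epss D))) \<in> borel_measurable MM"
    unfolding epss_def[abs_def]
    by (intro emp_measurable BZ_measurable[where om = "%x. x"] b3 e W_measurable) simp
  show "noise2 \<in> borel_measurable MM" unfolding noise2_def[abs_def]
    by (intro borel_measurable_sum borel_measurable_times w2_measurable[OF refl] x)
  show "noise4 \<in> borel_measurable MM" unfolding noise4_def[abs_def]
    by (intro borel_measurable_sum borel_measurable_times w4_measurable[OF refl] e)
qed

lemma bad_measurable_prob:
  assumes A: "0 < A" and \<tau>: "0 < \<tau>"
  shows "Measurable.pred MM (bad A)" "emeasure MM {D\<in>space MM. bad A D} \<le> ennreal (pbad A)"
proof -
  have g [measurable]: "Measurable.pred MM (good 1)" "Measurable.pred MM (good 2)" "Measurable.pred MM (good 3)"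
    by (rule good_measurable; simp)+
  note [measurable] = bad_parts_measurable Q_Fhat_measurable
  show "Measurable.pred MM (bad A)" unfolding bad_def[abs_def] by measurable
  have p0: "0 \<le> pgood" using Kc_pos by (simp add: pgood_def)
  have A0: "0 \<le> 1 / A" using A by simp
  have t: "0 < \<tau>^2 / 64" using \<tau> by simp
  have q: "0 \<le> qF A" using A by (intro qF_nonneg) simp
  have n2: "0 \<le> C0 * ((2 * \<tau> + 8 * \<kappa> * \<rho>^2) * (4 * \<kappa> ^ 3) / real n) / (\<tau>^2 / 64)"
    using C0_pos \<tau> kappa_pos by simp
  have n4: "0 \<le> C0 * (\<kappa> * qF A / real n) / (\<tau>^2 / 64)"
    using C0_pos \<tau> kappa_pos q by simp
  have gp: "emeasure MM {D\<in>space MM. \<not> good k D} \<le> ennreal pgood" if "k < 4" for k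
    unfolding pgood_def by (rule good_prob[OF that])
  have gps: "emeasure MM {D\<in>space MM. \<not> good 1 D} \<le> ennreal pgood" "emeasure MM {D\<in>space MM. \<not> good 2 D} \<le> ennreal pgood" "emeasure MM {D\<in>space MM. \<not> good 3 D} \<le> ennreal pgood"
    by (rule gp; simp)+
  have m: "Measurable.pred MM (%D. \<not> good 1 D)" "Measurable.pred MM (%D. \<not> good 2 D)" "Measurable.pred MM (%D. \<not> good 3 D)"
    "Measurable.pred MM (%D. A * \<tau> \<le> emp 1 D f)"
    "Measurable.pred MM (%D. good 1 D \<and> h2 A \<le> emp 1 D (A2 D (xis D)))"
    "Measurable.pred MM (%D. good 3 D \<and> h2 A \<le> emp 3 D (BZ 3 D (epss D)))"
    "Measurable.pred MM (%D. (good 1 D \<and> good 2 D \<and> good 3 D) \<and> \<tau>^2 / 64 \<le> (noise2 D)^2)"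
    "Measurable.pred MM (%D. (good 3 D \<and> Q (Fhat D) \<le> qF A) \<and> \<tau>^2 / 64 \<le> (noise4 D)^2)"
    by measurable
  have "emeasure MM {D\<in>space MM. bad A D} \<le> ennreal (pgood + (pgood + (pgood + (1 / A + (1 / A + (1 / A + (C0 * ((2 * \<tau> + 8 * \<kappa> * \<rho>^2) * (4 * \<kappa> ^ 3) / real n) / (\<tau>^2 / 64) + C0 * (\<kappa> * qF A / real n) / (\<tau>^2 / 64))))))))"
    unfolding bad_def
    by (intro emeasure_disj_le gps emp_f_tail[OF A \<tau>] xi_fit_tail[OF A] eps_fit_tail[OF A] noise2_tail[OF t] noise4_tail[OF t q]
        add_nonneg_nonneg p0 A0 n2 n4 pred_disj m)
  then show "emeasure MM {D\<in>space MM. bad A D} \<le> ennreal (pbad A)"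
    by (simp add: pbad_def algebra_simps)
qed

lemma not_bad:
  assumes A: "0 < A" and \<tau>: "0 < \<tau>" and nb: "\<not> bad A D"
    and H1: "sqrt (\<tau> * (4 * \<kappa> * \<rho>^2)) + sqrt (4 * \<kappa> * \<rho>^2 * (4 * \<kappa> ^ 3 * (12 * \<rho>^2 + 4 * (A * \<tau>)))) \<le> \<tau> / 4"
  shows "good 1 D" "Q (Fhat D) \<le> qF A" "Q (\<Delta> D) \<le> qD A" "\<tau> / 2 \<le> \<mu> D"
proof -
  have g: "good 1 D" "good 2 D" "good 3 D" and e: "emp 1 D f \<le> A * \<tau>" and x: "emp 1 D (A2 D (xis D)) \<le> h2 A"
    and z: "emp 3 D (BZ 3 D (epss D)) \<le> h2 A" and n2: "(noise2 D)^2 < \<tau>^2 / 64" and n4: "Q (Fhat D) \<le> qF A ==> (noise4 D)^2 < \<tau>^2 / 64"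
    using nb unfolding bad_def by (auto simp only: de_Morgan_disj de_Morgan_conj not_le not_not simp_thms less_imp_le)
  show "good 1 D" by fact
  have k3: "0 \<le> 8 * \<kappa> ^ 3" using kappa_pos by simp
  have "Q (Fhat D) \<le> 8 * \<kappa> ^ 3 * (12 * \<rho>^2 + 4 * emp 1 D f + emp 1 D (A2 D (xis D)))" by (rule Q_Fhat[OF g(1,2)])
  also have "... \<le> qF A" unfolding qF_def using e x k3 by (intro mult_left_mono add_mono) auto
  finally show q: "Q (Fhat D) \<le> qF A" .
  have "Q (\<Delta> D) \<le> 8 * \<kappa> * \<rho>^2 + 2 * \<kappa> * emp 3 D (BZ 3 D (epss D))" by (rule Q_Delta[OF g(3)])
  also have "... \<le> qD A" unfolding qD_def using z kappa_pos by (intro mult_left_mono add_mono) auto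
  finally show "Q (\<Delta> D) \<le> qD A" .
  \<comment> \<open>The budget: bias at most \<open>\<tau> / 4\<close>, two noise terms of at most
    \<open>\<tau> / 8\<close> each, so that \<open>\<tau> / 2\<close> of the signal is left.\<close>
  have sm: "\<bar>y\<bar> \<le> \<tau> / 8" if "y\<^sup>2 < \<tau>^2 / 64" for y
  proof -
    have "\<bar>y\<bar>\<^sup>2 \<le> (\<tau> / 8)^2" using that by (simp add: power_divide)
    from power2_le_imp_le[OF this] show ?thesis using \<tau> by simp
  qed
  have "sqrt (4 * \<kappa> * \<rho>^2 * (4 * \<kappa> ^ 3 * (12 * \<rho>^2 + 4 * emp 1 D f))) \<le> sqrt (4 * \<kappa> * \<rho>^2 * (4 * \<kappa> ^ 3 * (12 * \<rho>^2 + 4 * (A * \<tau>))))"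
    using e kappa_pos by (intro real_sqrt_le_mono mult_left_mono add_left_mono) auto
  then show "\<tau> / 2 \<le> \<mu> D" using mu_lower[OF g] H1 sm[OF n2] sm[OF n4[OF q]] by linarith
qed

definition l :: "('dx, 'dz) sample => ('dx, 'dz) obs => real" where
  "l D a = (obs_Y a - mhat D (obs_XZ a)) * Fhat D (obs_XZ a)"

lemma l_alt: "l D a = (\<epsilon> a + \<Delta> D (obs_XZ a)) * Fhat D (obs_XZ a)"
  by (simp add: l_def \<epsilon>_def \<Delta>_def)

lemma bm_meas: "bm h ==> h \<in> borel_measurable borel" by (simp add: bm_def)

lemma l_measurable: "l D \<in> borel_measurable P"
proof -
  have [measurable]: "Fhat D \<in> borel_measurable borel" "\<Delta> D \<in> borel_measurable borel" by (intro bm_meas bm_Fhat bm_Delta)+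
  show ?thesis unfolding l_alt[abs_def] measP by measurable
qed

text \<open>The direction is a function of \<open>(X, Z)\<close>, so \<open>\<epsilon>\<close> may
  be replaced by \<open>f\<close> under the integral.\<close>

lemma l_mean: "(\<integral>a. l D a \<partial>P) = \<mu> D"
proof -
  have F: "Fhat D \<in> borel_measurable borel" by (rule bm_meas[OF bm_Fhat])
  obtain B where B: "\<And>v. v \<in> ucube ==> \<bar>Fhat D v\<bar> \<le> B" using bm_Fhat[of D] unfolding bm_def by blast
  have bD: "bm (%v. \<Delta> D v * Fhat D v)" by (intro bm_mult bm_Delta bm_Fhat)
  then obtain B' where B': "\<And>v. v \<in> ucube ==> \<bar>\<Delta> D v * Fhat D v\<bar> \<le> B'" unfolding bm_def by blast
  note e = eps_XZ[OF F B]
  have i2: "integrable P (%a. \<Delta> D (obs_XZ a) * Fhat D (obs_XZ a))" by (rule integrable_bounded_XZ(1)[OF bm_meas[OF bD] B'])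
  have "(\<integral>a. l D a \<partial>P) = (\<integral>a. Fhat D (obs_XZ a) * \<epsilon> a + \<Delta> D (obs_XZ a) * Fhat D (obs_XZ a) \<partial>P)"
    by (simp add: l_alt algebra_simps)
  also have "... = (\<integral>a. Fhat D (obs_XZ a) * f (obs_XZ a) \<partial>P) + (\<integral>a. \<Delta> D (obs_XZ a) * Fhat D (obs_XZ a) \<partial>P)"
    using e i2 by simp
  also have "... = (\<integral>v. Fhat D v * f v \<partial>\<nu>) + (\<integral>v. \<Delta> D v * Fhat D v \<partial>\<nu>)"
    using integral_nu[OF bm_meas[OF bm_mult[OF bm_Fhat bm_f]]] integral_nu[OF bm_meas[OF bD]] by simp
  also have "... = ip f (Fhat D) + ip (\<Delta> D) (Fhat D)" by (simp add: ip_def mult.commute)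
  also have "... = \<mu> D" unfolding \<mu>_def by (rule ip_add_left[OF bm_f bm_Delta bm_Fhat, symmetric])
  finally show ?thesis .
qed

lemma nn_Q: assumes h: "bm h" shows "(\<integral>\<^sup>+a. ennreal ((h (obs_XZ a))^2) \<partial>P) = ennreal (Q h)"
proof -
  have h2: "bm (%v. (h v)^2)" using bm_mult[OF h h] by (simp add: power2_eq_square)
  then obtain B where B: "\<And>v. v \<in> ucube ==> \<bar>(h v)^2\<bar> \<le> B" unfolding bm_def by blast
  have "integrable P (%a. (h (obs_XZ a))^2)" by (rule integrable_bounded_XZ(1)[OF bm_meas[OF h2] B])
  then show ?thesis unfolding Q_def integral_nu[OF bm_meas[OF h2]] by (intro nn_integral_eq_integral) auto
qed

definition "qL A = (2 * (1 + C) + 2 * \<kappa> * Kc * qD A) * qF A"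

text \<open>The part with \<open>\<epsilon>\<close> is bounded by the conditional second moment of
  the noise. For the product of direction and error of \<open>m\<close> the direction is bounded by
  its supremum, which brings in the factor \<open>Kc\<close>; this is admissible as long as
  \<open>Kc * qD\<close> remains bounded.\<close>

lemma l_second:
  assumes g: "good 1 D" and q: "Q (Fhat D) \<le> qF A" "Q (\<Delta> D) \<le> qD A"
  shows "(\<integral>\<^sup>+a. ennreal ((l D a)^2) \<partial>P) \<le> ennreal (qL A)"
proof -
  define F where "F = Fhat D"
  have F: "F \<in> borel_measurable borel" and Dm: "\<Delta> D \<in> borel_measurable borel" unfolding F_def by (intro bm_meas bm_Fhat bm_Delta)+
  note [measurable] = F Dm
  have m1: "(%a. ennreal ((F (obs_XZ a) * \<epsilon> a)^2)) \<in> borel_measurable P" and m2: "(%a. ennreal ((\<Delta> D (obs_XZ a))^2)) \<in> borel_measurable P"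
    unfolding measP by measurable
  define B where "B = \<kappa> * Kc * Q F"
  have B0: "0 \<le> B" using kappa_pos Kc_pos Q_nonneg by (simp add: B_def)
  have "(\<integral>\<^sup>+a. ennreal ((l D a)^2) \<partial>P) \<le> (\<integral>\<^sup>+a. ennreal 2 * ennreal ((F (obs_XZ a) * \<epsilon> a)^2) + ennreal (2 * B) * ennreal ((\<Delta> D (obs_XZ a))^2) \<partial>P)"
  proof (rule nn_integral_mono_AE)
    show "AE a in P. ennreal ((l D a)^2) \<le> ennreal 2 * ennreal ((F (obs_XZ a) * \<epsilon> a)^2) + ennreal (2 * B) * ennreal ((\<Delta> D (obs_XZ a))^2)"
      using AE_ucube
    proof eventually_elim
      case (elim a)
      define d where "d = \<Delta> D (obs_XZ a)"
      define u where "u = F (obs_XZ a)"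
      have ub: "u\<^sup>2 \<le> B" unfolding u_def B_def F_def by (rule sup_bound[OF g PP_Fhat elim])
      have "l D a = u * \<epsilon> a + u * d" by (simp add: l_alt u_def d_def F_def algebra_simps)
      then have "(l D a)^2 \<le> 2 * (u * \<epsilon> a)^2 + 2 * (u * d)^2"
        using sum_squares_bound[of "u * \<epsilon> a" "u * d"] by (simp add: power2_sum)
      also have "(u * d)^2 \<le> B * d\<^sup>2" using ub by (simp add: power_mult_distrib mult_right_mono)
      finally have "(l D a)^2 \<le> 2 * (u * \<epsilon> a)^2 + 2 * B * d\<^sup>2" by simp
      then have "ennreal ((l D a)^2) \<le> ennreal (2 * (u * \<epsilon> a)^2 + 2 * B * d\<^sup>2)" by (rule ennreal_leI)
      also have "... = ennreal 2 * ennreal ((u * \<epsilon> a)^2) + ennreal (2 * B) * ennreal (d\<^sup>2)"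
        using B0 by (subst ennreal_plus) (simp_all add: ennreal_mult[symmetric] flip: ennreal_numeral)
      finally show ?case unfolding u_def d_def .
    qed
  qed
  also have "... = ennreal 2 * (\<integral>\<^sup>+a. ennreal ((F (obs_XZ a) * \<epsilon> a)^2) \<partial>P) + ennreal (2 * B) * (\<integral>\<^sup>+a. ennreal ((\<Delta> D (obs_XZ a))^2) \<partial>P)"
    using m1 m2 by (subst nn_integral_add) (auto simp: nn_integral_cmult)
  also have "... \<le> ennreal 2 * (ennreal (1 + C) * ennreal (Q F)) + ennreal (2 * B) * ennreal (Q (\<Delta> D))"
    using eps_second[OF F] nn_Q[OF bm_Delta[of D]] nn_Q[OF bm_Fhat[of D]] unfolding F_def[symmetric]
    by (intro add_mono mult_left_mono) auto
  also have "... = ennreal (2 * ((1 + C) * Q F) + 2 * B * Q (\<Delta> D))"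
    using constants Q_nonneg B0 by (subst ennreal_plus) (simp_all add: ennreal_mult[symmetric] del: ennreal_plus flip: ennreal_numeral)
  also have "... \<le> ennreal (qL A)"
  proof (rule ennreal_leI)
    have "2 * ((1 + C) * Q F) + 2 * B * Q (\<Delta> D) = (2 * (1 + C) + 2 * \<kappa> * Kc * Q (\<Delta> D)) * Q F" by (simp add: B_def algebra_simps)
    also have "... \<le> qL A" unfolding qL_def using q constants kappa_pos Kc_pos Q_nonneg[of F] Q_nonneg[of "\<Delta> D"]
      by (intro mult_mono add_mono mult_left_mono) (auto simp: F_def intro!: add_nonneg_nonneg mult_nonneg_nonneg order_trans[OF Q_nonneg q(2)])
    finally show "2 * ((1 + C) * Q F) + 2 * B * Q (\<Delta> D) \<le> qL A" .
  qed
  finally show ?thesis .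
qed

text \<open>A summand is the direction times \<open>\<epsilon> + \<Delta>\<close>. It is nonpositive
  where the noise opposes the sign of the direction by at least \<open>\<kappa>s\<close> and
  \<open>\<bar>\<Delta>\<bar>\<close> is below \<open>\<kappa>s\<close>. The first event has
  probability bounded below by \<open>noise_sign\<close>, and the exceptions to the second are
  controlled by Markov's inequality.\<close>

lemma l_nonpos:
  assumes \<kappa>s: "0 < \<kappa>s" "\<kappa>s = c / (24 * t)" and t: "t = (2 * C / c) powr (1 / \<delta>)" and \<eta>: "\<eta> \<le> measure \<nu> {v. \<bar>f v\<bar> \<le> \<kappa>s}"
    and q: "Q (\<Delta> D) \<le> qD A"
  shows "c / (8 * t * (1 + C)) * (c / (4 * t)) * \<eta> - qD A / \<kappa>s\<^sup>2 \<le> measure P {a\<in>space P. l D a \<le> 0}"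
proof -
  interpret nu: prob_space \<nu> by (rule prob_nu)
  have F: "Fhat D \<in> borel_measurable borel" and Dm: "\<Delta> D \<in> borel_measurable borel" by (intro bm_meas bm_Fhat bm_Delta)+
  note [measurable] = F Dm l_measurable[of D]
  define \<sigma> :: "('dx, 'dz) cov => real" where "\<sigma> v = (if 0 \<le> Fhat D v then 1 else -1)" for v
  have \<sigma>m [measurable]: "\<sigma> \<in> borel_measurable borel" unfolding \<sigma>_def by measurable
  have s1: "c / (8 * t * (1 + C)) * (c / (4 * t)) * \<eta> \<le> prob {a. \<sigma> (obs_XZ a) * \<epsilon> a \<le> - \<kappa>s}"
    by (rule noise_sign[OF \<sigma>m _ \<kappa>s t \<eta>]) (simp add: \<sigma>_def)
  define E where "E = {v. \<kappa>s\<^sup>2 \<le> (\<Delta> D v)^2}"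
  have Em: "E \<in> sets borel" unfolding E_def by measurable
  have "measure \<nu> E \<le> (\<integral>v. (\<Delta> D v)^2 \<partial>\<nu>) / \<kappa>s\<^sup>2"
    using integral_Markov_inequality_measure[OF bm_square[OF bm_Delta[of D]], of UNIV "\<kappa>s\<^sup>2"] \<kappa>s(1) by (simp add: E_def)
  also have "... \<le> qD A / \<kappa>s\<^sup>2" using q by (intro divide_right_mono) (auto simp: Q_def)
  finally have E1: "measure \<nu> E \<le> qD A / \<kappa>s\<^sup>2" .
  have E2: "measure \<nu> E = prob {a. obs_XZ a \<in> E}"
    unfolding \<nu>_def by (subst measure_distr[OF obs_P(3) Em]) (simp add: vimage_def)
  have sm: "{a. \<sigma> (obs_XZ a) * \<epsilon> a \<le> - \<kappa>s} \<in> sets P" "{a. obs_XZ a \<in> E} \<in> sets P" "{a\<in>space P. l D a \<le> 0} \<in> sets P"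
  proof -
    show "{a. \<sigma> (obs_XZ a) * \<epsilon> a \<le> - \<kappa>s} \<in> sets P" unfolding sets_P by measurable
    show "{a. obs_XZ a \<in> E} \<in> sets P" using measurable_sets[OF obs_P(3) Em] by (simp add: vimage_def)
    show "{a\<in>space P. l D a \<le> 0} \<in> sets P" by measurable
  qed
  have "{a. \<sigma> (obs_XZ a) * \<epsilon> a \<le> - \<kappa>s} \<subseteq> {a\<in>space P. l D a \<le> 0} \<union> {a. obs_XZ a \<in> E}"
  proof
    fix a assume a: "a \<in> {a. \<sigma> (obs_XZ a) * \<epsilon> a \<le> - \<kappa>s}"
    show "a \<in> {a\<in>space P. l D a \<le> 0} \<union> {a. obs_XZ a \<in> E}"
    proof (cases "obs_XZ a \<in> E")
      case False
      define d where "d = \<Delta> D (obs_XZ a)"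
      have "\<bar>d\<bar> < \<kappa>s"
      proof (rule power_less_imp_less_base[of _ 2])
        show "\<bar>d\<bar>\<^sup>2 < \<kappa>s\<^sup>2" using False by (simp add: E_def d_def)
      qed (use \<kappa>s in simp)
      then have "l D a \<le> 0" using a unfolding l_alt d_def[symmetric]
        by (cases "0 \<le> Fhat D (obs_XZ a)") (auto simp: \<sigma>_def mult_le_0_iff)
      then show ?thesis unfolding space_P by blast
    qed blast
  qed
  then have "prob {a. \<sigma> (obs_XZ a) * \<epsilon> a \<le> - \<kappa>s} \<le> prob ({a\<in>space P. l D a \<le> 0} \<union> {a. obs_XZ a \<in> E})"
    using sm by (intro finite_measure_mono) auto
  also have "... \<le> prob {a\<in>space P. l D a \<le> 0} + prob {a. obs_XZ a \<in> E}"
    using sm by (intro measure_Un_le) auto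
  finally show ?thesis using s1 E1 E2 by linarith
qed

lemma fit_z: "fit ginv K (basis_z r' N :: ('dx, 'dz) cov => _) I x y v = fit ginv K (tensor_spline r' N) I (%i. snd (x i)) y (snd v)"
proof -
  have "(basis_z r' N :: ('dx, 'dz) cov => _) = (%w. tensor_spline r' N (snd w))" by (simp add: fun_eq_iff basis_z_def)
  then show ?thesis by (simp add: fit_comp)
qed

lemma ols_block:
  assumes "\<And>w. dim_vec (b w) = K" "k * n + 1 = i0" "(k + 1) * n + 1 = i1"
  shows "ols_fit ginv K b (map (%w. (V w, h w)) (map D [i0..<i1])) v = fit ginv K b (blk k) (%i. V (D i)) (%i. h (D i)) v"
proof -
  have s: "set [i0..<i1] = blk k" using assms(2,3) by (auto simp: blk_def)
  have "map (%w. (V w, h w)) (map D [i0..<i1]) = map (%i. (V (D i), h (D i))) [i0..<i1]" by simp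
  moreover have "ols_fit ginv K b (map (%i. (V (D i), h (D i))) [i0..<i1]) v = fit ginv K b (set [i0..<i1]) (%i. V (D i)) (%i. h (D i)) v"
    by (rule ols_fit_eq_fit[OF ginv assms(1)]) simp
  ultimately show ?thesis unfolding s by (simp only:)
qed

text \<open>Bridges the regressions over lists and the fits over index sets; regressions on
  \<open>Z\<close> are read as functions of the pair.\<close>

lemma stat_eq:
  "spline_test_stat ginv r N n D = real n powr (- 1 / 2) * (\<Sum>i=1..n. l D (D i))
        / sqrt (1 / real n * (\<Sum>i=1..n. (l D (D i))^2) - (1 / real n * (\<Sum>i=1..n. l D (D i)))^2)"
proof -
  define gh where "gh = ols_fit ginv ((N + r) ^ CARD('dx) * (N + r) ^ CARD('dz)) (basis_xz r N) (map (%w. (obs_XZ w, obs_Y w)) (map D [n + 1..<2 * n + 1]))"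
  have gh: "gh = A2 D (%i. obs_Y (D i))"
    unfolding gh_def A2_def W_def[abs_def]
    by (rule ext) (rule ols_block, simp_all add: basis_xz_def case_prod_beta)
  define mt where "mt = ols_fit ginv ((N + r) ^ CARD('dz)) (tensor_spline r N) (map (%w. (obs_Z w, gh (obs_XZ w))) (map D [n + 1..<2 * n + 1]))"
  have mt: "mt z = AZ D (%i. A2 D (%i. obs_Y (D i)) (W D i)) (x, z)" for x z
    unfolding mt_def AZ_def fit_z by (subst ols_block[where k = 1]) (simp_all add: gh W_def)
  define fhat where "fhat = (%(x, z). gh (x, z) - mt z)"
  have fhat: "fhat v = fh D (%i. obs_Y (D i)) v" for v
    by (cases v) (simp add: fhat_def fh_def gh mt)
  have KZ: "N + 2 * r - 1 = N + (2 * r - 1)" using r_pos by simp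
  define mf where "mf = ols_fit ginv ((N + 2 * r - 1) ^ CARD('dz)) (tensor_spline (2 * r - 1) N) (map (%w. (obs_Z w, fhat (obs_XZ w))) (map D [2 * n + 1..<3 * n + 1]))"
  have mf: "mf (snd v) = BZ 2 D (%i. fh D (%i. obs_Y (D i)) (W D i)) v" for v
    unfolding mf_def BZ_def fit_z KZ by (subst ols_block[where k = 2]) (simp_all add: fhat W_def)
  define mh where "mh = ols_fit ginv ((N + 2 * r - 1) ^ CARD('dz)) (tensor_spline (2 * r - 1) N) (map (%w. (obs_Z w, obs_Y w)) (map D [3 * n + 1..<4 * n + 1]))"
  have mh: "mh (snd v) = mhat D v" for v
    unfolding mh_def mhat_def BZ_def fit_z KZ by (subst ols_block[where k = 3]) (simp_all add: W_def)
  have L: "(obs_Y a - mh (obs_Z a)) * (fhat (obs_XZ a) - mf (obs_Z a)) = l D a" for a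
    using mh[of "obs_XZ a"] mf[of "obs_XZ a"] by (simp add: l_def Fhat_def Fo_def fhat)
  show ?thesis
    unfolding spline_test_stat_def Let_def basis_xz_def[symmetric] gh_def[symmetric] mt_def[symmetric] fhat_def[symmetric] mf_def[symmetric] mh_def[symmetric] L ..
qed


lemma blocks_later: "k \<in> {1, 2, 3} ==> i \<in> blk k ==> i \<in> {n + 1..4 * n}"
  by (auto simp: blk_def)

text \<open>The direction and the fit of \<open>m\<close> come from the later blocks. With these
  fixed, the summands of the statistic are independent and identically distributed.\<close>

lemma l_cong: assumes "\<And>i. i \<in> {n + 1..4 * n} ==> D i = D' i" shows "l D = l D'"
proof -
  have e: "D i = D' i" if "k \<in> {1, 2, 3}" "i \<in> blk k" for i k using assms blocks_later[OF that] by blast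
  have "Fhat D = Fhat D'" using e[of 1] e[of 2] by (intro Fhat_cong) blast
  moreover have "mhat D = mhat D'" using e[of 3] by (intro mhat_cong) blast
  ultimately show ?thesis by (simp add: l_def[abs_def])
qed

lemma stat_measurable: "(%D. spline_test_stat ginv r N n D) \<in> borel_measurable MM"
proof -
  have b: "i \<in> blk k ==> k \<in> {1, 2, 3} ==> (%D. D i) \<in> measurable MM P" for i k by (rule blk_comp) auto
  have F: "(%D. Fhat D (v D)) \<in> borel_measurable MM" if "v \<in> measurable MM borel" for v
    using that b[of _ 1] b[of _ 2] by (intro Fhat_measurable[where om = "%x. x"]) blast+
  have m: "(%D. mhat D (v D)) \<in> borel_measurable MM" if "v \<in> measurable MM borel" for v
    using that b[of _ 3] by (intro mhat_measurable[where om = "%x. x"]) blast+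
  have lm: "(%D. l D (D i)) \<in> borel_measurable MM" if "i \<in> {1..n}" for i
  proof -
    have i: "(%D. D i) \<in> measurable MM P" using that by (intro comp_MM) auto
    show ?thesis unfolding l_def
      by (intro borel_measurable_times borel_measurable_diff F m measurable_compose[OF i] obs_P)
  qed
  show ?thesis unfolding stat_eq
    by (intro borel_measurable_divide borel_measurable_times borel_measurable_const borel_measurable_sum lm
        borel_measurable_sqrt measurable_compose[OF _ borel_measurable_sqrt] borel_measurable_diff borel_measurable_power)
qed

lemma qL_pos: assumes "0 < A" "0 < \<tau>" shows "0 < qL A"
proof -
  have h: "0 \<le> h2 A" "0 \<le> qD A" using assms by (auto intro: h2_nonneg qD_nonneg)
  have "0 < 12 * \<rho>^2 + 4 * (A * \<tau>) + h2 A" using assms h by (intro add_pos_nonneg add_nonneg_pos) auto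
  then have "0 < qF A" using kappa_pos by (simp add: qF_def)
  moreover have "0 < 2 * (1 + C) + 2 * \<kappa> * Kc * qD A" using constants kappa_pos Kc_pos h by (intro add_pos_nonneg) auto
  ultimately show ?thesis by (simp add: qL_def)
qed

text \<open>Fubini's theorem separates the fitting blocks from the averaged one. Off the bad event
  the summands have mean at least \<open>\<tau> / 2\<close> and second moment at most
  \<open>qL A\<close>, so the bounds for sample means apply to each section.\<close>

lemma rejection_bound:
  assumes \<tau>: "0 < \<tau>" and A: "0 < A"
    and H1: "sqrt (\<tau> * (4 * \<kappa> * \<rho>^2)) + sqrt (4 * \<kappa> * \<rho>^2 * (4 * \<kappa> ^ 3 * (12 * \<rho>^2 + 4 * (A * \<tau>)))) \<le> \<tau> / 4"
    and \<eta>: "\<eta> \<le> 1" "\<And>D. Q (\<Delta> D) \<le> qD A ==> \<eta> \<le> measure P {a\<in>space P. l D a \<le> 0}"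
    and z: "16 * z\<^sup>2 * (A * qL A) < real n * \<tau>^2"
  shows "1 - (pbad A + (16 * qL A / (real n * \<tau>^2) + 1 / A + (1 - \<eta>) ^ n)) \<le> measure MM {D\<in>space MM. z < spline_test_stat ginv r N n D}"
proof -
  interpret MM: prob_space MM by (rule prob_MM)
  interpret product_sigma_finite "%_. P" by standard
  define d0 where "d0 = 16 * qL A / (real n * \<tau>^2) + 1 / A + (1 - \<eta>) ^ n"
  have q0: "0 < qL A" by (rule qL_pos[OF A \<tau>])
  have d0: "0 \<le> d0" using q0 A \<eta>(1) by (simp add: d0_def)
  define I J where "I = {n + 1..4 * n}" and "J = {1..n}"
  have IJ: "I \<inter> J = {}" "finite I" "finite J" "J \<noteq> {}" "{1..4 * n} = I \<union> J" using n by (auto simp: I_def J_def)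
  have cJ: "card J = n" by (simp add: J_def)
  note [measurable] = stat_measurable bad_measurable_prob(1)[OF A \<tau>]
  define T :: "('dx, 'dz) sample => real" where "T = spline_test_stat ginv r N n"
  define G where "G = {D\<in>space MM. bad A D}"
  define H where "H = {D\<in>space MM. \<not> z < T D \<and> \<not> bad A D}"
  define E where "E = {D\<in>space MM. z < T D}"
  have sets: "G \<in> sets MM" "H \<in> sets MM" "E \<in> sets MM" unfolding G_def H_def E_def T_def by measurable
  \<comment> \<open>One completion \<open>y0\<close> outside the event \<open>bad\<close> suffices:
    \<open>l\<close> ignores the averaged block, so all completions of \<open>x\<close> share the
    function \<open>l D0\<close>. If no completion lies in \<open>H\<close>, the inner integral is
    0.\<close>
  have inner: "(\<integral>\<^sup>+y. indicator H (merge I J (x, y)) \<partial>PiM J (%_. P)) \<le> ennreal d0" for x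
  proof (cases "\<exists>y0. merge I J (x, y0) \<in> H")
    case True
    then obtain y0 where y0: "merge I J (x, y0) \<in> H" by blast
    define D0 where "D0 = merge I J (x, y0)"
    have lc: "l (merge I J (x, y)) = l D0" for y
      unfolding D0_def using IJ(1) by (intro l_cong) (simp only: merge_apply I_def[symmetric])
    have nb: "\<not> bad A D0" using y0 by (simp add: H_def D0_def)
    note b = not_bad[OF A \<tau> nb H1]
    define B where "B = {y\<in>space (PiM J (%_. P)). \<not> (real (card J) * \<mu> D0 / 2 \<le> (\<Sum>i\<in>J. l D0 (y i)) \<and> (\<Sum>i\<in>J. (l D0 (y i))^2) \<le> real (card J) * (A * qL A) \<and> (\<exists>i\<in>J. l D0 (y i) \<le> 0))}"
    have lJ: "(%y. l D0 (y i)) \<in> borel_measurable (PiM J (%_. P))" if "i \<in> J" for i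
      by (rule measurable_compose[OF measurable_component_singleton[OF that] l_measurable])
    have [measurable]: "Measurable.pred (PiM J (%_. P)) (%y. \<exists>i\<in>J. l D0 (y i) \<le> 0)"
    proof (intro pred_intros_finite IJ(3))
      fix i assume "i \<in> J"
      note [measurable] = lJ[OF this]
      show "Measurable.pred (PiM J (%_. P)) (%y. l D0 (y i) \<le> 0)" by measurable
    qed
    have [measurable]: "(%y. \<Sum>i\<in>J. l D0 (y i)) \<in> borel_measurable (PiM J (%_. P))" "(%y. \<Sum>i\<in>J. (l D0 (y i))^2) \<in> borel_measurable (PiM J (%_. P))"
      by (intro borel_measurable_sum borel_measurable_power lJ; assumption)+
    have Bm: "B \<in> sets (PiM J (%_. P))" unfolding B_def by measurable
    have \<mu>0: "0 < \<mu> D0" using b(4) \<tau> by simp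
    have "(\<integral>\<^sup>+y. indicator H (merge I J (x, y)) \<partial>PiM J (%_. P)) \<le> (\<integral>\<^sup>+y. indicator B y \<partial>PiM J (%_. P))"
    proof (rule nn_integral_mono)
      fix y assume y: "y \<in> space (PiM J (%_. P))"
      have "merge I J (x, y) \<notin> H" if nB: "y \<notin> B"
      proof -
        define D where "D = merge I J (x, y)"
        have D: "D i = y i" if "i \<in> J" for i using that IJ(1) by (simp add: D_def)
        have s: "(\<Sum>i\<in>J. l D (D i)) = (\<Sum>i\<in>J. l D0 (y i))" "(\<Sum>i\<in>J. (l D (D i))^2) = (\<Sum>i\<in>J. (l D0 (y i))^2)"
          unfolding D_def[symmetric] using lc[of y, folded D_def] D by simp_all
        have B': "real (card J) * \<mu> D0 / 2 \<le> (\<Sum>i\<in>J. l D0 (y i))" "(\<Sum>i\<in>J. (l D0 (y i))^2) \<le> real (card J) * (A * qL A)" "\<exists>i\<in>J. l D0 (y i) \<le> 0"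
          using nB y unfolding B_def by blast+
        \<comment> \<open>\<open>\<mu> \<ge> \<tau> / 2\<close>, and the sample sum reaches half of
          its mean: hence \<open>\<tau> / 4\<close> per observation, and the factor 16 in the
          condition on \<open>z\<close>.\<close>
        have "real n * (\<tau> / 4) \<le> real n * (\<mu> D0 / 2)" using b(4) by (intro mult_left_mono) auto
        then have S: "real n * (\<tau> / 4) \<le> (\<Sum>i=1..n. l D (D i))" using B'(1) s(1) cJ unfolding J_def by simp
        have S2: "(\<Sum>i=1..n. (l D (D i))^2) \<le> real n * (A * qL A)" using B'(2) s(2) cJ unfolding J_def by simp
        have ng: "\<exists>i\<in>{1..n}. l D (D i) \<le> 0" using B'(3) lc[of y, folded D_def] D unfolding J_def by auto
        have "z < T D" unfolding T_def stat_eq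
          by (rule studentised_sum_large[OF n _ S S2 ng]) (use \<tau> z in \<open>simp_all add: power_divide algebra_simps\<close>)
        then show ?thesis by (simp add: H_def D_def)
      qed
      then show "indicator H (merge I J (x, y)) \<le> (indicator B y :: ennreal)" by (auto simp: indicator_def)
    qed
    also have "... = emeasure (PiM J (%_. P)) B" using Bm by simp
    also have "... \<le> ennreal (4 * qL A / (real (card J) * (\<mu> D0)^2) + 1 / A + (1 - \<eta>) ^ card J)"
      unfolding B_def by (rule sample_mean_bounds[OF prob IJ(3,4) l_measurable l_second[OF b(1,2,3)] q0 l_mean \<mu>0 \<eta>(2)[OF b(3)] A])
    also have "... \<le> ennreal d0"
    proof (rule ennreal_leI)
      have "(\<tau> / 2)^2 \<le> (\<mu> D0)^2" using b(4) \<tau> by (intro power_mono) auto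
      then have "4 * qL A / (real n * (\<mu> D0)^2) \<le> 4 * qL A / (real n * (\<tau> / 2)^2)"
        using q0 n_pos \<tau> \<mu>0 by (intro divide_left_mono mult_left_mono mult_pos_pos) auto
      also have "... = 16 * qL A / (real n * \<tau>^2)" by (simp add: power_divide)
      finally show "4 * qL A / (real (card J) * (\<mu> D0)^2) + 1 / A + (1 - \<eta>) ^ card J \<le> d0" by (simp add: d0_def cJ)
    qed
    finally show ?thesis .
  next
    case False
    then show ?thesis by simp
  qed
  have Hm: "(indicator H :: _ => ennreal) \<in> borel_measurable MM" using sets by simp
  have "emeasure MM H = (\<integral>\<^sup>+D. indicator H D \<partial>MM)" using sets by simp
  also have "... = (\<integral>\<^sup>+x. (\<integral>\<^sup>+y. indicator H (merge I J (x, y)) \<partial>PiM J (%_. P)) \<partial>PiM I (%_. P))"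
    unfolding MM_def IJ(5) by (rule product_nn_integral_fold[OF IJ(1-3) Hm[unfolded MM_def IJ(5)]])
  also have "... \<le> (\<integral>\<^sup>+x. ennreal d0 \<partial>PiM I (%_. P))" by (intro nn_integral_mono inner)
  also have "... = ennreal d0"
  proof -
    interpret MI: prob_space "PiM I (%_. P)" by (intro prob_space_PiM prob)
    show ?thesis by (simp add: MI.emeasure_space_1)
  qed
  finally have H: "measure MM H \<le> d0" using d0 by (simp add: MM.emeasure_eq_measure)
  have p0: "0 \<le> pbad A" using A C0_pos \<tau> kappa_pos Kc_pos qF_nonneg[of A] by (simp add: pbad_def pgood_def)
  have G: "measure MM G \<le> pbad A" using bad_measurable_prob(2)[OF A \<tau>] p0 by (simp add: MM.emeasure_eq_measure G_def)
  have "1 = measure MM (space MM)" by (simp add: MM.prob_space)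
  also have "space MM = E \<union> (G \<union> H)" by (auto simp: E_def G_def H_def)
  also have "measure MM ... \<le> measure MM E + (measure MM G + measure MM H)"
    using sets by (intro order_trans[OF measure_Un_le] add_left_mono measure_Un_le) auto
  finally have "1 \<le> measure MM E + (pbad A + d0)" using G H by linarith
  then show ?thesis by (simp add: E_def T_def d0_def)
qed


text \<open>Here \<open>x = n powr (d / (4 * s + d))\<close>, so that the minimax rate is \<open>x / n\<close>, and \<open>t\<close> measures the
  separation in multiples of this rate.\<close>

lemma test_power:
  fixes x t A C1 C2 z k C0' F1 D1 L1 D \<eta>1 \<kappa>s u K :: real and L0 :: nat
  assumes A: "1 \<le> A" and x: "1 \<le> x" "x ^ 4 \<le> real n" and t: "D \<le> t" and CC: "0 < C1" "0 \<le> C2"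
    and Kc_le: "real (N + 1) ^ dd \<le> C1 * x\<^sup>2" and \<rho>_le: "\<rho>^2 \<le> C2 * (x / real n)" and \<tau>_ge: "t * (x / real n) \<le> \<tau>"
    and k: "k = 12 * C * real M ^ dd / c" and C0': "C0' = 4 * (1 + C)"
    and F1: "F1 = 8 * k ^ 3 * (12 * C2 + 4 + C0' * k\<^sup>2 * C1)"
    and D1: "D1 = 8 * k * C2 + 2 * k * (C0' * k\<^sup>2 * C1)"
    and L1: "L1 = (2 * (1 + C) + 2 * k * C1 * D1) * F1"
    and D: "D = 48 * z\<^sup>2 * L1 * A ^ 3 + 256 * k * C2 + 1024 * k ^ 4 * C2 * (12 * C2 + 4 * A) + 1
        + 768 * k ^ 3 * C0' * (2 + 8 * k * C2) + 192 * C0' * k * F1 * A + 48 * L1 * A\<^sup>2"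
    and \<kappa>s: "\<kappa>s = c / (24 * u)" and u: "u = (2 * C / c) powr (1 / \<delta>)"
    and K: "K \<ge> 0" "\<And>p::real poly. \<And>A a h s t. degree p \<le> r ==> 0 < h ==> (\<And>t. a \<le> t ==> t < a + h ==> \<bar>poly p t\<bar> \<le> A)
     ==> a \<le> s ==> s < a + h ==> a \<le> t ==> t < a + h ==> \<bar>poly p s - poly p t\<bar> \<le> K * A * (\<bar>s - t\<bar> / h)"
    and L0: "0 < L0" "(2 * (C + 1) + K * (sqrt (1 + C) + 2 * (C + 1))) * real dd \<le> \<kappa>s * real L0"
    and \<eta>1: "\<eta>1 = c / (8 * u * (1 + C)) * (c / (4 * u)) * (c * (1 / real L0) ^ dd)"
    and small: "D1 * A * (1 / sqrt (real n)) \<le> \<kappa>s\<^sup>2 * (\<eta>1 / 2)"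
    and z: "z = std_normal_quantile (1 - \<alpha>)"
  shows "1 - (4 / A + D / t + 6 * real M ^ dd * C1 * sqrt (real n) * exp (- (c / (10 * real M ^ dd * C1) * sqrt (real n))) + (1 - \<eta>1 / 2) ^ n)
    \<le> rejection_prob ginv r N \<alpha> n P"
proof -
  have C00: "C0' = C0" by (simp add: C0' C0_def)
  have Kc': "Kc \<le> C1 * x\<^sup>2" using Kc_le by (simp add: Kc_def)
  \<comment> \<open>The consequence of \<open>x ^ 4 \<le> n\<close> used for the number of cells: up
    to constants, \<open>Kc\<close> is at most \<open>sqrt n\<close>.\<close>
  have xs: "x\<^sup>2 \<le> sqrt (real n)"
    using x by (intro real_le_rsqrt) (simp flip: power_mult)
  have n0: "0 < real n" by (rule n_pos)
  have sq: "sqrt (real n) * sqrt (real n) = real n" by simp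
  have Mf: "0 < 2 * (C + 1) + K * (sqrt (1 + C) + 2 * (C + 1))" using constants K(1) by (intro add_pos_nonneg) auto
  have \<eta>0: "c * (1 / real L0) ^ dd \<le> measure \<nu> {v. \<bar>f v\<bar> \<le> \<kappa>s}"
    unfolding dd by (rule f_small_set[OF Mf f_axis_lipschitz[OF K] L0(1) L0(2)[unfolded dd]])
  have k\<kappa>: "k = \<kappa>" by (simp add: k \<kappa>_def)
  have k0: "0 < k" using kappa_pos k\<kappa> by simp
  have c0: "0 < C0'" using C0_pos C00 by simp
  have F0: "0 \<le> F1" and D10: "0 \<le> D1" using k0 c0 CC by (auto simp: F1 D1)
  have L10: "0 \<le> L1" using F0 D10 k0 CC constants by (simp add: L1)
  \<comment> \<open>All summands of \<open>D\<close> are nonnegative, so \<open>D \<le> t\<close>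
    yields each requirement separately: the first summand serves the threshold \<open>z\<close>, the
    next two the bias terms, the 1 gives \<open>t \<ge> 1\<close>, and the last three are the
    numerators of the variance terms.\<close>
  have parts: "0 \<le> 48 * z\<^sup>2 * L1 * A ^ 3" "0 \<le> 256 * k * C2" "0 \<le> 1024 * k ^ 4 * C2 * (12 * C2 + 4 * A)"
    "0 \<le> 768 * k ^ 3 * C0' * (2 + 8 * k * C2)" "0 \<le> 192 * C0' * k * F1 * A" "0 \<le> 48 * L1 * A\<^sup>2"
    using L10 A k0 CC c0 F0 by simp_all
  have "x\<^sup>2 / real n \<le> sqrt (real n) / real n" using xs by (intro divide_right_mono) auto
  also have "... = 1 / sqrt (real n)" using n0 sq by (simp add: field_simps)
  finally have "D1 * A * (x\<^sup>2 / real n) \<le> D1 * A * (1 / sqrt (real n))" using D10 A by (intro mult_left_mono) auto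
  then have small_x: "D1 * A * (x\<^sup>2 / real n) \<le> \<kappa>s\<^sup>2 * (\<eta>1 / 2)" using small by linarith
  have t1: "1 \<le> t" using parts t D by linarith
  have xn: "0 < x / real n" using x n0 by simp
  have \<tau>0: "0 < \<tau>" using mult_pos_pos[of t "x / real n"] t1 xn \<tau>_ge by linarith
  \<comment> \<open>The scale of all second moments. Each of its three parts, multiplied by
    \<open>t\<close>, is at most \<open>Y = n \<tau>^2\<close>; so every moment of order
    \<open>S\<close> is at most a constant over \<open>t\<close> relative to
    \<open>Y\<close>.\<close>
  define S where "S = x / real n + \<tau> + x\<^sup>2 / real n"
  define Y where "Y = real n * \<tau>^2"
  have Y0: "0 < Y" using n0 \<tau>0 by (simp add: Y_def)
  have S0: "0 \<le> S" using xn \<tau>0 by (simp add: S_def)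
  have x2: "x \<le> x\<^sup>2" using mult_right_mono[of 1 x x] x by (simp add: power2_eq_square)
  have tx: "t * x \<le> real n * \<tau>" using \<tau>_ge n0 by (simp add: field_simps)
  have s2: "\<tau> * t \<le> Y"
  proof -
    have "t * 1 \<le> t * x" using x t1 by (intro mult_left_mono) auto
    then have "\<tau> * t \<le> \<tau> * (real n * \<tau>)" using tx \<tau>0 by (intro mult_left_mono) auto
    then show ?thesis by (simp add: Y_def power2_eq_square mult_ac)
  qed
  have s3: "x\<^sup>2 / real n * t \<le> Y"
  proof -
    have "t * x\<^sup>2 \<le> t\<^sup>2 * x\<^sup>2" using mult_right_mono[of 1 t t] t1 by (intro mult_right_mono) (auto simp: power2_eq_square)
    also have "... = (t * x)^2" by (simp add: power_mult_distrib)
    also have "... \<le> (real n * \<tau>)^2" using tx t1 x by (intro power_mono) auto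
    finally have "t * x\<^sup>2 \<le> Y * real n" by (simp add: Y_def power2_eq_square mult_ac)
    then show ?thesis using n0 by (simp add: field_simps)
  qed
  have s1: "x / real n * t \<le> Y"
  proof -
    have "x / real n * t \<le> x\<^sup>2 / real n * t" using x2 n0 t1 by (intro mult_right_mono divide_right_mono) auto
    then show ?thesis using s3 by linarith
  qed
  have "S * t \<le> 3 * Y" using s1 s2 s3 by (simp add: S_def distrib_right)
  then have SY: "S / Y \<le> 3 / t" using Y0 t1 by (simp add: field_simps)
  have sc: "v / Y \<le> 3 * a / t" if "v \<le> a * S" "0 \<le> a" for v a
  proof -
    have "v / Y \<le> a * (S / Y)" using that Y0 by (simp add: divide_right_mono)
    also have "... \<le> a * (3 / t)" using SY that by (intro mult_left_mono)
    finally show ?thesis by (simp add: mult.commute)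
  qed
  have \<rho>S: "\<rho>^2 \<le> C2 * S"
  proof -
    have "C2 * (x / real n) \<le> C2 * S" using CC \<tau>0 by (intro mult_left_mono) (auto simp: S_def)
    then show ?thesis using \<rho>_le by linarith
  qed
  have h2: "h2 A \<le> C0' * k\<^sup>2 * C1 * A * (x\<^sup>2 / real n)"
  proof -
    have "A * C0' * k\<^sup>2 * Kc \<le> A * C0' * k\<^sup>2 * (C1 * x\<^sup>2)" using A c0 Kc' by (intro mult_left_mono) auto
    then have "A * C0' * k\<^sup>2 * Kc / real n \<le> A * C0' * k\<^sup>2 * (C1 * x\<^sup>2) / real n" using n0 by (intro divide_right_mono) auto
    then show ?thesis by (simp add: h2_def k\<kappa> C00 mult_ac)
  qed
  have qF: "qF A \<le> F1 * A * S"
  proof -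
    have "12 * \<rho>^2 \<le> 12 * (A * (C2 * S))" using \<rho>S A CC S0 mult_right_mono[of 1 A "C2 * S"] by simp
    moreover have "A * \<tau> \<le> A * S" using A xn by (intro mult_left_mono) (auto simp: S_def)
    moreover have "C0' * k\<^sup>2 * C1 * A * (x\<^sup>2 / real n) \<le> C0' * k\<^sup>2 * C1 * A * S"
      using A CC c0 xn \<tau>0 by (intro mult_left_mono) (auto simp: S_def)
    ultimately have "12 * \<rho>^2 + 4 * (A * \<tau>) + h2 A \<le> (12 * C2 + 4 + C0' * k\<^sup>2 * C1) * A * S"
      using h2 by (simp add: algebra_simps)
    then have "8 * k ^ 3 * (12 * \<rho>^2 + 4 * (A * \<tau>) + h2 A) \<le> 8 * k ^ 3 * ((12 * C2 + 4 + C0' * k\<^sup>2 * C1) * A * S)"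
      using k0 by (intro mult_left_mono) auto
    then show ?thesis by (simp add: qF_def F1 k\<kappa> mult_ac)
  qed
  have qD: "qD A \<le> D1 * A * (x\<^sup>2 / real n)"
  proof -
    have "x / real n \<le> x\<^sup>2 / real n" using x2 n0 by (intro divide_right_mono) auto
    then have "C2 * (x / real n) \<le> C2 * (x\<^sup>2 / real n)" using CC by (intro mult_left_mono)
    also have "... \<le> A * (C2 * (x\<^sup>2 / real n))" using mult_right_mono[of 1 A "C2 * (x\<^sup>2 / real n)"] A CC by simp
    finally have "8 * k * \<rho>^2 \<le> 8 * k * (A * (C2 * (x\<^sup>2 / real n)))" using \<rho>_le k0 by (intro mult_left_mono) auto
    moreover have "2 * k * h2 A \<le> 2 * k * (C0' * k\<^sup>2 * C1 * A * (x\<^sup>2 / real n))" using h2 k0 by (intro mult_left_mono) auto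
    moreover have "D1 * A * (x\<^sup>2 / real n) = 8 * k * (A * (C2 * (x\<^sup>2 / real n))) + 2 * k * (C0' * k\<^sup>2 * C1 * A * (x\<^sup>2 / real n))"
      unfolding D1 by (simp add: algebra_simps)
    ultimately show ?thesis unfolding qD_def k\<kappa>[symmetric] by linarith
  qed
  have qL: "qL A \<le> L1 * A\<^sup>2 * S"
  proof -
    \<comment> \<open>The place of \<open>x ^ 4 \<le> n\<close> in the second moment: the number of
      cells times the squared error of \<open>m\<close> has order \<open>x ^ 4 / n\<close>.\<close>
    have "Kc * qD A \<le> C1 * x\<^sup>2 * (D1 * A * (x\<^sup>2 / real n))"
      using Kc' qD Kc_pos qD_nonneg[of A] A CC by (intro mult_mono) auto
    also have "... = C1 * D1 * A * (x ^ 4 / real n)" by (simp add: power2_eq_square power4_eq_xxxx)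
    also have "... \<le> C1 * D1 * A * 1" using x n0 CC D10 A by (intro mult_left_mono) auto
    finally have "2 * k * (Kc * qD A) \<le> 2 * k * (C1 * D1 * A * 1)" using k0 by (intro mult_left_mono) auto
    moreover have "2 * (1 + C) \<le> A * (2 * (1 + C))" using mult_right_mono[of 1 A "2 * (1 + C)"] A constants by simp
    ultimately have "2 * (1 + C) + 2 * k * Kc * qD A \<le> (2 * (1 + C) + 2 * k * C1 * D1) * A" by (simp add: algebra_simps)
    then have "qL A \<le> ((2 * (1 + C) + 2 * k * C1 * D1) * A) * (F1 * A * S)"
      unfolding qL_def k\<kappa>[symmetric] using qF qF_nonneg[of A] A constants k0 CC D10
      by (intro mult_mono) auto
    also have "... = L1 * A\<^sup>2 * S" by (simp add: L1 power2_eq_square mult_ac)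
    finally show ?thesis .
  qed
  have T1: "C0 * ((2 * \<tau> + 8 * \<kappa> * \<rho>^2) * (4 * \<kappa> ^ 3) / real n) / (\<tau>^2 / 64) \<le> 768 * k ^ 3 * C0' * (2 + 8 * k * C2) / t"
  proof -
    have "8 * k * \<rho>^2 \<le> 8 * k * (C2 * S)" using \<rho>S k0 by (intro mult_left_mono) auto
    moreover have "2 * \<tau> \<le> 2 * S" using xn by (simp add: S_def)
    ultimately have "2 * \<tau> + 8 * k * \<rho>^2 \<le> (2 + 8 * k * C2) * S" by (simp add: algebra_simps)
    then have "256 * k ^ 3 * C0' * (2 * \<tau> + 8 * k * \<rho>^2) \<le> 256 * k ^ 3 * C0' * ((2 + 8 * k * C2) * S)"
      using k0 c0 by (intro mult_left_mono) auto
    then have "256 * k ^ 3 * C0' * (2 * \<tau> + 8 * k * \<rho>^2) \<le> (256 * k ^ 3 * C0' * (2 + 8 * k * C2)) * S" by (simp add: mult.assoc)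
    from sc[OF this] have "256 * k ^ 3 * C0' * (2 * \<tau> + 8 * k * \<rho>^2) / Y \<le> 3 * (256 * k ^ 3 * C0' * (2 + 8 * k * C2)) / t"
      using k0 c0 CC by simp
    moreover have "C0' * (w * (4 * k ^ 3) / real n) / (\<tau>^2 / 64) = 256 * k ^ 3 * C0' * w / Y" for w by (simp add: Y_def)
    moreover have "3 * (256 * k ^ 3 * C0' * w) = 768 * k ^ 3 * C0' * w" for w by simp
    ultimately show ?thesis by (simp only: k\<kappa>[symmetric] C00[symmetric])
  qed
  have T2: "C0 * (\<kappa> * qF A / real n) / (\<tau>^2 / 64) \<le> 192 * C0' * k * F1 * A / t"
  proof -
    have "64 * C0' * k * qF A \<le> 64 * C0' * k * (F1 * A * S)" using qF k0 c0 by (intro mult_left_mono) auto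
    then have "64 * C0' * k * qF A \<le> (64 * C0' * k * F1 * A) * S" by (simp add: mult.assoc)
    from sc[OF this] show ?thesis using k0 c0 F0 A by (simp add: Y_def k\<kappa>[symmetric] C00[symmetric] mult_ac)
  qed
  have T3: "16 * qL A / (real n * \<tau>^2) \<le> 48 * L1 * A\<^sup>2 / t"
    using sc[of "16 * qL A" "16 * (L1 * A\<^sup>2)"] qL L10 A by (simp add: Y_def mult_ac)
  have zc: "16 * z\<^sup>2 * (A * qL A) < real n * \<tau>^2"
  proof -
    have "16 * z\<^sup>2 * (A * qL A) \<le> 16 * z\<^sup>2 * (A * (L1 * A\<^sup>2 * S))" using qL A by (intro mult_left_mono) auto
    also have "... = (16 * z\<^sup>2 * L1 * A ^ 3) * S" by (simp add: power2_eq_square power3_eq_cube mult_ac)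
    finally have "16 * z\<^sup>2 * (A * qL A) / Y \<le> 3 * (16 * z\<^sup>2 * L1 * A ^ 3) / t" using L10 A by (intro sc) auto
    also have "... < 1"
    proof -
      have "3 * (16 * z\<^sup>2 * L1 * A ^ 3) = 48 * z\<^sup>2 * L1 * A ^ 3" by simp
      moreover have "48 * z\<^sup>2 * L1 * A ^ 3 < t" using parts t D by linarith
      ultimately show ?thesis using t1 by (simp only: divide_less_eq_1_pos)
    qed
    finally show ?thesis using Y0 by (simp add: Y_def)
  qed
  have H1: "sqrt (\<tau> * (4 * \<kappa> * \<rho>^2)) + sqrt (4 * \<kappa> * \<rho>^2 * (4 * \<kappa> ^ 3 * (12 * \<rho>^2 + 4 * (A * \<tau>)))) \<le> \<tau> / 4"
  proof -
    have "C2 * (x / real n) * t \<le> C2 * \<tau>" using \<tau>_ge CC mult_left_mono[of "t * (x / real n)" \<tau> C2] by (simp add: mult_ac)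
    then have "C2 * (x / real n) \<le> C2 * \<tau> / t" using t1 by (simp add: pos_le_divide_eq)
    then have r: "\<rho>^2 \<le> C2 * \<tau> / t" using \<rho>_le by linarith
    \<comment> \<open>\<open>1 / 64\<close> becomes \<open>1 / 8\<close> under the square root; the
      two bias terms together then take \<open>\<tau> / 4\<close>.\<close>
    have c1: "4 * k * C2 / t \<le> 1 / 64" using parts t D t1 by (simp add: field_simps)
    have c2: "16 * k ^ 4 * C2 * (12 * C2 + 4 * A) / t \<le> 1 / 64"
    proof -
      have "1024 * k ^ 4 * C2 * (12 * C2 + 4 * A) \<le> t" using parts t D by linarith
      then have "16 * k ^ 4 * C2 * (12 * C2 + 4 * A) \<le> 1 / 64 * t" by simp
      then show ?thesis using t1 by (subst pos_divide_le_eq) auto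
    qed
    have "\<tau> * (4 * k * \<rho>^2) \<le> \<tau> * (4 * k * (C2 * \<tau> / t))" using r \<tau>0 k0 by (intro mult_left_mono) auto
    also have "... = \<tau>^2 * (4 * k * C2 / t)" by (simp add: power2_eq_square)
    also have "... \<le> \<tau>^2 * (1 / 64)" using c1 by (intro mult_left_mono) auto
    also have "... = (\<tau> / 8)^2" by (simp add: power_divide)
    finally have a: "sqrt (\<tau> * (4 * k * \<rho>^2)) \<le> \<tau> / 8" using \<tau>0 by (intro real_le_lsqrt) auto
    have "C2 * \<tau> / t \<le> C2 * \<tau>" using t1 CC \<tau>0 mult_left_mono[of 1 t "C2 * \<tau>"] by (subst pos_divide_le_eq) auto
    then have "12 * \<rho>^2 + 4 * (A * \<tau>) \<le> (12 * C2 + 4 * A) * \<tau>" using r by (simp add: algebra_simps)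
    then have "4 * k * \<rho>^2 * (4 * k ^ 3 * (12 * \<rho>^2 + 4 * (A * \<tau>))) \<le> 4 * k * (C2 * \<tau> / t) * (4 * k ^ 3 * ((12 * C2 + 4 * A) * \<tau>))"
      using r k0 CC \<tau>0 t1 A by (intro mult_mono mult_left_mono) auto
    also have "... = \<tau>^2 * (16 * k ^ 4 * C2 * (12 * C2 + 4 * A) / t)" by (simp add: power2_eq_square power3_eq_cube power4_eq_xxxx)
    also have "... \<le> \<tau>^2 * (1 / 64)" using c2 by (intro mult_left_mono) auto
    also have "... = (\<tau> / 8)^2" by (simp add: power_divide)
    finally have b: "sqrt (4 * k * \<rho>^2 * (4 * k ^ 3 * (12 * \<rho>^2 + 4 * (A * \<tau>)))) \<le> \<tau> / 8" using \<tau>0 by (intro real_le_lsqrt) auto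
    show ?thesis using a b unfolding k\<kappa>[symmetric] by linarith
  qed
  have u0: "0 < u" using constants unfolding u by simp
  have \<kappa>s0: "0 < \<kappa>s" using constants u0 by (simp add: \<kappa>s)
  \<comment> \<open>Half of the probability from \<open>noise_sign\<close> is given up for the
    points at which the error of \<open>m\<close> is too large.\<close>
  have \<eta>: "\<eta>1 / 2 \<le> measure P {a\<in>space P. l y a \<le> 0}" if q: "Q (\<Delta> y) \<le> qD A" for y
  proof -
    have "qD A / \<kappa>s\<^sup>2 \<le> \<eta>1 / 2"
    proof -
      have "qD A \<le> \<kappa>s\<^sup>2 * (\<eta>1 / 2)" using qD small_x by linarith
      then show ?thesis using \<kappa>s0 by (subst pos_divide_le_eq) (auto simp: mult.commute)
    qed
    then show ?thesis using l_nonpos[OF \<kappa>s0 \<kappa>s u \<eta>0 q, folded \<eta>1] by linarith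
  qed
  \<comment> \<open>It is a lower bound for a probability.\<close>
  have "\<eta>1 \<le> 1"
  proof -
    have "\<eta>1 \<le> prob {a. (%_. 1) (obs_XZ a) * \<epsilon> a \<le> - \<kappa>s}" unfolding \<eta>1 by (rule noise_sign[OF _ _ \<kappa>s0 \<kappa>s u \<eta>0]) auto
    then show ?thesis using prob_le_1 order_trans by blast
  qed
  moreover have "0 \<le> \<eta>1" using u0 constants by (simp add: \<eta>1)
  ultimately have \<eta>le: "\<eta>1 / 2 \<le> 1" by linarith
  have A0: "0 < A" using A by simp
  have "pbad A + (16 * qL A / (real n * \<tau>^2) + 1 / A + (1 - \<eta>1 / 2) ^ n) \<le> 4 / A + D / t + 3 * pgood + (1 - \<eta>1 / 2) ^ n"
  proof -
    have "768 * k ^ 3 * C0' * (2 + 8 * k * C2) / t + 192 * C0' * k * F1 * A / t + 48 * L1 * A\<^sup>2 / t \<le> D / t"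
      unfolding add_divide_distrib[symmetric] using parts t1 unfolding D by (intro divide_right_mono) linarith+
    moreover have "3 / A + 1 / A = 4 / A" by (simp add: add_divide_distrib[symmetric])
    ultimately show ?thesis using T1 T2 T3 unfolding pbad_def by linarith
  qed
  then have pb: "1 - (4 / A + D / t + 3 * pgood + (1 - \<eta>1 / 2) ^ n) \<le> measure MM {y\<in>space MM. z < spline_test_stat ginv r N n y}"
    using rejection_bound[OF \<tau>0 A0 H1 \<eta>le \<eta> zc] by linarith
  have "pgood \<le> 2 * real M ^ dd * C1 * sqrt (real n) * exp (- (c / (10 * real M ^ dd * C1) * sqrt (real n)))"
  proof -
    define K' where "K' = C1 * sqrt (real n)"
    have Mp: "0 < real M ^ dd" using M by simp
    have K'0: "0 < K'" using CC n0 by (simp add: K'_def)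
    have "C1 * x\<^sup>2 \<le> K'" unfolding K'_def using xs CC by (intro mult_left_mono) auto
    \<comment> \<open>The failure bound increases with the number of cells, so \<open>Kc\<close> may
      be replaced by its upper bound of order \<open>sqrt n\<close>.\<close>
    then have KK: "Kc \<le> K'" using Kc' by linarith
    have "c * real n / (10 * real M ^ dd * K') \<le> c * real n / (10 * real M ^ dd * Kc)"
      using KK Kc_pos K'0 Mp constants n0 by (intro divide_left_mono mult_left_mono mult_pos_pos) auto
    then have "pgood \<le> 2 * real M ^ dd * K' * exp (- (c * real n / (10 * real M ^ dd * K')))"
      unfolding pgood_def using KK Kc_pos by (intro mult_mono mult_left_mono) auto
    also have "c * real n / (10 * real M ^ dd * K') = c / (10 * real M ^ dd * C1) * sqrt (real n)"
    proof -
      have "c * (sqrt (real n) * sqrt (real n)) / (10 * real M ^ dd * (C1 * sqrt (real n))) = c / (10 * real M ^ dd * C1) * sqrt (real n)"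
        using n0 CC Mp by (simp del: real_sqrt_mult_self)
      then show ?thesis unfolding sq K'_def .
    qed
    finally show ?thesis by (simp add: K'_def mult.assoc)
  qed
  moreover have "rejection_prob ginv r N \<alpha> n P = measure MM {y\<in>space MM. z < spline_test_stat ginv r N n y}"
    by (simp add: rejection_prob_def MM_def z)
  ultimately show ?thesis using pb by linarith
qed

end

section \<open>Rates in the sample size and uniformity over the class\<close>

lemma bigtheta_power_root:
  fixes u :: "nat => nat" and a :: real
  assumes k: "0 < k" and th: "(%n. real (u n ^ k)) \<in> \<Theta>(%n. real n powr (a * real k))"
  obtains a1 a2 where "0 < a1" "0 < a2"
    "\<forall>\<^sub>F n in sequentially. a1 * real n powr a \<le> real (u n) \<and> real (u n) \<le> a2 * real n powr a"
proof -
  have up: "(%n. real (u n ^ k)) \<in> O(%n. real n powr (a * real k))" and lo: "(%n. real (u n ^ k)) \<in> \<Omega>(%n. real n powr (a * real k))"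
    using th by (auto simp: bigtheta_def)
  obtain c2 where c2: "0 < c2" "\<forall>\<^sub>F n in sequentially. norm (real (u n ^ k)) \<le> c2 * norm (real n powr (a * real k))"
    using up by (elim landau_o.bigE)
  obtain c1 where c1: "0 < c1" "\<forall>\<^sub>F n in sequentially. c1 * norm (real n powr (a * real k)) \<le> norm (real (u n ^ k))"
    using lo by (elim landau_omega.bigE)
  have pw: "(b powr (1 / real k) * real n powr a) ^ k = b * real n powr (a * real k)" if "0 < b" "0 < n" for b :: real and n
    using that k powr_power[where z = "real n" and n = k and u = a] powr_power[where z = b and n = k and u = "1 / real k"] by (simp add: power_mult_distrib mult.commute)
  show ?thesis
  proof (rule that[of "c1 powr (1 / real k)" "c2 powr (1 / real k)"])
    show "0 < c1 powr (1 / real k)" "0 < c2 powr (1 / real k)" using c1 c2 by auto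
    show "\<forall>\<^sub>F n in sequentially. c1 powr (1 / real k) * real n powr a \<le> real (u n) \<and> real (u n) \<le> c2 powr (1 / real k) * real n powr a"
      using c1(2) c2(2) eventually_gt_at_top[of 0]
    proof eventually_elim
      case (elim n)
      have "(c1 powr (1 / real k) * real n powr a) ^ k \<le> real (u n) ^ k" "real (u n) ^ k \<le> (c2 powr (1 / real k) * real n powr a) ^ k"
        using elim c1(1) c2(1) by (simp_all add: pw)
      then show ?case using k by (auto simp: power_mono_iff)
    qed
  qed
qed

text \<open>The dimension rate gives \<open>N + r\<close> the order \<open>n powr (2 / E)\<close>.
  Then the number of cells has order \<open>n powr (2 d / E)\<close>, and the squared approximation
  error has order \<open>n powr (- 4 s / E)\<close>, which is \<open>n powr (d / E) / n\<close>
  because \<open>E = 4 s + d\<close>.\<close>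

lemma spline_dimension_rate:
  fixes s :: real and d r :: nat and Nn :: "nat => nat"
  defines "E \<equiv> 4 * s + real d"
  assumes r: "0 < r" and b: "0 \<le> b" and s: "0 < s" and k: "0 < k" and th: "(%n. real ((Nn n + r) ^ k)) \<in> \<Theta>(%n. real n powr (2 * real k / E))"
  obtains C1 C2 where "0 < C1" "0 \<le> C2" "\<forall>\<^sub>F n in sequentially. real (Nn n + 1) ^ d \<le> C1 * (real n powr (real d / E))^2
     \<and> (K * (b / real (Nn n + 1)) powr s)^2 \<le> C2 * (real n powr (real d / E) / real n)"
proof -
  have E0: "0 < E" using s by (simp add: E_def)
  have "(%n. real ((Nn n + r) ^ k)) \<in> \<Theta>(%n. real n powr (2 / E * real k))" using th by simp
  from bigtheta_power_root[OF k this] obtain a1 a2 where a: "0 < a1" "0 < a2"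
    "\<forall>\<^sub>F n in sequentially. a1 * real n powr (2 / E) \<le> real (Nn n + r) \<and> real (Nn n + r) \<le> a2 * real n powr (2 / E)" by blast
  define C2 where "C2 = (K * (b * real r / a1) powr s)^2"
  show ?thesis
  proof (rule that[of "a2 ^ d" C2])
    show "0 < a2 ^ d" "0 \<le> C2" using a by (auto simp: C2_def)
    show "\<forall>\<^sub>F n in sequentially. real (Nn n + 1) ^ d \<le> a2 ^ d * (real n powr (real d / E))^2
       \<and> (K * (b / real (Nn n + 1)) powr s)^2 \<le> C2 * (real n powr (real d / E) / real n)"
      using a(3) eventually_gt_at_top[of 0]
    proof eventually_elim
      case (elim n)
      have n0: "0 < real n" using elim by simp
      have "real (Nn n + 1) \<le> real (Nn n + r)" using r by simp
      then have "real (Nn n + 1) ^ d \<le> (a2 * real n powr (2 / E)) ^ d" using elim by (intro power_mono) auto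
      also have "... = a2 ^ d * (real n powr (real d / E))^2"
        using n0 by (simp add: power_mult_distrib powr_powr flip: powr_realpow) (simp add: powr_add[symmetric] power2_eq_square mult.commute)
      finally have 1: "real (Nn n + 1) ^ d \<le> a2 ^ d * (real n powr (real d / E))^2" .
      define p where "p = real n powr (2 / E)"
      have p0: "0 < p" using n0 by (simp add: p_def)
      \<comment> \<open>Transfers the lower bound from \<open>N + r\<close> to \<open>N + 1\<close>,
        the reciprocal of the mesh width.\<close>
      have "real (Nn n + r) \<le> real r * real (Nn n + 1)"
      proof -
        have "Nn n * 1 + r \<le> Nn n * r + r" using r by (intro add_right_mono mult_left_mono) auto
        then have "Nn n + r \<le> r * (Nn n + 1)" by (simp add: algebra_simps)
        then have "real (Nn n + r) \<le> real (r * (Nn n + 1))" by (simp only: of_nat_le_iff)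
        then show ?thesis by (simp only: of_nat_mult)
      qed
      then have "a1 * p \<le> real r * real (Nn n + 1)" using elim by (simp add: p_def)
      then have "1 / real (Nn n + 1) \<le> real r / (a1 * p)" using a p0 by (simp add: field_simps)
      then have "b * (1 / real (Nn n + 1)) \<le> b * (real r / (a1 * p))" using b by (intro mult_left_mono) auto
      then have "(b / real (Nn n + 1)) powr s \<le> (b * real r / a1 / p) powr s" using s b by (intro powr_mono2) auto
      also have "... = (b * real r / a1) powr s / p powr s" by (rule powr_divide)
      finally have le: "(b / real (Nn n + 1)) powr s \<le> (b * real r / a1) powr s / p powr s" .
      have "((b / real (Nn n + 1)) powr s)^2 \<le> ((b * real r / a1) powr s / p powr s)^2" using le by (intro power_mono) auto
      then have "K\<^sup>2 * ((b / real (Nn n + 1)) powr s)^2 \<le> K\<^sup>2 * ((b * real r / a1) powr s / p powr s)^2" by (intro mult_left_mono) auto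
      also have "... = C2 * (1 / (p powr s)^2)" by (simp add: C2_def power_mult_distrib power_divide)
      also have "1 / (p powr s)^2 = real n powr (real d / E) / real n"
      proof -
        have "(p powr s)^2 = real n powr (4 * s / E)"
          using n0 by (simp add: p_def powr_powr power2_eq_square powr_add[symmetric])
        moreover have "real n powr (real d / E) * real n powr (4 * s / E) = real n"
          using E0 n0 by (simp add: powr_add[symmetric] add_divide_distrib[symmetric] E_def add.commute)
        ultimately show ?thesis using n0 by (simp add: field_simps)
      qed
      finally show ?case using 1 by (simp add: power_mult_distrib)
    qed
  qed
qed

theorem theorem7:
  fixes \<P> :: "nat \<Rightarrow> ('dx::{finite,linorder}, 'dz::{finite,linorder}) obs measure set"
    and g :: "('dx, 'dz) obs measure \<Rightarrow> (real ^ 'dx::{finite,linorder}) \<times> (real ^ 'dz::{finite,linorder}) \<Rightarrow> real"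
    and m :: "('dx, 'dz) obs measure \<Rightarrow> real ^ 'dz::{finite,linorder} \<Rightarrow> real"
    and p :: "('dx, 'dz) obs measure \<Rightarrow> (real ^ 'dx::{finite,linorder}) \<times> (real ^ 'dz::{finite,linorder}) \<Rightarrow> real"
    and q :: "('dx, 'dz) obs measure \<Rightarrow> real ^ 'dx::{finite,linorder} \<Rightarrow> real ^ 'dz::{finite,linorder} \<Rightarrow> real"
    and \<epsilon> :: "('dx, 'dz) obs measure \<Rightarrow> ('dx, 'dz) obs \<Rightarrow> real"
    and \<tau> :: "('dx, 'dz) obs measure \<Rightarrow> real"
    and r d :: nat and s C c \<delta> \<alpha> :: real
    and eps :: "nat \<Rightarrow> real" and N :: "nat \<Rightarrow> nat"
    and ginv :: "real Matrix.mat \<Rightarrow> real Matrix.mat"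
  assumes d_def: "d = CARD('dx) + CARD('dz)"
    and s: "real r \<ge> s" "s \<ge> 3 * real d / 4"
    and constants: "C \<ge> 1" "0 < c" "c \<le> 1" "0 < \<delta>" "\<delta> \<le> 2" "0 < \<alpha>" "\<alpha> < 1"
    and distribution: "\<And>n P. P \<in> \<P> n \<Longrightarrow> prob_space P \<and> sets P = sets borel \<and>
          (AE w in P. obs_XZ w \<in> unit_cube)"
    and g_version: "\<And>n P. P \<in> \<P> n \<Longrightarrow> cond_mean_version P obs_Y obs_XZ (g P)"
    and m_version: "\<And>n P. P \<in> \<P> n \<Longrightarrow> cond_mean_version P obs_Y obs_Z (m P)"
    and p_version: "\<And>n P. P \<in> \<P> n \<Longrightarrow> joint_density_version P (p P)"
    and q_version: "\<And>n P. P \<in> \<P> n \<Longrightarrow> cond_density_version P (q P)"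
    and \<epsilon>_def: "\<And>P w. \<epsilon> P w = obs_Y w - m P (obs_Z w)"
    and \<tau>_def: "\<And>P. \<tau> P = (\<integral>w. (g P (obs_XZ w) - m P (obs_Z w))\<^sup>2 \<partial>P)"
    and a: "\<And>n P. P \<in> \<P> n \<Longrightarrow>
          (AE w in P. nn_cond_exp P (sigma_of P obs_XZ) (\<lambda>w. ennreal ((\<epsilon> P w)\<^sup>2)) w \<ge> ennreal c) \<and>
          (AE w in P. nn_cond_exp P (sigma_of P obs_XZ)
                        (\<lambda>w. ennreal (\<bar>\<epsilon> P w\<bar> powr (2 + \<delta>))) w \<le> ennreal C)"
    and b: "\<And>n P. P \<in> \<P> n \<Longrightarrow> \<forall>v\<in>unit_cube. c \<le> p P v \<and> p P v \<le> C"
    and c: "\<And>n P. P \<in> \<P> n \<Longrightarrow>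
          (\<forall>x\<in>unit_cube. q P x \<in> holder_space s \<and> holder_norm s (q P x) \<le> C) \<and>
          m P \<in> holder_space s \<and> holder_norm s (m P) \<le> C \<and>
          g P \<in> holder_space s \<and> holder_norm s (g P) \<le> C"
    and eps_pos: "\<And>n. eps n > 0"
    and eps_rate: "filterlim (\<lambda>n. eps n * real n powr (4 * s / (4 * s + real d))) at_top sequentially"
    and ginv: "generalised_inverse_rule ginv"
    and K_X: "(\<lambda>n. real ((N n + r) ^ CARD('dx))) \<in> \<Theta>(\<lambda>n. real n powr (2 * real CARD('dx) / (4 * s + real d)))"
    and K_Z: "(\<lambda>n. real ((N n + r) ^ CARD('dz))) \<in> \<Theta>(\<lambda>n. real n powr (2 * real CARD('dz) / (4 * s + real d)))"
    and K_Z_tilde: "(\<lambda>n. real ((N n + 2 * r - 1) ^ CARD('dz))) \<in> \<Theta>(\<lambda>n. real n powr (2 * real CARD('dz) / (4 * s + real d)))"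
  shows "(\<lambda>n. inf_prob {P \<in> \<P> n. \<tau> P \<ge> eps n} (rejection_prob ginv r (N n) \<alpha> n)) \<longlonglongrightarrow> 1"
proof -
  have "0 < CARD('dx)" "0 < CARD('dz)" by simp_all
  then have "2 \<le> d" unfolding d_def by linarith
  \<comment> \<open>From \<open>d \<ge> 2\<close> and \<open>s \<ge> 3 d / 4\<close> follows
    \<open>s \<ge> 3 / 2\<close>; hence all functions are differentiable and the Taylor expansion
    has at least a linear term.\<close>
  then have s1: "1 < s" and d2: "2 \<le> real d" using s(2) by linarith+
  have r0: "0 < r" "0 < 2 * r - 1" "r \<le> 2 * r - 1" using s(1) s1 by linarith+
  have s_r: "s \<le> real (2 * r - 1)" using s(1) r0 by linarith
  define E where "E = 4 * s + real d"
  have E0: "0 < E" and dE: "4 * real d \<le> E" using s(2) d2 by (simp_all add: E_def)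
  have dd: "d = DIM(('dx, 'dz) cov)" by (simp add: d_def)
  obtain M where M: "0 < M" and M_fine: "\<forall>L>0. \<forall>v :: ('dx, 'dz) cov => real. \<forall>\<kappa>\<in>cell_indices L. pp L (2 * r - 2) v -->
     (\<exists>\<kappa>'\<in>cell_indices (L * M). cell (L * M) \<kappa>' \<subseteq> cell L \<kappa> \<and>
        (\<forall>x\<in>cell L \<kappa>. \<forall>y\<in>cell (L * M) \<kappa>'. \<bar>v x\<bar> \<le> 2 * \<bar>v y\<bar>))"
    using pp_large_on_fine_cell[where 'a = "('dx, 'dz) cov" and D = "2 * r - 2"] by (elim exE conjE) (rule that)
  obtain KL where KL: "KL \<ge> 0" "\<And>p::real poly. \<And>A a h s t. degree p \<le> r ==> 0 < h ==> (\<And>t. a \<le> t ==> t < a + h ==> \<bar>poly p t\<bar> \<le> A)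
     ==> a \<le> s ==> s < a + h ==> a \<le> t ==> t < a + h ==> \<bar>poly p s - poly p t\<bar> \<le> KL * A * (\<bar>s - t\<bar> / h)"
    using poly_lipschitz_by_values[of r] by metis
  obtain K1 where K1: "K1 \<ge> 0" "\<And>N E. \<And>F :: ('dx, 'dz) cov => real. axis_taylor r (real r / real (N + 1)) E F ==> 0 \<le> E ==>
    (\<exists>v. spn ((N + r) ^ CARD('dx) * (N + r) ^ CARD('dz)) (basis_xz r N) v \<and> (\<forall>w\<in>ucube. \<bar>F w - v w\<bar> \<le> K1 * E))"
    using basis_xz_approximation[OF r0(1), where 'dx = 'dx and 'dz = 'dz] by blast
  obtain K2 where K2: "K2 \<ge> 0" "\<And>N E. \<And>F :: real ^ 'dz::{finite,linorder} => real. axis_taylor r (real r / real (N + 1)) E F ==> 0 \<le> E ==>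
    (\<exists>v. spn ((N + r) ^ CARD('dz)) (basis_z r N) v \<and> (\<forall>w::('dx, 'dz) cov\<in>ucube. \<bar>F (snd w) - v w\<bar> \<le> K2 * E))"
    using basis_z_approximation[OF r0(1), where 'dx = 'dx and 'dz = 'dz] by blast
  obtain K3 where K3: "K3 \<ge> 0" "\<And>N E. \<And>F :: real ^ 'dz::{finite,linorder} => real. axis_taylor (2 * r - 1) (real (2 * r - 1) / real (N + 1)) E F ==> 0 \<le> E ==>
    (\<exists>v. spn ((N + (2 * r - 1)) ^ CARD('dz)) (basis_z (2 * r - 1) N) v \<and> (\<forall>w::('dx, 'dz) cov\<in>ucube. \<bar>F (snd w) - v w\<bar> \<le> K3 * E))"
    using basis_z_approximation[OF r0(2), where 'dx = 'dx and 'dz = 'dz] by blast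
  define K where "K = (K1 + K2 + K3) * (C + 1)"
  \<comment> \<open>One error for all three bases: the widest Taylor radius, that of order
    \<open>2 r - 1\<close>, and the sum of the three constants.\<close>
  define \<rho> where "\<rho> n = K * (real (2 * r - 1) / real (N n + 1)) powr s" for n
  have \<rho>0: "0 \<le> \<rho> n" for n using K1(1) K2(1) K3(1) constants by (simp add: \<rho>_def K_def)
  have \<rho>_ge: "Ki * ((C + 1) * (real r' / real (N n + 1)) powr s) \<le> \<rho> n" if "0 \<le> Ki" "Ki \<le> K1 + K2 + K3" "r' \<le> 2 * r - 1" for Ki r' n
  proof -
    have "(real r' / real (N n + 1)) powr s \<le> (real (2 * r - 1) / real (N n + 1)) powr s"
      using that s1 by (intro powr_mono2 divide_right_mono) auto
    then have "Ki * (C + 1) * (real r' / real (N n + 1)) powr s \<le> (K1 + K2 + K3) * (C + 1) * (real (2 * r - 1) / real (N n + 1)) powr s"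
      using that constants by (intro mult_mono mult_right_mono) auto
    then show ?thesis by (simp add: \<rho>_def K_def mult.assoc)
  qed
  have test: "spline_test P (g P) (m P) (p P) r s C c \<delta> ginv (N n) n M d (\<rho> n)" if P: "P \<in> \<P> n" and n: "0 < n" for n P
  proof (intro spline_test.intro regression_model.intro spline_test_axioms.intro)
    have C0: "0 \<le> C" using constants by simp
    note h = holder_axis_taylor[OF s1 _ _ _ C0]
    have hm: "m P \<in> holder_space s" "holder_norm s (m P) \<le> C" and hg: "g P \<in> holder_space s" "holder_norm s (g P) \<le> C" using c[OF P] by auto
    show "1 < s" "s \<le> real r" "1 \<le> C" "0 < c" "0 < \<delta>" using s s1 constants by auto
    show "prob_space P" "sets P = sets borel" using distribution[OF P] by auto
    show "cond_mean_version P obs_Y obs_XZ (g P)" by (rule g_version[OF P])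
    show "cond_mean_version P obs_Y obs_Z (m P)" by (rule m_version[OF P])
    show "joint_density_version P (p P)" by (rule p_version[OF P])
    show "AE w in P. ennreal c \<le> nn_cond_exp P (sigma_of P obs_XZ) (%w. ennreal ((obs_Y w - m P (obs_Z w))\<^sup>2)) w"
      "AE w in P. nn_cond_exp P (sigma_of P obs_XZ) (%w. ennreal (\<bar>obs_Y w - m P (obs_Z w)\<bar> powr (2 + \<delta>))) w \<le> ennreal C"
      using a[OF P] unfolding \<epsilon>_def by auto
    show "\<forall>v\<in>unit_cube. c \<le> p P v \<and> p P v \<le> C" by (rule b[OF P])
    show "m P \<in> holder_space s" "holder_norm s (m P) \<le> C" "g P \<in> holder_space s" "holder_norm s (g P) \<le> C" by (fact hm hg)+
    show "generalised_inverse_rule ginv" "0 < n" "0 < M" "0 \<le> \<rho> n" by (fact ginv n M \<rho>0)+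
    show "d = DIM(('dx, 'dz) cov)" by (rule dd)
    show "\<exists>\<kappa>'\<in>cell_indices ((N n + 1) * M). cell ((N n + 1) * M) \<kappa>' \<subseteq> cell (N n + 1) \<kappa> \<and>
        (\<forall>x\<in>cell (N n + 1) \<kappa>. \<forall>y\<in>cell ((N n + 1) * M) \<kappa>'. \<bar>v x\<bar> \<le> 2 * \<bar>v y\<bar>)"
      if "\<kappa> \<in> cell_indices (N n + 1)" "pp (N n + 1) (2 * r - 2) v" for v :: "('dx, 'dz) cov => real" and \<kappa>
      by (rule M_fine[rule_format, OF _ that]) simp
    have E: "0 \<le> (C + 1) * (real r' / real (N n + 1)) powr s" for r' using constants by simp
    obtain v1 where "spn ((N n + r) ^ CARD('dx) * (N n + r) ^ CARD('dz)) (basis_xz r (N n)) v1"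
      "\<forall>w::('dx, 'dz) cov\<in>ucube. \<bar>g P w - v1 w\<bar> \<le> K1 * ((C + 1) * (real r / real (N n + 1)) powr s)"
      using K1(2)[OF h[OF s(1) hg] E] by (metis divide_nonneg_nonneg of_nat_0_le_iff)
    then show "\<exists>v. spn ((N n + r) ^ CARD('dx) * (N n + r) ^ CARD('dz)) (basis_xz r (N n)) v \<and> (\<forall>w::('dx, 'dz) cov\<in>ucube. \<bar>g P w - v w\<bar> \<le> \<rho> n)"
      using \<rho>_ge[of K1 r n] K1(1) K2(1) K3(1) r0 by (intro exI[of _ v1] conjI) (force intro: order_trans)+
    obtain v2 where "spn ((N n + r) ^ CARD('dz)) (basis_z r (N n)) v2"
      "\<forall>w::('dx, 'dz) cov\<in>ucube. \<bar>m P (snd w) - v2 w\<bar> \<le> K2 * ((C + 1) * (real r / real (N n + 1)) powr s)"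
      using K2(2)[OF h[OF s(1) hm] E] by (metis divide_nonneg_nonneg of_nat_0_le_iff)
    then show "\<exists>v. spn ((N n + r) ^ CARD('dz)) (basis_z r (N n)) v \<and> (\<forall>w::('dx, 'dz) cov\<in>ucube. \<bar>m P (snd w) - v w\<bar> \<le> \<rho> n)"
      using \<rho>_ge[of K2 r n] K1(1) K2(1) K3(1) r0 by (intro exI[of _ v2] conjI) (force intro: order_trans)+
    obtain v3 where "spn ((N n + (2 * r - 1)) ^ CARD('dz)) (basis_z (2 * r - 1) (N n)) v3"
      "\<forall>w::('dx, 'dz) cov\<in>ucube. \<bar>m P (snd w) - v3 w\<bar> \<le> K3 * ((C + 1) * (real (2 * r - 1) / real (N n + 1)) powr s)"
      using K3(2)[OF h[OF s_r hm] E] by (metis divide_nonneg_nonneg of_nat_0_le_iff)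
    then show "\<exists>v. spn ((N n + (2 * r - 1)) ^ CARD('dz)) (basis_z (2 * r - 1) (N n)) v \<and> (\<forall>w::('dx, 'dz) cov\<in>ucube. \<bar>m P (snd w) - v w\<bar> \<le> \<rho> n)"
      using \<rho>_ge[of K3 "2 * r - 1" n] K1(1) K2(1) K3(1) by (intro exI[of _ v3] conjI) (force intro: order_trans)+
  qed
  have cx: "0 < CARD('dx)" by simp
  have b0: "0 \<le> real (2 * r - 1)" by simp
  have s0: "0 < s" using s1 by simp
  obtain C1 C2 where CC: "0 < C1" "0 \<le> C2" and rate': "\<forall>\<^sub>F n in sequentially. real (N n + 1) ^ d \<le> C1 * (real n powr (real d / (4 * s + real d)))\<^sup>2
     \<and> (K * (real (2 * r - 1) / real (N n + 1)) powr s)\<^sup>2 \<le> C2 * (real n powr (real d / (4 * s + real d)) / real n)"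
    by (rule spline_dimension_rate[OF r0(1) b0 s0 cx K_X])
  note rate = rate'[folded E_def \<rho>_def]
  \<comment> \<open>All constants are fixed before \<open>n\<close> and \<open>P\<close>, which
    makes the final bound uniform over the class; \<open>D\<close> in addition takes
    \<open>A\<close>, which depends on the tolerance. The quantile enters as a fixed real
    number.\<close>
  define z where "z = std_normal_quantile (1 - \<alpha>)"
  define k where "k = 12 * C * real M ^ d / c"
  define C0' where "C0' = 4 * (1 + C)"
  define F1 where "F1 = 8 * k ^ 3 * (12 * C2 + 4 + C0' * k\<^sup>2 * C1)"
  define D1 where "D1 = 8 * k * C2 + 2 * k * (C0' * k\<^sup>2 * C1)"
  define L1 where "L1 = (2 * (1 + C) + 2 * k * C1 * D1) * F1"
  define D where "D A = 48 * z\<^sup>2 * L1 * A ^ 3 + 256 * k * C2 + 1024 * k ^ 4 * C2 * (12 * C2 + 4 * A) + 1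
        + 768 * k ^ 3 * C0' * (2 + 8 * k * C2) + 192 * C0' * k * F1 * A + 48 * L1 * A\<^sup>2" for A
  define u where "u = (2 * C / c) powr (1 / \<delta>)"
  define \<kappa>s where "\<kappa>s = c / (24 * u)"
  define Mf where "Mf = 2 * (C + 1) + KL * (sqrt (1 + C) + 2 * (C + 1))"
  define L0 where "L0 = nat \<lceil>Mf * real d / \<kappa>s\<rceil> + 1"
  define \<eta>1 where "\<eta>1 = c / (8 * u * (1 + C)) * (c / (4 * u)) * (c * (1 / real L0) ^ d)"
  have u1: "1 \<le> u" unfolding u_def using constants by (intro ge_one_powr_ge_zero) (auto simp: field_simps)
  have \<kappa>s0: "0 < \<kappa>s" using u1 constants by (simp add: \<kappa>s_def)
  have L0: "0 < L0" "Mf * real d \<le> \<kappa>s * real L0"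
  proof -
    show "0 < L0" by (simp add: L0_def)
    have "Mf * real d / \<kappa>s \<le> real L0" unfolding L0_def by linarith
    then show "Mf * real d \<le> \<kappa>s * real L0" using \<kappa>s0 by (simp add: field_simps)
  qed
  have \<eta>1: "0 < \<eta>1" "\<eta>1 \<le> 1"
  proof -
    show "0 < \<eta>1" using u1 constants L0(1) by (simp add: \<eta>1_def)
    have "8 * u * (1 + C) \<ge> 8 * 1 * 1" using u1 constants by (intro mult_mono) auto
    then have i: "c / (8 * u * (1 + C)) \<le> 1" using constants by (subst divide_le_eq_1_pos) auto
    have ii: "c / (4 * u) \<le> 1" using constants u1 by (subst divide_le_eq_1_pos) auto
    have "(1 / real L0) ^ d \<le> 1" using L0(1) by (intro power_le_one) auto
    then have iii: "c * (1 / real L0) ^ d \<le> 1 * 1" using constants by (intro mult_mono) auto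
    have "\<eta>1 \<le> 1 * 1 * 1" unfolding \<eta>1_def using i ii iii constants u1 by (intro mult_mono) auto
    then show "\<eta>1 \<le> 1" by simp
  qed
  define x where "x n = real n powr (real d / E)" for n
  define t where "t n = eps n * real n powr (4 * s / E)" for n
  have t_top: "filterlim t at_top sequentially" using eps_rate unfolding t_def E_def .
  have lower: "\<forall>\<^sub>F n in sequentially. \<forall>P\<in>{P \<in> \<P> n. \<tau> P \<ge> eps n}. 1 - e \<le> rejection_prob ginv r (N n) \<alpha> n P" if e: "0 < e" for e :: real
  proof -
    \<comment> \<open>Four error terms share the tolerance; the Markov terms receive
      \<open>e / 4\<close> by this choice, the others tend to 0.\<close>
    define A where "A = max 1 (16 / e)"
    have A: "1 \<le> A" "4 / A \<le> e / 4"
    proof -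
      show "1 \<le> A" by (simp add: A_def)
      have "16 / e \<le> A" by (simp add: A_def)
      then show "4 / A \<le> e / 4" using e \<open>1 \<le> A\<close> by (simp add: field_simps)
    qed
    define b where "b = c / (10 * real M ^ d * C1)"
    define B where "B = 6 * real M ^ d * C1"
    have b: "0 < b" and B: "0 < B" using constants M CC by (simp_all add: b_def B_def)
    have l1: "((%n. D A / t n) \<longlongrightarrow> 0) sequentially"
      by (rule real_tendsto_divide_at_top[OF tendsto_const t_top])
    have l2: "(%n. B * sqrt (real n) * exp (- (b * sqrt (real n)))) \<longlonglongrightarrow> 0" using b by real_asymp
    have l3: "(%n. (1 - \<eta>1 / 2) ^ n) \<longlonglongrightarrow> 0" using \<eta>1 by (intro LIMSEQ_power_zero) auto
    have l4: "(%n. D1 * A * (1 / sqrt (real n))) \<longlonglongrightarrow> 0" by real_asymp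
    have e4: "0 < e / 4" using e by simp
    have sm: "0 < \<kappa>s\<^sup>2 * (\<eta>1 / 2)" using \<kappa>s0 \<eta>1 by simp
    have "\<forall>\<^sub>F n in sequentially. D A \<le> t n" using t_top by (auto simp: filterlim_at_top)
    then show ?thesis
      using eventually_gt_at_top[of 0] rate order_tendstoD(2)[OF l1 e4] order_tendstoD(2)[OF l2 e4] order_tendstoD(2)[OF l3 e4] order_tendstoD(2)[OF l4 sm]
    proof eventually_elim
      case (elim n)
      have n0: "0 < real n" "1 \<le> real n" using elim by linarith+
      have xpos: "1 \<le> x n" unfolding x_def using n0 E0 by (intro ge_one_powr_ge_zero) auto
      \<comment> \<open>\<open>4 d \<le> 4 s + d\<close> is the smoothness condition
        \<open>s \<ge> 3 d / 4\<close>.\<close>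
      have x4: "x n ^ 4 \<le> real n"
      proof -
        have "x n ^ 4 = real n powr (4 * real d / E)" using n0 by (simp add: x_def powr_power mult.commute)
        also have "... \<le> real n powr 1" using n0 dE E0 by (intro powr_mono) (auto simp: field_simps)
        finally show ?thesis using n0 by simp
      qed
      \<comment> \<open>The exponents \<open>4 s / E\<close> and \<open>d / E\<close> sum to 1, so
        the separation \<open>eps n\<close> is \<open>t n\<close> times
        \<open>x n / n\<close>.\<close>
      have teps: "t n * (x n / real n) = eps n"
      proof -
        have "real n powr (4 * s / E) * real n powr (real d / E) = real n"
          using E0 n0 by (simp add: powr_add[symmetric] add_divide_distrib[symmetric] E_def)
        then show ?thesis using n0 by (simp add: t_def x_def mult.assoc)
      qed
      show ?case
      proof
        fix P assume P: "P \<in> {P \<in> \<P> n. \<tau> P \<ge> eps n}"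
        interpret S: spline_test P "g P" "m P" "p P" r s C c \<delta> ginv "N n" n M d "\<rho> n" using test P elim(2) by blast
        have S\<tau>: "S.\<tau> = \<tau> P" by (simp add: S.\<tau>_def S.f_def \<tau>_def)
        have tau: "t n * (x n / real n) \<le> S.\<tau>" using P teps S\<tau> by simp
        have "1 - (4 / A + D A / t n + 6 * real M ^ d * C1 * sqrt (real n) * exp (- (c / (10 * real M ^ d * C1) * sqrt (real n))) + (1 - \<eta>1 / 2) ^ n)
          \<le> rejection_prob ginv r (N n) \<alpha> n P"
          by (rule S.test_power[OF A(1) xpos x4 elim(1) CC _ _ tau k_def C0'_def F1_def D1_def L1_def D_def \<kappa>s_def u_def KL L0(1) _ \<eta>1_def less_imp_le[OF elim(7)] z_def])
            (use elim(3) L0(2) in \<open>simp_all add: x_def Mf_def\<close>)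
        then show "1 - e \<le> rejection_prob ginv r (N n) \<alpha> n P"
          using elim(4,5,6) A(2) unfolding b_def B_def by linarith
      qed
    qed
  qed
  have upper: "rejection_prob ginv r (N n) \<alpha> n P \<le> 1" if "P \<in> \<P> n" for n P
  proof -
    interpret prob_space "PiM {1..4 * n} (%_. P)" using distribution[OF that] by (intro prob_space_PiM) auto
    show ?thesis unfolding rejection_prob_def by (rule prob_le_1)
  qed
  \<comment> \<open>An empty class has infimum 1 by definition; otherwise the lower bound also
    ensures that the infimum is taken over a bounded set.\<close>
  have bounds: "1 - e \<le> inf_prob {P \<in> \<P> n. \<tau> P \<ge> eps n} (rejection_prob ginv r (N n) \<alpha> n) \<and> inf_prob {P \<in> \<P> n. \<tau> P \<ge> eps n} (rejection_prob ginv r (N n) \<alpha> n) \<le> 1"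
    if e: "0 < e" and lo: "\<forall>P\<in>{P \<in> \<P> n. \<tau> P \<ge> eps n}. 1 - e \<le> rejection_prob ginv r (N n) \<alpha> n P" for e n
  proof (cases "{P \<in> \<P> n. \<tau> P \<ge> eps n} = {}")
    case True
    then show ?thesis using e by (simp add: inf_prob_def)
  next
    case False
    then obtain P0 where P0: "P0 \<in> {P \<in> \<P> n. \<tau> P \<ge> eps n}" by blast
    have "(INF P\<in>{P \<in> \<P> n. \<tau> P \<ge> eps n}. rejection_prob ginv r (N n) \<alpha> n P) \<le> rejection_prob ginv r (N n) \<alpha> n P0"
      using P0 lo by (intro cINF_lower bdd_belowI2[where m = "1 - e"]) auto
    also have "... \<le> 1" using upper P0 by blast
    finally have "(INF P\<in>{P \<in> \<P> n. \<tau> P \<ge> eps n}. rejection_prob ginv r (N n) \<alpha> n P) \<le> 1" .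
    moreover have "1 - e \<le> (INF P\<in>{P \<in> \<P> n. \<tau> P \<ge> eps n}. rejection_prob ginv r (N n) \<alpha> n P)"
      using False lo by (intro cINF_greatest) auto
    ultimately show ?thesis unfolding inf_prob_def using False by simp
  qed
  show ?thesis
  proof (rule tendstoI)
    fix e :: real assume e: "0 < e"
    then have "0 < e / 2" by simp
    from lower[OF this] show "\<forall>\<^sub>F n in sequentially. dist (inf_prob {P \<in> \<P> n. \<tau> P \<ge> eps n} (rejection_prob ginv r (N n) \<alpha> n)) 1 < e"
    proof eventually_elim
      case (elim n)
      from bounds[OF \<open>0 < e / 2\<close> elim] show ?case using e by (simp add: dist_real_def)
    qed
  qed
qed

end
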